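(* Let $(X,\|\cdot\|)$ be a Banach space, let $m\in\mathbb{N}$, $m\ge 1$, and let $f:\mathbb{R}_+\to X$ be a locally integrable function such that its $m$-th weak derivative $f^{(m)}$ is in $L^p(\mathbb{R}_+;X)$ for some $1<p\le\infty$. Assume that there exist continuous and increasing functions $M,K:\mathbb{R}_+\to[2,\infty)$ satisfying (i) $K(s)\ge\max\{s,M(s)\}$ for all $s>1$; (ii) there is $\varepsilon\in(0,1)$ such that $K(s)=O\left(e^{e^{(sM(s))^{1-\varepsilon}}}\right)$ as $s\to\infty$; such that the Laplace transform $\hat f$ of $f$ extends analytically to $\Omega_M\cup\mathbb{C}_+$ and $$\|\hat f(z)\|\le K(|\operatorname{Im} z|)\quad\text{for all } z\in\Omega_M .$$ Then there exists a constant $c_1>0$ such that $$\left(t\mapsto\|w_{M_K}(c_1t)^m f(t)\|\right)\in L^p(\mathbb{R}_+),$$ where $M_K(s):=M(s)\log(K(s))$.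
   Context: $\mathbb{R}_+=[0,\infty)$ and $\mathbb{C}_+=\{z\in\mathbb{C}:\operatorname{Re} z\ge0\}$. "Increasing" is meant in the non-strict sense (constant functions $M$ are allowed). For a continuous increasing $M:\mathbb{R}_+\to[2,\infty)$, $$\Omega_M=\left\{z\in\mathbb{C}:\ 0>\operatorname{Re} z>-\frac{1}{M(|\operatorname{Im} z|)}\right\}.$$ For a continuous increasing function $N$ on $\mathbb{R}_+$ (here used with $N=M_K$, which is unbounded), $N^{-1}(t)=\sup\{s\ge0: N(s)=t\}$ is its right-continuous right-inverse, and $w_N(t)=N^{-1}(t)$ if $t\ge N(1)$, $w_N(t)=1$ otherwise. The Laplace transform is $\hat f(z)=\int_0^\infty e^{-zt}f(t)\,dt$ for $\operatorname{Re}z>0$; it is well defined as an absolutely convergent integral since the assumption $f\in L^1_{loc}$, $f^{(m)}\in L^p$ implies that $f$ is polynomially bounded. *)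

theory Defs
  imports "HOL-Analysis.Analysis" "HOL-Library.Landau_Symbols"
begin

section \<open>Complex Banach spaces\<close>

class complex_banach = banach +
  fixes scaleC :: "complex \<Rightarrow> 'a \<Rightarrow> 'a" (infixr \<open>*\<^sub>C\<close> 75)
  assumes scaleC_add_right: "a *\<^sub>C (x + y) = a *\<^sub>C x + a *\<^sub>C y"
    and scaleC_add_left: "(a + b) *\<^sub>C x = a *\<^sub>C x + b *\<^sub>C x"
    and scaleC_scaleC: "a *\<^sub>C (b *\<^sub>C x) = (a * b) *\<^sub>C x"
    and scaleC_of_real: "complex_of_real r *\<^sub>C x = r *\<^sub>R x"
    and norm_scaleC: "norm (a *\<^sub>C x) = cmod a * norm x"

instantiation complex :: complex_banach
begin

definition scaleC_complex :: "complex \<Rightarrow> complex \<Rightarrow> complex"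
  where "scaleC_complex a x = a * x"

instance
  by standard (auto simp: scaleC_complex_def algebra_simps norm_mult scaleR_conv_of_real)

end

text \<open>Vector-valued analogue of \<^const>\<open>analytic_on\<close>.\<close>

definition complex_differentiable_at :: "(complex \<Rightarrow> 'a::complex_banach) \<Rightarrow> complex \<Rightarrow> bool"
  where "complex_differentiable_at F z \<longleftrightarrow>
    (\<exists>D. (F has_derivative (\<lambda>h. h *\<^sub>C D)) (at z))"

definition vector_analytic_on :: "(complex \<Rightarrow> 'a::complex_banach) \<Rightarrow> complex set \<Rightarrow> bool"
  where "vector_analytic_on F S \<longleftrightarrow>
    (\<forall>z\<in>S. \<exists>e>0. \<forall>w\<in>ball z e. complex_differentiable_at F w)"

section \<open>Bochner integral in arbitrary Banach spaces\<close>

text \<open>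
  The library's \<^const>\<open>has_bochner_integral\<close> is restricted to second countable (hence separable)
  spaces. The definitions below follow it, with Borel measurability replaced by strong measurability
  (for complete measures), so that no separability is needed.
\<close>

definition strongly_measurable :: "'a measure \<Rightarrow> ('a \<Rightarrow> 'b::real_normed_vector) \<Rightarrow> bool"
  where "strongly_measurable M f \<longleftrightarrow>
    (\<exists>s. (\<forall>i::nat. simple_function M (s i)) \<and> (AE x in M. (\<lambda>i. s i x) \<longlonglongrightarrow> f x))"

definition has_vector_bochner_integral ::
    "'a measure \<Rightarrow> ('a \<Rightarrow> 'b::real_normed_vector) \<Rightarrow> 'b \<Rightarrow> bool"
  where "has_vector_bochner_integral M f x \<longleftrightarrow>
    strongly_measurable M f \<and>
    (\<exists>s. (\<forall>i::nat. Bochner_Integration.simple_bochner_integrable M (s i)) \<and>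
      (\<lambda>i. \<integral>\<^sup>+ t. ennreal (norm (f t - s i t)) \<partial>M) \<longlonglongrightarrow> 0 \<and>
      (\<lambda>i. Bochner_Integration.simple_bochner_integral M (s i)) \<longlonglongrightarrow> x)"

definition vector_bochner_integrable :: "'a measure \<Rightarrow> ('a \<Rightarrow> 'b::real_normed_vector) \<Rightarrow> bool"
  where "vector_bochner_integrable M f \<longleftrightarrow> (\<exists>x. has_vector_bochner_integral M f x)"

definition vector_bochner_integral :: "'a measure \<Rightarrow> ('a \<Rightarrow> 'b::real_normed_vector) \<Rightarrow> 'b"
  where "vector_bochner_integral M f =
    (if vector_bochner_integrable M f then THE x. has_vector_bochner_integral M f x else 0)"

section \<open>Function spaces on subsets of the line\<close>

text \<open>
  A function on a subset \<open>S\<close> of the line is represented by a total function on the reals, of which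
  only the values on \<open>S\<close> are used.
\<close>

definition locally_integrable_on :: "(real \<Rightarrow> 'b::real_normed_vector) \<Rightarrow> real set \<Rightarrow> bool"
  where "locally_integrable_on f S \<longleftrightarrow>
    (\<forall>C. compact C \<and> C \<subseteq> S \<longrightarrow> vector_bochner_integrable (lebesgue_on C) f)"

definition in_Lp_on :: "ennreal \<Rightarrow> real set \<Rightarrow> (real \<Rightarrow> 'b::real_normed_vector) \<Rightarrow> bool"
  where "in_Lp_on p S f \<longleftrightarrow>
    strongly_measurable (lebesgue_on S) f \<and>
    (if p = \<infinity> then \<exists>C. AE t in lebesgue_on S. norm (f t) \<le> C
     else (\<integral>\<^sup>+ t. ennreal (norm (f t) powr enn2real p) \<partial>lebesgue_on S) < \<infinity>)"

definition test_function_on :: "real set \<Rightarrow> (real \<Rightarrow> real) \<Rightarrow> bool"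
  where "test_function_on S \<phi> \<longleftrightarrow>
    (\<forall>k t. (deriv ^^ k) \<phi> field_differentiable at t) \<and>
    compact (closure {t. \<phi> t \<noteq> 0}) \<and> closure {t. \<phi> t \<noteq> 0} \<subseteq> S"

definition weak_derivative_on ::
    "real set \<Rightarrow> nat \<Rightarrow> (real \<Rightarrow> 'b::real_normed_vector) \<Rightarrow> (real \<Rightarrow> 'b) \<Rightarrow> bool"
  where "weak_derivative_on S m f g \<longleftrightarrow>
    locally_integrable_on f S \<and> locally_integrable_on g S \<and>
    (\<forall>\<phi>. test_function_on S \<phi> \<longrightarrow>
      vector_bochner_integral (lebesgue_on S) (\<lambda>t. (deriv ^^ m) \<phi> t *\<^sub>R f t) =
      (- 1) ^ m *\<^sub>R vector_bochner_integral (lebesgue_on S) (\<lambda>t. \<phi> t *\<^sub>R g t))"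

section \<open>Laplace transform, spectral region and weight\<close>

definition laplace_transform :: "(real \<Rightarrow> 'a::complex_banach) \<Rightarrow> complex \<Rightarrow> 'a"
  where "laplace_transform f z =
    vector_bochner_integral (lebesgue_on {0..}) (\<lambda>t. exp (- z * complex_of_real t) *\<^sub>C f t)"

definition Omega :: "(real \<Rightarrow> real) \<Rightarrow> complex set"
  where "Omega M = {z. 0 > Re z \<and> Re z > - 1 / M \<bar>Im z\<bar>}"

definition right_inverse :: "(real \<Rightarrow> real) \<Rightarrow> real \<Rightarrow> real"
  where "right_inverse N t = Sup {s. s \<ge> 0 \<and> N s = t}"

definition weight :: "(real \<Rightarrow> real) \<Rightarrow> real \<Rightarrow> real"
  where "weight N t = (if t \<ge> N 1 then right_inverse N t else 1)"

definition M_log :: "(real \<Rightarrow> real) \<Rightarrow> (real \<Rightarrow> real) \<Rightarrow> real \<Rightarrow> real"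
  where "M_log M K s = M s * ln (K s)"

end

theory Submission
  imports Defs "HOL-Complex_Analysis.Complex_Analysis" "HOL-Real_Asymp.Real_Asymp"
begin

text \<open>
  The function \<open>f\<close> is split, near a large time \<open>t\<close>, into low and high frequencies at the threshold
  \<open>R = w (c t)\<close>, where \<open>w\<close> is the weight. The high frequencies are small because the \<open>m\<close>-th derivative of
  \<open>f\<close> is in \<open>L\<^sup>p\<close>: their size is \<open>R powr (- m)\<close> times an average of \<open>norm (fm v)\<close> over \<open>v\<close> at distance
  about \<open>1 / R\<close> from \<open>t\<close>. The low frequencies are small because the Laplace transform extends to the left
  of the imaginary axis up to distance \<open>1 / M R\<close> with a bound \<open>K R\<close>: shifting the contour gains
  \<open>exp (- t / (2 m M R))\<close>, and \<open>R\<close> is chosen such that this beats a high power of \<open>K R\<close>, that is, such that \<open>t\<close>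
  is comparable to \<open>M R ln (K R)\<close> with a large constant. Multiplication by \<open>R ^ m\<close> then leaves an average
  of an \<open>L\<^sup>p\<close> function and an error of order \<open>1 / t\<^sup>2\<close>.

  The splitting is done by the kernel \<open>sinc (\<kappa> s) ^ N bessel_kernel U \<beta> s\<close>, whose frequencies are bounded by
  \<open>N \<kappa> + U / \<beta> < R\<close>. The Bessel factor is the Fourier transform of \<open>exp (- cosh u)\<close> truncated at
  \<open>\<bar>u\<bar> \<le> U\<close>. Shifting the contour in \<open>contour_shift_bound\<close> produces, besides the gain, the two vertical sides of a
  rectangle; there the weight is at most \<open>exp (- cosh U / 2)\<close>. With \<open>U = R M R / 4\<close> this is doubly
  exponentially small in \<open>R M R\<close>, and by the growth condition on \<open>K\<close> it beats every power
  of \<open>K R\<close> (\<open>double_exp_dominates\<close>, \<open>scale_selection\<close>).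

  For the high frequencies, \<open>f\<close> is almost everywhere an \<open>m\<close>-fold primitive of its weak derivative
  (\<open>weak_deriv_iter_primitive\<close>), and \<open>m\<close>-fold differences of it are controlled by local integrals of
  \<open>fm\<close> (\<open>nabla_iter_primitive_bound\<close>). In \<open>pointwise_estimate\<close> the kernel is integrated against the
  differences of \<open>f\<close>, not against \<open>f\<close>: the shifted terms are again low-frequency parts,
  and a lower bound of the mass of the kernel takes the place of vanishing moments.

  The scale \<open>\<kappa> = R / (4 N)\<close> is kept constant on dyadic blocks of \<open>t\<close>. The averaging kernels then
  satisfy a Schur-type bound (\<open>dyadic_kernel_mass\<close>), so the averages of \<open>norm (fm v)\<close> stay in \<open>L\<^sup>p\<close>
  (\<open>dyadic_convolution_Lp\<close>).

  All this is done for complex-valued functions with constants that depend only on \<open>m\<close>, \<open>M\<close> and \<open>K\<close>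
  (\<open>scalar_estimate\<close>). It is applied to \<open>\<phi> \<circ> f\<close> for the functionals \<open>\<phi>\<close> of norm at most 1. Such functionals
  are norming by the Hahn--Banach theorem, and since \<open>f\<close> is strongly measurable, countably many of them
  recover \<open>norm (f t)\<close> for almost every \<open>t\<close> (\<open>countable_norming_family\<close>).
\<close>


section \<open>Norming functionals\<close>

definition sublinear_below_norm :: "('a::real_normed_vector \<Rightarrow> real) \<Rightarrow> bool"
  where "sublinear_below_norm q \<longleftrightarrow> (\<forall>x y. q (x + y) \<le> q x + q y) \<and>
    (\<forall>a x. a \<ge> 0 \<longrightarrow> q (a *\<^sub>R x) = a * q x) \<and> (\<forall>x. q x \<le> norm x)"

lemma sublinear_below_normD:
  assumes "sublinear_below_norm q"
  shows "q (x + y) \<le> q x + q y" "a \<ge> 0 \<Longrightarrow> q (a *\<^sub>R x) = a * q x" "q x \<le> norm x"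
    "q 0 = 0" "- q (- x) \<le> q x" "- norm x \<le> q x"
proof -
  show 1: "q (x + y) \<le> q x + q y" "a \<ge> 0 \<Longrightarrow> q (a *\<^sub>R x) = a * q x" "q x \<le> norm x" for x y a
    using assms by (auto simp: sublinear_below_norm_def)
  show 0: "q 0 = 0" using 1(2)[of 0 0] by simp
  show "- q (- x) \<le> q x" using 1(1)[of x "-x"] 0 by simp
  then show "- norm x \<le> q x" using 1(3)[of "-x"] by simp
qed

text \<open>
  The function \<open>q' y = inf {q (y + a z) - a q z | a \<ge> 0}\<close> lies below \<open>q\<close>. For a minimal \<open>q\<close> it
  must equal \<open>q\<close>, and the last property then says that \<open>q\<close> is additive in the direction \<open>z\<close>; for \<open>q\<close>
  the norm it produces a functional that attains the norm at \<open>z\<close>.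
\<close>

lemma sublinear_lower_in_direction:
  fixes q :: "'a::real_normed_vector \<Rightarrow> real"
  assumes q: "sublinear_below_norm q"
  obtains q' where "sublinear_below_norm q'" "\<And>y. q' y \<le> q y" "\<And>y. q' y \<le> q (y + z) - q z"
proof -
  note D = sublinear_below_normD[OF q]
  define V where "V y = (\<lambda>a. q (y + a *\<^sub>R z) - a * q z) ` {0..}" for y
  define q' where "q' y = Inf (V y)" for y
  have lb: "- q (- y) \<le> q (y + a *\<^sub>R z) - a * q z" if "a \<ge> 0" for y a
    using D(1)[of "y + a *\<^sub>R z" "- y"] D(2)[OF that, of z] by (simp add: algebra_simps)
  have bdd: "bdd_below (V y)" for y
    unfolding V_def by (rule bdd_belowI[where m="- q (- y)"]) (use lb in auto)
  have ne: "V y \<noteq> {}" for y by (auto simp: V_def)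
  have upper: "q' y \<le> q (y + a *\<^sub>R z) - a * q z" if "a \<ge> 0" for y a
    unfolding q'_def by (rule cInf_lower[OF _ bdd]) (use that in \<open>auto simp: V_def\<close>)
  have le: "q' y \<le> q y" for y using upper[of 0 y] by simp
  have add: "q' (x + y) \<le> q' x + q' y" for x y
  proof -
    have "q' (x + y) - q' x \<le> v" if "v \<in> V y" for v
    proof -
      obtain b where b: "b \<ge> 0" "v = q (y + b *\<^sub>R z) - b * q z" using \<open>v \<in> V y\<close> by (auto simp: V_def)
      have "q' (x + y) - v \<le> u" if "u \<in> V x" for u
      proof -
        obtain a where a: "a \<ge> 0" "u = q (x + a *\<^sub>R z) - a * q z" using \<open>u \<in> V x\<close> by (auto simp: V_def)
        have "q' (x + y) \<le> q ((x + y) + (a + b) *\<^sub>R z) - (a + b) * q z"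
          using a b by (intro upper) auto
        also have "q ((x + y) + (a + b) *\<^sub>R z) \<le> q (x + a *\<^sub>R z) + q (y + b *\<^sub>R z)"
          using D(1)[of "x + a *\<^sub>R z" "y + b *\<^sub>R z"] by (simp add: algebra_simps)
        finally show ?thesis using a b by (simp add: algebra_simps)
      qed
      then have "q' (x + y) - v \<le> q' x" unfolding q'_def[of x] by (intro cInf_greatest ne)
      then show ?thesis by simp
    qed
    then have "q' (x + y) - q' x \<le> q' y" unfolding q'_def[of y] by (intro cInf_greatest ne)
    then show ?thesis by simp
  qed
  have scale_le: "q' (a *\<^sub>R x) \<le> a * q' x" if "a > 0" for a x
  proof -
    have "q' (a *\<^sub>R x) / a \<le> v" if "v \<in> V x" for v
    proof -
      obtain b where b: "b \<ge> 0" "v = q (x + b *\<^sub>R z) - b * q z" using \<open>v \<in> V x\<close> by (auto simp: V_def)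
      have "q' (a *\<^sub>R x) \<le> q (a *\<^sub>R x + (a * b) *\<^sub>R z) - (a * b) * q z"
        using \<open>a > 0\<close> b by (intro upper) auto
      also have "\<dots> = a * v" using D(2)[of a "x + b *\<^sub>R z"] \<open>a > 0\<close> by (simp add: b(2) scaleR_add_right right_diff_distrib)
      finally show ?thesis using \<open>a > 0\<close> by (simp add: field_simps)
    qed
    then have "q' (a *\<^sub>R x) / a \<le> q' x" unfolding q'_def[of x] by (intro cInf_greatest ne)
    then show ?thesis using \<open>a > 0\<close> by (simp add: field_simps)
  qed
  have zero: "q' 0 = 0"
  proof (rule antisym)
    show "q' 0 \<le> 0" using le[of 0] D(4) by simp
    show "0 \<le> q' 0" unfolding q'_def by (rule cInf_greatest[OF ne]) (use lb[where y=0] D(4) in \<open>auto simp: V_def\<close>)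
  qed
  have scale: "q' (a *\<^sub>R x) = a * q' x" if "a \<ge> 0" for a x
  proof (cases "a = 0")
    case False
    then have "a > 0" using that by simp
    have "q' x \<le> inverse a * q' (a *\<^sub>R x)"
      using scale_le[of "inverse a" "a *\<^sub>R x"] \<open>a > 0\<close> by simp
    then have "a * q' x \<le> q' (a *\<^sub>R x)" using \<open>a > 0\<close> by (simp add: field_simps)
    then show ?thesis using scale_le[OF \<open>a > 0\<close>, of x] by simp
  qed (simp add: zero)
  show ?thesis
  proof
    show "sublinear_below_norm q'"
      unfolding sublinear_below_norm_def using add scale le D(3) by (meson order_trans)
    show "q' y \<le> q y" for y by (rule le)
    show "q' y \<le> q (y + z) - q z" for y using upper[of 1 y] by simp
  qed
qed

text \<open>
  Zorn's lemma applies because every sublinear function below the norm is also bounded below by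
  minus the norm, so the pointwise infimum of a chain is finite and again sublinear.
\<close>

lemma minimal_sublinear_exists:
  fixes p :: "'a::real_normed_vector \<Rightarrow> real"
  assumes p: "sublinear_below_norm p"
  obtains q where "sublinear_below_norm q" "\<And>y. q y \<le> p y"
    "\<And>q'. sublinear_below_norm q' \<Longrightarrow> (\<And>y. q' y \<le> q y) \<Longrightarrow> q' = q"
proof -
  define A where "A = {q. sublinear_below_norm q \<and> (\<forall>y. q y \<le> p y)}"
  define P :: "('a \<Rightarrow> real) \<Rightarrow> ('a \<Rightarrow> real) \<Rightarrow> bool" where "P a b \<longleftrightarrow> (\<forall>y. b y \<le> a y)" for a b
  have "\<exists>q\<in>A. \<forall>a\<in>A. P q a \<longrightarrow> a = q"
  proof (rule predicate_Zorn)
    show "partial_order_on A (relation_of P A)"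
      unfolding P_def partial_order_on_def preorder_on_def refl_on_def trans_def antisym_def relation_of_def
      by (auto intro: order_trans simp: fun_eq_iff order_antisym)
    fix C assume C: "C \<in> Chains (relation_of P A)"
    have CA: "C \<subseteq> A" using C unfolding Chains_def relation_of_def by auto
    have tot: "(\<forall>y. a y \<le> b y) \<or> (\<forall>y. b y \<le> a y)" if "a \<in> C" "b \<in> C" for a b
      using C that unfolding Chains_def relation_of_def P_def by blast
    show "\<exists>u\<in>A. \<forall>a\<in>C. P a u"
    proof (cases "C = {}")
      case True
      then show ?thesis using p by (auto simp: A_def)
    next
      case ne: False
      define u where "u y = Inf ((\<lambda>q. q y) ` C)" for y
      have sub: "sublinear_below_norm q" if "q \<in> C" for q using that CA by (auto simp: A_def)
      note DD = sublinear_below_normD[OF sub]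
      have bdd: "bdd_below ((\<lambda>q. q y) ` C)" for y
        by (rule bdd_belowI[where m="- norm y"]) (use DD(6) in auto)
      have upper: "u y \<le> q y" if "q \<in> C" for q y
        unfolding u_def using that by (intro cInf_lower bdd) auto
      have greatest: "c \<le> u y" if "\<And>q. q \<in> C \<Longrightarrow> c \<le> q y" for c y
        unfolding u_def using ne that by (intro cInf_greatest) auto
      have "sublinear_below_norm u"
        unfolding sublinear_below_norm_def
      proof (intro conjI allI impI)
        fix x y
        have "u (x + y) - u y \<le> q x" if q: "q \<in> C" for q
        proof -
          have "u (x + y) - q x \<le> r y" if r: "r \<in> C" for r
          proof -
            obtain s where s: "s \<in> C" "\<forall>y. s y \<le> q y" "\<forall>y. s y \<le> r y" using tot[OF q r] q r by blast
            have "u (x + y) \<le> s (x + y)" using upper s by blast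
            also have "\<dots> \<le> s x + s y" using DD(1) s by blast
            finally show ?thesis using s(2)[rule_format, of x] s(3)[rule_format, of y] by linarith
          qed
          then have "u (x + y) - q x \<le> u y" by (rule greatest)
          then show ?thesis by simp
        qed
        then have "u (x + y) - u y \<le> u x" by (rule greatest)
        then show "u (x + y) \<le> u x + u y" by simp
      next
        fix a :: real and x assume a: "a \<ge> 0"
        have le: "u (b *\<^sub>R y) \<le> b * u y" if "b > 0" for b y
        proof -
          have "u (b *\<^sub>R y) / b \<le> q y" if "q \<in> C" for q
            using upper[OF that, of "b *\<^sub>R y"] DD(2)[OF that, of b y] \<open>b > 0\<close> by (simp add: field_simps)
          then have "u (b *\<^sub>R y) / b \<le> u y" by (rule greatest)
          then show ?thesis using \<open>b > 0\<close> by (simp add: field_simps)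
        qed
        show "u (a *\<^sub>R x) = a * u x"
        proof (cases "a = 0")
          case True
          have "(\<lambda>q. q (0::'a)) ` C = (\<lambda>q. 0) ` C" using DD(4) by (intro image_cong) auto
          then have "(\<lambda>q. q (0::'a)) ` C = {0}" using ne by auto
          then show ?thesis using True by (simp add: u_def)
        next
          case False
          then have "a > 0" using a by simp
          then show ?thesis using le[of a x] le[of "inverse a" "a *\<^sub>R x"] by (simp add: field_simps)
        qed
      next
        fix x show "u x \<le> norm x" using ne upper DD(3) by (meson all_not_in_conv order_trans)
      qed
      moreover have "u y \<le> p y" for y using ne upper CA unfolding A_def by (force intro: order_trans)
      ultimately show ?thesis using upper by (auto simp: A_def P_def intro!: bexI[of _ u])
    qed
  qed
  then show ?thesis using that unfolding A_def P_def by (auto intro: order_trans) (metis order_trans)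
qed

text \<open>
  A minimal sublinear function below the norm is linear. To make it attain the norm at \<open>x\<close>, the
  norm is first lowered in the direction \<open>x\<close>: this forces the value at \<open>- x\<close> to be at most
  \<open>- norm x\<close>.
\<close>

lemma real_norming_functional:
  fixes x :: "'a::real_normed_vector"
  obtains \<psi> where "\<And>y z. \<psi> (y + z) = \<psi> y + \<psi> z" "\<And>a y. \<psi> (a *\<^sub>R y) = a * \<psi> y"
    "\<And>y. \<psi> y \<le> norm y" "\<psi> x = norm x"
proof -
  have n: "sublinear_below_norm (norm :: 'a \<Rightarrow> real)"
    by (auto simp: sublinear_below_norm_def norm_triangle_ineq)
  obtain p where p: "sublinear_below_norm p" "\<And>y. p y \<le> norm (y + x) - norm x"
    using sublinear_lower_in_direction[OF n, of x] by metis
  obtain q where q: "sublinear_below_norm q" "\<And>y. q y \<le> p y"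
    and min: "\<And>q'. sublinear_below_norm q' \<Longrightarrow> (\<And>y. q' y \<le> q y) \<Longrightarrow> q' = q"
    using minimal_sublinear_exists[OF p(1)] by metis
  note D = sublinear_below_normD[OF q(1)]
  have add: "q (y + z) = q y + q z" for y z
  proof -
    obtain q' where q': "sublinear_below_norm q'" "\<And>y. q' y \<le> q y" "\<And>y. q' y \<le> q (y + z) - q z"
      using sublinear_lower_in_direction[OF q(1), of z] by metis
    have "q' = q" using min q' by blast
    then show ?thesis using q'(3)[of y] D(1)[of y z] by simp
  qed
  have neg: "q (- y) = - q y" for y using add[of y "-y"] D(4) by simp
  show ?thesis
  proof (rule that[of q])
    show "q (a *\<^sub>R y) = a * q y" for a y
    proof (cases "a \<ge> 0")
      case False
      then have "q ((- a) *\<^sub>R y) = (- a) * q y" by (intro D(2)) auto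
      then show ?thesis using neg[of "a *\<^sub>R y"] by simp
    qed (rule D(2))
    have "q (- x) \<le> - norm x" using q(2)[of "-x"] p(2)[of "-x"] by simp
    then show "q x = norm x" using neg[of x] D(3)[of x] by simp
  qed (use add D(3) in auto)
qed

definition dual_ball :: "('a::complex_banach \<Rightarrow> complex) set"
  where "dual_ball = {\<phi>. (\<forall>x y. \<phi> (x + y) = \<phi> x + \<phi> y) \<and> (\<forall>c x. \<phi> (c *\<^sub>C x) = c * \<phi> x) \<and>
    (\<forall>x. norm (\<phi> x) \<le> norm x)}"

lemma dual_ballD:
  assumes "\<phi> \<in> dual_ball"
  shows "\<phi> (x + y) = \<phi> x + \<phi> y" "\<phi> (c *\<^sub>C x) = c * \<phi> x" "norm (\<phi> x) \<le> norm x" "bounded_linear \<phi>"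
proof -
  show 1: "\<phi> (x + y) = \<phi> x + \<phi> y" "\<phi> (c *\<^sub>C x) = c * \<phi> x" "norm (\<phi> x) \<le> norm x" for x y c
    using assms by (auto simp: dual_ball_def)
  show "bounded_linear \<phi>"
    by (rule bounded_linear_intro[where K=1])
      (use 1(1,3) 1(2)[of "complex_of_real _"] in \<open>auto simp: scaleC_of_real scaleR_conv_of_real\<close>)
qed

text \<open>
  A real functional \<open>\<psi>\<close> is complexified as \<open>\<psi> y - i \<psi> (i y)\<close>. The bound by the norm survives
  because \<open>y\<close> can be rotated so that the complex value becomes real.
\<close>

lemma norming_functional:
  fixes x :: "'a::complex_banach"
  obtains \<phi> where "\<phi> \<in> dual_ball" "\<phi> x = complex_of_real (norm x)"
proof -
  obtain \<psi> :: "'a \<Rightarrow> real" where add: "\<And>y z. \<psi> (y + z) = \<psi> y + \<psi> z"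
    and sc: "\<And>a y. \<psi> (a *\<^sub>R y) = a * \<psi> y" and le: "\<And>y. \<psi> y \<le> norm y" and x: "\<psi> x = norm x"
    using real_norming_functional[of x] by metis
  define \<phi> where "\<phi> y = Complex (\<psi> y) (- \<psi> (\<i> *\<^sub>C y))" for y
  have expand: "c *\<^sub>C y = Re c *\<^sub>R y + Im c *\<^sub>R (\<i> *\<^sub>C y)" for c and y :: 'a
  proof -
    have "c = of_real (Re c) + of_real (Im c) * \<i>" by (simp add: complex_eq_iff)
    then have "c *\<^sub>C y = (of_real (Re c) + of_real (Im c) * \<i>) *\<^sub>C y" by simp
    then show ?thesis by (simp only: scaleC_add_left scaleC_scaleC[symmetric] scaleC_of_real)
  qed
  have \<psi>C: "\<psi> (c *\<^sub>C y) = Re c * \<psi> y + Im c * \<psi> (\<i> *\<^sub>C y)" for c and y :: 'a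
    by (subst expand) (simp only: add sc)
  have lin: "\<phi> (c *\<^sub>C y) = c * \<phi> y" for c y
    using \<psi>C[of c y] \<psi>C[of "\<i> * c" y] by (simp add: \<phi>_def scaleC_scaleC complex_eq_iff)
  have bound: "norm (\<phi> y) \<le> norm y" for y
  proof (cases "\<phi> y = 0")
    case False
    define c where "c = cnj (\<phi> y) / of_real (norm (\<phi> y))"
    have nc: "norm c = 1" using False by (simp add: c_def norm_divide)
    have "c * \<phi> y = of_real (norm (\<phi> y))"
      using False complex_norm_square[of "\<phi> y"] by (simp add: c_def field_simps power2_eq_square)
    then have "\<psi> (c *\<^sub>C y) = norm (\<phi> y)" using lin[of c y] by (simp add: \<phi>_def complex_eq_iff)
    then show ?thesis using le[of "c *\<^sub>C y"] nc by (simp add: norm_scaleC)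
  qed simp
  have "Re (\<phi> x) = norm x" by (simp add: \<phi>_def x)
  moreover have "Im (\<phi> x) = 0"
  proof -
    have "(Re (\<phi> x))\<^sup>2 + (Im (\<phi> x))\<^sup>2 \<le> (norm x)\<^sup>2"
      using bound[of x] by (metis cmod_power2 norm_ge_zero power_mono)
    then show ?thesis using \<open>Re (\<phi> x) = norm x\<close> by (simp add: power2_less_eq_zero_iff)
  qed
  ultimately have "\<phi> x = of_real (norm x)" by (simp add: complex_eq_iff)
  moreover have "\<phi> \<in> dual_ball"
  proof -
    have "\<phi> (y + z) = \<phi> y + \<phi> z" for y z by (simp add: \<phi>_def add scaleC_add_right complex_eq_iff)
    then show ?thesis unfolding dual_ball_def using lin bound by blast
  qed
  ultimately show ?thesis using that by blast
qed

section \<open>The Bochner integral in nonseparable spaces\<close>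

lemma complete_measure_lebesgue_on:
  assumes "S \<in> sets lebesgue"
  shows "complete_measure (lebesgue_on S)"
proof
  fix A B assume "B \<subseteq> A" "A \<in> null_sets (lebesgue_on S)"
  then show "B \<in> sets (lebesgue_on S)"
    using assms by (auto simp: null_sets_restrict_space sets_restrict_space_iff intro: completion.complete2[THEN null_setsD2])
qed

lemma strongly_measurable_compose2:
  fixes h :: "'b::real_normed_vector \<Rightarrow> 'c::real_normed_vector \<Rightarrow> 'd::real_normed_vector"
  assumes f: "strongly_measurable M f" and g: "strongly_measurable M g"
    and h: "\<And>a b u v. u \<longlonglongrightarrow> a \<Longrightarrow> v \<longlonglongrightarrow> b \<Longrightarrow> (\<lambda>i. h (u i) (v i)) \<longlonglongrightarrow> h a b"
  shows "strongly_measurable M (\<lambda>x. h (f x) (g x))"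
proof -
  obtain s where s: "\<And>i::nat. simple_function M (s i)" "AE x in M. (\<lambda>i. s i x) \<longlonglongrightarrow> f x"
    using f by (auto simp: strongly_measurable_def)
  obtain t where t: "\<And>i::nat. simple_function M (t i)" "AE x in M. (\<lambda>i. t i x) \<longlonglongrightarrow> g x"
    using g by (auto simp: strongly_measurable_def)
  have "AE x in M. (\<lambda>i. h (s i x) (t i x)) \<longlonglongrightarrow> h (f x) (g x)"
    using s(2) t(2) by eventually_elim (rule h)
  moreover have "simple_function M (\<lambda>x. h (s i x) (t i x))" for i
    by (rule simple_function_compose2[OF s(1) t(1)])
  ultimately show ?thesis unfolding strongly_measurable_def
    by (intro exI[of _ "\<lambda>i x. h (s i x) (t i x)"] conjI allI)
qed

lemma strongly_measurable_simple: "simple_function M s \<Longrightarrow> strongly_measurable M s"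
  unfolding strongly_measurable_def by (intro exI[of _ "\<lambda>_. s"]) auto

lemma borel_measurable_imp_strongly_measurable:
  fixes f :: "'a \<Rightarrow> 'b::{real_normed_vector, second_countable_topology}"
  assumes "f \<in> borel_measurable M"
  shows "strongly_measurable M f"
proof -
  obtain s where "\<forall>i::nat. simple_function M (s i)" "\<forall>x\<in>space M. (\<lambda>i. s i x) \<longlonglongrightarrow> f x"
    using borel_measurable_implies_sequence_metric[OF assms, of 0] by blast
  then show ?thesis unfolding strongly_measurable_def by (intro exI[of _ s] conjI AE_I2) auto
qed

text \<open>
  A strongly measurable function is a limit of simple functions only almost everywhere, so
  completeness of the measure is what turns this into Borel measurability of the composition.
\<close>

lemma strongly_measurable_imp_borel_measurable:
  fixes g :: "'b::real_normed_vector \<Rightarrow> 'c::{real_normed_vector, second_countable_topology}"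
  assumes M: "complete_measure M" and f: "strongly_measurable M f" and g: "continuous_on UNIV g"
  shows "(\<lambda>x. g (f x)) \<in> borel_measurable M"
proof -
  obtain s where s: "\<And>i::nat. simple_function M (s i)" "AE x in M. (\<lambda>i. s i x) \<longlonglongrightarrow> f x"
    using f by (auto simp: strongly_measurable_def)
  obtain N where N: "N \<in> null_sets M" "{x \<in> space M. \<not> (\<lambda>i. s i x) \<longlonglongrightarrow> f x} \<subseteq> N"
    using s(2) by (auto simp: eventually_ae_filter)
  define u where "u x = (if x \<in> N then 0 else g (f x))" for x
  have [measurable]: "N \<in> sets M" using N by auto
  have [measurable]: "(\<lambda>x. g (s i x)) \<in> borel_measurable M" for i
    by (rule borel_measurable_simple_function[OF simple_function_compose1[OF s(1)]])
  have "u \<in> borel_measurable M"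
  proof (rule borel_measurable_LIMSEQ_metric)
    show "(\<lambda>x. if x \<in> N then 0 else g (s i x)) \<in> borel_measurable M" for i by measurable
    fix x assume "x \<in> space M"
    show "(\<lambda>i. if x \<in> N then 0 else g (s i x)) \<longlonglongrightarrow> u x"
    proof (cases "x \<in> N")
      case False
      then have "(\<lambda>i. s i x) \<longlonglongrightarrow> f x" using N \<open>x \<in> space M\<close> by auto
      then have "(\<lambda>i. g (s i x)) \<longlonglongrightarrow> g (f x)"
        by (rule continuous_on_tendsto_compose[OF g]) auto
      then show ?thesis using False by (simp add: u_def)
    qed (simp add: u_def)
  qed
  then have [measurable]: "u \<in> borel_measurable M" .
  interpret complete_measure M by (rule M)
  show ?thesis
  proof (rule measurableI)
    fix A :: "'c set" assume A: "A \<in> sets borel"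
    have 1: "u -` A \<inter> space M \<in> sets M" using A by measurable
    have "AE x in M. x \<notin> N" using N(1) by (rule AE_not_in)
    then have "AE x in M. x \<in> u -` A \<inter> space M \<longleftrightarrow> x \<in> (\<lambda>x. g (f x)) -` A \<inter> space M"
      by eventually_elim (auto simp: u_def)
    then show "(\<lambda>x. g (f x)) -` A \<inter> space M \<in> sets M" by (rule in_sets_AE[OF _ 1]) auto
  qed auto
qed

text \<open>
  A functional maps simple functions to simple functions and is Lipschitz, so it carries an
  approximation of \<open>f\<close> in mean to an approximation of \<open>\<phi> f\<close> in mean.
\<close>

lemma has_vector_bochner_integral_bounded_linear:
  fixes \<phi> :: "'b::real_normed_vector \<Rightarrow> complex"
  assumes M: "complete_measure M" and x: "has_vector_bochner_integral M f x" and \<phi>: "bounded_linear \<phi>"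
  shows "has_bochner_integral M (\<lambda>t. \<phi> (f t)) (\<phi> x)"
proof -
  interpret \<phi>: bounded_linear \<phi> by fact
  obtain B where B: "B > 0" "\<And>y. norm (\<phi> y) \<le> norm y * B" using \<phi>.pos_bounded by blast
  obtain s where f: "strongly_measurable M f" and s: "\<And>i::nat. Bochner_Integration.simple_bochner_integrable M (s i)"
    "(\<lambda>i. \<integral>\<^sup>+ t. ennreal (norm (f t - s i t)) \<partial>M) \<longlonglongrightarrow> 0"
    "(\<lambda>i. Bochner_Integration.simple_bochner_integral M (s i)) \<longlonglongrightarrow> x"
    using x unfolding has_vector_bochner_integral_def by blast
  show ?thesis
  proof (rule has_bochner_integral.intros[where s="\<lambda>i t. \<phi> (s i t)"])
    show "(\<lambda>t. \<phi> (f t)) \<in> borel_measurable M"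
      by (rule strongly_measurable_imp_borel_measurable[OF M f])
        (simp add: \<phi>.continuous_on)
    show "Bochner_Integration.simple_bochner_integrable M (\<lambda>t. \<phi> (s i t))" for i
      using simple_bochner_integrable_compose2[of "\<lambda>a b. \<phi> a", OF _ s(1) s(1)] \<phi>.zero by blast
    have "(\<lambda>i. Bochner_Integration.simple_bochner_integral M (\<lambda>t. \<phi> (s i t))) = (\<lambda>i. \<phi> (Bochner_Integration.simple_bochner_integral M (s i)))"
      using simple_bochner_integral_linear[OF \<phi>.linear_axioms s(1)] by auto
    then show "(\<lambda>i. Bochner_Integration.simple_bochner_integral M (\<lambda>t. \<phi> (s i t))) \<longlonglongrightarrow> \<phi> x"
      using \<phi>.tendsto[OF s(3)] by simp
    have "(\<integral>\<^sup>+ t. ennreal (norm (\<phi> (f t) - \<phi> (s i t))) \<partial>M) \<le> ennreal B * (\<integral>\<^sup>+ t. ennreal (norm (f t - s i t)) \<partial>M)" for i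
    proof -
      have sm: "simple_function M (s i)" using s(1)[of i] by (rule simple_bochner_integrable.cases)
      have m: "(\<lambda>t. norm (f t - s i t)) \<in> borel_measurable M"
        by (rule strongly_measurable_imp_borel_measurable[OF M strongly_measurable_compose2[OF f strongly_measurable_simple[OF sm]]])
          (auto intro!: continuous_intros tendsto_intros)
      have "(\<integral>\<^sup>+ t. ennreal (norm (\<phi> (f t) - \<phi> (s i t))) \<partial>M) \<le> (\<integral>\<^sup>+ t. ennreal B * ennreal (norm (f t - s i t)) \<partial>M)"
      proof (rule nn_integral_mono)
        fix t
        have "norm (\<phi> (f t) - \<phi> (s i t)) \<le> B * norm (f t - s i t)"
          using B(2)[of "f t - s i t"] by (simp add: \<phi>.diff mult.commute)
        then show "ennreal (norm (\<phi> (f t) - \<phi> (s i t))) \<le> ennreal B * ennreal (norm (f t - s i t))"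
          using B(1) by (simp add: ennreal_mult[symmetric] ennreal_leI)
      qed
      also have "\<dots> = ennreal B * (\<integral>\<^sup>+ t. ennreal (norm (f t - s i t)) \<partial>M)"
        using m by (intro nn_integral_cmult) auto
      finally show ?thesis .
    qed
    moreover from ennreal_tendsto_cmult[OF _ s(2), of "ennreal B"]
    have "(\<lambda>i. ennreal B * (\<integral>\<^sup>+ t. ennreal (norm (f t - s i t)) \<partial>M)) \<longlonglongrightarrow> ennreal B * 0"
      by simp
    then have "(\<lambda>i. ennreal B * (\<integral>\<^sup>+ t. ennreal (norm (f t - s i t)) \<partial>M)) \<longlonglongrightarrow> 0" by simp
    ultimately show "(\<lambda>i. \<integral>\<^sup>+ t. ennreal (norm (\<phi> (f t) - \<phi> (s i t))) \<partial>M) \<longlonglongrightarrow> 0"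
      using tendsto_sandwich[OF _ _ tendsto_const, of 0 "\<lambda>i. \<integral>\<^sup>+ t. ennreal (norm (\<phi> (f t) - \<phi> (s i t))) \<partial>M"
        sequentially "\<lambda>i. ennreal B * (\<integral>\<^sup>+ t. ennreal (norm (f t - s i t)) \<partial>M)"] by simp
  qed
qed

text \<open>
  The dual ball separates points, so a vector-valued integral is determined by its scalar images; in
  particular it is unique.
\<close>

lemma dual_ball_eqI:
  fixes x y :: "'a::complex_banach"
  assumes "\<And>\<phi>. \<phi> \<in> dual_ball \<Longrightarrow> \<phi> x = \<phi> y"
  shows "x = y"
proof -
  obtain \<phi> where \<phi>: "\<phi> \<in> dual_ball" "\<phi> (x - y) = complex_of_real (norm (x - y))"
    by (rule norming_functional)
  have "\<phi> (x - y) = \<phi> x - \<phi> y"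
    using dual_ballD(4)[OF \<phi>(1)] by (simp add: bounded_linear.linear linear_diff)
  then show ?thesis using assms[OF \<phi>(1)] \<phi>(2) by simp
qed

lemma vector_bochner_integral_functional:
  fixes f :: "'b \<Rightarrow> 'a::complex_banach"
  assumes M: "complete_measure M" and f: "vector_bochner_integrable M f" and \<phi>: "\<phi> \<in> dual_ball"
  shows "integrable M (\<lambda>t. \<phi> (f t))" "\<phi> (vector_bochner_integral M f) = (\<integral>t. \<phi> (f t) \<partial>M)"
proof -
  obtain x where x: "has_vector_bochner_integral M f x" using f by (auto simp: vector_bochner_integrable_def)
  have scalar: "has_bochner_integral M (\<lambda>t. \<psi> (f t)) (\<psi> y)"
    if "has_vector_bochner_integral M f y" "\<psi> \<in> dual_ball" for y \<psi>
    using has_vector_bochner_integral_bounded_linear[OF M that(1) dual_ballD(4)[OF that(2)]] .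
  have "y = x" if "has_vector_bochner_integral M f y" for y
  proof (rule dual_ball_eqI)
    fix \<psi> :: "'a \<Rightarrow> complex" assume "\<psi> \<in> dual_ball"
    then show "\<psi> y = \<psi> x"
      using scalar[OF that] scalar[OF x] has_bochner_integral_eq by blast
  qed
  then have "vector_bochner_integral M f = x"
    using f unfolding vector_bochner_integral_def by (auto intro!: the_equality x)
  then show "integrable M (\<lambda>t. \<phi> (f t))" "\<phi> (vector_bochner_integral M f) = (\<integral>t. \<phi> (f t) \<partial>M)"
    using scalar[OF x \<phi>] by (auto simp: has_bochner_integral_iff)
qed

lemma vector_bochner_integrable_imp:
  assumes M: "complete_measure M" and f: "vector_bochner_integrable M f"
  shows "strongly_measurable M f" "(\<integral>\<^sup>+ t. ennreal (norm (f t)) \<partial>M) < \<infinity>"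
proof -
  obtain x where x: "has_vector_bochner_integral M f x" using f by (auto simp: vector_bochner_integrable_def)
  obtain s where f: "strongly_measurable M f" and s: "\<And>i::nat. Bochner_Integration.simple_bochner_integrable M (s i)"
    "(\<lambda>i. \<integral>\<^sup>+ t. ennreal (norm (f t - s i t)) \<partial>M) \<longlonglongrightarrow> 0"
    using x unfolding has_vector_bochner_integral_def by blast
  have "\<forall>\<^sub>F i in sequentially. (\<integral>\<^sup>+ t. ennreal (norm (f t - s i t)) \<partial>M) < 1"
    using s(2) by (rule order_tendstoD) simp
  then obtain i where i: "(\<integral>\<^sup>+ t. ennreal (norm (f t - s i t)) \<partial>M) < 1"
    by (auto simp: eventually_sequentially)
  have sm: "simple_function M (s i)" using s(1)[of i] by (rule simple_bochner_integrable.cases)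
  have m[measurable]: "(\<lambda>t. norm (f t - s i t)) \<in> borel_measurable M"
    by (rule strongly_measurable_imp_borel_measurable[OF M strongly_measurable_compose2[OF f strongly_measurable_simple[OF sm]]])
      (auto intro!: continuous_intros tendsto_intros)
  have ns: "Bochner_Integration.simple_bochner_integrable M (\<lambda>t. norm (s i t))"
    using simple_bochner_integrable_compose2[of "\<lambda>a b. norm a", OF _ s(1) s(1)] by simp
  have [measurable]: "(\<lambda>t. norm (s i t)) \<in> borel_measurable M"
    by (rule borel_measurable_simple_function[OF simple_function_compose1[OF sm]])
  have "(\<integral>\<^sup>+ t. ennreal (norm (f t)) \<partial>M) \<le> (\<integral>\<^sup>+ t. ennreal (norm (f t - s i t)) + ennreal (norm (s i t)) \<partial>M)"
    by (intro nn_integral_mono) (simp add: ennreal_plus[symmetric] del: ennreal_plus, metis add.commute norm_triangle_sub)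
  also have "\<dots> = (\<integral>\<^sup>+ t. ennreal (norm (f t - s i t)) \<partial>M) + (\<integral>\<^sup>+ t. ennreal (norm (s i t)) \<partial>M)"
    by (intro nn_integral_add) auto
  also have "(\<integral>\<^sup>+ t. ennreal (norm (s i t)) \<partial>M) = ennreal (Bochner_Integration.simple_bochner_integral M (\<lambda>t. norm (s i t)))"
    using simple_bochner_integral_eq_nn_integral[OF ns] by simp
  also have "(\<integral>\<^sup>+ t. ennreal (norm (f t - s i t)) \<partial>M) + ennreal (Bochner_Integration.simple_bochner_integral M (\<lambda>t. norm (s i t))) < \<infinity>"
    using i by (auto simp: less_top[symmetric])
  finally show "(\<integral>\<^sup>+ t. ennreal (norm (f t)) \<partial>M) < \<infinity>" .
qed (use assms in \<open>auto simp: vector_bochner_integrable_def has_vector_bochner_integral_def\<close>)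

text \<open>
  Since \<open>norm (s - t) \<le> norm (f - s) + norm (f - t)\<close>, simple functions that are close in mean to the
  same \<open>f\<close> have close integrals.
\<close>

lemma simple_bochner_integral_diff_bound:
  fixes f :: "'a \<Rightarrow> 'b::real_normed_vector"
  assumes M: "complete_measure M" and f: "strongly_measurable M f"
    and s: "Bochner_Integration.simple_bochner_integrable M s" and t: "Bochner_Integration.simple_bochner_integrable M t"
  shows "ennreal (norm (Bochner_Integration.simple_bochner_integral M s - Bochner_Integration.simple_bochner_integral M t)) \<le>
    (\<integral>\<^sup>+ x. norm (f x - s x) \<partial>M) + (\<integral>\<^sup>+ x. norm (f x - t x) \<partial>M)"
proof -
  have sm: "simple_function M s" "simple_function M t" using s t by (auto elim: simple_bochner_integrable.cases)
  have [measurable]: "(\<lambda>x. norm (f x - s x)) \<in> borel_measurable M" "(\<lambda>x. norm (f x - t x)) \<in> borel_measurable M"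
    by (rule strongly_measurable_imp_borel_measurable[OF M strongly_measurable_compose2[OF f strongly_measurable_simple[OF sm(1)]]]
      strongly_measurable_imp_borel_measurable[OF M strongly_measurable_compose2[OF f strongly_measurable_simple[OF sm(2)]]];
      auto intro!: continuous_intros tendsto_intros)+
  have "ennreal (norm (Bochner_Integration.simple_bochner_integral M s - Bochner_Integration.simple_bochner_integral M t))
      = norm (Bochner_Integration.simple_bochner_integral M (\<lambda>x. s x - t x))"
    using s t by (subst simple_bochner_integral_diff) auto
  also have "\<dots> \<le> Bochner_Integration.simple_bochner_integral M (\<lambda>x. norm (s x - t x))"
    using simple_bochner_integrable_compose2[of "(-)" M "s" "t"] s t
    by (auto intro!: simple_bochner_integral_norm_bound)
  also have "\<dots> = (\<integral>\<^sup>+x. norm (s x - t x) \<partial>M)"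
    using simple_bochner_integrable_compose2[of "\<lambda>x y. norm (x - y)" M "s" "t"] s t
    by (auto intro!: simple_bochner_integral_eq_nn_integral)
  also have "\<dots> \<le> (\<integral>\<^sup>+x. ennreal (norm (f x - s x)) + ennreal (norm (f x - t x)) \<partial>M)"
    by (intro nn_integral_mono)
      (simp add: ennreal_plus[symmetric] del: ennreal_plus, metis dual_order.refl norm_diff_triangle_le norm_minus_commute)
  also have "\<dots> = (\<integral>\<^sup>+ x. norm (f x - s x) \<partial>M) + (\<integral>\<^sup>+ x. norm (f x - t x) \<partial>M)"
    by (rule nn_integral_add) auto
  finally show ?thesis .
qed

text \<open>
  Bochner's criterion. The approximating simple functions are cut off where they exceed
  \<open>2 norm (f x)\<close>; this does not disturb the pointwise limit and makes \<open>3 norm (f x)\<close> a dominating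
  function, so the integrals of the truncations form a Cauchy sequence.
\<close>

lemma vector_bochner_integrableI:
  fixes f :: "'a \<Rightarrow> 'b::banach"
  assumes M: "complete_measure M" and f: "strongly_measurable M f"
    and fin: "(\<integral>\<^sup>+ t. ennreal (norm (f t)) \<partial>M) < \<infinity>"
  shows "vector_bochner_integrable M f"
proof -
  obtain s where s: "\<And>i::nat. simple_function M (s i)" "AE x in M. (\<lambda>i. s i x) \<longlonglongrightarrow> f x"
    using f by (auto simp: strongly_measurable_def)
  have nf[measurable]: "(\<lambda>x. norm (f x)) \<in> borel_measurable M"
    by (rule strongly_measurable_imp_borel_measurable[OF M f]) (intro continuous_intros)
  have [measurable]: "(\<lambda>x. norm (s i x)) \<in> borel_measurable M" for i
    by (rule borel_measurable_simple_function[OF simple_function_compose1[OF s(1)]])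
  \<comment> \<open>Truncation at twice the norm is eventually inactive where \<open>f x\<close> is nonzero.\<close>
  define t where "t i x = (if norm (s i x) \<le> 2 * norm (f x) then s i x else 0)" for i x
  have ts: "simple_function M (t i)" for i
    unfolding t_def by (intro simple_function_If s(1) simple_function_const) measurable
  have tn: "norm (t i x) \<le> 2 * norm (f x)" for i x by (simp add: t_def)
  have tlim: "AE x in M. (\<lambda>i. t i x) \<longlonglongrightarrow> f x"
    using s(2)
  proof eventually_elim
    case (elim x)
    show ?case
    proof (cases "f x = 0")
      case True
      then have "t i x = 0" for i using tn[of i x] by simp
      then show ?thesis using True by simp
    next
      case False
      then have "\<forall>\<^sub>F i in sequentially. norm (s i x) < 2 * norm (f x)"
        by (intro order_tendstoD(2)[OF tendsto_norm[OF elim]]) auto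
      then have "\<forall>\<^sub>F i in sequentially. s i x = t i x"
        by eventually_elim (auto simp: t_def)
      then show ?thesis using elim by (rule Lim_transform_eventually[rotated])
    qed
  qed
  have [measurable]: "(\<lambda>x. norm (f x - t i x)) \<in> borel_measurable M" for i
    by (rule strongly_measurable_imp_borel_measurable[OF M strongly_measurable_compose2[OF f strongly_measurable_simple[OF ts]]])
      (auto intro!: continuous_intros tendsto_intros)
  have tI: "Bochner_Integration.simple_bochner_integrable M (t i)" for i
  proof (rule simple_bochner_integrableI_bounded[OF ts])
    have "(\<integral>\<^sup>+ x. ennreal (norm (t i x)) \<partial>M) \<le> (\<integral>\<^sup>+ x. 2 * ennreal (norm (f x)) \<partial>M)"
      using tn by (intro nn_integral_mono) (simp add: ennreal_leI flip: ennreal_mult'' ennreal_numeral)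
    also have "\<dots> = 2 * (\<integral>\<^sup>+ x. ennreal (norm (f x)) \<partial>M)" by (intro nn_integral_cmult) measurable
    also have "\<dots> < \<infinity>" using fin by (simp add: ennreal_mult_less_top)
    finally show "(\<integral>\<^sup>+ x. ennreal (norm (t i x)) \<partial>M) < \<infinity>" .
  qed
  have conv: "(\<lambda>i. \<integral>\<^sup>+ x. ennreal (norm (f x - t i x)) \<partial>M) \<longlonglongrightarrow> (\<integral>\<^sup>+ x. 0 \<partial>M)"
  proof (rule nn_integral_dominated_convergence[where w="\<lambda>x. ennreal (3 * norm (f x))"])
    show "AE x in M. ennreal (norm (f x - t i x)) \<le> ennreal (3 * norm (f x))" for i
    proof (intro AE_I2 ennreal_leI)
      fix x show "norm (f x - t i x) \<le> 3 * norm (f x)"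
        using norm_triangle_ineq4[of "f x" "t i x"] tn[of i x] by linarith
    qed
    have "(\<integral>\<^sup>+ x. ennreal (3 * norm (f x)) \<partial>M) = 3 * (\<integral>\<^sup>+ x. ennreal (norm (f x)) \<partial>M)"
      by (subst nn_integral_cmult[symmetric]) (auto simp: ennreal_mult)
    then show "(\<integral>\<^sup>+ x. ennreal (3 * norm (f x)) \<partial>M) < \<infinity>" using fin by (simp add: ennreal_mult_less_top)
    show "AE x in M. (\<lambda>i. ennreal (norm (f x - t i x))) \<longlonglongrightarrow> 0"
      using tlim
    proof eventually_elim
      case (elim x)
      have "(\<lambda>i. norm (f x - t i x)) \<longlonglongrightarrow> norm (f x - f x)" by (intro tendsto_intros elim)
      then show ?case by (metis diff_self ennreal_0 norm_zero tendsto_ennrealI)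
    qed
  qed measurable
  then have conv0: "(\<lambda>i. \<integral>\<^sup>+ x. ennreal (norm (f x - t i x)) \<partial>M) \<longlonglongrightarrow> 0" by simp
  have "Cauchy (\<lambda>i. Bochner_Integration.simple_bochner_integral M (t i))"
  proof (rule CauchyI)
    fix e :: real assume "e > 0"
    then have "\<forall>\<^sub>F i in sequentially. (\<integral>\<^sup>+ x. ennreal (norm (f x - t i x)) \<partial>M) < ennreal (e / 2)"
      by (intro order_tendstoD(2)[OF conv0]) auto
    then obtain N where N: "\<And>i. i \<ge> N \<Longrightarrow> (\<integral>\<^sup>+ x. ennreal (norm (f x - t i x)) \<partial>M) < ennreal (e / 2)"
      by (auto simp: eventually_sequentially)
    show "\<exists>N. \<forall>m\<ge>N. \<forall>n\<ge>N. norm (Bochner_Integration.simple_bochner_integral M (t m) - Bochner_Integration.simple_bochner_integral M (t n)) < e"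
    proof (intro exI[of _ N] allI impI)
      fix m n assume mn: "m \<ge> N" "n \<ge> N"
      have "ennreal (norm (Bochner_Integration.simple_bochner_integral M (t m) - Bochner_Integration.simple_bochner_integral M (t n)))
          \<le> (\<integral>\<^sup>+ x. norm (f x - t m x) \<partial>M) + (\<integral>\<^sup>+ x. norm (f x - t n x) \<partial>M)"
        by (rule simple_bochner_integral_diff_bound[OF M f tI tI])
      also have "\<dots> < ennreal (e / 2) + ennreal (e / 2)"
        using N[OF mn(1)] N[OF mn(2)] by (rule add_strict_mono)
      also have "\<dots> = ennreal e" using \<open>e > 0\<close> by (simp flip: ennreal_plus)
      finally show "norm (Bochner_Integration.simple_bochner_integral M (t m) - Bochner_Integration.simple_bochner_integral M (t n)) < e"
        using \<open>e > 0\<close> by (simp add: ennreal_less_iff)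
    qed
  qed
  then obtain x where "(\<lambda>i. Bochner_Integration.simple_bochner_integral M (t i)) \<longlonglongrightarrow> x"
    unfolding Cauchy_convergent_iff convergent_def by blast
  then show ?thesis
    using f tI conv0 unfolding vector_bochner_integrable_def has_vector_bochner_integral_def by blast
qed

section \<open>Smooth cutoff functions\<close>

definition smooth :: "(real \<Rightarrow> real) \<Rightarrow> bool"
  where "smooth \<phi> \<longleftrightarrow> (\<forall>k t. (deriv ^^ k) \<phi> field_differentiable at t)"

text \<open>
  The higher derivatives of \<open>exp (- 1 / x)\<close> or of a product have no simple closed form. It is
  enough to exhibit a class of functions that contains the function and is closed under
  differentiation.
\<close>

lemma smooth_coinduct:
  assumes "\<phi> \<in> A" and A: "\<And>f. f \<in> A \<Longrightarrow> \<exists>f'\<in>A. \<forall>t. (f has_real_derivative f' t) (at t)"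
  shows "smooth \<phi>"
proof -
  have 1: "deriv f \<in> A" if f: "f \<in> A" for f
  proof -
    obtain f' where f': "f' \<in> A" "\<forall>t. (f has_real_derivative f' t) (at t)" using A[OF f] by blast
    then have "deriv f = f'" by (auto intro!: DERIV_imp_deriv)
    then show ?thesis using f' by simp
  qed
  have 2: "(deriv ^^ k) \<phi> \<in> A" for k
    by (induction k) (use assms(1) 1 in auto)
  have "(deriv ^^ k) \<phi> field_differentiable at t" for k t
    using A[OF 2[of k]] by (auto simp: field_differentiable_def)
  then show ?thesis by (simp add: smooth_def)
qed

lemma smooth_deriv: "smooth \<phi> \<Longrightarrow> smooth (deriv \<phi>)"
  unfolding smooth_def by (metis funpow_swap1 comp_apply funpow_Suc_right)

lemma smooth_funpow_deriv: "smooth \<phi> \<Longrightarrow> smooth ((deriv ^^ k) \<phi>)"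
  by (induction k) (auto simp: smooth_deriv)

lemma smooth_has_derivative: "smooth \<phi> \<Longrightarrow> (\<phi> has_real_derivative deriv \<phi> t) (at t)"
  unfolding smooth_def using DERIV_deriv_iff_field_differentiable[of \<phi> t] by (metis funpow_0)

lemma smooth_continuous: "smooth \<phi> \<Longrightarrow> continuous_on S \<phi>"
  by (meson DERIV_continuous_on has_field_derivative_at_within smooth_has_derivative)

lemma smooth_antiderivative:
  assumes "smooth \<phi>" "\<And>t. (\<Phi> has_real_derivative \<phi> t) (at t)"
  shows "smooth \<Phi>" "deriv \<Phi> = \<phi>"
proof -
  show d: "deriv \<Phi> = \<phi>" using assms(2) by (auto intro: DERIV_imp_deriv)
  show "smooth \<Phi>"
    by (rule smooth_coinduct[of _ "{f. f = \<Phi> \<or> smooth f}"])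
      (use assms smooth_has_derivative smooth_deriv in blast)+
qed

inductive sum_of_products :: "(real \<Rightarrow> real) \<Rightarrow> bool" where
  prod: "smooth f \<Longrightarrow> smooth g \<Longrightarrow> sum_of_products (\<lambda>x. f x * g x)"
| add: "sum_of_products u \<Longrightarrow> sum_of_products v \<Longrightarrow> sum_of_products (\<lambda>x. u x + v x)"

lemma smooth_mult:
  assumes "smooth f" "smooth g"
  shows "smooth (\<lambda>x. f x * g x)"
proof (rule smooth_coinduct[of _ "Collect sum_of_products"])
  show "(\<lambda>x. f x * g x) \<in> Collect sum_of_products" using assms by (simp add: sum_of_products.prod)
  fix u assume "u \<in> Collect sum_of_products"
  then have "sum_of_products u" by simp
  then show "\<exists>u'\<in>Collect sum_of_products. \<forall>t. (u has_real_derivative u' t) (at t)"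
  proof induction
    case (prod f g)
    have "((\<lambda>x. f x * g x) has_real_derivative (f t * deriv g t + deriv f t * g t)) (at t)" for t
      by (rule DERIV_mult'[OF smooth_has_derivative[OF prod(1)] smooth_has_derivative[OF prod(2)]])
    moreover have "sum_of_products (\<lambda>t. f t * deriv g t + deriv f t * g t)"
      using prod smooth_deriv by (intro sum_of_products.intros) auto
    ultimately show ?case by (intro bexI[of _ "\<lambda>t. f t * deriv g t + deriv f t * g t"]) auto
  next
    case (add u v)
    then obtain u' v' where *: "sum_of_products u'" "sum_of_products v'"
      "\<And>t. (u has_real_derivative u' t) (at t)" "\<And>t. (v has_real_derivative v' t) (at t)" by auto
    then have "((\<lambda>x. u x + v x) has_real_derivative (u' t + v' t)) (at t)" for t
      by (intro DERIV_add) auto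
    moreover have "sum_of_products (\<lambda>x. u' x + v' x)" using * by (intro sum_of_products.add)
    ultimately show ?case by (intro bexI[of _ "\<lambda>x. u' x + v' x"]) auto
  qed
qed

lemma smooth_affine:
  assumes "smooth f"
  shows "smooth (\<lambda>x. c * f (a * x + b))"
proof (rule smooth_coinduct[of _ "{\<lambda>x. c * f (a * x + b) |c f. smooth f}"])
  show "(\<lambda>x. c * f (a * x + b)) \<in> {\<lambda>x. c * f (a * x + b) |c f. smooth f}" using assms by blast
  fix u assume "u \<in> {\<lambda>x. c * f (a * x + b) |c f. smooth f}"
  then obtain c f where u: "u = (\<lambda>x. c * f (a * x + b))" and f: "smooth f" by blast
  have "(u has_real_derivative (c * a) * deriv f (a * t + b)) (at t)" for t
    unfolding u by (rule derivative_eq_intros DERIV_chain'[OF _ smooth_has_derivative[OF f]] refl | simp)+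
  then show "\<exists>f'\<in>{\<lambda>x. c * f (a * x + b) |c f. smooth f}. \<forall>t. (u has_real_derivative f' t) (at t)"
    using smooth_deriv[OF f] by (intro bexI[of _ "\<lambda>t. (c * a) * deriv f (a * t + b)"]) auto
qed

lemma smooth_diff_scale:
  assumes f: "smooth f" and g: "smooth g"
  shows "(deriv ^^ k) (\<lambda>x. f x - c * g x) = (\<lambda>x. (deriv ^^ k) f x - c * (deriv ^^ k) g x)"
    and "smooth (\<lambda>x. f x - c * g x)"
proof -
  have d: "((\<lambda>x. u x - c * v x) has_real_derivative (deriv u t - c * deriv v t)) (at t)"
    if "smooth u" "smooth v" for u v t
    using that by (auto intro!: derivative_eq_intros smooth_has_derivative)
  show "(deriv ^^ k) (\<lambda>x. f x - c * g x) = (\<lambda>x. (deriv ^^ k) f x - c * (deriv ^^ k) g x)" for k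
  proof (induction k)
    case (Suc k)
    have "(deriv ^^ Suc k) (\<lambda>x. f x - c * g x) = deriv (\<lambda>x. (deriv ^^ k) f x - c * (deriv ^^ k) g x)"
      using Suc by simp
    also have "\<dots> = (\<lambda>x. (deriv ^^ Suc k) f x - c * (deriv ^^ Suc k) g x)"
      using d[OF smooth_funpow_deriv[OF f] smooth_funpow_deriv[OF g]] by (auto intro!: DERIV_imp_deriv ext)
    finally show ?case .
  qed simp
  show "smooth (\<lambda>x. f x - c * g x)"
  proof (rule smooth_coinduct[of _ "{\<lambda>x. f x - c * g x |f g. smooth f \<and> smooth g}"])
    fix u assume "u \<in> {\<lambda>x. f x - c * g x |f g. smooth f \<and> smooth g}"
    then obtain f g where u: "u = (\<lambda>x. f x - c * g x)" "smooth f" "smooth g" by blast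
    show "\<exists>f'\<in>{\<lambda>x. f x - c * g x |f g. smooth f \<and> smooth g}. \<forall>t. (u has_real_derivative f' t) (at t)"
      using d[OF u(2,3)] smooth_deriv[OF u(2)] smooth_deriv[OF u(3)] unfolding u(1)
      by (intro bexI[of _ "\<lambda>t. deriv f t - c * deriv g t"]) auto
  qed (use f g in blast)
qed

definition flat_exp :: "real \<Rightarrow> real"
  where "flat_exp x = (if x > 0 then exp (- 1 / x) else 0)"

lemma poly_exp_decay: "((\<lambda>y::real. poly p y * exp (- y)) \<longlongrightarrow> 0) at_top"
proof -
  have "((\<lambda>y::real. \<Sum>i\<le>degree p. coeff p i * (y ^ i / exp y)) \<longlongrightarrow> (\<Sum>i\<le>degree p. coeff p i * 0)) at_top"
    by (intro tendsto_sum tendsto_mult tendsto_const tendsto_power_div_exp_0)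
  moreover have "(\<lambda>y::real. \<Sum>i\<le>degree p. coeff p i * (y ^ i / exp y)) = (\<lambda>y. poly p y * exp (- y))"
    by (simp add: poly_altdef sum_distrib_right exp_minus divide_inverse mult.assoc)
  ultimately show ?thesis by simp
qed

text \<open>
  The class \<open>p (1 / x) exp (- 1 / x)\<close> with a polynomial \<open>p\<close>, extended by 0 to the left half line, is
  closed under differentiation; at 0 the difference quotient tends to 0 because exponential decay
  beats every power of \<open>1 / x\<close>.
\<close>

lemma smooth_flat_exp: "smooth flat_exp"
proof (rule smooth_coinduct[of _ "range (\<lambda>p x. if x > 0 then poly p (1 / x) * exp (- 1 / x) else 0)"])
  show "flat_exp \<in> range (\<lambda>p x. if x > 0 then poly p (1 / x) * exp (- 1 / x) else 0)"
    by (rule image_eqI[of _ _ "1"]) (auto simp: flat_exp_def)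
  fix u :: "real \<Rightarrow> real" assume "u \<in> range (\<lambda>p x. if x > 0 then poly p (1 / x) * exp (- 1 / x) else 0)"
  then obtain p where u: "u = (\<lambda>x. if x > 0 then poly p (1 / x) * exp (- 1 / x) else 0)" by blast
  define q where "q = (p - pderiv p) * [:0, 0, 1:]"
  define u' where "u' = (\<lambda>x::real. if x > 0 then poly q (1 / x) * exp (- 1 / x) else 0)"
  have "(u has_real_derivative u' t) (at t)" for t
  proof (cases t "0::real" rule: linorder_cases)
    case less
    have "((\<lambda>x::real. 0::real) has_real_derivative 0) (at t)" by simp
    then have "(u has_real_derivative 0) (at t)"
      by (rule has_field_derivative_transform_within_open[of _ _ _ "{..<0}"]) (use less in \<open>auto simp: u\<close>)
    then show ?thesis using less by (simp add: u'_def)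
  next
    case greater
    have "((\<lambda>x. poly p (1 / x) * exp (- 1 / x)) has_real_derivative u' t) (at t)"
      using greater by (auto intro!: derivative_eq_intros DERIV_chain'[OF _ poly_DERIV] simp: u'_def q_def field_simps power2_eq_square)
    then show ?thesis
      by (rule has_field_derivative_transform_within_open[of _ _ _ "{0<..}"]) (use greater in \<open>auto simp: u\<close>)
  next
    case equal
    have "((\<lambda>x. (u (0 + x) - u 0) / x) \<longlongrightarrow> 0) (at 0)"
    proof (rule filterlim_split_at)
      have "\<forall>\<^sub>F x in at_left (0::real). 0 = (u (0 + x) - u 0) / x"
        by (auto simp: eventually_at_filter u)
      then show "((\<lambda>x. (u (0 + x) - u 0) / x) \<longlongrightarrow> 0) (at_left 0)"
        by (rule Lim_transform_eventually[OF tendsto_const])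
      have "((\<lambda>x. poly ([:0, 1:] * p) (inverse x) * exp (- inverse x)) \<longlongrightarrow> 0) (at_right (0::real))"
        by (rule filterlim_compose[OF poly_exp_decay filterlim_inverse_at_top_right])
      moreover have "\<forall>\<^sub>F x in at_right (0::real). poly ([:0, 1:] * p) (inverse x) * exp (- inverse x) = (u (0 + x) - u 0) / x"
        by (auto simp: eventually_at_filter u field_simps)
      ultimately show "((\<lambda>x. (u (0 + x) - u 0) / x) \<longlongrightarrow> 0) (at_right 0)"
        by (rule Lim_transform_eventually)
    qed
    then show ?thesis using equal by (simp add: has_field_derivative_def DERIV_def u'_def flip: has_field_derivative_def)
  qed
  then show "\<exists>f'\<in>range (\<lambda>p x. if x > 0 then poly p (1 / x) * exp (- 1 / x) else 0). \<forall>t. (u has_real_derivative f' t) (at t)"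
    by (intro bexI[of _ u']) (auto simp: u'_def)
qed

text \<open>
  The parameter \<open>n\<close> multiplies the distances to the two end points, so that for \<open>n\<close> tending to
  infinity the bumps increase to the indicator of the open interval while keeping its support.
\<close>

definition bump :: "real \<Rightarrow> real \<Rightarrow> real \<Rightarrow> real \<Rightarrow> real"
  where "bump n a b x = flat_exp (n * x + - (n * a)) * (1 * flat_exp ((- n) * x + n * b))"

lemma bump_smooth: "smooth (bump n a b)"
  unfolding bump_def[abs_def]
  using smooth_mult[OF smooth_affine[OF smooth_flat_exp, of 1 n "- (n * a)"] smooth_affine[OF smooth_flat_exp, of 1 "- n" "n * b"]]
  by simp

lemma bump_bounds: "0 \<le> bump n a b x" "bump n a b x \<le> 1"
  by (auto simp: bump_def flat_exp_def mult_le_one)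

lemma bump_eq_0: "n > 0 \<Longrightarrow> x \<notin> {a<..<b} \<Longrightarrow> bump n a b x = 0"
  by (auto simp: bump_def flat_exp_def not_less zero_less_mult_iff algebra_simps)

lemma bump_pos: "n > 0 \<Longrightarrow> x \<in> {a<..<b} \<Longrightarrow> bump n a b x > 0"
  by (auto simp: bump_def flat_exp_def)

text \<open>
  Testing against bumps is as good as testing against indicators of intervals.
\<close>

lemma bump_tendsto_indicator: "(\<lambda>n. bump (real (Suc n)) a b x) \<longlonglongrightarrow> indicator {a<..<b} x"
proof (cases "x \<in> {a<..<b}")
  case True
  have e: "(\<lambda>n. flat_exp (real (Suc n) * d)) \<longlonglongrightarrow> 1" if "d > 0" for d
  proof -
    have "(\<lambda>n. exp (- (1 / d) * inverse (real (Suc n)))) \<longlonglongrightarrow> exp (- (1 / d) * 0)"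
      by (intro tendsto_intros LIMSEQ_inverse_real_of_nat)
    moreover have "(\<lambda>n. exp (- (1 / d) * inverse (real (Suc n)))) = (\<lambda>n. flat_exp (real (Suc n) * d))"
      using that by (auto simp: flat_exp_def fun_eq_iff zero_less_mult_iff inverse_eq_divide)
    ultimately show ?thesis by simp
  qed
  have "(\<lambda>n. flat_exp (real (Suc n) * (x - a)) * flat_exp (real (Suc n) * (b - x))) \<longlonglongrightarrow> 1 * 1"
    using True by (intro tendsto_mult e) auto
  moreover have "flat_exp (real (Suc n) * (x - a)) * flat_exp (real (Suc n) * (b - x)) = bump (real (Suc n)) a b x" for n
    unfolding bump_def by (simp add: algebra_simps)
  ultimately show ?thesis using True by simp
next
  case False
  then show ?thesis using bump_eq_0 by auto
qed

section \<open>Weak derivatives and iterated primitives\<close>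

lemma Fubini_bounded_kernel:
  fixes a b :: "real \<Rightarrow> complex" and e :: "real \<Rightarrow> real \<Rightarrow> complex"
  assumes a: "integrable lborel a" and b: "integrable lborel b"
    and e: "(\<lambda>(x, y). e x y) \<in> borel_measurable (borel \<Otimes>\<^sub>M borel)" "\<And>x y. norm (e x y) \<le> B"
  shows "(\<integral>x. a x * (\<integral>y. b y * e x y \<partial>lborel) \<partial>lborel) = (\<integral>y. b y * (\<integral>x. a x * e x y \<partial>lborel) \<partial>lborel)"
proof -
  have [measurable]: "a \<in> borel_measurable borel" "b \<in> borel_measurable borel"
    using a b by auto
  have [measurable]: "(\<lambda>p. e (fst p) (snd p)) \<in> borel_measurable (borel \<Otimes>\<^sub>M borel)"
    using e(1) by (simp add: case_prod_beta')
  define h where "h = (\<lambda>(x, y). a x * b y * e x y)"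
  have [measurable]: "h \<in> borel_measurable (lborel \<Otimes>\<^sub>M lborel)"
    unfolding h_def case_prod_beta' by measurable
  have [measurable]: "(\<lambda>y. e x y) \<in> borel_measurable borel" "(\<lambda>x. e x y) \<in> borel_measurable borel" for x y
    using measurable_compose[OF _ e(1), of "\<lambda>y. (x, y)" borel] measurable_compose[OF _ e(1), of "\<lambda>x. (x, y)" borel]
    by simp_all
  have ib: "integrable lborel (\<lambda>y. b y * e x y)" for x
  proof (rule Bochner_Integration.integrable_bound[of _ "\<lambda>y. complex_of_real B * b y"])
    have "norm (b y * e x y) \<le> norm (complex_of_real B * b y)" for y
      using mult_right_mono[OF e(2)[of x y], of "norm (b y)"] abs_ge_self[of B]
        mult_right_mono[OF abs_ge_self[of B], of "norm (b y)"] by (simp add: norm_mult mult.commute)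
    then show "AE y in lborel. norm (b y * e x y) \<le> norm (complex_of_real B * b y)" by simp
  qed (use b in auto)
  have "integrable (lborel \<Otimes>\<^sub>M lborel) h"
  proof (rule lborel_pair.Fubini_integrable)
    show "integrable lborel (\<lambda>x. \<integral>y. norm (h (x, y)) \<partial>lborel)"
    proof (rule Bochner_Integration.integrable_bound[of _ "\<lambda>x. B * (\<integral>y. norm (b y) \<partial>lborel) * a x"])
      show "AE x in lborel. norm (\<integral>y. norm (h (x, y)) \<partial>lborel) \<le> norm (B * (\<integral>y. norm (b y) \<partial>lborel) * a x)"
      proof (rule AE_I2)
        fix x
        have B0: "B \<ge> 0" using e(2)[of 0 0] norm_ge_zero order_trans by blast
        have "(\<integral>y. norm (h (x, y)) \<partial>lborel) = norm (a x) * (\<integral>y. norm (b y * e x y) \<partial>lborel)"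
          by (simp add: h_def norm_mult mult.assoc)
        also have "\<dots> \<le> norm (a x) * (\<integral>y. B * norm (b y) \<partial>lborel)"
        proof (intro mult_left_mono integral_mono)
          show "integrable lborel (\<lambda>y. norm (b y * e x y))" using ib by (rule integrable_norm)
          show "norm (b y * e x y) \<le> B * norm (b y)" for y
            using mult_right_mono[OF e(2)[of x y], of "norm (b y)"] by (simp add: norm_mult mult.commute)
        qed (use b in auto)
        finally have "(\<integral>y. norm (h (x, y)) \<partial>lborel) \<le> norm (a x) * (B * (\<integral>y. norm (b y) \<partial>lborel))" by simp
        moreover have "0 \<le> (\<integral>y. norm (h (x, y)) \<partial>lborel)" "0 \<le> (\<integral>y. norm (b y) \<partial>lborel)" by simp_all
        ultimately show "norm (\<integral>y. norm (h (x, y)) \<partial>lborel) \<le> norm (B * (\<integral>y. norm (b y) \<partial>lborel) * a x)"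
          using B0 by (simp add: norm_mult abs_mult mult_ac)
      qed
    qed (use a in \<open>simp_all\<close>)
    show "AE x in lborel. integrable lborel (\<lambda>y. h (x, y))"
      using ib by (simp add: h_def mult.assoc)
  qed simp
  then have "(\<integral>y. \<integral>x. h (x, y) \<partial>lborel \<partial>lborel) = (\<integral>x. \<integral>y. h (x, y) \<partial>lborel \<partial>lborel)"
    by (intro lborel_pair.Fubini_integral) (simp add: case_prod_beta')
  moreover have "(\<integral>x. h (x, y) \<partial>lborel) = b y * (\<integral>x. a x * e x y \<partial>lborel)" for y
  proof -
    have "(\<lambda>x. h (x, y)) = (\<lambda>x. b y * (a x * e x y))" by (simp add: h_def mult_ac)
    then show ?thesis by simp
  qed
  ultimately show ?thesis by (simp add: h_def mult.assoc)
qed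

lemma test_functionI:
  assumes "smooth \<phi>" "0 < a" "\<And>t. t \<notin> {a..b} \<Longrightarrow> \<phi> t = 0"
  shows "test_function_on {0<..} \<phi>"
proof -
  have "{t. \<phi> t \<noteq> 0} \<subseteq> {a..b}" using assms(3) by blast
  then have "closure {t. \<phi> t \<noteq> 0} \<subseteq> {a..b}" by (rule closure_minimal) auto
  moreover from this have "compact (closure {t. \<phi> t \<noteq> 0})"
    using compact_Int_closed[of "{a..b}" "closure {t. \<phi> t \<noteq> 0}"] by (simp add: Int_absorb1)
  moreover have "{a..b} \<subseteq> {0<..}" using assms(2) by auto
  ultimately show ?thesis using assms(1) unfolding test_function_on_def smooth_def by blast
qed

lemma test_functionE:
  assumes "test_function_on {0<..} \<phi>"
  obtains a b where "smooth \<phi>" "0 < a" "a < b" "\<And>k t. t \<notin> {a..b} \<Longrightarrow> (deriv ^^ k) \<phi> t = 0"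
proof -
  define C where "C = closure {t. \<phi> t \<noteq> 0}"
  have C: "compact C" "C \<subseteq> {0<..}" "smooth \<phi>"
    using assms by (auto simp: test_function_on_def C_def smooth_def)
  obtain a b where ab: "0 < a" "a < b" "C \<subseteq> {a..b}"
  proof (cases "C = {}")
    case True
    then show ?thesis using that[of 1 2] by simp
  next
    case False
    then obtain x y where "x \<in> C" "y \<in> C" "\<forall>t\<in>C. x \<le> t" "\<forall>t\<in>C. t \<le> y"
      using compact_attains_inf[OF C(1)] compact_attains_sup[OF C(1)] by metis
    then show ?thesis using C(2) by (intro that[of x "y + 1"]) fastforce+
  qed
  have "\<forall>t. t \<notin> {a..b} \<longrightarrow> (deriv ^^ k) \<phi> t = 0" for k
  proof (induction k)
    case 0
    have "\<phi> t = 0" if "t \<notin> {a..b}" for t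
      using that ab(3) closure_subset[of "{t. \<phi> t \<noteq> 0}"] by (auto simp: C_def)
    then show ?case by simp
  next
    case (Suc k)
    show ?case
    proof (intro allI impI)
      fix t assume t: "t \<notin> {a..b}"
      have "((\<lambda>_. 0) has_real_derivative 0) (at t)" by simp
      then have "((deriv ^^ k) \<phi> has_real_derivative 0) (at t)"
        by (rule has_field_derivative_transform_within_open[of _ _ _ "- {a..b}"]) (use t Suc in auto)
      then show "(deriv ^^ Suc k) \<phi> t = 0" by (simp add: DERIV_imp_deriv)
    qed
  qed
  then show ?thesis using that[OF C(3) ab(1,2)] by blast
qed

text \<open>
  Local integrability on the closed half line for Borel representatives; values at negative arguments
  are unconstrained apart from measurability.
\<close>

definition loc_int :: "(real \<Rightarrow> complex) \<Rightarrow> bool"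
  where "loc_int f \<longleftrightarrow> f \<in> borel_measurable borel \<and> (\<forall>T. integrable lborel (\<lambda>t. indicator {0..T} t *\<^sub>R f t))"

lemma loc_int_mult_integrable:
  assumes f: "loc_int f" and u: "continuous_on UNIV u" "\<And>t. t \<notin> {a..b} \<Longrightarrow> u t = 0" and a: "0 \<le> a"
  shows "integrable lborel (\<lambda>t. u t *\<^sub>R f t)"
proof -
  have "bounded (u ` {a..b})"
    by (intro compact_imp_bounded compact_continuous_image continuous_on_subset[OF u(1)]) auto
  then obtain B where "\<forall>x\<in>u ` {a..b}. norm x \<le> B" unfolding bounded_iff by blast
  then have B: "\<bar>u t\<bar> \<le> B" if "t \<in> {a..b}" for t using that by force
  have [measurable]: "f \<in> borel_measurable borel" "u \<in> borel_measurable borel"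
    using f u(1) by (auto simp: loc_int_def borel_measurable_continuous_onI)
  show ?thesis
  proof (rule Bochner_Integration.integrable_bound[of _ "\<lambda>t. B *\<^sub>R (indicator {0..b} t *\<^sub>R f t)"])
    show "AE t in lborel. norm (u t *\<^sub>R f t) \<le> norm (B *\<^sub>R (indicator {0..b} t *\<^sub>R f t))"
    proof (rule AE_I2)
      fix t
      show "norm (u t *\<^sub>R f t) \<le> norm (B *\<^sub>R (indicator {0..b} t *\<^sub>R f t))"
        using B[of t] u(2)[of t] a
        by (cases "t \<in> {a..b}") (auto simp: indicator_def intro!: mult_right_mono)
    qed
    show "integrable lborel (\<lambda>t. B *\<^sub>R (indicator {0..b} t *\<^sub>R f t))"
      using f unfolding loc_int_def by (intro integrable_scaleR_right) blast
  qed measurable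
qed

definition primitive :: "(real \<Rightarrow> complex) \<Rightarrow> real \<Rightarrow> complex"
  where "primitive g t = (\<integral>s. indicator {0..t} s *\<^sub>R g s \<partial>lborel)"

lemma primitive_measurable:
  assumes [measurable]: "g \<in> borel_measurable borel"
  shows "primitive g \<in> borel_measurable borel"
proof -
  have "primitive g = (\<lambda>t. \<integral>s. (if 0 \<le> s \<and> s \<le> t then g s else 0) \<partial>lborel)"
    unfolding primitive_def by (intro ext Bochner_Integration.integral_cong) auto
  also have "\<dots> \<in> borel_measurable borel" by measurable
  finally show ?thesis .
qed

lemma primitive_norm_le:
  assumes "loc_int g" "t \<le> T"
  shows "norm (primitive g t) \<le> (\<integral>s. norm (indicator {0..T} s *\<^sub>R g s) \<partial>lborel)"
proof -
  have "norm (primitive g t) \<le> (\<integral>s. norm (indicator {0..t} s *\<^sub>R g s) \<partial>lborel)"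
    unfolding primitive_def by (rule integral_norm_bound)
  also have "\<dots> \<le> (\<integral>s. norm (indicator {0..T} s *\<^sub>R g s) \<partial>lborel)"
    using assms by (intro integral_mono integrable_norm) (auto simp: loc_int_def indicator_def)
  finally show ?thesis .
qed

lemma loc_int_bounded:
  assumes "f \<in> borel_measurable borel" "\<And>T. \<exists>B. \<forall>t\<in>{0..T}. norm (f t) \<le> B"
  shows "loc_int f"
  unfolding loc_int_def
proof (intro conjI allI)
  have [measurable]: "f \<in> borel_measurable borel" by fact
  fix T
  obtain B where B: "\<forall>t\<in>{0..T}. norm (f t) \<le> B" using assms(2) by blast
  show "integrable lborel (\<lambda>t. indicator {0..T} t *\<^sub>R f t)"
  proof (rule Bochner_Integration.integrable_bound[of _ "\<lambda>t. indicator {0..T} t *\<^sub>R B"])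
    show "integrable lborel (\<lambda>t. indicator {0..T} t *\<^sub>R B)"
      by (rule borel_integrable_compact) auto
    have "norm (indicator {0..T} t *\<^sub>R f t) \<le> norm (indicator {0..T} t *\<^sub>R B)" for t
      using B by (cases "t \<in> {0..T}") force+
    then show "AE t in lborel. norm (indicator {0..T} t *\<^sub>R f t) \<le> norm (indicator {0..T} t *\<^sub>R B)" by simp
  qed measurable
qed fact

lemma loc_int_primitive:
  assumes "loc_int g"
  shows "loc_int (\<lambda>t. c + primitive g t)"
proof (rule loc_int_bounded)
  have [measurable]: "primitive g \<in> borel_measurable borel"
    using assms by (auto simp: loc_int_def intro: primitive_measurable)
  show "(\<lambda>t. c + primitive g t) \<in> borel_measurable borel" by measurable
  show "\<exists>B. \<forall>t\<in>{0..T}. norm (c + primitive g t) \<le> B" for T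
    using primitive_norm_le[OF assms, of _ T]
    by (intro exI[of _ "norm c + (\<integral>s. norm (indicator {0..T} s *\<^sub>R g s) \<partial>lborel)"])
      (auto intro!: order_trans[OF norm_triangle_ineq])
qed

text \<open>
  Both sides are the double integral of \<open>deriv \<phi> t * g s\<close> over \<open>0 \<le> s \<le> t\<close>. Integrating over \<open>t\<close> first gives
  \<open>- \<phi> s\<close> by the fundamental theorem, since \<open>\<phi>\<close> vanishes far to the right.
\<close>

lemma integration_by_parts_primitive:
  assumes \<phi>: "test_function_on {0<..} \<phi>" and g: "loc_int g"
  shows "(\<integral>t. deriv \<phi> t *\<^sub>R primitive g t \<partial>lborel) = - (\<integral>t. \<phi> t *\<^sub>R g t \<partial>lborel)"
proof -
  obtain a b where ab: "smooth \<phi>" "0 < a" "a < b" "\<And>k t. t \<notin> {a..b} \<Longrightarrow> (deriv ^^ k) \<phi> t = 0"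
    using test_functionE[OF \<phi>] by metis
  have d0: "deriv \<phi> t = 0" if "t \<notin> {a..b}" for t using ab(4)[OF that, of 1] by simp
  have p0: "\<phi> t = 0" if "t \<notin> {a..b}" for t using ab(4)[OF that, of 0] by simp
  have cd: "continuous_on S (deriv \<phi>)" for S by (rule smooth_continuous[OF smooth_deriv[OF ab(1)]])
  have [measurable]: "g \<in> borel_measurable borel" using g by (simp add: loc_int_def)
  have [measurable]: "deriv \<phi> \<in> borel_measurable borel" using cd by (rule borel_measurable_continuous_onI)
  define e where "e t s = (if 0 \<le> s \<and> s \<le> t then 1 else 0 :: complex)" for t s :: real
  have em: "(\<lambda>(t, s). e t s) \<in> borel_measurable (borel \<Otimes>\<^sub>M borel)"
    unfolding e_def case_prod_beta' by measurable
  have ia: "integrable lborel (\<lambda>t. complex_of_real (deriv \<phi> t))"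
  proof -
    have "integrable lborel (\<lambda>t. indicator {a..b} t *\<^sub>R deriv \<phi> t)"
      by (rule borel_integrable_compact) (use cd in auto)
    also have "(\<lambda>t. indicator {a..b} t *\<^sub>R deriv \<phi> t) = deriv \<phi>"
      using d0 by (auto simp: indicator_def fun_eq_iff)
    finally show ?thesis by simp
  qed
  have ig: "integrable lborel (\<lambda>s. indicator {0..b} s *\<^sub>R g s)" using g by (simp add: loc_int_def)
  have "(\<integral>t. deriv \<phi> t *\<^sub>R primitive g t \<partial>lborel)
      = (\<integral>t. complex_of_real (deriv \<phi> t) * (\<integral>s. (indicator {0..b} s *\<^sub>R g s) * e t s \<partial>lborel) \<partial>lborel)"
  proof (rule Bochner_Integration.integral_cong[OF refl])
    fix t
    show "deriv \<phi> t *\<^sub>R primitive g t = complex_of_real (deriv \<phi> t) * (\<integral>s. (indicator {0..b} s *\<^sub>R g s) * e t s \<partial>lborel)"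
    proof (cases "t \<in> {a..b}")
      case True
      then have "primitive g t = (\<integral>s. (indicator {0..b} s *\<^sub>R g s) * e t s \<partial>lborel)"
        unfolding primitive_def by (intro Bochner_Integration.integral_cong) (auto simp: e_def indicator_def)
      then show ?thesis by (simp add: scaleR_conv_of_real)
    qed (simp add: d0)
  qed
  also have "\<dots> = (\<integral>s. (indicator {0..b} s *\<^sub>R g s) * (\<integral>t. complex_of_real (deriv \<phi> t) * e t s \<partial>lborel) \<partial>lborel)"
    by (rule Fubini_bounded_kernel[OF ia ig em, of 1]) (simp add: e_def)
  also have "\<dots> = (\<integral>s. - (\<phi> s *\<^sub>R g s) \<partial>lborel)"
  proof (rule Bochner_Integration.integral_cong[OF refl])
    fix s
    show "(indicator {0..b} s *\<^sub>R g s) * (\<integral>t. complex_of_real (deriv \<phi> t) * e t s \<partial>lborel) = - (\<phi> s *\<^sub>R g s)"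
    proof (cases "s \<in> {0..b}")
      case True
      have "(\<integral>t. complex_of_real (deriv \<phi> t) * e t s \<partial>lborel) = (\<integral>t. complex_of_real (indicator {s..b} t *\<^sub>R deriv \<phi> t) \<partial>lborel)"
        using True d0 by (intro Bochner_Integration.integral_cong) (auto simp: e_def indicator_def)
      also have "\<dots> = complex_of_real (\<integral>t. indicator {s..b} t *\<^sub>R deriv \<phi> t \<partial>lborel)"
        by (rule integral_complex_of_real)
      also have "(\<integral>t. indicator {s..b} t *\<^sub>R deriv \<phi> t \<partial>lborel) = \<phi> b - \<phi> s"
        by (rule integral_FTC_Icc)
          (use True cd smooth_has_derivative[OF ab(1)] in \<open>auto simp: has_real_derivative_iff_has_vector_derivative[symmetric] intro: has_field_derivative_at_within\<close>)
      also have "\<phi> b = 0"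
      proof -
        have "eventually (\<lambda>x. \<phi> x = 0) (at_right b)"
          using p0 by (auto simp: eventually_at_filter)
        then have "((\<lambda>x. \<phi> x) \<longlongrightarrow> 0) (at_right b)" by (simp add: tendsto_eventually)
        moreover have "(\<phi> \<longlongrightarrow> \<phi> b) (at_right b)"
          using smooth_continuous[OF ab(1), of UNIV] by (simp add: continuous_on_def filterlim_at_split)
        ultimately show ?thesis by (metis tendsto_unique trivial_limit_at_right_real)
      qed
      finally show ?thesis using True by (simp add: scaleR_conv_of_real)
    next
      case False
      then show ?thesis using p0[of s] ab(2) by auto
    qed
  qed
  finally show ?thesis by simp
qed

text \<open>
  The antiderivative has compact support exactly because the total integral vanishes. This is the
  step that reduces the order of a weak derivative by one.
\<close>

lemma test_function_antiderivative:
  assumes \<phi>: "test_function_on {0<..} \<phi>" and zero: "(\<integral>t. \<phi> t \<partial>lborel) = 0"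
  obtains \<Phi> where "test_function_on {0<..} \<Phi>" "deriv \<Phi> = \<phi>"
proof -
  obtain a b where ab: "smooth \<phi>" "0 < a" "a < b" "\<And>k t. t \<notin> {a..b} \<Longrightarrow> (deriv ^^ k) \<phi> t = 0"
    using test_functionE[OF \<phi>] by metis
  have p0: "\<phi> t = 0" if "t \<notin> {a..b}" for t using ab(4)[OF that, of 0] by simp
  have c: "continuous_on S \<phi>" for S by (rule smooth_continuous[OF ab(1)])
  define \<Phi> where "\<Phi> t = integral {0..t} \<phi>" for t
  have z1: "\<Phi> t = 0" if "t < a" for t
  proof -
    have "\<Phi> t = integral {0..t} (\<lambda>_. 0)"
      unfolding \<Phi>_def by (rule Henstock_Kurzweil_Integration.integral_cong) (use that in \<open>auto intro: p0\<close>)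
    then show ?thesis by simp
  qed
  have z2: "\<Phi> t = 0" if "t > b" for t
  proof -
    have "integrable lborel (\<lambda>s. indicator {0..t} s *\<^sub>R \<phi> s)"
      by (rule borel_integrable_compact) (use c in auto)
    then have "(\<integral>s. indicator {0..t} s *\<^sub>R \<phi> s \<partial>lborel) = integral {0..t} \<phi>"
      using set_borel_integral_eq_integral(2)[of "{0..t}" \<phi>] by (simp add: set_integrable_def set_lebesgue_integral_def)
    also have "(\<lambda>s. indicator {0..t} s *\<^sub>R \<phi> s) = \<phi>"
    proof
      show "indicator {0..t} s *\<^sub>R \<phi> s = \<phi> s" for s
        using p0[of s] that ab(2) by (cases "s \<in> {0..t}") auto
    qed
    finally show ?thesis using zero by (simp add: \<Phi>_def)
  qed
  have "(\<Phi> has_real_derivative \<phi> t) (at t)" for t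
  proof (cases "t < a")
    case True
    have "((\<lambda>_. 0) has_real_derivative 0) (at t)" by simp
    then have "(\<Phi> has_real_derivative 0) (at t)"
      by (rule has_field_derivative_transform_within_open[of _ _ _ "{..<a}"]) (use True z1 in auto)
    then show ?thesis using p0[of t] True by simp
  next
    case False
    have "((\<lambda>u. integral {0..u} \<phi>) has_real_derivative \<phi> t) (at t within {0..t+1})"
      by (rule integral_has_real_derivative) (use False ab(2) c in auto)
    then show ?thesis using False ab(2) at_within_interior[of t "{0..t+1}"] by (simp add: \<Phi>_def[abs_def])
  qed
  then have "smooth \<Phi>" "deriv \<Phi> = \<phi>" using smooth_antiderivative[OF ab(1)] by auto
  moreover from this have "test_function_on {0<..} \<Phi>"
    using z1 z2 ab(2) by (intro test_functionI[of _ a b]) (auto simp: not_le)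
  ultimately show ?thesis using that by blast
qed

text \<open>
  The scalar form of the weak derivative, written with the Lebesgue--Borel integral over the line:
  a test function vanishes off the positive half line.
\<close>

definition weak_deriv :: "nat \<Rightarrow> (real \<Rightarrow> complex) \<Rightarrow> (real \<Rightarrow> complex) \<Rightarrow> bool"
  where "weak_deriv m f g \<longleftrightarrow> (\<forall>\<phi>. test_function_on {0<..} \<phi> \<longrightarrow>
    (\<integral>t. (deriv ^^ m) \<phi> t *\<^sub>R f t \<partial>lborel) = (- 1) ^ m * (\<integral>t. \<phi> t *\<^sub>R g t \<partial>lborel))"

lemma test_function_mult_integrable:
  assumes "test_function_on {0<..} \<phi>" "loc_int f"
  shows "integrable lborel (\<lambda>t. (deriv ^^ k) \<phi> t *\<^sub>R f t)"
proof -
  obtain a b where ab: "smooth \<phi>" "0 < a" "a < b" "\<And>k t. t \<notin> {a..b} \<Longrightarrow> (deriv ^^ k) \<phi> t = 0"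
    using test_functionE[OF assms(1)] by metis
  show ?thesis
    by (rule loc_int_mult_integrable[OF assms(2) _ ab(4)])
      (use ab smooth_continuous[OF smooth_funpow_deriv[OF ab(1)]] in auto)
qed

lemma test_function_integrable:
  assumes "test_function_on {0<..} \<phi>"
  shows "integrable lborel \<phi>"
proof -
  obtain a b where ab: "smooth \<phi>" "0 < a" "a < b" "\<And>k t. t \<notin> {a..b} \<Longrightarrow> (deriv ^^ k) \<phi> t = 0"
    using test_functionE[OF assms] by metis
  have "integrable lborel (\<lambda>t. indicator {a..b} t *\<^sub>R \<phi> t)"
    by (rule borel_integrable_compact) (use smooth_continuous[OF ab(1)] in auto)
  also have "(\<lambda>t. indicator {a..b} t *\<^sub>R \<phi> t) = \<phi>"
  proof
    show "indicator {a..b} t *\<^sub>R \<phi> t = \<phi> t" for t using ab(4)[of t 0] by (cases "t \<in> {a..b}") auto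
  qed
  finally show ?thesis .
qed

lemma unit_mass_test_function:
  obtains \<rho> where "test_function_on {0<..} \<rho>" "(\<integral>t. \<rho> t \<partial>lborel) = 1"
    "\<And>k t. t \<notin> {1..2} \<Longrightarrow> (deriv ^^ k) \<rho> t = 0"
proof -
  define I where "I = (\<integral>t. bump 1 1 2 t \<partial>lborel)"
  have t: "test_function_on {0<..} (bump 1 1 2)"
    by (rule test_functionI[OF bump_smooth, of 1 2]) (auto intro: bump_eq_0)
  have int: "integrable lborel (bump 1 1 2)" by (rule test_function_integrable[OF t])
  have "I \<noteq> 0"
  proof
    assume "I = 0"
    then have "AE t in lborel. bump 1 1 2 t = 0"
      unfolding I_def using integral_nonneg_eq_0_iff_AE[OF int] bump_bounds by auto
    then have "AE t in lborel. t \<notin> {1<..<2::real}"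
      by eventually_elim (use bump_pos[of 1 _ 1 2] in force)
    then have "{1<..<2::real} \<in> null_sets lborel" by (simp add: AE_iff_null_sets)
    then show False by (simp add: null_sets_def)
  qed
  define \<rho> where "\<rho> = (\<lambda>t. (1 / I) * bump 1 1 2 (1 * t + 0))"
  have s: "smooth \<rho>" unfolding \<rho>_def by (rule smooth_affine[OF bump_smooth])
  have z: "\<rho> t = 0" if "t \<notin> {1<..<2}" for t using bump_eq_0[of 1 t 1 2] that by (simp add: \<rho>_def)
  show ?thesis
  proof (rule that[of \<rho>])
    show "test_function_on {0<..} \<rho>" by (rule test_functionI[OF s, of 1 2]) (use z in auto)
    show "(\<integral>t. \<rho> t \<partial>lborel) = 1" using \<open>I \<noteq> 0\<close> by (simp add: \<rho>_def I_def)
    have "\<forall>t. t \<notin> {1..2} \<longrightarrow> (deriv ^^ k) \<rho> t = 0" for k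
    proof (induction k)
      case (Suc k)
      show ?case
      proof (intro allI impI)
        fix t :: real assume t: "t \<notin> {1..2}"
        have "((\<lambda>_. 0) has_real_derivative 0) (at t)" by simp
        then have "((deriv ^^ k) \<rho> has_real_derivative 0) (at t)"
          by (rule has_field_derivative_transform_within_open[of _ _ _ "- {1..2}"]) (use t Suc in auto)
        then show "(deriv ^^ Suc k) \<rho> t = 0" by (simp add: DERIV_imp_deriv)
      qed
    qed (use z in auto)
    then show "(deriv ^^ k) \<rho> t = 0" if "t \<notin> {1..2}" for k t using that by blast
  qed
qed

text \<open>
  The Du Bois-Reymond argument. The functional
  \<open>\<Lambda> \<psi> = (integral of the m-th derivative of \<psi> times f) - (- 1) ^ m (integral of \<psi> times the primitive of g)\<close>
  vanishes on derivatives of test functions, hence on test functions of mean zero, hence it is a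
  multiple of the mean. The multiple is the constant of integration \<open>c\<close>, computed by testing with one
  fixed bump on \<open>{1..2}\<close>; this gives a bound of \<open>c\<close> that is uniform in \<open>f\<close> and \<open>g\<close>. Uniformity is
  essential later, where \<open>f\<close> and \<open>g\<close> range over all scalar images of one vector-valued pair.
\<close>

lemma weak_deriv_Suc:
  "\<exists>C\<ge>0. \<forall>f g. loc_int f \<longrightarrow> loc_int g \<longrightarrow> weak_deriv (Suc m) f g \<longrightarrow>
      (\<exists>c. weak_deriv m f (\<lambda>t. c + primitive g t) \<and>
        norm c \<le> C * ((\<integral>t. norm (indicator {1..2} t *\<^sub>R f t) \<partial>lborel) + (\<integral>t. norm (indicator {0..2} t *\<^sub>R g t) \<partial>lborel)))"
proof -
  obtain \<rho> where \<rho>: "test_function_on {0<..} \<rho>" "(\<integral>t. \<rho> t \<partial>lborel) = 1"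
    and \<rho>0: "\<And>k t. t \<notin> {1..2} \<Longrightarrow> (deriv ^^ k) \<rho> t = 0"
    using unit_mass_test_function by metis
  have \<rho>s: "smooth \<rho>" using test_functionE[OF \<rho>(1)] by metis
  have "bounded ((deriv ^^ m) \<rho> ` {1..2})" "bounded (\<rho> ` {1..2})"
    using smooth_continuous[OF smooth_funpow_deriv[OF \<rho>s]] smooth_continuous[OF \<rho>s]
    by (auto intro!: compact_imp_bounded compact_continuous_image)
  then obtain B1 B2 where B: "\<forall>x\<in>(deriv ^^ m) \<rho> ` {1..2}. norm x \<le> B1" "\<forall>x\<in>\<rho> ` {1..2}. norm x \<le> B2"
    unfolding bounded_iff by blast
  have B1: "\<bar>(deriv ^^ m) \<rho> t\<bar> \<le> \<bar>B1\<bar> * indicator {1..2} t" for t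
    using B(1) \<rho>0[of t m] by (cases "t \<in> {1..2}") force+
  have B2: "\<bar>\<rho> t\<bar> \<le> \<bar>B2\<bar> * indicator {1..2} t" for t
    using B(2) \<rho>0[of t 0] by (cases "t \<in> {1..2}") force+
  have \<rho>i: "integrable lborel \<rho>" by (rule test_function_integrable[OF \<rho>(1)])
  show ?thesis
  proof (intro exI[of _ "\<bar>B1\<bar> + \<bar>B2\<bar>"] conjI allI impI)
    fix f g assume f: "loc_int f" and g: "loc_int g" and w: "weak_deriv (Suc m) f g"
    define G where "G = primitive g"
    have G: "loc_int G" using loc_int_primitive[OF g, of 0] by (simp add: G_def)
    \<comment> \<open>The defect of the claim for the constant 0.\<close>
    define \<Lambda> where "\<Lambda> \<psi> = (\<integral>t. (deriv ^^ m) \<psi> t *\<^sub>R f t \<partial>lborel) - (- 1) ^ m * (\<integral>t. \<psi> t *\<^sub>R G t \<partial>lborel)" for \<psi>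
    have zero: "\<Lambda> (deriv \<phi>) = 0" if "test_function_on {0<..} \<phi>" for \<phi>
    proof -
      have "(\<integral>t. (deriv ^^ m) (deriv \<phi>) t *\<^sub>R f t \<partial>lborel) = (- 1) ^ Suc m * (\<integral>t. \<phi> t *\<^sub>R g t \<partial>lborel)"
        using w that unfolding weak_deriv_def by (simp add: funpow_Suc_right del: funpow.simps)
      moreover have "(\<integral>t. deriv \<phi> t *\<^sub>R G t \<partial>lborel) = - (\<integral>t. \<phi> t *\<^sub>R g t \<partial>lborel)"
        unfolding G_def by (rule integration_by_parts_primitive[OF that g])
      ultimately show ?thesis by (simp add: \<Lambda>_def)
    qed
    have \<Lambda>: "\<Lambda> \<psi> = complex_of_real (\<integral>t. \<psi> t \<partial>lborel) * \<Lambda> \<rho>" if \<psi>: "test_function_on {0<..} \<psi>" for \<psi>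
    proof -
      define J where "J = (\<integral>t. \<psi> t \<partial>lborel)"
      define \<eta> where "\<eta> = (\<lambda>t. \<psi> t - J * \<rho> t)"
      obtain a b where ab: "smooth \<psi>" "0 < a" "a < b" "\<And>k t. t \<notin> {a..b} \<Longrightarrow> (deriv ^^ k) \<psi> t = 0"
        using test_functionE[OF \<psi>] by metis
      have "test_function_on {0<..} \<eta>"
      proof (rule test_functionI[of _ "min a 1" "max b 2"])
        show "smooth \<eta>" unfolding \<eta>_def by (rule smooth_diff_scale(2)[OF ab(1) \<rho>s])
        show "\<eta> t = 0" if "t \<notin> {min a 1..max b 2}" for t
        proof -
          have "t \<notin> {a..b}" "t \<notin> {1..2}" using that by auto
          then show ?thesis using ab(4)[of t 0] \<rho>0[of t 0] by (simp add: \<eta>_def)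
        qed
      qed (use ab in auto)
      moreover have "(\<integral>t. \<eta> t \<partial>lborel) = 0"
        using test_function_integrable[OF \<psi>] \<rho>i \<rho>(2) by (simp add: \<eta>_def J_def)
      ultimately obtain \<Phi> where "test_function_on {0<..} \<Phi>" "deriv \<Phi> = \<eta>"
        using test_function_antiderivative by metis
      then have "\<Lambda> \<eta> = 0" using zero by blast
      moreover have "\<Lambda> \<eta> = \<Lambda> \<psi> - J * \<Lambda> \<rho>"
      proof -
        have "(\<integral>t. (deriv ^^ m) \<eta> t *\<^sub>R f t \<partial>lborel) = (\<integral>t. (deriv ^^ m) \<psi> t *\<^sub>R f t - J *\<^sub>R ((deriv ^^ m) \<rho> t *\<^sub>R f t) \<partial>lborel)"
          unfolding \<eta>_def smooth_diff_scale(1)[OF ab(1) \<rho>s] by (simp add: scaleR_left_diff_distrib)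
        also have "\<dots> = (\<integral>t. (deriv ^^ m) \<psi> t *\<^sub>R f t \<partial>lborel) - J *\<^sub>R (\<integral>t. (deriv ^^ m) \<rho> t *\<^sub>R f t \<partial>lborel)"
          using test_function_mult_integrable[OF \<psi> f] test_function_mult_integrable[OF \<rho>(1) f]
          by (subst Bochner_Integration.integral_diff) (auto simp del: scaleR_scaleR)
        finally have 1: "(\<integral>t. (deriv ^^ m) \<eta> t *\<^sub>R f t \<partial>lborel) = \<dots>" .
        have "(\<integral>t. \<eta> t *\<^sub>R G t \<partial>lborel) = (\<integral>t. \<psi> t *\<^sub>R G t - J *\<^sub>R (\<rho> t *\<^sub>R G t) \<partial>lborel)"
          unfolding \<eta>_def by (simp add: scaleR_left_diff_distrib)
        also have "\<dots> = (\<integral>t. \<psi> t *\<^sub>R G t \<partial>lborel) - J *\<^sub>R (\<integral>t. \<rho> t *\<^sub>R G t \<partial>lborel)"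
          using test_function_mult_integrable[OF \<psi> G, of 0] test_function_mult_integrable[OF \<rho>(1) G, of 0]
          by (subst Bochner_Integration.integral_diff) (auto simp del: scaleR_scaleR)
        finally have 2: "(\<integral>t. \<eta> t *\<^sub>R G t \<partial>lborel) = \<dots>" .
        show ?thesis unfolding \<Lambda>_def 1 2 by (simp add: algebra_simps scaleR_conv_of_real)
      qed
      ultimately show ?thesis by (simp add: J_def)
    qed
    define c where "c = (- 1) ^ m * \<Lambda> \<rho>"
    have "weak_deriv m f (\<lambda>t. c + primitive g t)"
      unfolding weak_deriv_def
    proof (intro allI impI)
      fix \<psi> assume \<psi>: "test_function_on {0<..} \<psi>"
      have i: "integrable lborel (\<lambda>t. complex_of_real (\<psi> t))" using test_function_integrable[OF \<psi>] by simp
      have "(\<integral>t. \<psi> t *\<^sub>R (c + primitive g t) \<partial>lborel) = (\<integral>t. complex_of_real (\<psi> t) * c + \<psi> t *\<^sub>R G t \<partial>lborel)"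
        by (simp add: G_def scaleR_conv_of_real algebra_simps)
      also have "\<dots> = complex_of_real (\<integral>t. \<psi> t \<partial>lborel) * c + (\<integral>t. \<psi> t *\<^sub>R G t \<partial>lborel)"
        using i test_function_mult_integrable[OF \<psi> G, of 0] by (subst Bochner_Integration.integral_add) auto
      finally show "(\<integral>t. (deriv ^^ m) \<psi> t *\<^sub>R f t \<partial>lborel) = (- 1) ^ m * (\<integral>t. \<psi> t *\<^sub>R (c + primitive g t) \<partial>lborel)"
        using \<Lambda>[OF \<psi>] unfolding \<Lambda>_def[of \<psi>] c_def
        by (simp add: algebra_simps)
    qed
    moreover have "norm c \<le> (\<bar>B1\<bar> + \<bar>B2\<bar>) * ((\<integral>t. norm (indicator {1..2} t *\<^sub>R f t) \<partial>lborel) + (\<integral>t. norm (indicator {0..2} t *\<^sub>R g t) \<partial>lborel))"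
      (is "_ \<le> _ * (?F + ?G)")
    proof -
      have fi: "integrable lborel (\<lambda>t. indicator {1..2} t *\<^sub>R f t)"
      proof (rule Bochner_Integration.integrable_bound[of _ "\<lambda>t. indicator {0..2} t *\<^sub>R f t"])
        show "integrable lborel (\<lambda>t. indicator {0..2} t *\<^sub>R f t)" using f by (simp add: loc_int_def)
        have "f \<in> borel_measurable borel" using f by (simp add: loc_int_def)
        then show "(\<lambda>t. indicator {1..2} t *\<^sub>R f t) \<in> borel_measurable lborel" by measurable
      qed (auto simp: indicator_def)
      have F0: "0 \<le> ?F" and G0: "0 \<le> ?G" by (intro Bochner_Integration.integral_nonneg; simp)+
      have "norm (\<integral>t. (deriv ^^ m) \<rho> t *\<^sub>R f t \<partial>lborel) \<le> (\<integral>t. norm ((deriv ^^ m) \<rho> t *\<^sub>R f t) \<partial>lborel)"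
        by (rule integral_norm_bound)
      also have "\<dots> \<le> (\<integral>t. \<bar>B1\<bar> * norm (indicator {1..2} t *\<^sub>R f t) \<partial>lborel)"
      proof (rule integral_mono)
        show "integrable lborel (\<lambda>t. norm ((deriv ^^ m) \<rho> t *\<^sub>R f t))"
          by (intro integrable_norm test_function_mult_integrable[OF \<rho>(1) f])
        show "integrable lborel (\<lambda>t. \<bar>B1\<bar> * norm (indicator {1..2} t *\<^sub>R f t))"
          by (intro integrable_mult_right integrable_norm fi)
        show "norm ((deriv ^^ m) \<rho> t *\<^sub>R f t) \<le> \<bar>B1\<bar> * norm (indicator {1..2} t *\<^sub>R f t)" for t
          using mult_right_mono[OF B1[of t], of "norm (f t)"] by (simp add: mult.assoc)
      qed
      finally have 1: "norm (\<integral>t. (deriv ^^ m) \<rho> t *\<^sub>R f t \<partial>lborel) \<le> \<bar>B1\<bar> * ?F" by simp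
      have Gb: "norm (G t) \<le> ?G" if "t \<le> 2" for t unfolding G_def by (rule primitive_norm_le[OF g that])
      have "norm (\<integral>t. \<rho> t *\<^sub>R G t \<partial>lborel) \<le> (\<integral>t. norm (\<rho> t *\<^sub>R G t) \<partial>lborel)"
        by (rule integral_norm_bound)
      also have "\<dots> \<le> (\<integral>t. indicator {1..2::real} t *\<^sub>R (\<bar>B2\<bar> * ?G) \<partial>lborel)"
      proof (rule integral_mono)
        show "integrable lborel (\<lambda>t. norm (\<rho> t *\<^sub>R G t))"
          by (intro integrable_norm test_function_mult_integrable[OF \<rho>(1) G, of 0, simplified])
        show "integrable lborel (\<lambda>t. indicator {1..2::real} t *\<^sub>R (\<bar>B2\<bar> * ?G))"
          by (rule borel_integrable_compact) auto
        show "norm (\<rho> t *\<^sub>R G t) \<le> indicator {1..2} t *\<^sub>R (\<bar>B2\<bar> * ?G)" for t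
          using mult_mono[OF B2[of t] Gb[of t]] B2[of t] G0 by (cases "t \<in> {1..2}") auto
      qed
      also have "\<dots> = \<bar>B2\<bar> * ?G" by simp
      finally have 2: "norm (\<integral>t. \<rho> t *\<^sub>R G t \<partial>lborel) \<le> \<bar>B2\<bar> * ?G" .
      have "norm c \<le> norm (\<integral>t. (deriv ^^ m) \<rho> t *\<^sub>R f t \<partial>lborel) + norm (\<integral>t. \<rho> t *\<^sub>R G t \<partial>lborel)"
        unfolding c_def \<Lambda>_def using norm_triangle_ineq4[of "\<integral>t. (deriv ^^ m) \<rho> t *\<^sub>R f t \<partial>lborel" "(- 1) ^ m * (\<integral>t. \<rho> t *\<^sub>R G t \<partial>lborel)"]
        by (simp add: norm_mult norm_power)
      also have "\<dots> \<le> \<bar>B1\<bar> * ?F + \<bar>B2\<bar> * ?G" using 1 2 by simp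
      also have "\<dots> \<le> (\<bar>B1\<bar> + \<bar>B2\<bar>) * (?F + ?G)" using F0 G0 by (simp add: algebra_simps)
      finally show ?thesis .
    qed
    ultimately show "\<exists>c. weak_deriv m f (\<lambda>t. c + primitive g t) \<and> norm c \<le> (\<bar>B1\<bar> + \<bar>B2\<bar>) *
      ((\<integral>t. norm (indicator {1..2} t *\<^sub>R f t) \<partial>lborel) + (\<integral>t. norm (indicator {0..2} t *\<^sub>R g t) \<partial>lborel))"
      by blast
  qed simp
qed

text \<open>
  Open intervals are stable under intersection and generate the Borel sets, so the integral vanishes
  over every Borel set.
\<close>

lemma AE_zero_if_interval_integrals_zero:
  fixes v :: "real \<Rightarrow> real"
  assumes v: "integrable lborel v" and zero: "\<And>a b. (\<integral>t. indicator {a<..<b} t *\<^sub>R v t \<partial>lborel) = 0"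
    and total: "(\<integral>t. v t \<partial>lborel) = 0"
  shows "AE t in lborel. v t = 0"
proof -
  have si: "set_integrable lborel A v" if "A \<in> sets lborel" for A
    using v that unfolding set_integrable_def by (intro integrable_mult_indicator)
  have all: "(LINT t:A|lborel. v t) = 0" if "A \<in> sets lborel" for A
  proof -
    have sb: "sets lborel = sigma_sets UNIV (range (\<lambda>(a, b). {a<..<b::real}))"
      unfolding sets_lborel by (subst borel_eq_box) (simp add: case_prod_beta' box_real)
    have "Int_stable (range (\<lambda>(a, b). {a<..<b::real}))"
      unfolding Int_stable_def
    proof (intro ballI)
      fix x y assume "x \<in> range (\<lambda>(a, b). {a<..<b::real})" "y \<in> range (\<lambda>(a, b). {a<..<b::real})"
      then obtain a b c d where "x = {a<..<b}" "y = {c<..<d}" by auto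
      then show "x \<inter> y \<in> range (\<lambda>(a, b). {a<..<b::real})"
        by (intro image_eqI[of _ _ "(max a c, min b d)"]) auto
    qed
    moreover have "range (\<lambda>(a, b). {a<..<b::real}) \<subseteq> Pow UNIV" by simp
    moreover have "A \<in> sigma_sets UNIV (range (\<lambda>(a, b). {a<..<b::real}))"
      using that unfolding sb .
    ultimately show ?thesis
    proof (induction rule: sigma_sets_induct_disjoint)
      case (basic A)
      then show ?case using zero by (auto simp: set_lebesgue_integral_def)
    next
      case empty
      then show ?case by (simp add: set_lebesgue_integral_def)
    next
      case (compl A)
      then have A: "A \<in> sets lborel" unfolding sb by blast
      have "(LINT t:(A \<union> (UNIV - A))|lborel. v t) = (LINT t:A|lborel. v t) + (LINT t:(UNIV - A)|lborel. v t)"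
        by (rule set_integral_Un) (use A si in auto)
      then show ?case using compl total by (simp add: set_lebesgue_integral_def)
    next
      case (union A)
      then have A: "A i \<in> sets lborel" for i unfolding sb by blast
      have "(LINT t:(\<Union>i. A i)|lborel. v t) = (\<Sum>i. (LINT t:(A i)|lborel. v t))"
        by (rule lebesgue_integral_countable_add)
          (use A si union in \<open>auto simp: disjoint_family_on_def\<close>)
      then show ?case using union by simp
    qed
  qed
  show ?thesis
    by (rule density_unique_real[of lborel v "\<lambda>_. 0"]) (use v all in \<open>auto simp: set_lebesgue_integral_def\<close>)
qed

lemma weak_deriv_0:
  assumes f: "loc_int f" and g: "loc_int g" and w: "weak_deriv 0 f g"
  shows "AE t in lborel. t > 0 \<longrightarrow> f t = g t"
proof -
  have [measurable]: "f \<in> borel_measurable borel" "g \<in> borel_measurable borel" using f g by (auto simp: loc_int_def)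
  have zero: "(\<integral>t. indicator {a<..<b} t *\<^sub>R (f t - g t) \<partial>lborel) = 0" if "0 < a" for a b
  proof (rule LIMSEQ_unique[OF _ tendsto_const])
    have bt: "test_function_on {0<..} (bump (real (Suc n)) a b)" for n
      by (rule test_functionI[OF bump_smooth that, of b]) (auto intro: bump_eq_0)
    have "(\<integral>t. bump (real (Suc n)) a b t *\<^sub>R (f t - g t) \<partial>lborel) = 0" for n
    proof -
      have "(\<integral>t. bump (real (Suc n)) a b t *\<^sub>R (f t - g t) \<partial>lborel)
          = (\<integral>t. bump (real (Suc n)) a b t *\<^sub>R f t \<partial>lborel) - (\<integral>t. bump (real (Suc n)) a b t *\<^sub>R g t \<partial>lborel)"
        using test_function_mult_integrable[OF bt f, of 0] test_function_mult_integrable[OF bt g, of 0]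
        by (subst Bochner_Integration.integral_diff[symmetric]) (auto simp: scaleR_right_diff_distrib)
      also have "\<dots> = 0" using w bt[of n] by (simp add: weak_deriv_def)
      finally show ?thesis .
    qed
    moreover have "(\<lambda>n. \<integral>t. bump (real (Suc n)) a b t *\<^sub>R (f t - g t) \<partial>lborel)
        \<longlonglongrightarrow> (\<integral>t. indicator {a<..<b} t *\<^sub>R (f t - g t) \<partial>lborel)"
    proof (rule integral_dominated_convergence[where w="\<lambda>t. norm (indicator {0..b} t *\<^sub>R f t) + norm (indicator {0..b} t *\<^sub>R g t)"])
      have [measurable]: "bump (real (Suc n)) a b \<in> borel_measurable borel" for n
        by (rule borel_measurable_continuous_onI[OF smooth_continuous[OF bump_smooth]])
      show "(\<lambda>t. bump (real (Suc n)) a b t *\<^sub>R (f t - g t)) \<in> borel_measurable lborel" for n by measurable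
      show "(\<lambda>t. indicator {a<..<b} t *\<^sub>R (f t - g t)) \<in> borel_measurable lborel" by measurable
      show "integrable lborel (\<lambda>t. norm (indicator {0..b} t *\<^sub>R f t) + norm (indicator {0..b} t *\<^sub>R g t))"
        using f g unfolding loc_int_def by (intro Bochner_Integration.integrable_add integrable_norm) auto
      show "AE t in lborel. (\<lambda>n. bump (real (Suc n)) a b t *\<^sub>R (f t - g t)) \<longlonglongrightarrow> indicator {a<..<b} t *\<^sub>R (f t - g t)"
        by (intro AE_I2 tendsto_scaleR tendsto_const bump_tendsto_indicator)
      show "AE t in lborel. norm (bump (real (Suc n)) a b t *\<^sub>R (f t - g t))
          \<le> norm (indicator {0..b} t *\<^sub>R f t) + norm (indicator {0..b} t *\<^sub>R g t)" for n
      proof (rule AE_I2)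
        fix t
        show "norm (bump (real (Suc n)) a b t *\<^sub>R (f t - g t)) \<le> norm (indicator {0..b} t *\<^sub>R f t) + norm (indicator {0..b} t *\<^sub>R g t)"
        proof (cases "t \<in> {a<..<b}")
          case True
          have "bump (real (Suc n)) a b t * norm (f t - g t) \<le> 1 * (norm (f t) + norm (g t))"
            using bump_bounds[of "real (Suc n)" a b t] by (intro mult_mono norm_triangle_ineq4) auto
          then show ?thesis using True that bump_bounds[of "real (Suc n)" a b t] by simp
        next
          case False
          then show ?thesis using bump_eq_0[of "real (Suc n)" t a b] by simp
        qed
      qed
    qed
    ultimately show "(\<lambda>_. 0) \<longlonglongrightarrow> (\<integral>t. indicator {a<..<b} t *\<^sub>R (f t - g t) \<partial>lborel)" by simp
  qed
  have "AE t in lborel. t \<in> {inverse (real (Suc n))<..<real (Suc n)} \<longrightarrow> f t = g t" for n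
  proof -
    define u where "u t = indicator {inverse (real (Suc n))<..<real (Suc n)} t *\<^sub>R (f t - g t)" for t
    have ui: "integrable lborel u"
    proof (rule Bochner_Integration.integrable_bound[of _ "\<lambda>t. norm (indicator {0..real (Suc n)} t *\<^sub>R f t) + norm (indicator {0..real (Suc n)} t *\<^sub>R g t)"])
      show "integrable lborel (\<lambda>t. norm (indicator {0..real (Suc n)} t *\<^sub>R f t) + norm (indicator {0..real (Suc n)} t *\<^sub>R g t))"
        using f g unfolding loc_int_def by (intro Bochner_Integration.integrable_add integrable_norm) auto
      have "norm (u t) \<le> norm (norm (indicator {0..real (Suc n)} t *\<^sub>R f t) + norm (indicator {0..real (Suc n)} t *\<^sub>R g t))" for t
        using norm_triangle_ineq4[of "f t" "g t"] less_trans[of 0 "inverse (real (Suc n))" t]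
        by (cases "t \<in> {inverse (real (Suc n))<..<real (Suc n)}") (auto simp: u_def)
      then show "AE t in lborel. norm (u t) \<le> norm (norm (indicator {0..real (Suc n)} t *\<^sub>R f t) + norm (indicator {0..real (Suc n)} t *\<^sub>R g t))" by simp
    qed (simp add: u_def[abs_def])
    have uz: "(\<integral>t. indicator {a<..<b} t *\<^sub>R u t \<partial>lborel) = 0" for a b
    proof -
      have "(\<integral>t. indicator {a<..<b} t *\<^sub>R u t \<partial>lborel)
          = (\<integral>t. indicator {max a (inverse (real (Suc n)))<..<min b (real (Suc n))} t *\<^sub>R (f t - g t) \<partial>lborel)"
        by (intro Bochner_Integration.integral_cong) (auto simp: u_def indicator_def)
      also have "\<dots> = 0" by (rule zero) (simp add: less_max_iff_disj)
      finally show ?thesis .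
    qed
    have ut: "(\<integral>t. u t \<partial>lborel) = 0" unfolding u_def by (rule zero) simp
    have "AE t in lborel. Re (u t) = 0"
    proof (rule AE_zero_if_interval_integrals_zero)
      show "integrable lborel (\<lambda>t. Re (u t))" using ui by simp
      show "(\<integral>t. Re (u t) \<partial>lborel) = 0" using ut ui by simp
      fix a b
      have "integrable lborel (\<lambda>t. indicator {a<..<b} t *\<^sub>R u t)" using ui by (intro integrable_mult_indicator) auto
      from integral_Re[OF this] show "(\<integral>t. indicator {a<..<b} t *\<^sub>R Re (u t) \<partial>lborel) = 0" using uz by simp
    qed
    moreover have "AE t in lborel. Im (u t) = 0"
    proof (rule AE_zero_if_interval_integrals_zero)
      show "integrable lborel (\<lambda>t. Im (u t))" using ui by simp
      show "(\<integral>t. Im (u t) \<partial>lborel) = 0" using ut ui by simp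
      fix a b
      have "integrable lborel (\<lambda>t. indicator {a<..<b} t *\<^sub>R u t)" using ui by (intro integrable_mult_indicator) auto
      from integral_Im[OF this] show "(\<integral>t. indicator {a<..<b} t *\<^sub>R Im (u t) \<partial>lborel) = 0" using uz by simp
    qed
    ultimately show ?thesis by eventually_elim (auto simp: u_def complex_eq_iff)
  qed
  then have "AE t in lborel. \<forall>n. t \<in> {inverse (real (Suc n))<..<real (Suc n)} \<longrightarrow> f t = g t"
    unfolding AE_all_countable by blast
  then show ?thesis
  proof eventually_elim
    case (elim t)
    show ?case
    proof
      assume "t > 0"
      then obtain n1 n2 where n: "inverse (real (Suc n1)) < t" "t < real n2"
        using reals_Archimedean[of t] reals_Archimedean2[of t] by metis
      have "inverse (real (Suc (max n1 n2))) \<le> inverse (real (Suc n1))" by (intro le_imp_inverse_le) auto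
      then have "inverse (real (Suc (max n1 n2))) < t" using n(1) by (rule order_le_less_trans)
      moreover have "t < real (Suc (max n1 n2))" using n(2) by simp
      ultimately have "t \<in> {inverse (real (Suc (max n1 n2)))<..<real (Suc (max n1 n2))}"
        unfolding greaterThanLessThan_iff by blast
      then show "f t = g t" using elim by blast
    qed
  qed
qed

text \<open>
  The list holds the constants of integration, outermost first.
\<close>

primrec iter_primitive :: "complex list \<Rightarrow> (real \<Rightarrow> complex) \<Rightarrow> real \<Rightarrow> complex" where
  "iter_primitive [] g = g"
| "iter_primitive (c # cs) g = (\<lambda>t. c + primitive (iter_primitive cs g) t)"

lemma iter_primitive_snoc: "iter_primitive (cs @ [c]) g = iter_primitive cs (\<lambda>t. c + primitive g t)"
  by (induction cs) auto

lemma loc_int_iter_primitive: "loc_int g \<Longrightarrow> loc_int (iter_primitive cs g)"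
  by (induction cs) (auto intro: loc_int_primitive)

text \<open>
  Peeling off one weak derivative at a time replaces \<open>g\<close> by \<open>c + primitive g\<close>, whose integral over \<open>{0..t}\<close> grows by one more power of \<open>t\<close>. The exponent \<open>r\<close> is therefore generalised in the
  induction, and the constant depends on \<open>m\<close> and \<open>r\<close> only.
\<close>

lemma weak_deriv_iter_primitive:
  "\<exists>C\<ge>0. \<forall>f g B. loc_int f \<longrightarrow> loc_int g \<longrightarrow> weak_deriv (Suc m) f g \<longrightarrow> B \<ge> 0 \<longrightarrow>
      (\<forall>t\<ge>0. (\<integral>s. norm (indicator {0..t} s *\<^sub>R g s) \<partial>lborel) \<le> B * (1 + t) ^ r) \<longrightarrow>
      (\<integral>s. norm (indicator {1..2} s *\<^sub>R f s) \<partial>lborel) \<le> B \<longrightarrow>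
      (\<exists>cs. length cs = Suc m \<and> (AE t in lborel. t > 0 \<longrightarrow> f t = iter_primitive cs g t) \<and>
        (\<forall>t\<ge>0. norm (iter_primitive cs g t) \<le> C * B * (1 + t) ^ (r + m)))"
proof (induction m arbitrary: r)
  case (0 r)
  obtain C where C: "C \<ge> 0" "\<forall>f g. loc_int f \<longrightarrow> loc_int g \<longrightarrow> weak_deriv (Suc 0) f g \<longrightarrow>
      (\<exists>c. weak_deriv 0 f (\<lambda>t. c + primitive g t) \<and>
        norm c \<le> C * ((\<integral>t. norm (indicator {1..2} t *\<^sub>R f t) \<partial>lborel) + (\<integral>t. norm (indicator {0..2} t *\<^sub>R g t) \<partial>lborel)))"
    using weak_deriv_Suc[of 0] by blast
  show ?case
  proof (intro exI[of _ "C * (1 + 3 ^ r) + 1"] conjI allI impI)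
    fix f g :: "real \<Rightarrow> complex" and B :: real
    assume a: "loc_int f" "loc_int g" "weak_deriv (Suc 0) f g" "B \<ge> 0"
      "\<forall>t\<ge>0. (\<integral>s. norm (indicator {0..t} s *\<^sub>R g s) \<partial>lborel) \<le> B * (1 + t) ^ r"
      "(\<integral>s. norm (indicator {1..2} s *\<^sub>R f s) \<partial>lborel) \<le> B"
    obtain c where c: "weak_deriv 0 f (\<lambda>t. c + primitive g t)"
      "norm c \<le> C * ((\<integral>t. norm (indicator {1..2} t *\<^sub>R f t) \<partial>lborel) + (\<integral>t. norm (indicator {0..2} t *\<^sub>R g t) \<partial>lborel))"
      using C(2) a(1-3) by blast
    have cb: "norm c \<le> C * (B + B * 3 ^ r)" 
      using a(6) a(5)[rule_format, of 2] by (intro order_trans[OF c(2) mult_left_mono[OF add_mono C(1)]]) simp_all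
    have "norm (c + primitive g t) \<le> (C * (1 + 3 ^ r) + 1) * B * (1 + t) ^ (r + 0)" if "t \<ge> 0" for t
    proof -
      have "norm (c + primitive g t) \<le> norm c + norm (primitive g t)" by (rule norm_triangle_ineq)
      also have "\<dots> \<le> C * (B + B * 3 ^ r) * 1 + B * (1 + t) ^ r"
        using cb primitive_norm_le[OF a(2) order_refl, of t] a(5)[rule_format, OF that] by linarith
      also have "\<dots> \<le> C * (B + B * 3 ^ r) * (1 + t) ^ r + B * (1 + t) ^ r"
        using C(1) a(4) that by (intro add_right_mono mult_left_mono one_le_power) auto
      finally show ?thesis by (simp add: algebra_simps)
    qed
    moreover have "AE t in lborel. t > 0 \<longrightarrow> f t = c + primitive g t"
      by (rule weak_deriv_0[OF a(1) loc_int_primitive[OF a(2)] c(1)])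
    ultimately show "\<exists>cs. length cs = Suc 0 \<and> (AE t in lborel. t > 0 \<longrightarrow> f t = iter_primitive cs g t) \<and>
        (\<forall>t\<ge>0. norm (iter_primitive cs g t) \<le> (C * (1 + 3 ^ r) + 1) * B * (1 + t) ^ (r + 0))"
      by (intro exI[of _ "[c]"]) simp
  qed (use C in simp)
next
  case (Suc m r)
  obtain C where C: "C \<ge> 0" "\<forall>f g. loc_int f \<longrightarrow> loc_int g \<longrightarrow> weak_deriv (Suc (Suc m)) f g \<longrightarrow>
      (\<exists>c. weak_deriv (Suc m) f (\<lambda>t. c + primitive g t) \<and>
        norm c \<le> C * ((\<integral>t. norm (indicator {1..2} t *\<^sub>R f t) \<partial>lborel) + (\<integral>t. norm (indicator {0..2} t *\<^sub>R g t) \<partial>lborel)))"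
    using weak_deriv_Suc[of "Suc m"] by blast
  obtain E where E: "E \<ge> 0"
    "\<forall>f g B. loc_int f \<longrightarrow> loc_int g \<longrightarrow> weak_deriv (Suc m) f g \<longrightarrow> B \<ge> 0 \<longrightarrow>
      (\<forall>t\<ge>0. (\<integral>s. norm (indicator {0..t} s *\<^sub>R g s) \<partial>lborel) \<le> B * (1 + t) ^ Suc r) \<longrightarrow>
      (\<integral>s. norm (indicator {1..2} s *\<^sub>R f s) \<partial>lborel) \<le> B \<longrightarrow>
      (\<exists>cs. length cs = Suc m \<and> (AE t in lborel. t > 0 \<longrightarrow> f t = iter_primitive cs g t) \<and>
        (\<forall>t\<ge>0. norm (iter_primitive cs g t) \<le> E * B * (1 + t) ^ (Suc r + m)))"
    using Suc.IH[of "Suc r"] by blast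
  define D where "D = C * (1 + 3 ^ r) + 1"
  have D: "D \<ge> 1" using C by (simp add: D_def)
  show ?case
  proof (intro exI[of _ "E * D"] conjI allI impI)
    fix f g :: "real \<Rightarrow> complex" and B :: real
    assume a: "loc_int f" "loc_int g" "weak_deriv (Suc (Suc m)) f g" "B \<ge> 0"
      "\<forall>t\<ge>0. (\<integral>s. norm (indicator {0..t} s *\<^sub>R g s) \<partial>lborel) \<le> B * (1 + t) ^ r"
      "(\<integral>s. norm (indicator {1..2} s *\<^sub>R f s) \<partial>lborel) \<le> B"
    obtain c where c: "weak_deriv (Suc m) f (\<lambda>t. c + primitive g t)"
      "norm c \<le> C * ((\<integral>t. norm (indicator {1..2} t *\<^sub>R f t) \<partial>lborel) + (\<integral>t. norm (indicator {0..2} t *\<^sub>R g t) \<partial>lborel))"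
      using C(2) a(1-3) by blast
    have cb: "norm c \<le> C * (B + B * 3 ^ r)" 
      using a(6) a(5)[rule_format, of 2] by (intro order_trans[OF c(2) mult_left_mono[OF add_mono C(1)]]) simp_all
    have pb: "norm (c + primitive g t) \<le> D * B * (1 + t) ^ r" if "t \<ge> 0" for t
    proof -
      have "norm (c + primitive g t) \<le> norm c + norm (primitive g t)" by (rule norm_triangle_ineq)
      also have "\<dots> \<le> C * (B + B * 3 ^ r) * 1 + B * (1 + t) ^ r"
        using cb primitive_norm_le[OF a(2) order_refl, of t] a(5)[rule_format, OF that] by linarith
      also have "\<dots> \<le> C * (B + B * 3 ^ r) * (1 + t) ^ r + B * (1 + t) ^ r"
        using C(1) a(4) that by (intro add_right_mono mult_left_mono one_le_power) auto
      finally show ?thesis by (simp add: D_def algebra_simps)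
    qed
    have li: "loc_int (\<lambda>t. c + primitive g t)" by (rule loc_int_primitive[OF a(2)])
    have "\<exists>cs. length cs = Suc m \<and> (AE t in lborel. t > 0 \<longrightarrow> f t = iter_primitive cs (\<lambda>t. c + primitive g t) t) \<and>
        (\<forall>t\<ge>0. norm (iter_primitive cs (\<lambda>t. c + primitive g t) t) \<le> E * (D * B) * (1 + t) ^ (Suc r + m))"
    proof (rule E(2)[rule_format, OF a(1) li c(1)])
      show "D * B \<ge> 0" using D a by simp
      show "(\<integral>s. norm (indicator {1..2} s *\<^sub>R f s) \<partial>lborel) \<le> D * B"
        using a(6) mult_right_mono[OF D a(4)] by simp
      fix t :: real assume t: "t \<ge> 0"
      have "(\<integral>s. norm (indicator {0..t} s *\<^sub>R (c + primitive g s)) \<partial>lborel) \<le> (\<integral>s. indicator {0..t} s *\<^sub>R (D * B * (1 + t) ^ r) \<partial>lborel)"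
      proof (rule integral_mono)
        show "integrable lborel (\<lambda>s. norm (indicator {0..t} s *\<^sub>R (c + primitive g s)))"
          using li unfolding loc_int_def by (intro integrable_norm) blast
        show "integrable lborel (\<lambda>s. indicator {0..t} s *\<^sub>R (D * B * (1 + t) ^ r))"
          by (rule borel_integrable_compact) auto
        show "norm (indicator {0..t} s *\<^sub>R (c + primitive g s)) \<le> indicator {0..t} s *\<^sub>R (D * B * (1 + t) ^ r)" for s
        proof (cases "s \<in> {0..t}")
          case True
          then have "norm (c + primitive g s) \<le> D * B * (1 + s) ^ r" using pb by simp
          also have "\<dots> \<le> D * B * (1 + t) ^ r" using True D a by (intro mult_left_mono power_mono) auto
          finally show ?thesis using True by simp
        qed simp
      qed
      also have "\<dots> = t * (D * B * (1 + t) ^ r)" using t by simp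
      also have "\<dots> \<le> (1 + t) * (D * B * (1 + t) ^ r)" using t D a by (intro mult_right_mono) auto
      finally show "(\<integral>s. norm (indicator {0..t} s *\<^sub>R (c + primitive g s)) \<partial>lborel) \<le> D * B * (1 + t) ^ Suc r" by (simp add: mult_ac)
    qed
    then obtain cs where "length cs = Suc m" "AE t in lborel. t > 0 \<longrightarrow> f t = iter_primitive cs (\<lambda>t. c + primitive g t) t"
        "\<forall>t\<ge>0. norm (iter_primitive cs (\<lambda>t. c + primitive g t) t) \<le> E * (D * B) * (1 + t) ^ (Suc r + m)" by blast
    then show "\<exists>cs. length cs = Suc (Suc m) \<and> (AE t in lborel. t > 0 \<longrightarrow> f t = iter_primitive cs g t) \<and>
        (\<forall>t\<ge>0. norm (iter_primitive cs g t) \<le> (E * D) * B * (1 + t) ^ (r + Suc m))"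
      by (intro exI[of _ "cs @ [c]"]) (simp add: iter_primitive_snoc mult.assoc)
  qed (use E D in simp)
qed

section \<open>Iterated differences\<close>

primrec nabla :: "nat \<Rightarrow> real \<Rightarrow> (real \<Rightarrow> complex) \<Rightarrow> real \<Rightarrow> complex" where
  "nabla 0 s G t = G t"
| "nabla (Suc m) s G t = nabla m s G t - nabla m s G (t - s)"

text \<open>
  The coefficients are the signed binomial coefficients. The value 1 at \<open>l = 0\<close> isolates \<open>G t\<close>.
\<close>

lemma nabla_sum:
  "\<exists>a. a 0 = 1 \<and> (\<forall>s G t. nabla m s G t = (\<Sum>l\<le>m. a l *\<^sub>R G (t - real l * s)))"
proof (induction m)
  case 0
  show ?case by (intro exI[of _ "\<lambda>_. 1"]) simp
next
  case (Suc m)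
  then obtain a where a: "a 0 = 1" "\<And>s G t. nabla m s G t = (\<Sum>l\<le>m. a l *\<^sub>R G (t - real l * s))" by blast
  define b where "b l = (if l \<le> m then a l else 0) - (if l = 0 then 0 else a (l - 1))" for l
  have "nabla (Suc m) s G t = (\<Sum>l\<le>Suc m. b l *\<^sub>R G (t - real l * s))" for s G t
  proof -
    have "(\<Sum>l\<le>Suc m. b l *\<^sub>R G (t - real l * s))
        = (\<Sum>l\<le>Suc m. (if l \<le> m then a l else 0) *\<^sub>R G (t - real l * s))
          - (\<Sum>l\<le>Suc m. (if l = 0 then 0 else a (l - 1)) *\<^sub>R G (t - real l * s))"
      by (simp only: b_def scaleR_left_diff_distrib sum_subtractf)
    also have "(\<Sum>l\<le>Suc m. (if l \<le> m then a l else 0) *\<^sub>R G (t - real l * s)) = nabla m s G t"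
      by (simp add: a(2))
    also have "(\<Sum>l\<le>Suc m. (if l = 0 then 0 else a (l - 1)) *\<^sub>R G (t - real l * s))
        = (\<Sum>l\<le>m. a l *\<^sub>R G (t - real (Suc l) * s))"
      by (subst sum.atMost_Suc_shift) simp
    also have "\<dots> = nabla m s G (t - s)"
      unfolding a(2) by (intro sum.cong) (auto simp: algebra_simps)
    finally show ?thesis by simp
  qed
  then show ?case using a(1) by (intro exI[of _ b]) (simp add: b_def)
qed

lemma nabla_Suc_inner: "nabla (Suc m) s G t = nabla m s (\<lambda>t. G t - G (t - s)) t"
proof (induction m arbitrary: t)
  case (Suc m)
  have "nabla (Suc (Suc m)) s G t = nabla (Suc m) s G t - nabla (Suc m) s G (t - s)"
    by (rule nabla.simps(2))
  also have "\<dots> = nabla m s (\<lambda>t. G t - G (t - s)) t - nabla m s (\<lambda>t. G t - G (t - s)) (t - s)"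
    unfolding Suc ..
  finally show ?case by simp
qed simp

lemma nabla_neg_step: "nabla m (- s) G t = (- 1) ^ m * nabla m s G (t + real m * s)"
  by (induction m arbitrary: t) (auto simp: algebra_simps)

lemma nabla_zero_step: "m > 0 \<Longrightarrow> nabla m 0 G t = 0"
  by (cases m) auto

lemma primitive_diff:
  assumes g: "loc_int g" and t: "0 \<le> t - s" "0 < s"
  shows "primitive g t - primitive g (t - s) = (\<integral>v. indicator {t - s<..t} v *\<^sub>R g v \<partial>lborel)"
    and "integrable lborel (\<lambda>v. indicator {t - s<..t} v *\<^sub>R g v)"
proof -
  have i: "integrable lborel (\<lambda>v. indicator {0..T} v *\<^sub>R g v)" for T using g by (simp add: loc_int_def)
  have e: "indicator {t - s<..t} v *\<^sub>R g v = indicator {0..t} v *\<^sub>R g v - indicator {0..t - s} v *\<^sub>R g v" for v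
    using t by (auto simp: indicator_def)
  show "integrable lborel (\<lambda>v. indicator {t - s<..t} v *\<^sub>R g v)"
    unfolding e by (intro Bochner_Integration.integrable_diff i)
  show "primitive g t - primitive g (t - s) = (\<integral>v. indicator {t - s<..t} v *\<^sub>R g v \<partial>lborel)"
    unfolding e primitive_def by (rule Bochner_Integration.integral_diff[OF i i, symmetric])
qed

text \<open>
  One difference of a primitive is an integral over a step,
  \<open>P t - P (t - s) = (integral over 0 \<le> u < s of p (t - u))\<close>, and differences commute with this
  integral. So every further primitive costs one factor \<open>s\<close>, the constants of integration are
  annihilated, and the first primitive contributes the integral of \<open>g\<close> itself.
\<close>

lemma nabla_iter_primitive_bound_pos:
  assumes g: "loc_int g" and h: "\<And>T. integrable lborel (\<lambda>v. indicator {0..T} v * h v)" "\<And>v. 0 \<le> h v"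
    and gh: "AE v in lborel. 0 \<le> v \<longrightarrow> norm (g v) \<le> h v"
    and s: "0 < s"
  shows "cs \<noteq> [] \<Longrightarrow> 0 \<le> t - real (length cs) * s \<Longrightarrow>
    norm (nabla (length cs) s (iter_primitive cs g) t)
      \<le> s ^ (length cs - 1) * (\<integral>v. indicator {t - real (length cs) * s..t} v * h v \<partial>lborel)"
proof (induction cs arbitrary: t)
  case (Cons c cs)
  have hi: "integrable lborel (\<lambda>v. indicator {a..b} v * h v)" if "0 \<le> a" for a b
  proof (rule Bochner_Integration.integrable_bound[OF h(1)[of b]])
    have "(\<lambda>v. indicator {a..b} v * (indicator {0..b} v * h v)) \<in> borel_measurable lborel"
      using borel_measurable_integrable[OF h(1)[of b]] by measurable
    also have "(\<lambda>v. indicator {a..b} v * (indicator {0..b} v * h v)) = (\<lambda>v. indicator {a..b} v * h v)"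
      using that by (auto simp: indicator_def fun_eq_iff)
    finally show "(\<lambda>v. indicator {a..b} v * h v) \<in> borel_measurable lborel" .
  qed (use that h(2) in \<open>auto simp: indicator_def\<close>)
  define p where "p = iter_primitive cs g"
  have p: "loc_int p" unfolding p_def by (rule loc_int_iter_primitive[OF g])
  show ?case
  proof (cases "cs = []")
    case True
    have "nabla (length (c # cs)) s (iter_primitive (c # cs) g) t = primitive g t - primitive g (t - s)"
      using True by simp
    also have "norm \<dots> \<le> (\<integral>v. norm (indicator {t - s<..t} v *\<^sub>R g v) \<partial>lborel)"
      using Cons.prems True by (subst primitive_diff(1)[OF g _ s]) (simp, rule integral_norm_bound)
    also have "\<dots> \<le> (\<integral>v. indicator {t - s..t} v * h v \<partial>lborel)"
    proof (rule integral_mono_AE)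
      show "integrable lborel (\<lambda>v. norm (indicator {t - s<..t} v *\<^sub>R g v))"
        using Cons.prems True by (intro integrable_norm primitive_diff(2)[OF g _ s]) simp
      show "integrable lborel (\<lambda>v. indicator {t - s..t} v * h v)" using Cons.prems True by (intro hi) simp
      show "AE v in lborel. norm (indicator {t - s<..t} v *\<^sub>R g v) \<le> indicator {t - s..t} v * h v"
        using gh by eventually_elim (use Cons.prems True h(2) in \<open>auto simp: indicator_def\<close>)
    qed
    finally show ?thesis using True by simp
  next
    case False
    define m where "m = length cs"
    obtain a where a: "\<And>s G t. nabla m s G t = (\<Sum>l\<le>m. a l *\<^sub>R G (t - real l * s))"
      using nabla_sum[of m] by blast
    define P where "P t = c + primitive p t" for t
    have t0: "0 \<le> t - real (Suc m) * s" using Cons.prems by (simp add: m_def)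
    have step: "P \<tau> - P (\<tau> - s) = (\<integral>u. indicator {0..<s} u *\<^sub>R p (\<tau> - u) \<partial>lborel)"
      "integrable lborel (\<lambda>u. indicator {0..<s} u *\<^sub>R p (\<tau> - u))" if "0 \<le> \<tau> - s" for \<tau>
    proof -
      have e: "indicator {\<tau> - s<..\<tau>} (\<tau> + (- 1) * u) *\<^sub>R p (\<tau> + (- 1) * u) = indicator {0..<s} u *\<^sub>R p (\<tau> - u)" for u
        by (auto simp: indicator_def)
      have "P \<tau> - P (\<tau> - s) = (\<integral>v. indicator {\<tau> - s<..\<tau>} v *\<^sub>R p v \<partial>lborel)"
        using primitive_diff(1)[OF p that s] by (simp add: P_def)
      also have "\<dots> = (\<integral>u. indicator {\<tau> - s<..\<tau>} (\<tau> + (- 1) * u) *\<^sub>R p (\<tau> + (- 1) * u) \<partial>lborel)"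
        by (subst lborel_integral_real_affine[where c="-1" and t=\<tau>]) auto
      finally show "P \<tau> - P (\<tau> - s) = (\<integral>u. indicator {0..<s} u *\<^sub>R p (\<tau> - u) \<partial>lborel)" unfolding e .
      have "integrable lborel (\<lambda>u. indicator {\<tau> - s<..\<tau>} (\<tau> + (- 1) * u) *\<^sub>R p (\<tau> + (- 1) * u))"
        by (rule lborel_integrable_real_affine[OF primitive_diff(2)[OF p that s]]) simp
      then show "integrable lborel (\<lambda>u. indicator {0..<s} u *\<^sub>R p (\<tau> - u))" unfolding e .
    qed
    have \<tau>: "0 \<le> t - real l * s - s" if "l \<le> m" for l
    proof -
      have "real (Suc l) * s \<le> real (Suc m) * s" using that s by (intro mult_right_mono) auto
      then show ?thesis using t0 by (simp add: algebra_simps)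
    qed
    define I where "I = (\<integral>v. indicator {t - real (Suc m) * s..t} v * h v \<partial>lborel)"
    have int: "integrable lborel (\<lambda>u. \<Sum>l\<le>m. a l *\<^sub>R (indicator {0..<s} u *\<^sub>R p (t - real l * s - u)))"
      using step(2)[OF \<tau>] by (intro Bochner_Integration.integrable_sum integrable_scaleR_right) auto
    have eq: "(\<Sum>l\<le>m. a l *\<^sub>R (indicator {0..<s} u *\<^sub>R p (t - real l * s - u))) = indicator {0..<s} u *\<^sub>R nabla m s p (t - u)" for u
      unfolding a by (simp add: scaleR_sum_right scaleR_left_commute algebra_simps)
    have "nabla (length (c # cs)) s (iter_primitive (c # cs) g) t = nabla m s (\<lambda>t. P t - P (t - s)) t"
      unfolding P_def p_def by (simp only: m_def list.size iter_primitive.simps add_0_right add_Suc_right nabla_Suc_inner)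
    also have "\<dots> = (\<Sum>l\<le>m. a l *\<^sub>R (\<integral>u. indicator {0..<s} u *\<^sub>R p (t - real l * s - u) \<partial>lborel))"
      unfolding a by (intro sum.cong refl) (use step(1)[OF \<tau>] in simp)
    also have "\<dots> = (\<integral>u. (\<Sum>l\<le>m. a l *\<^sub>R (indicator {0..<s} u *\<^sub>R p (t - real l * s - u))) \<partial>lborel)"
      using step(2)[OF \<tau>] by (subst Bochner_Integration.integral_sum) (auto simp del: scaleR_scaleR)
    also have "\<dots> = (\<integral>u. indicator {0..<s} u *\<^sub>R nabla m s p (t - u) \<partial>lborel)" unfolding eq ..
    also have "norm \<dots> \<le> (\<integral>u. norm (indicator {0..<s} u *\<^sub>R nabla m s p (t - u)) \<partial>lborel)"
      by (rule integral_norm_bound)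
    also have "\<dots> \<le> (\<integral>u. indicator {0..s} u *\<^sub>R (s ^ (m - 1) * I) \<partial>lborel)"
    proof (rule integral_mono)
      show "integrable lborel (\<lambda>u. norm (indicator {0..<s} u *\<^sub>R nabla m s p (t - u)))"
        using int unfolding eq by (rule integrable_norm)
      show "integrable lborel (\<lambda>u. indicator {0..s} u *\<^sub>R (s ^ (m - 1) * I))"
        by (rule borel_integrable_compact) auto
      have I0: "0 \<le> I" unfolding I_def using h(2) by (intro Bochner_Integration.integral_nonneg) simp
      show "norm (indicator {0..<s} u *\<^sub>R nabla m s p (t - u)) \<le> indicator {0..s} u *\<^sub>R (s ^ (m - 1) * I)" for u
      proof (cases "u \<in> {0..<s}")
        case True
        have "0 \<le> t - u - real m * s" using t0 True by (simp add: algebra_simps)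
        then have "norm (nabla m s p (t - u)) \<le> s ^ (m - 1) * (\<integral>v. indicator {t - u - real m * s..t - u} v * h v \<partial>lborel)"
          using Cons.IH[of "t - u"] False by (simp add: m_def p_def)
        also have "\<dots> \<le> s ^ (m - 1) * I"
          unfolding I_def
        proof (intro mult_left_mono integral_mono hi)
          show "indicator {t - u - real m * s..t - u} v * h v \<le> indicator {t - real (Suc m) * s..t} v * h v" for v
            using True h(2)[of v] by (auto simp: indicator_def algebra_simps)
        qed (use s t0 \<open>0 \<le> t - u - real m * s\<close> in auto)
        finally show ?thesis using True by simp
      next
        case False
        then have "indicator {0..<s} u = (0 :: real)" by simp
        then show ?thesis using I0 s by simp
      qed
    qed
    also have "\<dots> = s ^ m * I" using s False by (cases m) (auto simp: m_def)
    finally show ?thesis by (simp add: m_def I_def)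
  qed
qed simp

text \<open>
  A negative step is a positive step based at the other end of the interval.
\<close>

lemma nabla_iter_primitive_bound:
  assumes g: "loc_int g" and h: "\<And>T. integrable lborel (\<lambda>v. indicator {0..T} v * h v)" "\<And>v. 0 \<le> h v"
    and gh: "AE v in lborel. 0 \<le> v \<longrightarrow> norm (g v) \<le> h v"
    and cs: "length cs = Suc k" and t: "real (Suc k) * \<bar>s\<bar> \<le> t"
  shows "norm (nabla (Suc k) s (iter_primitive cs g) t)
      \<le> \<bar>s\<bar> ^ k * (\<integral>v. indicator {t - real (Suc k) * \<bar>s\<bar>..t + real (Suc k) * \<bar>s\<bar>} v * h v \<partial>lborel)"
proof -
  have cs0: "cs \<noteq> []" using cs by auto
  have hi: "integrable lborel (\<lambda>v. indicator {a..b} v * h v)" if "0 \<le> a" for a b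
  proof (rule Bochner_Integration.integrable_bound[OF h(1)[of b]])
    have "(\<lambda>v. indicator {a..b} v * (indicator {0..b} v * h v)) \<in> borel_measurable lborel"
      using borel_measurable_integrable[OF h(1)[of b]] by measurable
    also have "(\<lambda>v. indicator {a..b} v * (indicator {0..b} v * h v)) = (\<lambda>v. indicator {a..b} v * h v)"
      using that by (auto simp: indicator_def fun_eq_iff)
    finally show "(\<lambda>v. indicator {a..b} v * h v) \<in> borel_measurable lborel" .
  qed (use that h(2) in \<open>auto simp: indicator_def\<close>)
  have mono: "(\<integral>v. indicator {a..b} v * h v \<partial>lborel) \<le> (\<integral>v. indicator {a'..b'} v * h v \<partial>lborel)"
    if "0 \<le> a'" "a' \<le> a" "b \<le> b'" for a b a' b'
    using that h(2) by (intro integral_mono hi) (auto simp: indicator_def)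
  consider "s = 0" | "s > 0" | "s < 0" by linarith
  then show ?thesis
  proof cases
    case 1
    then show ?thesis using h(2) by (simp add: nabla_zero_step del: nabla.simps)
  next
    case 2
    have "norm (nabla (Suc k) s (iter_primitive cs g) t) \<le> s ^ k * (\<integral>v. indicator {t - real (Suc k) * s..t} v * h v \<partial>lborel)"
      using nabla_iter_primitive_bound_pos[OF g h gh 2 cs0, of t] cs t 2 by simp
    also have "\<dots> \<le> s ^ k * (\<integral>v. indicator {t - real (Suc k) * s..t + real (Suc k) * s} v * h v \<partial>lborel)"
      using 2 t by (intro mult_left_mono mono) auto
    finally show ?thesis using 2 by simp
  next
    case 3
    define r where "r = - s"
    have r: "r > 0" "s = - r" using 3 by (auto simp: r_def)
    have "norm (nabla (Suc k) s (iter_primitive cs g) t) = norm (nabla (Suc k) r (iter_primitive cs g) (t + real (Suc k) * r))"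
      unfolding r(2) nabla_neg_step by (simp add: norm_mult norm_power del: nabla.simps)
    also have "\<dots> \<le> r ^ k * (\<integral>v. indicator {t..t + real (Suc k) * r} v * h v \<partial>lborel)"
    proof -
      have "0 \<le> real (Suc k) * r" using r by simp
      moreover have "real (Suc k) * r \<le> t" using t r by simp
      ultimately have "0 \<le> t" by (rule order_trans)
      then show ?thesis
        using nabla_iter_primitive_bound_pos[OF g h gh r(1) cs0, of "t + real (Suc k) * r"] cs
        by (simp del: nabla.simps)
    qed
    also have "\<dots> \<le> r ^ k * (\<integral>v. indicator {t - real (Suc k) * r..t + real (Suc k) * r} v * h v \<partial>lborel)"
      using r t by (intro mult_left_mono mono) auto
    finally show ?thesis using r by simp
  qed
qed

section \<open>Low frequencies and the Laplace transform\<close>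

definition sinc :: "real \<Rightarrow> real"
  where "sinc x = (if x = 0 then 1 else sin x / x)"

text \<open>
  \<open>sinc\<close> is an average of characters with frequencies in \<open>{-1..1}\<close>: its powers, suitably scaled, are
  band-limited and decay polynomially.
\<close>

lemma sinc_average:
  "(\<integral>\<eta>. indicator {-1..1} \<eta> *\<^sub>R cis (\<eta> * x) \<partial>lborel) = 2 * complex_of_real (sinc x)"
proof (cases "x = 0")
  case False
  have "(\<integral>\<eta>. indicator {-1..1} \<eta> *\<^sub>R cis (\<eta> * x) \<partial>lborel)
      = (\<lambda>\<eta>. cis (\<eta> * x) / (\<i> * complex_of_real x)) 1 - (\<lambda>\<eta>. cis (\<eta> * x) / (\<i> * complex_of_real x)) (-1)"
  proof (rule integral_FTC_Icc)
    show "((\<lambda>\<eta>. cis (\<eta> * x) / (\<i> * complex_of_real x)) has_vector_derivative cis (\<eta> * x)) (at \<eta> within {- 1..1})" for \<eta>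
    proof -
      have "((\<lambda>\<eta>. cis (\<eta> * x)) has_vector_derivative (x *\<^sub>R (\<i> * cis (\<eta> * x)))) (at \<eta> within {- 1..1})"
      proof -
        have "((\<lambda>z. exp (\<i> * (z * complex_of_real x))) has_field_derivative (x *\<^sub>R (\<i> * cis (\<eta> * x)))) (at (complex_of_real \<eta>))"
          by (auto intro!: derivative_eq_intros simp: scaleR_conv_of_real cis_conv_exp)
        from has_vector_derivative_real_field[OF this] show ?thesis by (simp add: cis_conv_exp o_def)
      qed
      from has_vector_derivative_mult_left[OF this, of "inverse (\<i> * complex_of_real x)"]
      show ?thesis using False by (simp add: field_simps scaleR_conv_of_real)
    qed
  qed (auto intro!: continuous_intros)
  also have "\<dots> = 2 * complex_of_real (sinc x)"
    using False by (simp add: sinc_def complex_eq_iff cis.ctr Re_divide Im_divide power2_eq_square field_simps)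
  finally show ?thesis .
qed (simp add: sinc_def scaleR_conv_of_real)

lemma sinc_measurable [measurable]: "sinc \<in> borel_measurable borel"
  unfolding sinc_def[abs_def] by measurable

lemma sinc_bounds: "\<bar>sinc x\<bar> \<le> 1" "\<bar>x\<bar> * \<bar>sinc x\<bar> \<le> 1"
  using abs_sin_x_le_abs_x[of x] by (auto simp: sinc_def divide_simps)

text \<open>
  For \<open>U\<close> tending to infinity this is twice the modified Bessel function \<open>K\<close> of order \<open>i s / \<beta>\<close> at 1. The weight
  \<open>exp (- cosh u)\<close> is chosen because it is entire, stays bounded on the strip
  \<open>0 \<le> Im u \<le> 1\<close> and is doubly exponentially small at \<open>u = \<plusminus> U\<close>, so that truncation at \<open>U\<close> and a
  shift of the contour by 1 cost almost nothing.
\<close>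

definition bessel_kernel :: "real \<Rightarrow> real \<Rightarrow> real \<Rightarrow> complex"
  where "bessel_kernel U \<beta> s = (\<integral>u. complex_of_real (indicator {-U..U} u * exp (- cosh u)) * cis (u * s / \<beta>) \<partial>lborel)"

lemma cosh_real_measurable [measurable]: "(cosh :: real \<Rightarrow> real) \<in> borel_measurable borel"
  by (intro borel_measurable_continuous_onI continuous_intros)

lemma cis_measurable [measurable]: "cis \<in> borel_measurable borel"
  by (intro borel_measurable_continuous_onI continuous_intros)

lemma bessel_weight_integrable: "integrable lborel (\<lambda>u. complex_of_real (indicator {-U..U} u * exp (- cosh u)))"
proof -
  have "integrable lborel (\<lambda>u. indicator {-U..U} u *\<^sub>R exp (- cosh u :: real))"
    by (rule borel_integrable_compact) (auto intro!: continuous_intros)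
  from integrable_of_real[OF this, where 'a=complex] show ?thesis by (simp only: real_scaleR_def)
qed

lemma bessel_measurable [measurable]: "bessel_kernel U \<beta> \<in> borel_measurable borel"
  unfolding bessel_kernel_def[abs_def] by measurable

definition bessel_mass :: "real \<Rightarrow> real"
  where "bessel_mass U = (\<integral>u. indicator {-U..U} u * exp (- cosh u) \<partial>lborel)"

lemma bessel_norm_le: "norm (bessel_kernel U \<beta> s) \<le> bessel_mass U"
proof -
  have "norm (bessel_kernel U \<beta> s) \<le> (\<integral>u. norm (complex_of_real (indicator {-U..U} u * exp (- cosh u)) * cis (u * s / \<beta>)) \<partial>lborel)"
    unfolding bessel_kernel_def by (rule integral_norm_bound)
  also have "\<dots> = bessel_mass U" unfolding bessel_mass_def by (intro Bochner_Integration.integral_cong) (auto simp: norm_mult)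
  finally show ?thesis .
qed

lemma cos_ge_half: "0 \<le> v \<Longrightarrow> v \<le> 1 \<Longrightarrow> cos v \<ge> (1/2 :: real)"
proof -
  assume v: "0 \<le> v" "v \<le> 1"
  have "\<bar>sin (v / 2)\<bar> \<le> 1 / 2" using abs_sin_x_le_abs_x[of "v / 2"] v by simp
  then have "(sin (v / 2))\<^sup>2 \<le> (1 / 2)\<^sup>2" by (metis power2_abs abs_ge_zero power_mono)
  then show ?thesis using cos_double_sin[of "v / 2"] by (simp add: power2_eq_square)
qed

lemma Re_cosh_complex: "Re (cosh (Complex a b)) = cosh a * cos b"
  by (simp add: cosh_def Re_exp algebra_simps)

text \<open>
  Substituting \<open>z = \<sigma> + i (\<theta> + u / \<beta>)\<close>, a shift of \<open>u\<close> by \<open>i v\<close> moves \<open>z\<close> to the left by \<open>v / \<beta>\<close>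
  and turns the oscillating factor into one of modulus \<open>exp (- v t / \<beta>)\<close>. At \<open>v = 1\<close> the integrand
  has the factor \<open>exp (- t / \<beta>)\<close>. On the vertical sides of the rectangle
  \<open>norm (exp (- cosh w)) = exp (- cosh U cos v) \<le> exp (- cosh U / 2)\<close>, as \<open>cos v \<ge> 1 / 2\<close>.
\<close>

lemma contour_shift_bound:
  fixes F :: "complex \<Rightarrow> complex"
  assumes F: "F holomorphic_on {z. - d < Re z \<and> \<bar>Im z\<bar> < R}"
    and d: "0 < \<beta>" "1 / \<beta> < d" "0 \<le> \<sigma>" and U: "0 \<le> U" "\<bar>\<theta>\<bar> + U / \<beta> < R" and t: "0 \<le> t"
    and K: "\<And>z. - d < Re z \<Longrightarrow> Re z \<le> \<sigma> \<Longrightarrow> \<bar>Im z\<bar> \<le> \<bar>\<theta>\<bar> + U / \<beta> \<Longrightarrow> norm (F z) \<le> K"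
  shows "norm (\<integral>u. complex_of_real (indicator {-U..U} u * exp (- cosh u)) *
      (cis ((\<theta> + u / \<beta>) * t) * F (Complex \<sigma> (\<theta> + u / \<beta>))) \<partial>lborel)
    \<le> 2 * K * (U * exp (- t / \<beta>) + exp (- cosh U / 2))"
proof -
  define D where "D = {z. - d < Re z \<and> \<bar>Im z\<bar> < R}"
  define \<zeta> where "\<zeta> w = complex_of_real \<sigma> + \<i> * (complex_of_real \<theta> + w / complex_of_real \<beta>)" for w
  define S where "S = {w. - d < Re (\<zeta> w) \<and> \<bar>Im (\<zeta> w)\<bar> < R}"
  have \<zeta>: "Re (\<zeta> w) = \<sigma> - Im w / \<beta>" "Im (\<zeta> w) = \<theta> + Re w / \<beta>" for w
    using d by (simp_all add: \<zeta>_def)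
  define \<Psi> where "\<Psi> w = exp (- cosh w) * (exp (\<i> * (complex_of_real \<theta> + w / complex_of_real \<beta>) * complex_of_real t) * F (\<zeta> w))" for w
  have S_eq: "S = {w. Im w < \<beta> * (\<sigma> + d)} \<inter> {w. Re w < \<beta> * (R - \<theta>)} \<inter> {w. Re w > - \<beta> * (R + \<theta>)}"
    using d by (auto simp: S_def \<zeta> field_simps abs_less_iff)
  have "open S" unfolding S_eq by (intro open_Int open_halfspace_Re_lt open_halfspace_Im_lt open_halfspace_Re_gt)
  have "convex S" unfolding S_eq by (intro convex_Int convex_halfspace_Im_lt convex_halfspace_Re_lt convex_halfspace_Re_gt)
  have "\<zeta> ` S \<subseteq> {z. - d < Re z \<and> \<bar>Im z\<bar> < R}" by (auto simp: S_def)
  moreover have "\<zeta> holomorphic_on S" unfolding \<zeta>_def[abs_def] using d by (auto intro!: holomorphic_intros)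
  ultimately have "(F \<circ> \<zeta>) holomorphic_on S" using F by (intro holomorphic_on_compose_gen)
  then have \<Psi>h: "\<Psi> holomorphic_on S"
    unfolding \<Psi>_def[abs_def] cosh_def using d by (auto intro!: holomorphic_intros simp: o_def)
  obtain G where "\<And>w. w \<in> S \<Longrightarrow> (G has_field_derivative \<Psi> w) (at w within S)"
    using holomorphic_convex_primitive'[OF \<open>convex S\<close> \<open>open S\<close> \<Psi>h] by blast
  then have G: "(G has_field_derivative \<Psi> w) (at w)" if "w \<in> S" for w
    using that at_within_open[OF that \<open>open S\<close>] by metis
  have inS: "w \<in> S" if "\<bar>Re w\<bar> \<le> U" "0 \<le> Im w" "Im w \<le> 1" for w
  proof -
    have "Im w / \<beta> \<le> 1 / \<beta>" using that d by (simp add: divide_right_mono)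
    moreover have "\<bar>Re w / \<beta>\<bar> \<le> U / \<beta>" using that d by (simp add: divide_right_mono)
    ultimately show ?thesis using d U unfolding S_def \<zeta> by (simp; linarith)
  qed
  have bound: "norm (\<Psi> w) \<le> exp (- cosh (Re w) * cos (Im w)) * (exp (- Im w * t / \<beta>) * K)"
    if "\<bar>Re w\<bar> \<le> U" "0 \<le> Im w" "Im w \<le> 1" for w
  proof -
    have "norm (exp (- cosh w)) = exp (- cosh (Re w) * cos (Im w))"
      using Re_cosh_complex[of "Re w" "Im w"] by simp
    moreover have "norm (exp (\<i> * (complex_of_real \<theta> + w / complex_of_real \<beta>) * complex_of_real t)) = exp (- Im w * t / \<beta>)"
      using d by simp
    moreover have "norm (F (\<zeta> w)) \<le> K"
    proof (rule K)
      show "- d < Re (\<zeta> w)" using inS[OF that] by (simp add: S_def)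
      show "Re (\<zeta> w) \<le> \<sigma>" using that d by (simp add: \<zeta>)
      have "\<bar>Re w / \<beta>\<bar> \<le> U / \<beta>" using that d by (simp add: divide_right_mono)
      then show "\<bar>Im (\<zeta> w)\<bar> \<le> \<bar>\<theta>\<bar> + U / \<beta>" unfolding \<zeta> by linarith
    qed
    ultimately show ?thesis unfolding \<Psi>_def norm_mult by (intro mult_mono) auto
  qed
  have K0: "0 \<le> K"
    using K[of "Complex 0 \<theta>"] d U by (auto intro: order_trans[OF norm_ge_zero] simp: divide_nonneg_nonneg order.strict_trans[of 0 "1 / \<beta>" d])
  have seg: "norm (G a - G b) \<le> B * norm (a - b)"
    if "\<And>w. w \<in> closed_segment a b \<Longrightarrow> \<bar>Re w\<bar> \<le> U \<and> 0 \<le> Im w \<and> Im w \<le> 1 \<and> norm (\<Psi> w) \<le> B" for a b B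
    by (rule field_differentiable_bound[of "closed_segment a b" G \<Psi>])
      (use that inS G in \<open>auto intro: has_field_derivative_at_within\<close>)
  have side: "norm (G (Complex x 0) - G (Complex x 1)) \<le> K * exp (- cosh U / 2)" if x: "\<bar>x\<bar> = U" for x
  proof -
    have "norm (G (Complex x 0) - G (Complex x 1)) \<le> (K * exp (- cosh U / 2)) * norm (Complex x 0 - Complex x 1)"
    proof (rule seg)
      fix w assume "w \<in> closed_segment (Complex x 0) (Complex x 1)"
      then obtain v where v: "0 \<le> v" "v \<le> 1" "w = Complex x v"
        by (auto simp: closed_segment_def complex_eq_iff left_diff_distrib)
      have "norm (\<Psi> w) \<le> exp (- cosh x * cos v) * (exp (- v * t / \<beta>) * K)"
        using bound[of w] v x by simp
      also have "\<dots> \<le> exp (- cosh U / 2) * (1 * K)"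
      proof (intro mult_mono)
        have "cosh U * (1 / 2) \<le> cosh x * cos v"
        proof -
          have e: "cosh x = cosh U" using x cosh_real_abs[of x] by simp
          show ?thesis unfolding e using mult_left_mono[OF cos_ge_half[OF v(1,2)], of "cosh U"] by simp
        qed
        then show "exp (- cosh x * cos v) \<le> exp (- cosh U / 2)" by simp
        show "exp (- v * t / \<beta>) \<le> 1" using v t d by (simp add: divide_nonneg_nonneg)
      qed (use K0 in auto)
      finally show "\<bar>Re w\<bar> \<le> U \<and> 0 \<le> Im w \<and> Im w \<le> 1 \<and> norm (\<Psi> w) \<le> K * exp (- cosh U / 2)"
        using v x by (simp add: mult.commute)
    qed
    also have "norm (Complex x 0 - Complex x 1) = 1" by (simp add: cmod_def)
    finally show ?thesis by simp
  qed
  have top: "norm (G (Complex U 1) - G (Complex (-U) 1)) \<le> K * exp (- t / \<beta>) * (2 * U)"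
  proof -
    have "norm (G (Complex U 1) - G (Complex (-U) 1)) \<le> (K * exp (- t / \<beta>)) * norm (Complex U 1 - Complex (-U) 1)"
    proof (rule seg)
      fix w assume "w \<in> closed_segment (Complex U 1) (Complex (-U) 1)"
      then obtain r where r: "0 \<le> r" "r \<le> 1" "w = Complex ((1 - r) * U + r * (-U)) 1"
        by (auto simp: closed_segment_def complex_eq_iff)
      have "(1 - r) * U \<le> U" "0 \<le> (1 - r) * U" "r * U \<le> U" "0 \<le> r * U"
        using r U by (auto simp: mult_left_le_one_le)
      then have w: "\<bar>Re w\<bar> \<le> U" "Im w = 1" using r(3) by auto
      have "norm (\<Psi> w) \<le> exp (- cosh (Re w) * cos 1) * (exp (- 1 * t / \<beta>) * K)"
        using bound[of w] w by simp
      also have "\<dots> \<le> 1 * (exp (- 1 * t / \<beta>) * K)"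
      proof (rule mult_right_mono)
        have "0 \<le> cosh (Re w) * cos 1"
          using cos_ge_half[of 1] cosh_real_nonneg[of "Re w"] by (intro mult_nonneg_nonneg) auto
        then show "exp (- cosh (Re w) * cos 1) \<le> 1" by simp
      qed (use K0 in simp)
      finally show "\<bar>Re w\<bar> \<le> U \<and> 0 \<le> Im w \<and> Im w \<le> 1 \<and> norm (\<Psi> w) \<le> K * exp (- t / \<beta>)"
        using w by (simp add: mult.commute[of K])
    qed
    also have "norm (Complex U 1 - Complex (-U) 1) = 2 * U"
    proof -
      have "Complex U 1 - Complex (-U) 1 = complex_of_real (2 * U)" by (simp add: complex_eq_iff)
      then show ?thesis using U by (simp del: of_real_mult)
    qed
    finally show ?thesis .
  qed
  have real_in: "complex_of_real u \<in> S" if "u \<in> {-U..U}" for u using inS[of "complex_of_real u"] that by auto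
  have "(\<integral>u. indicator {-U..U} u *\<^sub>R \<Psi> (complex_of_real u) \<partial>lborel) = G (complex_of_real U) - G (complex_of_real (- U))"
  proof (rule integral_FTC_Icc)
    show "((\<lambda>u. G (complex_of_real u)) has_vector_derivative \<Psi> (complex_of_real u)) (at u within {- U..U})"
      if "- U \<le> u" "u \<le> U" for u
    proof -
      have "(G has_field_derivative \<Psi> (complex_of_real u)) (at (complex_of_real u))"
        using that by (intro G real_in) simp
      from has_vector_derivative_real_field[OF this] show ?thesis .
    qed
    show "continuous_on {- U..U} (\<lambda>u. \<Psi> (complex_of_real u))"
      by (rule continuous_on_compose2[OF holomorphic_on_imp_continuous_on[OF \<Psi>h]])
        (use real_in in \<open>auto intro!: continuous_intros\<close>)
  qed (use U in simp)
  also have "(\<lambda>u. indicator {-U..U} u *\<^sub>R \<Psi> (complex_of_real u)) = (\<lambda>u. complex_of_real (indicator {-U..U} u * exp (- cosh u)) *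
      (cis ((\<theta> + u / \<beta>) * t) * F (Complex \<sigma> (\<theta> + u / \<beta>))))"
  proof
    fix u
    have 1: "\<zeta> (complex_of_real u) = Complex \<sigma> (\<theta> + u / \<beta>)" by (simp add: complex_eq_iff \<zeta>)
    have 2: "exp (\<i> * (complex_of_real \<theta> + complex_of_real u / complex_of_real \<beta>) * complex_of_real t) = cis ((\<theta> + u / \<beta>) * t)"
      by (simp add: cis_conv_exp mult.assoc)
    have 3: "exp (- cosh (complex_of_real u)) = complex_of_real (exp (- cosh u))"
    proof -
      have "cosh (complex_of_real u) = complex_of_real (cosh u)"
        by (simp add: cosh_def scaleR_conv_of_real exp_of_real flip: of_real_minus)
      then show ?thesis by (simp add: exp_of_real flip: of_real_minus)
    qed
    show "indicator {-U..U} u *\<^sub>R \<Psi> (complex_of_real u) = complex_of_real (indicator {-U..U} u * exp (- cosh u)) *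
      (cis ((\<theta> + u / \<beta>) * t) * F (Complex \<sigma> (\<theta> + u / \<beta>)))"
      unfolding \<Psi>_def 1 2 3 by (simp add: scaleR_conv_of_real mult.assoc)
  qed
  finally have "(\<integral>u. complex_of_real (indicator {-U..U} u * exp (- cosh u)) *
      (cis ((\<theta> + u / \<beta>) * t) * F (Complex \<sigma> (\<theta> + u / \<beta>))) \<partial>lborel) = G (Complex U 0) - G (Complex (-U) 0)"
    by (simp add: complex_of_real_def)
  also have "\<dots> = (G (Complex U 0) - G (Complex U 1)) + (G (Complex U 1) - G (Complex (-U) 1)) - (G (Complex (-U) 0) - G (Complex (-U) 1))"
    by simp
  also have "norm \<dots> \<le> K * exp (- cosh U / 2) + K * exp (- t / \<beta>) * (2 * U) + K * exp (- cosh U / 2)"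
  proof -
    have tri: "norm (a + b - c) \<le> norm a + norm b + norm c" for a b c :: complex
      using norm_triangle_ineq4[of "a + b" c] norm_triangle_ineq[of a b] by linarith
    show ?thesis by (rule order_trans[OF tri]) (use side[of U] side[of "-U"] top U in auto)
  qed
  also have "\<dots> = 2 * K * (U * exp (- t / \<beta>) + exp (- cosh U / 2))" by (simp add: algebra_simps)
  finally show ?thesis .
qed

text \<open>
  Without the factor \<open>sinc\<close>, Fubini's theorem turns the integral into a weighted integral of \<open>F\<close>
  over a vertical segment, and the contour shift applies. Every factor \<open>sinc\<close> averages this over
  translates \<open>\<theta> + \<eta> \<kappa>\<close> of the frequency with \<open>\<bar>\<eta>\<bar> \<le> 1\<close>, which preserves the bound as long as all
  frequencies stay below \<open>R'\<close>.
\<close>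

lemma low_frequency_damped:
  fixes f F
  assumes fm: "f \<in> borel_measurable borel"
    and fi: "integrable lborel (\<lambda>r. exp (- \<sigma> * r) *\<^sub>R f r)"
    and lap: "\<And>z. Re z = \<sigma> \<Longrightarrow> F z = (\<integral>r. exp (- z * complex_of_real r) * f r \<partial>lborel)"
    and F: "F holomorphic_on {z. - d < Re z \<and> \<bar>Im z\<bar> < R}"
    and d: "0 < \<beta>" "1 / \<beta> < d" "0 < \<sigma>" and U: "0 \<le> U" and \<kappa>: "0 \<le> \<kappa>" and t: "0 \<le> t"
    and R': "R' < R"
    and K: "\<And>z. - d < Re z \<Longrightarrow> Re z \<le> \<sigma> \<Longrightarrow> \<bar>Im z\<bar> \<le> R' \<Longrightarrow> norm (F z) \<le> K"
  shows "\<bar>\<theta>\<bar> + real j * \<kappa> + U / \<beta> \<le> R' \<Longrightarrow>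
    norm (\<integral>r. exp (- \<sigma> * r) *\<^sub>R f r * (cis (\<theta> * (t - r)) * complex_of_real (sinc (\<kappa> * (t - r))) ^ j * bessel_kernel U \<beta> (t - r)) \<partial>lborel)
      \<le> 2 * K * (U * exp (- t / \<beta>) + exp (- cosh U / 2))"
proof (induction j arbitrary: \<theta>)
  case (0 \<theta>)
  note [measurable] = fm
  define a where "a r = exp (- \<sigma> * r) *\<^sub>R f r * cis (\<theta> * (t - r))" for r
  have ai: "integrable lborel a"
    by (rule Bochner_Integration.integrable_bound[OF fi]) (auto simp: a_def[abs_def] norm_mult)
  define b where "b u = complex_of_real (indicator {-U..U} u * exp (- cosh u))" for u
  have bi: "integrable lborel b" unfolding b_def[abs_def] by (rule bessel_weight_integrable)
  have "(\<integral>r. exp (- \<sigma> * r) *\<^sub>R f r * (cis (\<theta> * (t - r)) * complex_of_real (sinc (\<kappa> * (t - r))) ^ 0 * bessel_kernel U \<beta> (t - r)) \<partial>lborel)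
      = (\<integral>r. a r * (\<integral>u. b u * cis (u * (t - r) / \<beta>) \<partial>lborel) \<partial>lborel)"
    by (simp add: a_def b_def bessel_kernel_def mult.assoc)
  also have "\<dots> = (\<integral>u. b u * (\<integral>r. a r * cis (u * (t - r) / \<beta>) \<partial>lborel) \<partial>lborel)"
  proof (rule Fubini_bounded_kernel[where B=1, OF ai bi])
    show "(\<lambda>(r, u). cis (u * (t - r) / \<beta>)) \<in> borel_measurable (borel \<Otimes>\<^sub>M borel)"
      unfolding case_prod_beta' by measurable
  qed simp
  also have "\<dots> = (\<integral>u. b u * (cis ((\<theta> + u / \<beta>) * t) * F (Complex \<sigma> (\<theta> + u / \<beta>))) \<partial>lborel)"
  proof (rule Bochner_Integration.integral_cong[OF refl])
    fix u
    have "a r * cis (u * (t - r) / \<beta>) = cis ((\<theta> + u / \<beta>) * t) * (exp (- Complex \<sigma> (\<theta> + u / \<beta>) * complex_of_real r) * f r)" for r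
    proof -
      have e: "exp (- Complex \<sigma> y * complex_of_real r) = complex_of_real (exp (- \<sigma> * r)) * cis (- y * r)" for y
        by (simp add: exp_eq_polar complex_eq_iff)
      have c: "cis (\<theta> * (t - r)) * cis (u * (t - r) / \<beta>) = cis ((\<theta> + u / \<beta>) * t) * cis (- (\<theta> + u / \<beta>) * r)"
        unfolding cis_mult using d(1) by (intro arg_cong[of _ _ cis]) (simp add: field_simps)
      have "a r * cis (u * (t - r) / \<beta>) = complex_of_real (exp (- \<sigma> * r)) * f r * (cis (\<theta> * (t - r)) * cis (u * (t - r) / \<beta>))"
        by (simp add: a_def scaleR_conv_of_real mult.assoc)
      then show ?thesis unfolding c e by (simp add: mult_ac)
    qed
    then show "b u * (\<integral>r. a r * cis (u * (t - r) / \<beta>) \<partial>lborel) = b u * (cis ((\<theta> + u / \<beta>) * t) * F (Complex \<sigma> (\<theta> + u / \<beta>)))"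
      by (simp add: lap)
  qed
  also have "norm \<dots> \<le> 2 * K * (U * exp (- t / \<beta>) + exp (- cosh U / 2))"
    unfolding b_def
    by (rule contour_shift_bound[OF F d(1,2) _ U _ t]) (use d R' 0 K in auto)
  finally show ?case .
next
  case (Suc j \<theta>)
  note [measurable] = fm
  define B where "B = 2 * K * (U * exp (- t / \<beta>) + exp (- cosh U / 2))"
  define a where "a r = exp (- \<sigma> * r) *\<^sub>R f r * (cis (\<theta> * (t - r)) * complex_of_real (sinc (\<kappa> * (t - r))) ^ j * bessel_kernel U \<beta> (t - r))" for r
  have ai: "integrable lborel a"
  proof (rule Bochner_Integration.integrable_bound[of _ "\<lambda>r. bessel_mass U *\<^sub>R (exp (- \<sigma> * r) *\<^sub>R f r)"])
    show "integrable lborel (\<lambda>r. bessel_mass U *\<^sub>R (exp (- \<sigma> * r) *\<^sub>R f r))" by (rule integrable_scaleR_right[OF fi])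
    have "norm (a r) \<le> norm (bessel_mass U *\<^sub>R (exp (- \<sigma> * r) *\<^sub>R f r))" for r
    proof -
      have "norm (a r) = (exp (- \<sigma> * r) * norm (f r)) * (\<bar>sinc (\<kappa> * (t - r))\<bar> ^ j * norm (bessel_kernel U \<beta> (t - r)))"
        by (simp add: a_def norm_mult norm_power)
      also have "\<dots> \<le> (exp (- \<sigma> * r) * norm (f r)) * (1 * bessel_mass U)"
        using sinc_bounds(1) bessel_norm_le by (intro mult_left_mono mult_mono power_le_one) auto
      also have "\<dots> \<le> norm (bessel_mass U *\<^sub>R (exp (- \<sigma> * r) *\<^sub>R f r))"
        using mult_right_mono[OF abs_ge_self[of "bessel_mass U"], of "exp (- \<sigma> * r) * norm (f r)"]
        by (simp add: abs_mult mult_ac)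
      finally show ?thesis .
    qed
    then show "AE r in lborel. norm (a r) \<le> norm (bessel_mass U *\<^sub>R (exp (- \<sigma> * r) *\<^sub>R f r))" by simp
  qed (simp add: a_def[abs_def])
  have bi: "integrable lborel (\<lambda>\<eta>. complex_of_real (indicator {-1..1::real} \<eta>))"
    using borel_integrable_compact[of "{-1..1::real}" "\<lambda>_. 1::complex"] by (simp add: scaleR_conv_of_real)
  have "(\<integral>r. exp (- \<sigma> * r) *\<^sub>R f r * (cis (\<theta> * (t - r)) * complex_of_real (sinc (\<kappa> * (t - r))) ^ Suc j * bessel_kernel U \<beta> (t - r)) \<partial>lborel)
      = (\<integral>r. a r * complex_of_real (sinc (\<kappa> * (t - r))) \<partial>lborel)"
    by (simp add: a_def mult_ac)
  also have "\<dots> = (\<integral>r. a r * ((1 / 2) * (\<integral>\<eta>. complex_of_real (indicator {-1..1} \<eta>) * cis (\<eta> * (\<kappa> * (t - r))) \<partial>lborel)) \<partial>lborel)"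
    using sinc_average by (simp add: scaleR_conv_of_real)
  also have "\<dots> = (1 / 2) * (\<integral>r. a r * (\<integral>\<eta>. complex_of_real (indicator {-1..1} \<eta>) * cis (\<eta> * (\<kappa> * (t - r))) \<partial>lborel) \<partial>lborel)"
    by (subst integral_mult_right_zero[symmetric]) (simp add: mult_ac)
  also have "(\<integral>r. a r * (\<integral>\<eta>. complex_of_real (indicator {-1..1} \<eta>) * cis (\<eta> * (\<kappa> * (t - r))) \<partial>lborel) \<partial>lborel)
      = (\<integral>\<eta>. complex_of_real (indicator {-1..1} \<eta>) * (\<integral>r. a r * cis (\<eta> * (\<kappa> * (t - r))) \<partial>lborel) \<partial>lborel)"
  proof (rule Fubini_bounded_kernel[where B=1, OF ai bi])
    show "(\<lambda>(r, \<eta>). cis (\<eta> * (\<kappa> * (t - r)))) \<in> borel_measurable (borel \<Otimes>\<^sub>M borel)"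
      unfolding case_prod_beta' by measurable
  qed simp
  finally have eq: "(\<integral>r. exp (- \<sigma> * r) *\<^sub>R f r * (cis (\<theta> * (t - r)) * complex_of_real (sinc (\<kappa> * (t - r))) ^ Suc j * bessel_kernel U \<beta> (t - r)) \<partial>lborel)
      = (1 / 2) * (\<integral>\<eta>. complex_of_real (indicator {-1..1} \<eta>) * (\<integral>r. a r * cis (\<eta> * (\<kappa> * (t - r))) \<partial>lborel) \<partial>lborel)" .
  have bound: "norm (\<integral>r. a r * cis (\<eta> * (\<kappa> * (t - r))) \<partial>lborel) \<le> B" if "\<eta> \<in> {-1..1}" for \<eta>
  proof -
    have c: "cis (\<theta> * (t - r)) * cis (\<eta> * (\<kappa> * (t - r))) = cis ((\<theta> + \<eta> * \<kappa>) * (t - r))" for r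
      unfolding cis_mult by (rule arg_cong[of _ _ cis]) (simp add: algebra_simps)
    have "a r * cis (\<eta> * (\<kappa> * (t - r))) = exp (- \<sigma> * r) *\<^sub>R f r * (cis ((\<theta> + \<eta> * \<kappa>) * (t - r)) * complex_of_real (sinc (\<kappa> * (t - r))) ^ j * bessel_kernel U \<beta> (t - r))" for r
      unfolding a_def c[symmetric] by (simp add: mult_ac)
    moreover have "norm (\<integral>r. exp (- \<sigma> * r) *\<^sub>R f r * (cis ((\<theta> + \<eta> * \<kappa>) * (t - r)) * complex_of_real (sinc (\<kappa> * (t - r))) ^ j * bessel_kernel U \<beta> (t - r)) \<partial>lborel) \<le> B"
      unfolding B_def
    proof (rule Suc.IH)
      have "\<bar>\<eta>\<bar> * \<kappa> \<le> 1 * \<kappa>" using that \<kappa> by (intro mult_right_mono) auto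
      then have "\<bar>\<eta> * \<kappa>\<bar> \<le> \<kappa>" using \<kappa> by (simp add: abs_mult)
      then show "\<bar>\<theta> + \<eta> * \<kappa>\<bar> + real j * \<kappa> + U / \<beta> \<le> R'"
        using Suc.prems by (simp add: algebra_simps)
    qed
    ultimately show ?thesis by simp
  qed
  have B0: "0 \<le> B" using bound[of 0] norm_ge_zero order_trans by (metis atLeastAtMost_iff neg_le_0_iff_le zero_le_one)
  have "norm (\<integral>\<eta>. complex_of_real (indicator {-1..1} \<eta>) * (\<integral>r. a r * cis (\<eta> * (\<kappa> * (t - r))) \<partial>lborel) \<partial>lborel)
      \<le> (\<integral>\<eta>. norm (complex_of_real (indicator {-1..1} \<eta>) * (\<integral>r. a r * cis (\<eta> * (\<kappa> * (t - r))) \<partial>lborel)) \<partial>lborel)"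
    by (rule integral_norm_bound)
  also have "\<dots> \<le> (\<integral>\<eta>. indicator {-1..1::real} \<eta> *\<^sub>R B \<partial>lborel)"
  proof (rule integral_mono_AE')
    show "integrable lborel (\<lambda>\<eta>. indicator {-1..1::real} \<eta> *\<^sub>R B)" by (rule borel_integrable_compact) auto
    show "AE \<eta> in lborel. norm (complex_of_real (indicator {-1..1} \<eta>) * (\<integral>r. a r * cis (\<eta> * (\<kappa> * (t - r))) \<partial>lborel)) \<le> indicator {-1..1} \<eta> *\<^sub>R B"
      using bound by (intro AE_I2) (auto simp: norm_mult indicator_def)
  qed (use B0 in auto)
  also have "\<dots> = 2 * B" by simp
  finally show ?case unfolding eq by (simp add: norm_mult B_def)
qed

text \<open>
  The damping \<open>\<sigma>\<close> is sent to 0. The bound for \<open>F\<close> is given to the left of the imaginary axis only;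
  by continuity it persists with \<open>2 K\<close> on a thin strip to the right, over the compact set of
  frequencies that occur. This is where the factor 4 arises.
\<close>

lemma low_frequency_bound:
  fixes f F
  assumes fm: "f \<in> borel_measurable borel"
    and fi: "\<And>\<sigma>. \<sigma> > 0 \<Longrightarrow> integrable lborel (\<lambda>r. exp (- \<sigma> * r) *\<^sub>R f r)"
    and f0: "\<And>r. r < 0 \<Longrightarrow> f r = 0"
    and lap: "\<And>z. Re z > 0 \<Longrightarrow> F z = (\<integral>r. exp (- z * complex_of_real r) * f r \<partial>lborel)"
    and F: "F holomorphic_on {z. - d < Re z \<and> \<bar>Im z\<bar> < R}"
    and K: "\<And>z. - d < Re z \<Longrightarrow> Re z < 0 \<Longrightarrow> \<bar>Im z\<bar> < R \<Longrightarrow> norm (F z) \<le> K" and K0: "0 < K"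
    and d: "0 < \<beta>" "1 / \<beta> < d" and U: "0 \<le> U" and \<kappa>: "0 \<le> \<kappa>" and t: "0 \<le> t"
    and R': "real N * \<kappa> + U / \<beta> < R"
    and int: "integrable lborel (\<lambda>r. f r * complex_of_real (sinc (\<kappa> * (t - r))) ^ N)"
  shows "norm (\<integral>r. f r * (complex_of_real (sinc (\<kappa> * (t - r))) ^ N * bessel_kernel U \<beta> (t - r)) \<partial>lborel)
      \<le> 4 * K * (U * exp (- t / \<beta>) + exp (- cosh U / 2))"
proof -
  note [measurable] = fm
  define R' where "R' = real N * \<kappa> + U / \<beta>"
  have R'R: "R' < R" using R' by (simp add: R'_def)
  have d0: "d > 0" using d by (metis divide_pos_pos less_trans zero_less_one)
  have R'0: "0 \<le> R'" using \<kappa> U d by (simp add: R'_def)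
  have contF: "continuous_on {z. - d < Re z \<and> \<bar>Im z\<bar> < R} F" by (rule holomorphic_on_imp_continuous_on[OF F])
  \<comment> \<open>On the axis itself the bound is a limit from the left.\<close>
  have axis: "norm (F (Complex 0 y)) \<le> K" if "\<bar>y\<bar> \<le> R'" for y
  proof (rule tendsto_upperbound)
    have "continuous_on {-d<..<1} (\<lambda>x. F (Complex x y))"
      by (rule continuous_on_compose2[OF contF]) (use that R'R in \<open>auto simp: Complex_eq intro!: continuous_intros\<close>)
    then have "isCont (\<lambda>x. F (Complex x y)) 0"
      using d0 by (intro continuous_on_interior[of "{-d<..<1}"]) auto
    then have "((\<lambda>x. F (Complex x y)) \<longlongrightarrow> F (Complex 0 y)) (at_left 0)"
      by (simp add: isCont_def filterlim_at_split)
    then show "((\<lambda>x. norm (F (Complex x y))) \<longlongrightarrow> norm (F (Complex 0 y))) (at_left 0)" by (rule tendsto_norm)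
    have "eventually (\<lambda>x. x \<in> {-d<..<0}) (at_left (0::real))"
      using d0 eventually_at_left_real[of "-d" 0] by simp
    then show "eventually (\<lambda>x. norm (F (Complex x y)) \<le> K) (at_left 0)"
      by eventually_elim (use that R'R in \<open>auto intro!: K\<close>)
  qed simp
  define C where "C = cbox (Complex 0 (-R')) (Complex 1 R')"
  have Csub: "C \<subseteq> {z. - d < Re z \<and> \<bar>Im z\<bar> < R}"
    using d0 R'R by (auto simp: C_def in_cbox_complex_iff)
  have "uniformly_continuous_on C F"
    by (rule compact_uniformly_continuous[OF continuous_on_subset[OF contF Csub]]) (simp add: C_def)
  then obtain \<delta> where \<delta>: "\<delta> > 0" "\<And>z w. z \<in> C \<Longrightarrow> w \<in> C \<Longrightarrow> dist z w < \<delta> \<Longrightarrow> dist (F z) (F w) < K"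
    unfolding uniformly_continuous_on_def using K0 by metis
  define \<sigma>0 where "\<sigma>0 = min 1 (\<delta> / 2)"
  have \<sigma>0: "0 < \<sigma>0" "\<sigma>0 \<le> 1" "\<sigma>0 < \<delta>" using \<delta>(1) by (auto simp: \<sigma>0_def)
  have K2: "norm (F z) \<le> 2 * K" if z: "- d < Re z" "Re z \<le> \<sigma>0" "\<bar>Im z\<bar> \<le> R'" for z
  proof (cases "Re z < 0")
    case True
    then have "norm (F z) \<le> K" using z R'R by (intro K) auto
    then show ?thesis using K0 by simp
  next
    case False
    have "dist z (Complex 0 (Im z)) = Re z" using False by (simp add: dist_norm cmod_def)
    then have "dist (F z) (F (Complex 0 (Im z))) < K"
      using z False \<sigma>0 by (intro \<delta>(2)) (auto simp: C_def in_cbox_complex_iff)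
    moreover have "norm (F (Complex 0 (Im z))) \<le> K" using z by (intro axis)
    ultimately show ?thesis
      using norm_triangle_sub[of "F z" "F (Complex 0 (Im z))"] by (simp add: dist_norm)
  qed
  have damped: "norm (\<integral>r. exp (- \<sigma> * r) *\<^sub>R f r * (complex_of_real (sinc (\<kappa> * (t - r))) ^ N * bessel_kernel U \<beta> (t - r)) \<partial>lborel)
      \<le> 4 * K * (U * exp (- t / \<beta>) + exp (- cosh U / 2))" if "0 < \<sigma>" "\<sigma> \<le> \<sigma>0" for \<sigma>
  proof -
    have "norm (\<integral>r. exp (- \<sigma> * r) *\<^sub>R f r * (cis (0 * (t - r)) * complex_of_real (sinc (\<kappa> * (t - r))) ^ N * bessel_kernel U \<beta> (t - r)) \<partial>lborel)
      \<le> 2 * (2 * K) * (U * exp (- t / \<beta>) + exp (- cosh U / 2))"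
      by (rule low_frequency_damped[OF fm fi[OF that(1)] _ F d(1,2) that(1) U \<kappa> t R'R])
        (use lap that K2 in \<open>auto simp: R'_def\<close>)
    then show ?thesis by simp
  qed
  define \<sigma> where "\<sigma> n = \<sigma>0 * inverse (real (Suc n))" for n
  have \<sigma>: "0 < \<sigma> n" "\<sigma> n \<le> \<sigma>0" for n
    using \<sigma>0 by (auto simp: \<sigma>_def field_simps)
  have \<sigma>lim: "\<sigma> \<longlonglongrightarrow> 0"
    using tendsto_mult[OF tendsto_const[of \<sigma>0] LIMSEQ_inverse_real_of_nat] by (simp add: \<sigma>_def[abs_def])
  have "(\<lambda>n. \<integral>r. exp (- \<sigma> n * r) *\<^sub>R f r * (complex_of_real (sinc (\<kappa> * (t - r))) ^ N * bessel_kernel U \<beta> (t - r)) \<partial>lborel)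
      \<longlonglongrightarrow> (\<integral>r. f r * (complex_of_real (sinc (\<kappa> * (t - r))) ^ N * bessel_kernel U \<beta> (t - r)) \<partial>lborel)"
  proof (rule integral_dominated_convergence[where w="\<lambda>r. bessel_mass U * norm (f r * complex_of_real (sinc (\<kappa> * (t - r))) ^ N)"])
    show "integrable lborel (\<lambda>r. bessel_mass U * norm (f r * complex_of_real (sinc (\<kappa> * (t - r))) ^ N))"
      by (intro integrable_mult_right integrable_norm int)
    show "AE r in lborel. (\<lambda>n. exp (- \<sigma> n * r) *\<^sub>R f r * (complex_of_real (sinc (\<kappa> * (t - r))) ^ N * bessel_kernel U \<beta> (t - r)))
        \<longlonglongrightarrow> f r * (complex_of_real (sinc (\<kappa> * (t - r))) ^ N * bessel_kernel U \<beta> (t - r))"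
    proof (rule AE_I2)
      fix r
      have "(\<lambda>n. exp (- \<sigma> n * r) *\<^sub>R f r * (complex_of_real (sinc (\<kappa> * (t - r))) ^ N * bessel_kernel U \<beta> (t - r)))
        \<longlonglongrightarrow> exp (- 0 * r) *\<^sub>R f r * (complex_of_real (sinc (\<kappa> * (t - r))) ^ N * bessel_kernel U \<beta> (t - r))"
        by (intro tendsto_intros \<sigma>lim)
      then show "(\<lambda>n. exp (- \<sigma> n * r) *\<^sub>R f r * (complex_of_real (sinc (\<kappa> * (t - r))) ^ N * bessel_kernel U \<beta> (t - r)))
        \<longlonglongrightarrow> f r * (complex_of_real (sinc (\<kappa> * (t - r))) ^ N * bessel_kernel U \<beta> (t - r))" by simp
    qed
    show "AE r in lborel. norm (exp (- \<sigma> n * r) *\<^sub>R f r * (complex_of_real (sinc (\<kappa> * (t - r))) ^ N * bessel_kernel U \<beta> (t - r)))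
        \<le> bessel_mass U * norm (f r * complex_of_real (sinc (\<kappa> * (t - r))) ^ N)" for n
    proof (rule AE_I2)
      fix r
      have e: "norm (exp (- \<sigma> n * r) *\<^sub>R f r) \<le> norm (f r)"
      proof (cases "r < 0")
        case False
        then have "exp (- \<sigma> n * r) \<le> 1" using \<sigma>(1)[of n] by simp
        then show ?thesis by (simp add: mult_left_le_one_le)
      qed (simp add: f0)
      have "norm (exp (- \<sigma> n * r) *\<^sub>R f r * (complex_of_real (sinc (\<kappa> * (t - r))) ^ N * bessel_kernel U \<beta> (t - r)))
          \<le> norm (f r) * (norm (complex_of_real (sinc (\<kappa> * (t - r))) ^ N) * bessel_mass U)"
        unfolding norm_mult using e bessel_norm_le by (intro mult_mono) (auto simp: norm_mult)
      then show "norm (exp (- \<sigma> n * r) *\<^sub>R f r * (complex_of_real (sinc (\<kappa> * (t - r))) ^ N * bessel_kernel U \<beta> (t - r)))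
        \<le> bessel_mass U * norm (f r * complex_of_real (sinc (\<kappa> * (t - r))) ^ N)" by (simp add: norm_mult mult_ac)
    qed
  qed measurable
  then have "(\<lambda>n. norm (\<integral>r. exp (- \<sigma> n * r) *\<^sub>R f r * (complex_of_real (sinc (\<kappa> * (t - r))) ^ N * bessel_kernel U \<beta> (t - r)) \<partial>lborel))
      \<longlonglongrightarrow> norm (\<integral>r. f r * (complex_of_real (sinc (\<kappa> * (t - r))) ^ N * bessel_kernel U \<beta> (t - r)) \<partial>lborel)"
    by (rule tendsto_norm)
  then show ?thesis
    by (rule LIMSEQ_le_const2) (use damped[OF \<sigma>] in auto)
qed

section \<open>The pointwise estimate\<close>

lemma integral_inverse_square:
  fixes \<kappa> :: real
  assumes "0 < \<kappa>"
  shows "integrable lborel (\<lambda>s. 1 / (1 + \<kappa> * \<bar>s\<bar>)\<^sup>2)" "(\<integral>s. 1 / (1 + \<kappa> * \<bar>s\<bar>)\<^sup>2 \<partial>lborel) = 2 / \<kappa>"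
proof -
  define w :: "real \<Rightarrow> real" where "w s = 1 / (1 + \<kappa> * \<bar>s\<bar>)\<^sup>2" for s
  have [measurable]: "w \<in> borel_measurable borel" unfolding w_def[abs_def] by measurable
  have half: "(\<integral>\<^sup>+s. ennreal (w s) * indicator {0..} s \<partial>lborel) = ennreal (1 / \<kappa>)"
  proof -
    have "(\<integral>\<^sup>+s. ennreal (w s) * indicator {0..} s \<partial>lborel) = ennreal (0 - (- inverse (1 + \<kappa> * 0) / \<kappa>))"
    proof (rule nn_integral_FTC_atLeast)
      show "((\<lambda>s. - inverse (1 + \<kappa> * s) / \<kappa>) has_real_derivative w s) (at s)" if "0 \<le> s" for s
      proof -
        have x: "1 + \<kappa> * s \<noteq> 0" using mult_nonneg_nonneg[of \<kappa> s] that assms by linarith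
        have d: "((\<lambda>s. 1 + \<kappa> * s) has_real_derivative \<kappa>) (at s)" by (auto intro!: derivative_eq_intros)
        from DERIV_cdivide[OF DERIV_minus[OF DERIV_inverse_fun[OF d x]], of \<kappa>]
        show ?thesis using that assms by (simp add: w_def inverse_eq_divide power2_eq_square)
      qed
      show "((\<lambda>s. - inverse (1 + \<kappa> * s) / \<kappa>) \<longlongrightarrow> 0) at_top"
        using assms by real_asymp
    qed (auto simp: w_def)
    then show ?thesis using assms by (simp add: inverse_eq_divide)
  qed
  have half': "(\<integral>\<^sup>+s. ennreal (w s) * indicator {..0} s \<partial>lborel) = ennreal (1 / \<kappa>)"
  proof -
    have "(\<integral>\<^sup>+s. ennreal (w s) * indicator {..0} s \<partial>lborel)
        = ennreal \<bar>-1\<bar> * (\<integral>\<^sup>+s. ennreal (w (0 + (-1) * s)) * indicator {..0} (0 + (-1) * s) \<partial>lborel)"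
      by (rule nn_integral_real_affine) auto
    also have "\<dots> = (\<integral>\<^sup>+s. ennreal (w s) * indicator {0..} s \<partial>lborel)"
      by (auto intro!: nn_integral_cong simp: w_def indicator_def)
    finally show ?thesis using half by simp
  qed
  have "(\<integral>\<^sup>+s. ennreal (w s) \<partial>lborel) = (\<integral>\<^sup>+s. ennreal (w s) * indicator {0..} s + ennreal (w s) * indicator {..0} s \<partial>lborel)"
  proof (rule nn_integral_cong_AE)
    have "AE s in lborel. s \<noteq> (0::real)" by (rule AE_lborel_singleton)
    then show "AE s in lborel. ennreal (w s) = ennreal (w s) * indicator {0..} s + ennreal (w s) * indicator {..0} s"
      by eventually_elim (auto simp: indicator_def)
  qed
  also have "\<dots> = ennreal (1 / \<kappa>) + ennreal (1 / \<kappa>)"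
    by (subst nn_integral_add) (auto simp: half half')
  also have "\<dots> = ennreal (2 / \<kappa>)" using assms by (subst ennreal_plus[symmetric]) auto
  finally have t: "(\<integral>\<^sup>+s. ennreal (w s) \<partial>lborel) = ennreal (2 / \<kappa>)" .
  then have "has_bochner_integral lborel w (2 / \<kappa>)"
    using assms by (intro has_bochner_integral_nn_integral) (auto simp: w_def)
  then show "integrable lborel (\<lambda>s. 1 / (1 + \<kappa> * \<bar>s\<bar>)\<^sup>2)" "(\<integral>s. 1 / (1 + \<kappa> * \<bar>s\<bar>)\<^sup>2 \<partial>lborel) = 2 / \<kappa>"
    by (auto simp: has_bochner_integral_iff w_def[abs_def])
qed

lemma sinc_decay: "\<bar>sinc x\<bar> ^ n \<le> 2 ^ n / (1 + \<bar>x\<bar>) ^ n"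
proof -
  have "(1 + \<bar>x\<bar>) * \<bar>sinc x\<bar> \<le> 2" using sinc_bounds[of x] by (simp add: algebra_simps)
  then have "((1 + \<bar>x\<bar>) * \<bar>sinc x\<bar>) ^ n \<le> 2 ^ n" by (intro power_mono) auto
  then show ?thesis by (simp add: power_mult_distrib pos_le_divide_eq mult.commute)
qed

lemma sinc_lower: "\<bar>x\<bar> \<le> 1 \<Longrightarrow> 1 / 2 \<le> sinc x"
proof -
  have pos: "x / 2 \<le> sin x" if "0 \<le> x" "x \<le> 1" for x :: real
  proof -
    have "sin 0 - 0 / 2 \<le> sin x - x / 2"
    proof (rule DERIV_nonneg_imp_nondecreasing[OF that(1)])
      fix y :: real assume "0 \<le> y" "y \<le> x"
      then have "cos y - 1 / 2 \<ge> 0" using cos_ge_half[of y] that by simp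
      moreover have "((\<lambda>x. sin x - x / 2) has_real_derivative (cos y - 1 / 2)) (at y)"
        by (auto intro!: derivative_eq_intros)
      ultimately show "\<exists>z. ((\<lambda>x. sin x - x / 2) has_real_derivative z) (at y) \<and> 0 \<le> z" by blast
    qed
    then show ?thesis by simp
  qed
  assume x: "\<bar>x\<bar> \<le> 1"
  consider "x = 0" | "x > 0" | "x < 0" by linarith
  then show ?thesis
    by cases (use pos[of x] pos[of "-x"] x in \<open>auto simp: sinc_def field_simps\<close>)
qed

text \<open>
  The cubic rate leaves a quadratic one after multiplication by \<open>\<bar>u\<bar>\<close>, so one integrable majorant
  serves for the mass and for the first moment.
\<close>

lemma exp_minus_cosh_le: "exp (- cosh u) \<le> 216 / (1 + \<bar>u\<bar>) ^ 3" for u :: real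
proof -
  have "1 + \<bar>u\<bar> \<le> exp \<bar>u\<bar>" by (rule exp_ge_add_one_self)
  also have "\<dots> \<le> 2 * cosh \<bar>u\<bar>" by (simp add: cosh_def)
  also have "cosh \<bar>u\<bar> = cosh u" by (rule cosh_real_abs)
  finally have c: "(1 + \<bar>u\<bar>) / 2 \<le> cosh u" by simp
  have "((1 + \<bar>u\<bar>) / 6) ^ 3 \<le> (1 + cosh u / real 3) ^ 3" using c by (intro power_mono) auto
  also have "\<dots> \<le> exp (cosh u)" using exp_ge_one_plus_x_over_n_power_n[of 3 "cosh u"] cosh_real_nonneg[of u] by simp
  finally have "(1 + \<bar>u\<bar>) ^ 3 / 216 \<le> exp (cosh u)" by (simp add: power_divide)
  then show ?thesis by (simp add: exp_minus field_simps)
qed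

lemma bessel_mass_bounds:
  shows "bessel_mass U \<le> 432" "0 \<le> bessel_mass U"
    and "(\<integral>u. indicator {-U..U} u * exp (- cosh u) * \<bar>u\<bar> \<partial>lborel) \<le> 432"
    and "integrable lborel (\<lambda>u. indicator {-U..U} u * exp (- cosh u) * \<bar>u\<bar>)"
    and "U \<ge> 1 \<Longrightarrow> 2 * exp (- cosh 1) \<le> bessel_mass U"
proof -
  have i: "integrable lborel (\<lambda>u::real. 216 * (1 / (1 + 1 * \<bar>u\<bar>)\<^sup>2))"
    by (intro integrable_mult_right integral_inverse_square) simp
  have v: "(\<integral>u. 216 * (1 / (1 + 1 * \<bar>u\<bar>)\<^sup>2) \<partial>(lborel :: real measure)) = 432"
    using integral_inverse_square(2)[of 1] by (subst integral_mult_right_zero) simp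
  have b: "indicator {-U..U} u * exp (- cosh u) * \<bar>u\<bar> ^ j \<le> 216 * (1 / (1 + 1 * \<bar>u\<bar>)\<^sup>2)" if "j \<le> 1" for u j
  proof -
    have "indicator {-U..U} u * exp (- cosh u) * \<bar>u\<bar> ^ j \<le> exp (- cosh u) * (1 + \<bar>u\<bar>)"
      using that by (cases j) (auto simp: indicator_def algebra_simps)
    also have "\<dots> \<le> (216 / (1 + \<bar>u\<bar>) ^ 3) * (1 + \<bar>u\<bar>)"
      by (intro mult_right_mono exp_minus_cosh_le) auto
    also have "\<dots> = 216 * (1 / (1 + 1 * \<bar>u\<bar>)\<^sup>2)"
    proof -
      define x where "x = 1 + \<bar>u\<bar>"
      have "x > 0" by (simp add: x_def)
      then have "216 / x ^ 3 * x = 216 * (1 / x\<^sup>2)" by (simp add: power3_eq_cube power2_eq_square)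
      then show ?thesis by (simp only: x_def mult_1)
    qed
    finally show ?thesis .
  qed
  have m1: "integrable lborel (\<lambda>u. indicator {-U..U} u * exp (- cosh u) * \<bar>u\<bar>)"
  proof -
    have "integrable lborel (\<lambda>u. indicator {-U..U} u *\<^sub>R (exp (- cosh u) * \<bar>u\<bar>))"
      by (rule borel_integrable_compact) (auto intro!: continuous_intros)
    then show ?thesis by (simp add: mult.assoc)
  qed
  have m0: "integrable lborel (\<lambda>u. indicator {-U..U} u * exp (- cosh u :: real))"
  proof -
    have "integrable lborel (\<lambda>u. indicator {-U..U} u *\<^sub>R (exp (- cosh u :: real)))"
      by (rule borel_integrable_compact) (auto intro!: continuous_intros)
    then show ?thesis by simp
  qed
  show "integrable lborel (\<lambda>u. indicator {-U..U} u * exp (- cosh u) * \<bar>u\<bar>)" by (rule m1)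
  have "bessel_mass U \<le> (\<integral>u. 216 * (1 / (1 + 1 * \<bar>u\<bar>)\<^sup>2) \<partial>(lborel :: real measure))"
    unfolding bessel_mass_def using b[of 0] by (intro integral_mono m0 i) auto
  then show "bessel_mass U \<le> 432" unfolding v .
  show "0 \<le> bessel_mass U" unfolding bessel_mass_def by (intro Bochner_Integration.integral_nonneg) auto
  have "(\<integral>u. indicator {-U..U} u * exp (- cosh u) * \<bar>u\<bar> \<partial>lborel) \<le> (\<integral>u. 216 * (1 / (1 + 1 * \<bar>u\<bar>)\<^sup>2) \<partial>(lborel :: real measure))"
    using b[of 1] by (intro integral_mono m1 i) auto
  then show "(\<integral>u. indicator {-U..U} u * exp (- cosh u) * \<bar>u\<bar> \<partial>lborel) \<le> 432" unfolding v .
  show "2 * exp (- cosh 1) \<le> bessel_mass U" if U: "U \<ge> 1"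
  proof -
    have "(\<integral>u. indicator {-1..1::real} u *\<^sub>R exp (- cosh 1 :: real) \<partial>lborel) \<le> bessel_mass U"
      unfolding bessel_mass_def
    proof (intro integral_mono m0)
      show "integrable lborel (\<lambda>u. indicator {-1..1::real} u *\<^sub>R exp (- cosh 1 :: real))"
        by (rule borel_integrable_compact) auto
      show "indicator {-1..1} u *\<^sub>R exp (- cosh 1) \<le> indicator {-U..U} u * exp (- cosh u)" for u :: real
      proof (cases "u \<in> {-1..1}")
        case True
        have "cosh u \<le> cosh 1" using cosh_real_nonneg_le_iff[of "\<bar>u\<bar>" 1] True by auto
        then show ?thesis using True U by auto
      qed auto
    qed
    then show ?thesis by simp
  qed
qed

text \<open>
  The difference is bounded by the first moment of the weight. For \<open>\<bar>s\<bar>\<close> small compared with \<open>\<alpha>\<close> the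
  kernel is thus close to a positive constant, which keeps the mass of its product with \<open>sinc ^ N\<close> away from 0.
\<close>

lemma bessel_near_mass: "0 < \<alpha> \<Longrightarrow> norm (bessel_kernel U \<alpha> s - complex_of_real (bessel_mass U)) \<le> 432 * \<bar>s\<bar> / \<alpha>"
proof -
  assume \<alpha>: "0 < \<alpha>"
  have e: "norm (exp (\<i> * complex_of_real x) - 1) \<le> \<bar>x\<bar>" for x
    using dist_exp_i_1[of x] abs_sin_x_le_abs_x[of "x / 2"] by simp
  define b where "b u = complex_of_real (indicator {-U..U} u * exp (- cosh u))" for u
  have b: "integrable lborel b" unfolding b_def[abs_def] by (rule bessel_weight_integrable)
  have bc: "integrable lborel (\<lambda>u. b u * cis (u * s / \<alpha>))"
    by (rule Bochner_Integration.integrable_bound[OF b]) (use b in \<open>auto simp: norm_mult\<close>)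
  have "complex_of_real (bessel_mass U) = (\<integral>u. b u \<partial>lborel)"
    unfolding bessel_mass_def b_def by (rule integral_complex_of_real[symmetric])
  then have "bessel_kernel U \<alpha> s - complex_of_real (bessel_mass U) = (\<integral>u. b u * cis (u * s / \<alpha>) - b u \<partial>lborel)"
    unfolding bessel_kernel_def b_def[symmetric] using Bochner_Integration.integral_diff[OF bc b] by simp
  also have "norm \<dots> \<le> (\<integral>u. norm (b u * cis (u * s / \<alpha>) - b u) \<partial>lborel)" by (rule integral_norm_bound)
  also have "\<dots> \<le> (\<integral>u. (\<bar>s\<bar> / \<alpha>) * (indicator {-U..U} u * exp (- cosh u) * \<bar>u\<bar>) \<partial>lborel)"
  proof (rule integral_mono)
    show "integrable lborel (\<lambda>u. norm (b u * cis (u * s / \<alpha>) - b u))"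
      by (intro integrable_norm Bochner_Integration.integrable_diff bc b)
    show "integrable lborel (\<lambda>u. (\<bar>s\<bar> / \<alpha>) * (indicator {-U..U} u * exp (- cosh u) * \<bar>u\<bar>))"
      by (intro integrable_mult_right bessel_mass_bounds)
    show "norm (b u * cis (u * s / \<alpha>) - b u) \<le> (\<bar>s\<bar> / \<alpha>) * (indicator {-U..U} u * exp (- cosh u) * \<bar>u\<bar>)" for u
    proof -
      have nb: "norm (b u) = indicator {-U..U} u * exp (- cosh u)" by (auto simp: b_def norm_mult indicator_def)
      have "b u * cis (u * s / \<alpha>) - b u = b u * (cis (u * s / \<alpha>) - 1)" by (simp add: algebra_simps)
      then have "norm (b u * cis (u * s / \<alpha>) - b u) = norm (b u) * norm (exp (\<i> * complex_of_real (u * s / \<alpha>)) - 1)"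
        by (simp add: norm_mult cis_conv_exp)
      also have "\<dots> \<le> norm (b u) * \<bar>u * s / \<alpha>\<bar>" by (intro mult_left_mono e) auto
      also have "\<dots> = (\<bar>s\<bar> / \<alpha>) * (indicator {-U..U} u * exp (- cosh u) * \<bar>u\<bar>)"
        using \<alpha> by (simp add: nb abs_mult mult_ac)
      finally show ?thesis .
    qed
  qed
  also have "\<dots> \<le> (\<bar>s\<bar> / \<alpha>) * 432"
  proof -
    have "(\<integral>u. (\<bar>s\<bar> / \<alpha>) * (indicator {-U..U} u * exp (- cosh u) * \<bar>u\<bar>) \<partial>lborel)
        = (\<bar>s\<bar> / \<alpha>) * (\<integral>u. indicator {-U..U} u * exp (- cosh u) * \<bar>u\<bar> \<partial>lborel)"
      by (rule integral_mult_right_zero)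
    also have "\<dots> \<le> (\<bar>s\<bar> / \<alpha>) * 432" using \<alpha> by (intro mult_left_mono bessel_mass_bounds) simp
    finally show ?thesis .
  qed
  finally show ?thesis by (simp add: mult.commute)
qed

lemma power_quotient_le:
  fixes D :: real
  assumes "1 \<le> D" "a + b \<le> n"
  shows "D ^ a / D ^ n \<le> 1 / D ^ b"
proof -
  have "D ^ a * D ^ b \<le> D ^ n" using assms by (simp add: power_add[symmetric] power_increasing)
  then show ?thesis using assms by (simp add: divide_simps)
qed

text \<open>
  Let \<open>k s = sinc (\<kappa> s) ^ N bessel_kernel U \<alpha> s\<close> and \<open>S = t / (2 m)\<close>. Expanding the difference gives
  \<open>Z f(t) = H - (\<Sum>l\<in>{1..m}. a l T l)\<close>, where \<open>Z\<close> is the integral of \<open>k\<close> over \<open>\<bar>s\<bar> \<le> S\<close>, \<open>H\<close> that of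
  \<open>k s\<close> times the \<open>m\<close>-th difference of \<open>f\<close>, and \<open>T l\<close> that of \<open>k s f (t - l s)\<close>. This is Jackson's device:
  no moment of the kernel has to vanish, only \<open>Z\<close> must not be small, and \<open>Z\<close> is of size \<open>1 / \<kappa>\<close>.
  The term \<open>H\<close> carries the smoothness of \<open>f\<close>. In \<open>T l\<close> the substitution \<open>r = t - l s\<close> leads to the
  same kernel with \<open>\<kappa> / l\<close> and \<open>l \<alpha>\<close>, which is the low-frequency quantity \<open>B\<close>, up to a tail
  \<open>\<bar>s\<bar> > S\<close>. The exponent \<open>N = 2 m + 4\<close> compensates the growth of \<open>f\<close> (\<open>m\<close>), the factor
  \<open>\<kappa> ^ (m + 1) t\<^sup>2\<close> in the tail (\<open>m + 2\<close>) and integrability (2).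
\<close>

lemma pointwise_estimate:
  fixes k :: nat
  defines "m \<equiv> Suc k" and "N \<equiv> 2 * Suc k + 4"
  shows "\<exists>A C. 0 < A \<and> 0 \<le> C \<and> (\<forall>f \<kappa> U \<alpha> t Cf J B.
      f \<in> borel_measurable borel \<longrightarrow> (\<forall>r<0. f r = 0) \<longrightarrow> (\<forall>r\<ge>0. norm (f r) \<le> Cf * (1 + r) ^ m) \<longrightarrow> 0 \<le> Cf \<longrightarrow>
      1 \<le> \<kappa> \<longrightarrow> 1 \<le> U \<longrightarrow> 0 < \<alpha> \<longrightarrow> A \<le> \<alpha> * \<kappa> \<longrightarrow> 2 * real m \<le> t \<longrightarrow> 0 \<le> J \<longrightarrow>
      (\<forall>s. real m * \<bar>s\<bar> \<le> t / 2 \<longrightarrow> norm (nabla m s f t) \<le> \<bar>s\<bar> ^ k * ((1 + \<kappa> * \<bar>s\<bar>)\<^sup>2 * J)) \<longrightarrow>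
      (\<forall>l\<in>{1..m}. norm (\<integral>r. f r * (complex_of_real (sinc (\<kappa> / real l * (t - r))) ^ N * bessel_kernel U (real l * \<alpha>) (t - r)) \<partial>lborel) \<le> B) \<longrightarrow>
      \<kappa> ^ m * norm (f t) \<le> C * (\<kappa> * J + \<kappa> ^ Suc m * B + Cf / t\<^sup>2))"
proof -
  obtain a where a0: "a 0 = 1" and a: "\<And>s G t. nabla m s G t = (\<Sum>l\<le>m. a l *\<^sub>R G (t - real l * s))"
    using nabla_sum[of m] by blast
  define c0 where "c0 = 2 * exp (- cosh (1::real))"
  have c0: "c0 > 0" by (simp add: c0_def)
  \<comment> \<open>432 bounds the mass and the first moment of the Bessel weight, and \<open>c0\<close> is a lower bound of its mass for \<open>U \<ge> 1\<close>.\<close>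
  define A where "A = 2 * 432 * 2 ^ N * 2 ^ N / c0"
  define Sa where "Sa = (\<Sum>l\<in>{1..m}. \<bar>a l\<bar>)"
  define Q where "Q = (432 * 2 ^ N * 2 :: real)"
  define C where "C = (2 ^ N / c0) * (Q + Sa + Sa * (Q * (8 * real m) ^ m * (2 * real m) ^ (m + 2)))"
  have Sa0: "0 \<le> Sa" by (simp add: Sa_def sum_nonneg)
  have Q0: "0 \<le> Q" by (simp add: Q_def)
  have main: "\<kappa> ^ m * norm (f t) \<le> C * (\<kappa> * J + \<kappa> ^ Suc m * B + Cf / t\<^sup>2)"
    if fm: "f \<in> borel_measurable borel" and f0: "\<forall>r<0. f r = 0" and fb: "\<forall>r\<ge>0. norm (f r) \<le> Cf * (1 + r) ^ m"
      and Cf: "0 \<le> Cf" and \<kappa>: "1 \<le> \<kappa>" and U: "1 \<le> U" and \<alpha>: "0 < \<alpha>" "A \<le> \<alpha> * \<kappa>" and t: "2 * real m \<le> t" and J: "0 \<le> J"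
      and nab: "\<forall>s. real m * \<bar>s\<bar> \<le> t / 2 \<longrightarrow> norm (nabla m s f t) \<le> \<bar>s\<bar> ^ k * ((1 + \<kappa> * \<bar>s\<bar>)\<^sup>2 * J)"
      and low: "\<forall>l\<in>{1..m}. norm (\<integral>r. f r * (complex_of_real (sinc (\<kappa> / real l * (t - r))) ^ N * bessel_kernel U (real l * \<alpha>) (t - r)) \<partial>lborel) \<le> B"
    for f \<kappa> U \<alpha> t Cf J B
  proof -
    note [measurable] = fm
    define S where "S = t / (2 * real m)"
    have m1: "1 \<le> real m" by (simp add: m_def)
    have S: "1 \<le> S" "t = 2 * real m * S" using t m1 by (auto simp: S_def)
    have t0: "0 < t" using S m1 by simp
    define D where "D s = 1 + \<kappa> * \<bar>s\<bar>" for s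
    have D1: "1 \<le> D s" for s using \<kappa> by (simp add: D_def)
    have [measurable]: "D \<in> borel_measurable borel" unfolding D_def[abs_def] by measurable
    have sD: "\<bar>s\<bar> \<le> D s / \<kappa>" "\<bar>s\<bar> \<le> D s" for s
    proof -
      show "\<bar>s\<bar> \<le> D s / \<kappa>" using \<kappa> by (simp add: D_def field_simps)
      have "1 * \<bar>s\<bar> \<le> \<kappa> * \<bar>s\<bar>" using \<kappa> by (intro mult_right_mono) auto
      then show "\<bar>s\<bar> \<le> D s" by (simp add: D_def)
    qed
    define w where "w s = 1 / (D s)\<^sup>2" for s
    have w: "integrable lborel w" "(\<integral>s. w s \<partial>lborel) = 2 / \<kappa>"
      using integral_inverse_square[of \<kappa>] \<kappa> by (simp_all add: w_def[abs_def] D_def)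
    have w0: "0 \<le> w s" for s by (simp add: w_def)
    have wI: "integrable lborel (\<lambda>s. c * w s)" "(\<integral>s. c * w s \<partial>lborel) = c * (2 / \<kappa>)" for c
      using w(1) by (rule integrable_mult_right) (simp add: w(2))
    define q where "q s = complex_of_real (sinc (\<kappa> * s)) ^ N" for s
    define g where "g s = bessel_kernel U \<alpha> s" for s
    have [measurable]: "q \<in> borel_measurable borel" "g \<in> borel_measurable borel"
      unfolding q_def[abs_def] g_def[abs_def] by measurable
    have qb: "norm (q s) \<le> 2 ^ N / D s ^ N" for s
      using sinc_decay[of "\<kappa> * s" N] \<kappa> by (simp add: q_def norm_power D_def abs_mult)
    have gb: "norm (g s) \<le> 432" for s
      unfolding g_def by (rule order_trans[OF bessel_norm_le bessel_mass_bounds(1)])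
    have qgb: "norm (q s * g s) \<le> 432 * 2 ^ N / D s ^ N" for s
    proof -
      have "0 \<le> 2 ^ N / D s ^ N" using D1[of s] by simp
      from mult_mono[OF qb[of s] gb[of s] this] show ?thesis by (simp add: norm_mult mult.commute)
    qed
    define I where "I = {-S..S}"
    have [measurable]: "I \<in> sets borel" by (simp add: I_def)
    have qi: "integrable lborel (\<lambda>s. q s * g s)"
    proof (rule Bochner_Integration.integrable_bound[OF wI(1)[of "432 * 2 ^ N"]])
      have "norm (q s * g s) \<le> norm (432 * 2 ^ N * w s)" for s
      proof -
        have "D s ^ 0 / D s ^ N \<le> 1 / (D s)\<^sup>2" by (rule power_quotient_le[OF D1]) (simp add: N_def)
        then have "432 * 2 ^ N * (1 / D s ^ N) \<le> 432 * 2 ^ N * w s" unfolding w_def by (intro mult_left_mono) auto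
        then show ?thesis using qgb[of s] w0[of s] by (simp add: abs_mult)
      qed
      then show "AE s in lborel. norm (q s * g s) \<le> norm (432 * 2 ^ N * w s)" by simp
    qed measurable
    \<comment> \<open>\<open>Z\<close> is compared with the mass of \<open>sinc ^ N\<close> times \<open>bessel_mass U\<close>; the choice of \<open>A\<close> makes the error at most half of it.\<close>
    define Z where "Z = (\<integral>s. indicator I s *\<^sub>R (q s * g s) \<partial>lborel)"
    have Z: "c0 / (2 ^ N * \<kappa>) \<le> norm Z"
    proof -
      define qr where "qr s = indicator I s * sinc (\<kappa> * s) ^ N" for s
      have qr0: "0 \<le> qr s" for s by (auto simp: qr_def indicator_def N_def intro!: zero_le_even_power)
      have [measurable]: "qr \<in> borel_measurable borel" unfolding qr_def[abs_def] by measurable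
      have qrI: "integrable lborel qr"
      proof (rule Bochner_Integration.integrable_bound[OF wI(1)[of "2 ^ N"]])
        have "norm (qr s) \<le> norm (2 ^ N * w s)" for s
        proof -
          have "D s ^ 0 / D s ^ N \<le> 1 / (D s)\<^sup>2" by (rule power_quotient_le[OF D1]) (simp add: N_def)
          then have "2 ^ N * (1 / D s ^ N) \<le> 2 ^ N * w s" unfolding w_def by (intro mult_left_mono) auto
          then show ?thesis using qb[of s] w0[of s] by (simp add: abs_mult qr_def q_def norm_power power_abs indicator_def)
        qed
        then show "AE s in lborel. norm (qr s) \<le> norm (2 ^ N * w s)" by simp
      qed measurable
      have mass: "2 / (2 ^ N * \<kappa>) \<le> (\<integral>s. qr s \<partial>lborel)"
      proof -
        have "(\<integral>s. indicator {- (1 / \<kappa>)..1 / \<kappa>} s *\<^sub>R (1 / 2 ^ N) \<partial>lborel) \<le> (\<integral>s. qr s \<partial>lborel)"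
        proof (rule integral_mono[OF _ qrI])
          show "integrable lborel (\<lambda>s. indicator {- (1 / \<kappa>)..1 / \<kappa>} s *\<^sub>R (1 / 2 ^ N :: real))"
            by (rule borel_integrable_compact) auto
          show "indicator {- (1 / \<kappa>)..1 / \<kappa>} s *\<^sub>R (1 / 2 ^ N) \<le> qr s" for s
          proof (cases "s \<in> {- (1 / \<kappa>)..1 / \<kappa>}")
            case True
            then have "\<bar>s\<bar> \<le> 1 / \<kappa>" by auto
            then have s1: "\<bar>\<kappa> * s\<bar> \<le> 1" using \<kappa> by (simp add: abs_mult field_simps)
            have "1 / \<kappa> \<le> 1" using \<kappa> by simp
            then have "1 / \<kappa> \<le> S" using S(1) by linarith
            then have "s \<in> I" using True by (auto simp: I_def)
            moreover have "(1 / 2) ^ N \<le> sinc (\<kappa> * s) ^ N" by (intro power_mono sinc_lower s1) simp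
            ultimately show ?thesis using True by (simp add: qr_def power_divide)
          qed (simp add: qr0)
        qed
        then show ?thesis using \<kappa> by (simp add: field_simps)
      qed
      have gm: "norm (g s - complex_of_real (bessel_mass U)) \<le> 432 * \<bar>s\<bar> / \<alpha>" for s
        unfolding g_def by (rule bessel_near_mass[OF \<alpha>(1)])
      have zi: "integrable lborel (\<lambda>s. indicator I s *\<^sub>R (q s * g s))"
        using qi by (intro integrable_mult_indicator) auto
      have zi2: "integrable lborel (\<lambda>s. complex_of_real (qr s) * complex_of_real (bessel_mass U))"
        using qrI by simp
      have "Z - complex_of_real (\<integral>s. qr s \<partial>lborel) * complex_of_real (bessel_mass U)
          = (\<integral>s. indicator I s *\<^sub>R (q s * g s) - complex_of_real (qr s) * complex_of_real (bessel_mass U) \<partial>lborel)"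
        unfolding Z_def Bochner_Integration.integral_diff[OF zi zi2] by simp
      also have "norm \<dots> \<le> (\<integral>s. norm (indicator I s *\<^sub>R (q s * g s) - complex_of_real (qr s) * complex_of_real (bessel_mass U)) \<partial>lborel)"
        by (rule integral_norm_bound)
      also have "\<dots> \<le> (\<integral>s. (432 * 2 ^ N / (\<alpha> * \<kappa>)) * w s \<partial>lborel)"
      proof (rule integral_mono)
        show "integrable lborel (\<lambda>s. norm (indicator I s *\<^sub>R (q s * g s) - complex_of_real (qr s) * complex_of_real (bessel_mass U)))"
          by (intro integrable_norm Bochner_Integration.integrable_diff zi zi2)
        show "integrable lborel (\<lambda>s. (432 * 2 ^ N / (\<alpha> * \<kappa>)) * w s)" by (rule wI)
        show "norm (indicator I s *\<^sub>R (q s * g s) - complex_of_real (qr s) * complex_of_real (bessel_mass U)) \<le> (432 * 2 ^ N / (\<alpha> * \<kappa>)) * w s" for s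
        proof -
          have "indicator I s *\<^sub>R (q s * g s) - complex_of_real (qr s) * complex_of_real (bessel_mass U)
              = indicator I s *\<^sub>R (q s * (g s - complex_of_real (bessel_mass U)))"
            by (simp add: qr_def q_def scaleR_conv_of_real algebra_simps)
          also have "norm \<dots> \<le> norm (q s) * norm (g s - complex_of_real (bessel_mass U))"
            by (auto simp: indicator_def norm_mult)
          also have "\<dots> \<le> (2 ^ N / D s ^ N) * (432 * (D s / \<kappa>) / \<alpha>)"
            using sD(1)[of s] \<alpha> D1[of s] by (intro mult_mono qb order_trans[OF gm] divide_right_mono mult_left_mono) auto
          also have "\<dots> = (432 * 2 ^ N / (\<alpha> * \<kappa>)) * (D s ^ 1 / D s ^ N)" by (simp add: mult_ac)
          also have "\<dots> \<le> (432 * 2 ^ N / (\<alpha> * \<kappa>)) * w s"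
            unfolding w_def using \<alpha> \<kappa> by (intro mult_left_mono power_quotient_le D1) (auto simp: N_def)
          finally show ?thesis .
        qed
      qed
      also have "\<dots> = (2 * 432 * 2 ^ N / \<kappa>) * (1 / (\<alpha> * \<kappa>))" by (simp add: w(2))
      also have "\<dots> \<le> (2 * 432 * 2 ^ N / \<kappa>) * (1 / A)"
        using \<alpha> \<kappa> c0 by (intro mult_left_mono divide_left_mono) (auto simp: A_def)
      also have "\<dots> = c0 / (2 ^ N * \<kappa>)" using \<kappa> c0 by (simp add: A_def field_simps)
      finally have 1: "norm (Z - complex_of_real (\<integral>s. qr s \<partial>lborel) * complex_of_real (bessel_mass U)) \<le> c0 / (2 ^ N * \<kappa>)" .
      have "2 * (c0 / (2 ^ N * \<kappa>)) = 2 / (2 ^ N * \<kappa>) * c0" by simp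
      also have "\<dots> \<le> (\<integral>s. qr s \<partial>lborel) * bessel_mass U"
        using mass bessel_mass_bounds(5)[OF U] c0 \<kappa> by (intro mult_mono) (auto simp: c0_def intro!: Bochner_Integration.integral_nonneg qr0)
      also have "\<dots> = norm (complex_of_real (\<integral>s. qr s \<partial>lborel) * complex_of_real (bessel_mass U))"
        using bessel_mass_bounds(2)[of U] Bochner_Integration.integral_nonneg[of lborel qr] qr0
        by (simp only: norm_mult norm_of_real) (simp add: abs_mult)
      finally show ?thesis
        using 1 norm_triangle_ineq3[of Z "complex_of_real (\<integral>s. qr s \<partial>lborel) * complex_of_real (bessel_mass U)"] by linarith
    qed
    have growth: "norm (f (t - real l * s)) \<le> Cf * (1 + t + real m * \<bar>s\<bar>) ^ m" if "l \<le> m" for l s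
    proof (cases "t - real l * s < 0")
      case False
      have "\<bar>real l * s\<bar> \<le> real m * \<bar>s\<bar>" using that by (simp add: abs_mult mult_right_mono)
      then have "1 + (t - real l * s) \<le> 1 + t + real m * \<bar>s\<bar>" by linarith
      then have "(1 + (t - real l * s)) ^ m \<le> (1 + t + real m * \<bar>s\<bar>) ^ m" using False by (intro power_mono) auto
      then show ?thesis using fb False Cf by (meson mult_left_mono not_less order_trans)
    qed (use f0 Cf t0 in auto)
    have kfi: "integrable lborel (\<lambda>s. q s * g s * f (t - real l * s))" if l: "l \<le> m" for l
    proof (rule Bochner_Integration.integrable_bound[OF wI(1)[of "432 * 2 ^ N * (Cf * (1 + t + real m) ^ m)"]])
      have "norm (q s * g s * f (t - real l * s)) \<le> norm (432 * 2 ^ N * (Cf * (1 + t + real m) ^ m) * w s)" for s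
      proof -
        have "1 + t + real m * \<bar>s\<bar> \<le> (1 + t) * D s + real m * D s"
          using sD(2)[of s] D1[of s] t0 by (intro add_mono mult_left_mono) auto
        then have "1 + t + real m * \<bar>s\<bar> \<le> (1 + t + real m) * D s" by (simp add: algebra_simps)
        then have "(1 + t + real m * \<bar>s\<bar>) ^ m \<le> ((1 + t + real m) * D s) ^ m" using t0 by (intro power_mono) auto
        then have "norm (f (t - real l * s)) \<le> Cf * ((1 + t + real m) * D s) ^ m"
          using growth[OF l, of s] Cf by (meson mult_left_mono order_trans)
        then have "norm (q s * g s * f (t - real l * s)) \<le> (432 * 2 ^ N / D s ^ N) * (Cf * ((1 + t + real m) * D s) ^ m)"
          unfolding norm_mult[of "q s * g s"] using qgb[of s] D1[of s] by (intro mult_mono) auto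
        also have "\<dots> = 432 * 2 ^ N * (Cf * (1 + t + real m) ^ m) * (D s ^ m / D s ^ N)"
          by (simp add: power_mult_distrib)
        also have "\<dots> \<le> 432 * 2 ^ N * (Cf * (1 + t + real m) ^ m) * w s"
          unfolding w_def using Cf t0 by (intro mult_left_mono power_quotient_le D1) (auto simp: N_def m_def)
        finally show ?thesis using w0[of s] by simp
      qed
      then show "AE s in lborel. norm (q s * g s * f (t - real l * s)) \<le> norm (432 * 2 ^ N * (Cf * (1 + t + real m) ^ m) * w s)" by simp
    qed measurable
    have kfiI: "integrable lborel (\<lambda>s. indicator I s *\<^sub>R (q s * g s * f (t - real l * s)))" if "l \<le> m" for l
      using kfi[OF that] by (intro integrable_mult_indicator) auto
    \<comment> \<open>The term \<open>l = 0\<close> of the difference, with coefficient 1, isolates \<open>f t\<close>.\<close>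
    define H where "H = (\<integral>s. indicator I s *\<^sub>R (q s * g s * nabla m s f t) \<partial>lborel)"
    have Hdecomp: "indicator I s *\<^sub>R (q s * g s * nabla m s f t)
        = (\<Sum>l\<le>m. a l *\<^sub>R (indicator I s *\<^sub>R (q s * g s * f (t - real l * s))))" for s
      unfolding a by (simp add: sum_distrib_left scaleR_sum_right mult.commute[of "indicator I s"])
    have Hi: "integrable lborel (\<lambda>s. indicator I s *\<^sub>R (q s * g s * nabla m s f t))"
      unfolding Hdecomp using kfiI by (intro Bochner_Integration.integrable_sum integrable_scaleR_right) auto
    define T where "T l = (\<integral>s. indicator I s *\<^sub>R (q s * g s * f (t - real l * s)) \<partial>lborel)" for l
    have "H = (\<Sum>l\<le>m. (\<integral>s. a l *\<^sub>R (indicator I s *\<^sub>R (q s * g s * f (t - real l * s))) \<partial>lborel))"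
      unfolding H_def Hdecomp by (rule Bochner_Integration.integral_sum) (use kfiI in \<open>auto intro!: integrable_scaleR_right simp del: scaleR_scaleR\<close>)
    also have "\<dots> = (\<Sum>l\<le>m. a l *\<^sub>R T l)"
      by (simp only: T_def integral_scaleR_right)
    also have "\<dots> = T 0 + (\<Sum>l\<in>{1..m}. a l *\<^sub>R T l)"
    proof -
      have "{..m} = insert 0 {1..m}" by auto
      then have "(\<Sum>l\<le>m. a l *\<^sub>R T l) = a 0 *\<^sub>R T 0 + (\<Sum>l\<in>{1..m}. a l *\<^sub>R T l)" by (simp only: sum.insert finite_atLeastAtMost) simp
      then show ?thesis using a0 by simp
    qed
    also have "T 0 = Z * f t"
    proof -
      have "T 0 = (\<integral>s. indicator I s *\<^sub>R (q s * g s) * f t \<partial>lborel)" by (simp add: T_def)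
      then show ?thesis unfolding Z_def by (simp only: integral_mult_left_zero)
    qed
    finally have key: "Z * f t = H - (\<Sum>l\<in>{1..m}. a l *\<^sub>R T l)" by simp
    have Hb: "norm H \<le> Q * J / \<kappa> ^ m"
    proof -
      have "norm H \<le> (\<integral>s. norm (indicator I s *\<^sub>R (q s * g s * nabla m s f t)) \<partial>lborel)"
        unfolding H_def by (rule integral_norm_bound)
      also have "\<dots> \<le> (\<integral>s. (432 * 2 ^ N * J / \<kappa> ^ k) * w s \<partial>lborel)"
      proof (rule integral_mono[OF integrable_norm[OF Hi] wI(1)])
        show "norm (indicator I s *\<^sub>R (q s * g s * nabla m s f t)) \<le> (432 * 2 ^ N * J / \<kappa> ^ k) * w s" for s
        proof (cases "s \<in> I")
          case True
          then have "real m * \<bar>s\<bar> \<le> real m * S" by (intro mult_left_mono) (auto simp: I_def)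
          then have "real m * \<bar>s\<bar> \<le> t / 2" using S by simp
          then have n: "norm (nabla m s f t) \<le> \<bar>s\<bar> ^ k * ((D s)\<^sup>2 * J)" using nab by (simp add: D_def)
          also have "\<dots> \<le> (D s / \<kappa>) ^ k * ((D s)\<^sup>2 * J)"
            using sD(1)[of s] J by (intro mult_right_mono power_mono) auto
          finally have "norm (q s * g s * nabla m s f t) \<le> (432 * 2 ^ N / D s ^ N) * ((D s / \<kappa>) ^ k * ((D s)\<^sup>2 * J))"
            unfolding norm_mult[of "q s * g s"] using qgb[of s] D1[of s] by (intro mult_mono) auto
          also have "\<dots> = (432 * 2 ^ N * J / \<kappa> ^ k) * (D s ^ (k + 2) / D s ^ N)"
            by (simp add: power_divide power_add power2_eq_square mult_ac)
          also have "\<dots> \<le> (432 * 2 ^ N * J / \<kappa> ^ k) * w s"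
            unfolding w_def using J \<kappa> by (intro mult_left_mono power_quotient_le D1) (auto simp: N_def)
          finally show ?thesis using True by simp
        next
          case False
          then show ?thesis using J \<kappa> w0[of s] by simp
        qed
      qed
      also have "\<dots> = Q * J / \<kappa> ^ m" by (simp add: w(2) Q_def m_def)
      finally show ?thesis .
    qed
    have Tb: "norm (T l) \<le> B + (Q * (8 * real m) ^ m * (2 * real m) ^ (m + 2)) * (Cf / (\<kappa> ^ Suc m * t\<^sup>2))" if l: "l \<in> {1..m}" for l
    proof -
      have lm: "l \<le> m" "l > 0" using l by auto
      define full where "full = (\<integral>s. q s * g s * f (t - real l * s) \<partial>lborel)"
      have ci: "integrable lborel (\<lambda>s. indicator (- I) s *\<^sub>R (q s * g s * f (t - real l * s)))"
        using kfi[OF lm(1)] by (intro integrable_mult_indicator) auto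
      have "full = (\<integral>s. indicator I s *\<^sub>R (q s * g s * f (t - real l * s)) + indicator (- I) s *\<^sub>R (q s * g s * f (t - real l * s)) \<partial>lborel)"
        unfolding full_def by (intro Bochner_Integration.integral_cong) (auto simp: indicator_def)
      also have "\<dots> = T l + (\<integral>s. indicator (- I) s *\<^sub>R (q s * g s * f (t - real l * s)) \<partial>lborel)"
        unfolding T_def by (rule Bochner_Integration.integral_add[OF kfiI[OF lm(1)] ci])
      finally have Tl: "T l = full - (\<integral>s. indicator (- I) s *\<^sub>R (q s * g s * f (t - real l * s)) \<partial>lborel)" by simp
      have "full = (\<integral>r. f r * (complex_of_real (sinc (\<kappa> / real l * (t - r))) ^ N * bessel_kernel U (real l * \<alpha>) (t - r)) \<partial>lborel) / of_nat l"
      proof -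
        have "(\<integral>r. f r * (complex_of_real (sinc (\<kappa> / real l * (t - r))) ^ N * bessel_kernel U (real l * \<alpha>) (t - r)) \<partial>lborel)
            = \<bar>- real l\<bar> *\<^sub>R (\<integral>s. f (t + (- real l) * s) * (complex_of_real (sinc (\<kappa> / real l * (t - (t + (- real l) * s)))) ^ N
                * bessel_kernel U (real l * \<alpha>) (t - (t + (- real l) * s))) \<partial>lborel)"
          by (rule lborel_integral_real_affine) (use lm in simp)
        also have "(\<lambda>s. f (t + (- real l) * s) * (complex_of_real (sinc (\<kappa> / real l * (t - (t + (- real l) * s)))) ^ N
                * bessel_kernel U (real l * \<alpha>) (t - (t + (- real l) * s)))) = (\<lambda>s. q s * g s * f (t - real l * s))"
          using lm by (auto simp: q_def g_def bessel_kernel_def fun_eq_iff field_simps)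
        finally show ?thesis using lm by (simp add: full_def scaleR_conv_of_real)
      qed
      then have fullb: "norm full \<le> B"
      proof -
        assume e: "full = (\<integral>r. f r * (complex_of_real (sinc (\<kappa> / real l * (t - r))) ^ N * bessel_kernel U (real l * \<alpha>) (t - r)) \<partial>lborel) / of_nat l"
        have "norm full \<le> norm (\<integral>r. f r * (complex_of_real (sinc (\<kappa> / real l * (t - r))) ^ N * bessel_kernel U (real l * \<alpha>) (t - r)) \<partial>lborel) / 1"
          unfolding e norm_divide norm_of_nat using lm by (intro divide_left_mono) auto
        then show ?thesis using low l by force
      qed
      have "norm (\<integral>s. indicator (- I) s *\<^sub>R (q s * g s * f (t - real l * s)) \<partial>lborel)
          \<le> (\<integral>s. norm (indicator (- I) s *\<^sub>R (q s * g s * f (t - real l * s))) \<partial>lborel)"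
        by (rule integral_norm_bound)
      also have "\<dots> \<le> (\<integral>s. (432 * 2 ^ N * Cf * (8 * real m) ^ m * (1 / (\<kappa> * S) ^ (m + 2))) * w s \<partial>lborel)"
      proof (rule integral_mono[OF integrable_norm[OF ci] wI(1)])
        show "norm (indicator (- I) s *\<^sub>R (q s * g s * f (t - real l * s)))
            \<le> (432 * 2 ^ N * Cf * (8 * real m) ^ m * (1 / (\<kappa> * S) ^ (m + 2))) * w s" for s
        proof (cases "s \<in> I")
          case False
          then have s: "S < \<bar>s\<bar>" by (auto simp: I_def)
          have mS: "real m * S \<le> real m * \<bar>s\<bar>" using s m1 by (intro mult_left_mono) auto
          have "1 \<le> real m * \<bar>s\<bar>" using m1 s S(1) mult_mono[of 1 "real m" 1 "\<bar>s\<bar>"] by simp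
          then have "1 + t + real m * \<bar>s\<bar> \<le> 8 * real m * \<bar>s\<bar>" using mS S(2) by linarith
          also have "\<dots> \<le> 8 * real m * D s" using sD(2)[of s] m1 by (intro mult_left_mono) auto
          finally have "(1 + t + real m * \<bar>s\<bar>) ^ m \<le> (8 * real m * D s) ^ m" using t0 by (intro power_mono) auto
          then have "norm (f (t - real l * s)) \<le> Cf * (8 * real m * D s) ^ m"
            using growth[OF lm(1), of s] Cf by (meson mult_left_mono order_trans)
          then have "norm (q s * g s * f (t - real l * s)) \<le> (432 * 2 ^ N / D s ^ N) * (Cf * (8 * real m * D s) ^ m)"
            unfolding norm_mult[of "q s * g s"] using qgb[of s] D1[of s] by (intro mult_mono) auto
          also have "\<dots> = 432 * 2 ^ N * Cf * (8 * real m) ^ m * (D s ^ m / D s ^ N)"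
            by (simp add: power_mult_distrib)
          also have "\<dots> \<le> 432 * 2 ^ N * Cf * (8 * real m) ^ m * (1 / D s ^ (m + 4))"
            using Cf by (intro mult_left_mono power_quotient_le D1) (auto simp: N_def m_def)
          also have "1 / D s ^ (m + 4) = (1 / D s ^ (m + 2)) * w s"
            unfolding w_def by (simp add: power_add[symmetric] numeral_eq_Suc)
          also have "432 * 2 ^ N * Cf * (8 * real m) ^ m * ((1 / D s ^ (m + 2)) * w s)
              \<le> 432 * 2 ^ N * Cf * (8 * real m) ^ m * ((1 / (\<kappa> * S) ^ (m + 2)) * w s)"
          proof (intro mult_left_mono mult_right_mono w0 divide_left_mono power_mono)
            have "\<kappa> * S \<le> \<kappa> * \<bar>s\<bar>" using s \<kappa> by (intro mult_left_mono) auto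
            then show "\<kappa> * S \<le> D s" by (simp add: D_def)
            show "0 < D s ^ (m + 2) * (\<kappa> * S) ^ (m + 2)"
              using D1[of s] \<kappa> S(1) by (intro mult_pos_pos zero_less_power) auto
          qed (use Cf \<kappa> S(1) in auto)
          finally show ?thesis using False by (simp add: mult_ac)
        next
          case True
          then show ?thesis using w0[of s] Cf \<kappa> S(1) by simp
        qed
      qed
      also have "\<dots> = Q * (8 * real m) ^ m * Cf * (1 / (\<kappa> * (\<kappa> * S) ^ (m + 2)))"
        by (simp add: w(2) Q_def mult_ac)
      also have "\<dots> \<le> Q * (8 * real m) ^ m * Cf * ((2 * real m) ^ (m + 2) / (\<kappa> ^ Suc m * t\<^sup>2))"
      proof (rule mult_left_mono)
        have "\<kappa> ^ Suc m * t\<^sup>2 = \<kappa> ^ Suc m * S\<^sup>2 * (2 * real m)\<^sup>2" by (simp add: S(2) power_mult_distrib)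
        also have "\<dots> \<le> (\<kappa> ^ Suc m * \<kappa>\<^sup>2) * (S\<^sup>2 * S ^ m) * ((2 * real m)\<^sup>2 * (2 * real m) ^ m)"
        proof (intro mult_mono)
          show "\<kappa> ^ Suc m \<le> \<kappa> ^ Suc m * \<kappa>\<^sup>2" using \<kappa> by simp
          show "S\<^sup>2 \<le> S\<^sup>2 * S ^ m" using S(1) by simp
          have "1 \<le> (2 * real m) ^ m" using m1 by (intro one_le_power) auto
          then show "(2 * real m)\<^sup>2 \<le> (2 * real m)\<^sup>2 * (2 * real m) ^ m" using mult_left_mono[of 1 "(2 * real m) ^ m" "(2 * real m)\<^sup>2"] by simp
        qed (use \<kappa> S(1) in auto)
        also have "\<dots> = \<kappa> * (\<kappa> * S) ^ (m + 2) * (2 * real m) ^ (m + 2)"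
          by (simp add: power_mult_distrib power_add power2_eq_square mult_ac)
        finally show "1 / (\<kappa> * (\<kappa> * S) ^ (m + 2)) \<le> (2 * real m) ^ (m + 2) / (\<kappa> ^ Suc m * t\<^sup>2)"
          using \<kappa> S(1) t0 by (simp add: divide_simps mult_ac)
      qed (use Q0 Cf in auto)
      finally have "norm (\<integral>s. indicator (- I) s *\<^sub>R (q s * g s * f (t - real l * s)) \<partial>lborel)
          \<le> (Q * (8 * real m) ^ m * (2 * real m) ^ (m + 2)) * (Cf / (\<kappa> ^ Suc m * t\<^sup>2))" by (simp add: mult_ac)
      then show ?thesis unfolding Tl using fullb by (intro order_trans[OF norm_triangle_ineq4] add_mono)
    qed
    define E where "E = Q * (8 * real m) ^ m * (2 * real m) ^ (m + 2)"
    have E0: "0 \<le> E" using Q0 by (simp add: E_def)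
    have B0: "0 \<le> B"
    proof -
      have "1 \<in> {1..m}" by (simp add: m_def)
      from order_trans[OF norm_ge_zero low[rule_format, OF this]] show ?thesis .
    qed
    define Y where "Y = Cf / t\<^sup>2"
    have Y0: "0 \<le> Y" using Cf by (simp add: Y_def)
    have "norm (Z * f t) \<le> norm H + norm (\<Sum>l\<in>{1..m}. a l *\<^sub>R T l)" unfolding key by (rule norm_triangle_ineq4)
    also have "norm (\<Sum>l\<in>{1..m}. a l *\<^sub>R T l) \<le> (\<Sum>l\<in>{1..m}. \<bar>a l\<bar> * (B + E * (Y / \<kappa> ^ Suc m)))"
      using Tb by (intro sum_norm_le) (auto simp: E_def Y_def mult.commute intro!: mult_left_mono)
    also have "\<dots> = Sa * (B + E * (Y / \<kappa> ^ Suc m))" by (simp add: Sa_def sum_distrib_right)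
    finally have 1: "norm Z * norm (f t) \<le> Q * J / \<kappa> ^ m + Sa * (B + E * (Y / \<kappa> ^ Suc m))"
      using Hb by (simp add: norm_mult)
    have "c0 / (2 ^ N * \<kappa>) * norm (f t) \<le> norm Z * norm (f t)" using Z by (intro mult_right_mono) auto
    also note 1
    finally have "(2 ^ N / c0) * \<kappa> ^ Suc m * (c0 / (2 ^ N * \<kappa>) * norm (f t))
        \<le> (2 ^ N / c0) * \<kappa> ^ Suc m * (Q * J / \<kappa> ^ m + Sa * (B + E * (Y / \<kappa> ^ Suc m)))"
      using c0 \<kappa> by (intro mult_left_mono) auto
    also have "(2 ^ N / c0) * \<kappa> ^ Suc m * (c0 / (2 ^ N * \<kappa>) * norm (f t)) = \<kappa> ^ m * norm (f t)"
      using c0 \<kappa> by (simp add: field_simps)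
    also have "(2 ^ N / c0) * \<kappa> ^ Suc m * (Q * J / \<kappa> ^ m + Sa * (B + E * (Y / \<kappa> ^ Suc m)))
        = (2 ^ N / c0) * (Q * (\<kappa> * J) + Sa * (\<kappa> ^ Suc m * B) + Sa * E * Y)"
    proof -
      have gen: "c * p * (x + s * (b + e * y)) = c * (p * x + s * (p * b) + s * e * (p * y))" for c p x s b e y :: real
        by (simp add: algebra_simps)
      have e1: "\<kappa> ^ Suc m * (Q * J / \<kappa> ^ m) = Q * (\<kappa> * J)" using \<kappa> by simp
      have e2: "\<kappa> ^ Suc m * (Y / \<kappa> ^ Suc m) = Y" using \<kappa> by simp
      show ?thesis unfolding gen e1 e2 ..
    qed
    also have "\<dots> \<le> (2 ^ N / c0) * ((Q + Sa + Sa * E) * (\<kappa> * J) + (Q + Sa + Sa * E) * (\<kappa> ^ Suc m * B) + (Q + Sa + Sa * E) * Y)"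
      using c0 Q0 Sa0 E0 \<kappa> J B0 Y0 by (intro mult_left_mono add_mono mult_right_mono) auto
    also have "\<dots> = C * (\<kappa> * J + \<kappa> ^ Suc m * B + Y)"
    proof -
      have "c * (x * u + x * v + x * y) = c * x * (u + v + y)" for c x u v y :: real
        by (simp add: algebra_simps)
      then show ?thesis by (simp only: C_def E_def)
    qed
    finally show ?thesis unfolding Y_def .
  qed
  have "0 < A" using c0 by (simp add: A_def)
  moreover have "0 \<le> C" using c0 Q0 Sa0 unfolding C_def by (intro mult_nonneg_nonneg add_nonneg_nonneg) auto
  ultimately show ?thesis using main by blast
qed

section \<open>The weight and the choice of the scale\<close>

context
  fixes N :: "real \<Rightarrow> real"
  assumes cont: "continuous_on {0..} N" and mono: "mono_on {0..} N"
    and unbounded: "\<And>x. \<exists>s\<ge>1. x \<le> N s"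
begin

text \<open>
  The level set is nonempty by the intermediate value theorem and compact, so its supremum is attained.
\<close>

lemma right_inverse_props:
  assumes \<tau>: "N 1 \<le> \<tau>"
  shows "1 \<le> right_inverse N \<tau>" "N (right_inverse N \<tau>) = \<tau>"
    "\<And>s. 0 \<le> s \<Longrightarrow> N s = \<tau> \<Longrightarrow> s \<le> right_inverse N \<tau>"
proof -
  define V where "V = {s. 0 \<le> s \<and> N s = \<tau>}"
  obtain b where b: "1 \<le> b" "\<tau> + 1 \<le> N b" using unbounded by blast
  have ub: "s \<le> b" if "s \<in> V" for s
  proof (rule ccontr)
    assume "\<not> s \<le> b"
    then have "N b \<le> N s" using b that by (intro mono_onD[OF mono]) (auto simp: V_def)
    then show False using b that by (simp add: V_def)
  qed
  have "\<exists>x\<ge>1. x \<le> b \<and> N x = \<tau>"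
    using b \<tau> by (intro IVT') (auto intro: continuous_on_subset[OF cont])
  then obtain x where x: "1 \<le> x" "x \<in> V" by (auto simp: V_def)
  have bdd: "bdd_above V" using ub by (rule bdd_aboveI)
  have "closed ({0..} \<inter> N -` {\<tau>})"
    using continuous_closed_preimage[OF cont, of "{\<tau>}"] by simp
  moreover have "V = {0..} \<inter> N -` {\<tau>}" by (auto simp: V_def)
  ultimately have "closed V" by simp
  then have "Sup V \<in> V" using x bdd by (intro closed_contains_Sup) auto
  moreover have "right_inverse N \<tau> = Sup V" by (simp add: right_inverse_def V_def)
  moreover have "1 \<le> Sup V" using cSup_upper[OF x(2) bdd] x(1) by linarith
  ultimately show "1 \<le> right_inverse N \<tau>" "N (right_inverse N \<tau>) = \<tau>"
      "\<And>s. 0 \<le> s \<Longrightarrow> N s = \<tau> \<Longrightarrow> s \<le> right_inverse N \<tau>"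
    using cSup_upper[OF _ bdd] by (auto simp: V_def)
qed

lemma weight_ge_1: "1 \<le> weight N \<tau>"
  using right_inverse_props(1) by (simp add: weight_def)

lemma weight_mono: "\<tau> \<le> \<tau>' \<Longrightarrow> weight N \<tau> \<le> weight N \<tau>'"
proof (cases "N 1 \<le> \<tau>")
  case True
  assume le: "\<tau> \<le> \<tau>'"
  have T': "N 1 \<le> \<tau>'" using True le by simp
  show ?thesis
  proof (rule ccontr)
    assume "\<not> ?thesis"
    then have lt: "right_inverse N \<tau>' < right_inverse N \<tau>" using True T' by (simp add: weight_def)
    then have "N (right_inverse N \<tau>') \<le> N (right_inverse N \<tau>)"
      using right_inverse_props(1)[OF T'] by (intro mono_onD[OF mono]) auto
    then have "N (right_inverse N \<tau>) = \<tau>'"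
      using right_inverse_props(2)[OF T'] right_inverse_props(2)[OF True] le by simp
    then show False
      using right_inverse_props(3)[OF T', of "right_inverse N \<tau>"] right_inverse_props(1)[OF True] lt by simp
  qed
qed (use weight_ge_1 in \<open>simp add: weight_def\<close>)

lemma weight_ge: "1 \<le> R \<Longrightarrow> N R \<le> \<tau> \<Longrightarrow> R \<le> weight N \<tau>"
proof -
  assume R: "1 \<le> R" "N R \<le> \<tau>"
  have N1: "N 1 \<le> N R" using R by (intro mono_onD[OF mono]) auto
  have "R \<le> weight N (N R)" using right_inverse_props(3)[OF N1, of R] N1 R by (simp add: weight_def)
  then show ?thesis using weight_mono[OF R(2)] by simp
qed

end

text \<open>
  A power of \<open>x\<close> below 1 is eventually smaller than \<open>x / 8\<close>. This is the only place where the
  exponent \<open>1 - \<epsilon>\<close> of the growth condition on \<open>K\<close> enters: it makes \<open>ln K\<close> negligible against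
  \<open>cosh (s M s / 4)\<close>.
\<close>

lemma double_exp_dominates:
  fixes \<delta> a L :: real
  assumes "0 < \<delta>" "\<delta> < 1"
  shows "eventually (\<lambda>x. L * (a + exp (x powr \<delta>)) \<le> cosh (x / 4) / 2) at_top"
proof -
  have 1: "eventually (\<lambda>x::real. x powr \<delta> \<le> x / 8) at_top"
    using assms by real_asymp
  have 2: "eventually (\<lambda>x::real. \<bar>L\<bar> * (\<bar>a\<bar> + exp (x / 8)) \<le> exp (x / 4) / 4) at_top"
    by real_asymp
  show ?thesis using 1 2
  proof eventually_elim
    case (elim x)
    have "L * (a + exp (x powr \<delta>)) \<le> \<bar>L\<bar> * \<bar>a + exp (x powr \<delta>)\<bar>"
      by (metis abs_ge_self abs_mult)
    also have "\<dots> \<le> \<bar>L\<bar> * (\<bar>a\<bar> + exp (x / 8))"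
    proof (rule mult_left_mono)
      have "exp (x powr \<delta>) \<le> exp (x / 8)" using elim(1) by simp
      then show "\<bar>a + exp (x powr \<delta>)\<bar> \<le> \<bar>a\<bar> + exp (x / 8)"
        using abs_triangle_ineq[of a "exp (x powr \<delta>)"] abs_of_nonneg[OF exp_ge_zero[of "x powr \<delta>"]] by linarith
    qed simp
    also have "\<dots> \<le> exp (x / 4) / 4" by (rule elim)
    also have "\<dots> \<le> cosh (x / 4) / 2" by (simp add: cosh_def)
    finally show ?case .
  qed
qed

text \<open>
  With \<open>R\<close> the weight at \<open>c1 2 ^ (n + 1)\<close> one has \<open>M R ln (K R) = c1 2 ^ (n + 1)\<close>, which is comparable
  to \<open>t\<close>. For \<open>c1 = 1 / (4 m L)\<close> this gives \<open>exp (- t / (2 m M R)) \<le> K R powr (- L)\<close>, and the growth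
  condition on \<open>K\<close> gives the same bound for \<open>exp (- cosh (R M R / 4) / 2)\<close>. The choice
  \<open>L = m + 8\<close> leaves four powers of \<open>K R\<close> after absorbing \<open>R ^ (m + 1)\<close>, \<open>K R\<close> and
  \<open>R M R \<le> (K R)\<^sup>2\<close>; these four pay for \<open>1 / t\<^sup>2\<close> since \<open>c1 t \<le> M R ln (K R) \<le> (K R)\<^sup>2\<close>.
  The scale is taken constant on dyadic blocks of \<open>t\<close> so that the averages built from it are easy to
  handle in \<open>L\<^sup>p\<close>.
\<close>

lemma scale_selection:
  fixes M K :: "real \<Rightarrow> real" and m N :: nat and A :: real
  assumes M: "continuous_on {0..} M" "mono_on {0..} M" "\<forall>s\<ge>0. M s \<ge> 2"
    and K: "continuous_on {0..} K" "mono_on {0..} K" "\<forall>s\<ge>0. K s \<ge> 2"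
    and KM: "\<forall>s>1. K s \<ge> max s (M s)"
    and dexp: "\<exists>\<epsilon>. 0 < \<epsilon> \<and> \<epsilon> < 1 \<and> K \<in> O[at_top](\<lambda>s. exp (exp ((s * M s) powr (1 - \<epsilon>))))"
    and m: "1 \<le> m" and N: "1 \<le> N"
  shows "\<exists>c1 n0. 0 < c1 \<and> (\<forall>n t R. n0 \<le> n \<longrightarrow> 2 ^ n \<le> t \<longrightarrow> t < 2 ^ Suc n \<longrightarrow> R = weight (M_log M K) (c1 * 2 ^ Suc n) \<longrightarrow>
      1 < R \<and> 1 \<le> R / (4 * real N) \<and> 1 \<le> R * M R / 4 \<and> A \<le> 2 * M R * (R / (4 * real N)) \<and> 2 * real m \<le> t \<and>
      weight (M_log M K) (c1 * t) \<le> R \<and>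
      (\<forall>l\<in>{1..m}. (R / (4 * real N)) ^ Suc m * (4 * K R * ((R * M R / 4) * exp (- t / (real l * (2 * M R))) + exp (- cosh (R * M R / 4) / 2)))
        \<le> (8 / c1\<^sup>2) / t\<^sup>2))"
    and "continuous_on {0..} (M_log M K)" "mono_on {0..} (M_log M K)" "\<And>x. \<exists>s\<ge>1. x \<le> M_log M K s"
proof -
  define NK where "NK = M_log M K"
  have K0: "0 < K s" if "0 \<le> s" for s using K(3) that by force
  have lnK: "0 \<le> ln (K s)" if "0 \<le> s" for s using K(3) that by (intro ln_ge_zero) force
  show NKc: "continuous_on {0..} (M_log M K)"
    unfolding M_log_def[abs_def] using K0 by (intro continuous_intros M K) force
  show NKm: "mono_on {0..} (M_log M K)"
  proof (rule mono_onI)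
    fix r s :: real assume rs: "r \<in> {0..}" "s \<in> {0..}" "r \<le> s"
    have "M r \<le> M s" "K r \<le> K s" using rs by (auto intro: mono_onD[OF M(2)] mono_onD[OF K(2)])
    moreover have "0 \<le> M s" using M(3)[rule_format, of s] rs by auto
    ultimately show "M_log M K r \<le> M_log M K s"
      unfolding M_log_def using K0[of r] lnK[of r] rs by (intro mult_mono) auto
  qed
  have NKlow: "2 * ln s \<le> M_log M K s" if "1 < s" for s
  proof -
    have "ln s \<le> ln (K s)" using KM that by (simp add: K0)
    moreover have "2 \<le> M s" using M(3) that by simp
    ultimately show ?thesis unfolding M_log_def using that by (intro mult_mono) auto
  qed
  show unb: "\<exists>s\<ge>1. x \<le> M_log M K s" for x
  proof -
    have "1 < exp (\<bar>x\<bar> + 1)" by simp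
    from NKlow[OF this] show ?thesis by (intro exI[of _ "exp (\<bar>x\<bar> + 1)"]) auto
  qed
  note W = weight_ge_1[OF NKc NKm unb] weight_mono[OF NKc NKm unb] weight_ge[OF NKc NKm unb] right_inverse_props[OF NKc NKm unb]
  \<comment> \<open>The powers of \<open>K R\<close> to be beaten are \<open>m + 1\<close> from \<open>\<kappa>\<close>, 1 from the bound of the transform, 2 from \<open>R M R / 4\<close> and 4 from \<open>t\<^sup>2\<close>.\<close>
  define L where "L = m + 8"
  define c1 where "c1 = 1 / (4 * real m * real L)"
  have c1: "0 < c1" using m by (simp add: c1_def L_def)
  obtain \<epsilon> where \<epsilon>: "0 < \<epsilon>" "\<epsilon> < 1" "K \<in> O[at_top](\<lambda>s. exp (exp ((s * M s) powr (1 - \<epsilon>))))" using dexp by blast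
  obtain c where c: "0 < c" "eventually (\<lambda>s. norm (K s) \<le> c * norm (exp (exp ((s * M s) powr (1 - \<epsilon>))))) at_top"
    using landau_o.bigE[OF \<epsilon>(3)] by blast
  have RM: "filterlim (\<lambda>s. s * M s) at_top at_top"
  proof (rule filterlim_at_top_mono)
    show "filterlim (\<lambda>s::real. s * 2) at_top at_top" by real_asymp
    show "eventually (\<lambda>s. s * 2 \<le> s * M s) at_top"
      using eventually_ge_at_top[of 0] by eventually_elim (use M(3) in \<open>auto intro: mult_left_mono\<close>)
  qed
  have "eventually (\<lambda>x. real L * (ln c + exp (x powr (1 - \<epsilon>))) \<le> cosh (x / 4) / 2) at_top"
    using \<epsilon> by (intro double_exp_dominates) auto
  then have e1: "eventually (\<lambda>s. real L * (ln c + exp ((s * M s) powr (1 - \<epsilon>))) \<le> cosh (s * M s / 4) / 2) at_top"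
    using RM by (rule eventually_compose_filterlim)
  have "eventually (\<lambda>s. real L * ln (K s) \<le> cosh (s * M s / 4) / 2 \<and> 2 \<le> s \<and> 4 * real N \<le> s \<and> A * real N \<le> s) at_top"
    using e1 c(2) eventually_ge_at_top[of 2] eventually_ge_at_top[of "4 * real N"] eventually_ge_at_top[of "A * real N"]
  proof eventually_elim
    case (elim s)
    have "ln (K s) \<le> ln (c * exp (exp ((s * M s) powr (1 - \<epsilon>))))"
      using elim(2,3) K0[of s] c(1) by (intro ln_mono) auto
    also have "\<dots> = ln c + exp ((s * M s) powr (1 - \<epsilon>))" using c(1) by (simp add: ln_mult)
    finally have "real L * ln (K s) \<le> real L * (ln c + exp ((s * M s) powr (1 - \<epsilon>)))" by (rule mult_left_mono) simp
    then show ?case using elim by linarith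
  qed
  then obtain R0 where R0: "\<And>s. R0 \<le> s \<Longrightarrow> real L * ln (K s) \<le> cosh (s * M s / 4) / 2 \<and> 2 \<le> s \<and> 4 * real N \<le> s \<and> A * real N \<le> s"
    by (auto simp: eventually_at_top_linorder)
  define R1 where "R1 = max R0 1"
  obtain n1 :: nat where n1: "NK R1 / c1 < 2 ^ n1" using real_arch_pow[of 2 "NK R1 / c1"] by auto
  obtain n2 :: nat where n2: "2 * real m < 2 ^ n2" using real_arch_pow[of 2 "2 * real m"] by auto
  define n0 where "n0 = max n1 n2"
  have goal: "1 < R \<and> 1 \<le> R / (4 * real N) \<and> 1 \<le> R * M R / 4 \<and> A \<le> 2 * M R * (R / (4 * real N)) \<and> 2 * real m \<le> t \<and>
      weight (M_log M K) (c1 * t) \<le> R \<and>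
      (\<forall>l\<in>{1..m}. (R / (4 * real N)) ^ Suc m * (4 * K R * ((R * M R / 4) * exp (- t / (real l * (2 * M R))) + exp (- cosh (R * M R / 4) / 2)))
        \<le> (8 / c1\<^sup>2) / t\<^sup>2)"
    if n: "n0 \<le> n" and t: "2 ^ n \<le> t" "t < 2 ^ Suc n" and R: "R = weight (M_log M K) (c1 * 2 ^ Suc n)" for n t R
  proof -
    have "(2::real) ^ n1 \<le> 2 ^ n" using n by (intro power_increasing) (auto simp: n0_def)
    then have "NK R1 / c1 \<le> 2 ^ Suc n" using n1 zero_le_power[of "2::real" n] unfolding power_Suc by linarith
    then have \<tau>: "NK R1 \<le> c1 * 2 ^ Suc n" using c1 by (simp add: pos_divide_le_eq mult.commute)
    have "(2::real) ^ n2 \<le> 2 ^ n" using n by (intro power_increasing) (auto simp: n0_def)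
    then have tm: "2 * real m \<le> t" using n2 t by linarith
    have t0: "0 < t" using tm m by linarith
    have "NK 1 \<le> NK R1" unfolding NK_def by (rule mono_onD[OF NKm]) (auto simp: R1_def)
    then have \<tau>1: "M_log M K 1 \<le> c1 * 2 ^ Suc n" using \<tau> by (simp add: NK_def)
    have RR1: "R1 \<le> R" unfolding R using \<tau> by (intro W(3)) (auto simp: R1_def NK_def)
    have Rri: "R = right_inverse (M_log M K) (c1 * 2 ^ Suc n)" using \<tau>1 R by (simp add: weight_def)
    have NKR: "M R * ln (K R) = c1 * 2 ^ Suc n"
      using W(5)[OF \<tau>1] unfolding Rri[symmetric] M_log_def[of M K R] .
    have "R0 \<le> R" using RR1 by (simp add: R1_def)
    then have r: "real L * ln (K R) \<le> cosh (R * M R / 4) / 2" "2 \<le> R" "4 * real N \<le> R" "A * real N \<le> R"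
      using R0 by blast+
    have MR: "2 \<le> M R" using M(3) r by simp
    have KR: "R \<le> K R" "M R \<le> K R" "2 \<le> K R" using KM r K(3) by auto
    have b1: "1 \<le> R / (4 * real N)" using r N by (simp add: pos_le_divide_eq)
    have b2: "1 \<le> R * M R / 4" using mult_mono[of 2 R 2 "M R"] r MR by simp
    have "A * real N * 4 \<le> R * (2 * M R)" using r MR by (intro mult_mono) auto
    then have b3: "A \<le> 2 * M R * (R / (4 * real N))" using N by (simp add: field_simps)
    have b4: "weight (M_log M K) (c1 * t) \<le> R" unfolding R using t c1 by (intro W(2)) auto
    have b5: "(R / (4 * real N)) ^ Suc m * (4 * K R * ((R * M R / 4) * exp (- t / (real l * (2 * M R))) + exp (- cosh (R * M R / 4) / 2)))
        \<le> (8 / c1\<^sup>2) / t\<^sup>2" if l: "l \<in> {1..m}" for l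
    proof -
      define k where "k = K R"
      have k: "2 \<le> k" "R \<le> k" "M R \<le> k" using KR by (auto simp: k_def)
      have kL: "exp (- (real L * ln k)) = 1 / k ^ L"
        using k by (simp add: exp_minus exp_of_nat_mult inverse_eq_divide)
      have "real l * (2 * M R) \<le> real m * (2 * M R)" using l MR by (intro mult_right_mono) auto
      then have "t / (real m * (2 * M R)) \<le> t / (real l * (2 * M R))"
        using t0 l MR m by (intro divide_left_mono) auto
      moreover have "real L * ln k \<le> t / (real m * (2 * M R))"
      proof -
        have "M R * ln k \<le> 2 * c1 * t" using NKR t c1 by (simp add: k_def)
        then have "M R * ln k * (2 * real m * real L) \<le> 2 * c1 * t * (2 * real m * real L)" by (intro mult_right_mono) auto
        also have "\<dots> = t" using m by (simp add: c1_def L_def)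
        finally show ?thesis using MR m by (simp add: pos_le_divide_eq mult_ac)
      qed
      ultimately have "exp (- t / (real l * (2 * M R))) \<le> exp (- (real L * ln k))" by simp
      then have x1: "exp (- t / (real l * (2 * M R))) \<le> 1 / k ^ L" unfolding kL .
      have "exp (- cosh (R * M R / 4) / 2) \<le> exp (- (real L * ln k))" using r(1) by (simp add: k_def)
      then have x2: "exp (- cosh (R * M R / 4) / 2) \<le> 1 / k ^ L" unfolding kL .
      have "R * M R \<le> k * k" using k r MR by (intro mult_mono) auto
      moreover have "0 \<le> k * k" by simp
      ultimately have x3: "R * M R / 4 \<le> k\<^sup>2" unfolding power2_eq_square by linarith
      have "1 \<le> k\<^sup>2" using k by (intro one_le_power) auto
      have x4: "(R / (4 * real N)) ^ Suc m \<le> k ^ Suc m"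
      proof (intro power_mono)
        have "R / (4 * real N) \<le> R / 1" using r N by (intro divide_left_mono) auto
        then show "R / (4 * real N) \<le> k" using k by simp
      qed (use r in auto)
      have "(R / (4 * real N)) ^ Suc m * (4 * k * ((R * M R / 4) * exp (- t / (real l * (2 * M R))) + exp (- cosh (R * M R / 4) / 2)))
          \<le> k ^ Suc m * (4 * k * (k\<^sup>2 * (1 / k ^ L) + k\<^sup>2 * (1 / k ^ L)))"
      proof (intro mult_mono add_mono x1 x3 x4)
        show "exp (- cosh (R * M R / 4) / 2) \<le> k\<^sup>2 * (1 / k ^ L)"
          using x2 \<open>1 \<le> k\<^sup>2\<close> mult_mono[of 1 "k\<^sup>2" "1 / k ^ L" "1 / k ^ L"] k by simp
      qed (use k b2 r in auto)
      also have "\<dots> = 8 * (k ^ (m + 4) / k ^ (m + 8))"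
        by (simp add: L_def power_add power2_eq_square numeral_eq_Suc)
      also have "k ^ (m + 4) / k ^ (m + 8) = 1 / k ^ 4"
        using k by (simp add: power_add field_simps)
      finally have y: "(R / (4 * real N)) ^ Suc m * (4 * K R * ((R * M R / 4) * exp (- t / (real l * (2 * M R))) + exp (- cosh (R * M R / 4) / 2)))
          \<le> 8 * (1 / k ^ 4)" by (simp only: k_def)
      have "ln k \<le> k" using k ln_bound[of k] by simp
      then have "M R * ln k \<le> k * k" using k MR by (intro mult_mono) auto
      then have "c1 * t \<le> k\<^sup>2" using NKR mult_strict_left_mono[OF t(2) c1] unfolding k_def power2_eq_square by linarith
      then have "(c1 * t)\<^sup>2 \<le> (k\<^sup>2)\<^sup>2" using c1 t0 by (intro power_mono) auto
      then have "c1\<^sup>2 * t\<^sup>2 \<le> k ^ 4" by (simp add: power_mult_distrib flip: power_mult)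
      then have "1 / k ^ 4 \<le> 1 / (c1\<^sup>2 * t\<^sup>2)" using c1 t0 k by (intro divide_left_mono) auto
      then show ?thesis using y by simp
    qed
    show ?thesis using b1 b2 b3 b4 b5 tm r by auto
  qed
  then show "\<exists>c1 n0. 0 < c1 \<and> (\<forall>n t R. n0 \<le> n \<longrightarrow> 2 ^ n \<le> t \<longrightarrow> t < 2 ^ Suc n \<longrightarrow> R = weight (M_log M K) (c1 * 2 ^ Suc n) \<longrightarrow>
      1 < R \<and> 1 \<le> R / (4 * real N) \<and> 1 \<le> R * M R / 4 \<and> A \<le> 2 * M R * (R / (4 * real N)) \<and> 2 * real m \<le> t \<and>
      weight (M_log M K) (c1 * t) \<le> R \<and>
      (\<forall>l\<in>{1..m}. (R / (4 * real N)) ^ Suc m * (4 * K R * ((R * M R / 4) * exp (- t / (real l * (2 * M R))) + exp (- cosh (R * M R / 4) / 2)))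
        \<le> (8 / c1\<^sup>2) / t\<^sup>2))"
    using c1 by (intro exI[of _ c1] exI[of _ n0]) blast
qed

section \<open>The estimate for scalar functions\<close>

lemma exp_decay_bound:
  fixes \<sigma> :: real
  assumes "0 < \<sigma>"
  shows "\<exists>C. \<forall>r\<ge>0. exp (- \<sigma> * r) * (1 + r) ^ m \<le> C * (1 / (1 + 1 * \<bar>r\<bar>)\<^sup>2)"
proof (intro exI allI impI)
  fix r :: real assume r: "0 \<le> r"
  define n where "n = m + 2"
  have n: "0 < real n" by (simp add: n_def)
  have "(\<sigma> * (1 + r) / real n) ^ n \<le> (1 + \<sigma> * (1 + r) / real n) ^ n"
    using assms r n by (intro power_mono) auto
  also have "\<dots> \<le> exp (\<sigma> * (1 + r))"
    using assms r n by (intro exp_ge_one_plus_x_over_n_power_n) (auto simp: n_def intro: order_trans[of _ 0])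
  finally have "(\<sigma> / real n) ^ n * (1 + r) ^ n \<le> exp \<sigma> * exp (\<sigma> * r)"
    by (simp add: power_mult_distrib[symmetric] exp_add[symmetric] algebra_simps add_divide_distrib)
  then have "exp (- \<sigma> * r) * ((1 + r) ^ m * (1 + r)\<^sup>2) \<le> exp \<sigma> / (\<sigma> / real n) ^ n"
  proof -
    assume a: "(\<sigma> / real n) ^ n * (1 + r) ^ n \<le> exp \<sigma> * exp (\<sigma> * r)"
    have p: "0 < (\<sigma> / real n) ^ n" using assms n by simp
    have "exp (- \<sigma> * r) * ((\<sigma> / real n) ^ n * (1 + r) ^ n) \<le> exp (- \<sigma> * r) * (exp \<sigma> * exp (\<sigma> * r))"
      using a by (rule mult_left_mono) simp
    also have "\<dots> = exp \<sigma>" by (simp add: exp_add[symmetric])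
    finally have "exp (- \<sigma> * r) * (1 + r) ^ n \<le> exp \<sigma> / (\<sigma> / real n) ^ n"
      using p by (simp only: pos_le_divide_eq) (simp only: mult_ac)
    moreover have "(1 + r) ^ m * (1 + r)\<^sup>2 = (1 + r) ^ n" by (simp only: n_def power_add)
    ultimately show ?thesis by simp
  qed
  then have "exp (- \<sigma> * r) * ((1 + r) ^ m * (1 + r)\<^sup>2) * (1 / (1 + r)\<^sup>2) \<le> exp \<sigma> / (\<sigma> / real n) ^ n * (1 / (1 + r)\<^sup>2)"
    by (rule mult_right_mono) simp
  moreover have "exp (- \<sigma> * r) * ((1 + r) ^ m * (1 + r)\<^sup>2) * (1 / (1 + r)\<^sup>2) = exp (- \<sigma> * r) * (1 + r) ^ m"
    using r by simp
  moreover have "1 + 1 * \<bar>r\<bar> = 1 + r" using r by simp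
  ultimately show "exp (- \<sigma> * r) * (1 + r) ^ m \<le> (exp \<sigma> / (\<sigma> / real (m + 2)) ^ (m + 2)) * (1 / (1 + 1 * \<bar>r\<bar>)\<^sup>2)"
    unfolding n_def by (simp only:)
qed

lemma growth_integrable:
  fixes f :: "real \<Rightarrow> complex"
  assumes fm: "f \<in> borel_measurable borel" and f0: "\<And>r. r < 0 \<Longrightarrow> f r = 0"
    and fb: "\<And>r. 0 \<le> r \<Longrightarrow> norm (f r) \<le> Cf * (1 + r) ^ m"
  shows "0 < \<sigma> \<Longrightarrow> integrable lborel (\<lambda>r. exp (- \<sigma> * r) *\<^sub>R f r)"
    and "0 < \<kappa> \<Longrightarrow> 0 \<le> t \<Longrightarrow> m + 2 \<le> n \<Longrightarrow> integrable lborel (\<lambda>r. f r * complex_of_real (sinc (\<kappa> * (t - r))) ^ n)"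
proof -
  note [measurable] = fm
  have Cf: "0 \<le> Cf" using fb[of 0] norm_ge_zero[of "f 0"] by (simp, linarith)
  show "integrable lborel (\<lambda>r. exp (- \<sigma> * r) *\<^sub>R f r)" if \<sigma>: "0 < \<sigma>"
  proof -
    obtain C where C: "\<And>r. 0 \<le> r \<Longrightarrow> exp (- \<sigma> * r) * (1 + r) ^ m \<le> C * (1 / (1 + 1 * \<bar>r\<bar>)\<^sup>2)"
      using exp_decay_bound[OF \<sigma>] by blast
    show ?thesis
    proof (rule Bochner_Integration.integrable_bound)
      show "integrable lborel (\<lambda>r. Cf * (C * (1 / (1 + 1 * \<bar>r\<bar>)\<^sup>2)))"
        by (intro integrable_mult_right integral_inverse_square) simp
      have "norm (exp (- \<sigma> * r) *\<^sub>R f r) \<le> norm (Cf * (C * (1 / (1 + 1 * \<bar>r\<bar>)\<^sup>2)))" for r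
      proof (cases "r < 0")
        case False
        then have "norm (exp (- \<sigma> * r) *\<^sub>R f r) \<le> exp (- \<sigma> * r) * (Cf * (1 + r) ^ m)" using fb[of r] by simp
        also have "\<dots> = Cf * (exp (- \<sigma> * r) * (1 + r) ^ m)" by simp
        also have "\<dots> \<le> Cf * (C * (1 / (1 + 1 * \<bar>r\<bar>)\<^sup>2))" using C[of r] Cf False by (intro mult_left_mono) auto
        finally show ?thesis by (metis abs_ge_self order_trans real_norm_def)
      qed (simp add: f0)
      then show "AE r in lborel. norm (exp (- \<sigma> * r) *\<^sub>R f r) \<le> norm (Cf * (C * (1 / (1 + 1 * \<bar>r\<bar>)\<^sup>2)))" by simp
    qed measurable
  qed
  show "integrable lborel (\<lambda>r. f r * complex_of_real (sinc (\<kappa> * (t - r))) ^ n)" if \<kappa>: "0 < \<kappa>" and t: "0 \<le> t" and n: "m + 2 \<le> n"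
  proof -
    define E where "E = Cf * ((1 + t) * (1 + 1 / \<kappa>)) ^ m * 2 ^ n"
    define D where "D r = 1 + \<kappa> * \<bar>t - r\<bar>" for r
    have D1: "1 \<le> D r" for r using \<kappa> by (simp add: D_def)
    show ?thesis
    proof (rule Bochner_Integration.integrable_bound)
      have "integrable lborel (\<lambda>r. 1 / (1 + \<kappa> * \<bar>t + (-1) * r\<bar>)\<^sup>2)"
        by (rule lborel_integrable_real_affine[OF integral_inverse_square(1)[OF \<kappa>]]) simp
      then show "integrable lborel (\<lambda>r. E * (1 / (D r)\<^sup>2))" unfolding D_def by (intro integrable_mult_right) simp
      have "norm (f r * complex_of_real (sinc (\<kappa> * (t - r))) ^ n) \<le> norm (E * (1 / (D r)\<^sup>2))" for r
      proof (cases "r < 0")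
        case False
        have "\<bar>t - r\<bar> \<le> (1 / \<kappa>) * D r" using \<kappa> by (simp add: D_def field_simps)
        then have "1 + \<bar>t - r\<bar> \<le> (1 + 1 / \<kappa>) * D r" using D1[of r] by (simp add: algebra_simps)
        moreover have "1 + r \<le> (1 + t) * (1 + \<bar>t - r\<bar>)"
          using mult_nonneg_nonneg[OF t abs_ge_zero[of "t - r"]] t by (simp add: algebra_simps; linarith)
        ultimately have "1 + r \<le> (1 + t) * ((1 + 1 / \<kappa>) * D r)"
          using t by (meson add_nonneg_nonneg mult_left_mono order_trans zero_le_one)
        then have "(1 + r) ^ m \<le> ((1 + t) * (1 + 1 / \<kappa>) * D r) ^ m" using False by (intro power_mono) (auto simp: mult.assoc)
        then have "norm (f r) \<le> Cf * ((1 + t) * (1 + 1 / \<kappa>) * D r) ^ m"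
          using fb[of r] Cf False by (meson mult_left_mono not_less order_trans)
        moreover have "norm (complex_of_real (sinc (\<kappa> * (t - r))) ^ n) \<le> 2 ^ n / D r ^ n"
          using sinc_decay[of "\<kappa> * (t - r)" n] \<kappa> by (simp add: norm_power D_def abs_mult)
        ultimately have "norm (f r * complex_of_real (sinc (\<kappa> * (t - r))) ^ n)
            \<le> (Cf * ((1 + t) * (1 + 1 / \<kappa>) * D r) ^ m) * (2 ^ n / D r ^ n)"
          unfolding norm_mult using Cf D1[of r] t \<kappa> by (intro mult_mono) auto
        also have "\<dots> = E * (D r ^ m / D r ^ n)" by (simp add: E_def power_mult_distrib)
        also have "\<dots> \<le> E * (1 / (D r)\<^sup>2)"
          using n Cf t \<kappa> by (intro mult_left_mono power_quotient_le D1) (auto simp: E_def)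
        finally show ?thesis by (metis abs_ge_self order_trans real_norm_def)
      qed (simp add: f0)
      then show "AE r in lborel. norm (f r * complex_of_real (sinc (\<kappa> * (t - r))) ^ n) \<le> norm (E * (1 / (D r)\<^sup>2))" by simp
    qed measurable
  qed
qed

lemma dyadic_block:
  fixes t :: real
  assumes "1 \<le> t"
  defines "n \<equiv> nat \<lfloor>log 2 t\<rfloor>"
  shows "2 ^ n \<le> t" "t < 2 ^ Suc n"
proof -
  have l: "0 \<le> log 2 t" using assms by simp
  have "real n \<le> log 2 t" "log 2 t < real (Suc n)" using l unfolding n_def by linarith+
  then have "2 powr real n \<le> t" "t < 2 powr real (Suc n)" using assms(1)
    by (simp_all only: le_log_iff[of 2 t] log_less_iff[of 2 t])
  then show "2 ^ n \<le> t" "t < 2 ^ Suc n" by (auto simp: powr_realpow simp del: power_Suc of_nat_Suc)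
qed

text \<open>
  The frequency scale \<open>\<kappa>\<close>, as a step function of \<open>t\<close> that is constant for \<open>2 ^ n \<le> t < 2 ^ (n + 1)\<close>. The
  factor 4 reserves three quarters of the band \<open>{-R..R}\<close> for the Bessel kernel.
\<close>

definition dyadic_scale :: "(real \<Rightarrow> real) \<Rightarrow> real \<Rightarrow> nat \<Rightarrow> real \<Rightarrow> real"
  where "dyadic_scale W c N t = W (c * 2 ^ Suc (nat \<lfloor>log 2 t\<rfloor>)) / (4 * real N)"

text \<open>
  A linear bound for the integral of \<open>h\<close>, which every \<open>h\<close> in \<open>L\<^sup>p\<close> has, makes \<open>f\<close> grow at
  most like \<open>t ^ m\<close>.
\<close>

lemma scalar_growth:
  "\<exists>C\<ge>0. \<forall>f g h Ch. loc_int f \<longrightarrow> loc_int g \<longrightarrow> weak_deriv (Suc k) f g \<longrightarrow>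
      (\<forall>T. integrable lborel (\<lambda>v. indicator {0..T} v * h v)) \<longrightarrow>
      (AE v in lborel. 0 \<le> v \<longrightarrow> norm (g v) \<le> h v) \<longrightarrow> 0 \<le> Ch \<longrightarrow>
      (\<forall>t\<ge>0. (\<integral>v. indicator {0..t} v * h v \<partial>lborel) \<le> Ch * (1 + t)) \<longrightarrow>
      (\<integral>s. norm (indicator {1..2} s *\<^sub>R f s) \<partial>lborel) \<le> Ch \<longrightarrow>
      (\<exists>cs. length cs = Suc k \<and> (AE t in lborel. t > 0 \<longrightarrow> f t = iter_primitive cs g t) \<and>
        (\<forall>t\<ge>0. norm (iter_primitive cs g t) \<le> C * Ch * (1 + t) ^ Suc k))"
proof -
  obtain C where C: "C \<ge> 0" "\<forall>f g B. loc_int f \<longrightarrow> loc_int g \<longrightarrow> weak_deriv (Suc k) f g \<longrightarrow> B \<ge> 0 \<longrightarrow>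
      (\<forall>t\<ge>0. (\<integral>s. norm (indicator {0..t} s *\<^sub>R g s) \<partial>lborel) \<le> B * (1 + t) ^ 1) \<longrightarrow>
      (\<integral>s. norm (indicator {1..2} s *\<^sub>R f s) \<partial>lborel) \<le> B \<longrightarrow>
      (\<exists>cs. length cs = Suc k \<and> (AE t in lborel. t > 0 \<longrightarrow> f t = iter_primitive cs g t) \<and>
        (\<forall>t\<ge>0. norm (iter_primitive cs g t) \<le> C * B * (1 + t) ^ (1 + k)))"
    using weak_deriv_iter_primitive[of k 1] by blast
  show ?thesis
  proof (intro exI[of _ C] conjI allI impI)
    fix f g h Ch
    assume a: "loc_int f" "loc_int g" "weak_deriv (Suc k) f g" "\<forall>T. integrable lborel (\<lambda>v. indicator {0..T} v * h v)"
      "AE v in lborel. 0 \<le> v \<longrightarrow> norm (g v) \<le> h v" "0 \<le> Ch"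
      "\<forall>t\<ge>0. (\<integral>v. indicator {0..t} v * h v \<partial>lborel) \<le> Ch * (1 + t)"
      "(\<integral>s. norm (indicator {1..2} s *\<^sub>R f s) \<partial>lborel) \<le> Ch"
    have "(\<integral>s. norm (indicator {0..t} s *\<^sub>R g s) \<partial>lborel) \<le> Ch * (1 + t) ^ 1" if "0 \<le> t" for t
    proof -
      have "(\<integral>s. norm (indicator {0..t} s *\<^sub>R g s) \<partial>lborel) \<le> (\<integral>v. indicator {0..t} v * h v \<partial>lborel)"
      proof (rule integral_mono_AE)
        show "integrable lborel (\<lambda>s. norm (indicator {0..t} s *\<^sub>R g s))"
          using a(2) unfolding loc_int_def by (intro integrable_norm) blast
        show "integrable lborel (\<lambda>v. indicator {0..t} v * h v)" using a(4) by blast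
        show "AE s in lborel. norm (indicator {0..t} s *\<^sub>R g s) \<le> indicator {0..t} s * h s"
          using a(5) by eventually_elim (auto simp: indicator_def)
      qed
      then show ?thesis using a(7) that by fastforce
    qed
    then show "\<exists>cs. length cs = Suc k \<and> (AE t in lborel. t > 0 \<longrightarrow> f t = iter_primitive cs g t) \<and>
        (\<forall>t\<ge>0. norm (iter_primitive cs g t) \<le> C * Ch * (1 + t) ^ Suc k)"
      using C(2)[rule_format, OF a(1-3,6) _ a(8)] by simp
  qed (rule C(1))
qed

text \<open>
  The pointwise estimate is applied with \<open>R\<close> the weight on the dyadic block of \<open>t\<close>,
  \<open>\<kappa> = R / (4 N)\<close>, \<open>U = R M R / 4\<close> and \<open>\<alpha> = 2 M R\<close>. The frequencies involved are at most
  \<open>R / 4 + R / 8 < R\<close>, where the transform is holomorphic to the left up to \<open>- 1 / M R\<close>, and the contour is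
  shifted by at most half of that. The constants do not depend on the functions \<open>f\<close>, \<open>g\<close> and \<open>F\<close>, so the
  estimate applies uniformly to all scalar images of a vector-valued function.
\<close>

lemma scalar_estimate:
  fixes M K :: "real \<Rightarrow> real" and k :: nat
  assumes M: "continuous_on {0..} M" "mono_on {0..} M" "\<forall>s\<ge>0. M s \<ge> 2"
    and K: "continuous_on {0..} K" "mono_on {0..} K" "\<forall>s\<ge>0. K s \<ge> 2"
    and KM: "\<forall>s>1. K s \<ge> max s (M s)"
    and dexp: "\<exists>\<epsilon>. 0 < \<epsilon> \<and> \<epsilon> < 1 \<and> K \<in> O[at_top](\<lambda>s. exp (exp ((s * M s) powr (1 - \<epsilon>))))"
  defines "m \<equiv> Suc k" and "N \<equiv> 2 * Suc k + 4"
  shows "\<exists>c1 T0 C. 0 < c1 \<and> 1 \<le> T0 \<and> 0 \<le> C \<and>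
    (\<forall>t\<ge>T0. 1 \<le> dyadic_scale (weight (M_log M K)) c1 N t) \<and> (\<forall>f g h Ch F.
      loc_int f \<longrightarrow> loc_int g \<longrightarrow> weak_deriv m f g \<longrightarrow> (\<forall>v. 0 \<le> h v) \<longrightarrow>
      (\<forall>T. integrable lborel (\<lambda>v. indicator {0..T} v * h v)) \<longrightarrow>
      (AE v in lborel. 0 \<le> v \<longrightarrow> norm (g v) \<le> h v) \<longrightarrow> 0 \<le> Ch \<longrightarrow>
      (\<forall>t\<ge>0. (\<integral>v. indicator {0..t} v * h v \<partial>lborel) \<le> Ch * (1 + t)) \<longrightarrow>
      (\<integral>s. norm (indicator {1..2} s *\<^sub>R f s) \<partial>lborel) \<le> Ch \<longrightarrow>
      (\<forall>\<kappa>>0. \<forall>t. integrable lborel (\<lambda>v. h v / (1 + \<kappa> * \<bar>t - v\<bar>)\<^sup>2)) \<longrightarrow>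
      F holomorphic_on {z. - 1 / M \<bar>Im z\<bar> < Re z} \<longrightarrow> (\<forall>z\<in>Omega M. norm (F z) \<le> K \<bar>Im z\<bar>) \<longrightarrow>
      (\<forall>z. 0 < Re z \<longrightarrow> F z = (\<integral>r. indicator {0..} r *\<^sub>R (exp (- z * complex_of_real r) * f r) \<partial>lborel)) \<longrightarrow>
      (AE t in lborel. T0 \<le> t \<longrightarrow> weight (M_log M K) (c1 * t) ^ m * norm (f t)
        \<le> C * (dyadic_scale (weight (M_log M K)) c1 N t * (\<integral>v. h v / (1 + dyadic_scale (weight (M_log M K)) c1 N t / real m * \<bar>t - v\<bar>)\<^sup>2 \<partial>lborel)
            + (1 + Ch) / t\<^sup>2)))"
proof -
  obtain A C where A: "0 < A" and C: "0 \<le> C" and point: "\<forall>f \<kappa> U \<alpha> t Cf J B.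
      f \<in> borel_measurable borel \<longrightarrow> (\<forall>r<0. f r = 0) \<longrightarrow> (\<forall>r\<ge>0. norm (f r) \<le> Cf * (1 + r) ^ m) \<longrightarrow> 0 \<le> Cf \<longrightarrow>
      1 \<le> \<kappa> \<longrightarrow> 1 \<le> U \<longrightarrow> 0 < \<alpha> \<longrightarrow> A \<le> \<alpha> * \<kappa> \<longrightarrow> 2 * real m \<le> t \<longrightarrow> 0 \<le> J \<longrightarrow>
      (\<forall>s. real m * \<bar>s\<bar> \<le> t / 2 \<longrightarrow> norm (nabla m s f t) \<le> \<bar>s\<bar> ^ k * ((1 + \<kappa> * \<bar>s\<bar>)\<^sup>2 * J)) \<longrightarrow>
      (\<forall>l\<in>{1..m}. norm (\<integral>r. f r * (complex_of_real (sinc (\<kappa> / real l * (t - r))) ^ N * bessel_kernel U (real l * \<alpha>) (t - r)) \<partial>lborel) \<le> B) \<longrightarrow>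
      \<kappa> ^ m * norm (f t) \<le> C * (\<kappa> * J + \<kappa> ^ Suc m * B + Cf / t\<^sup>2)"
    using pointwise_estimate[of k] unfolding m_def N_def by blast
  have mN: "1 \<le> m" "1 \<le> N" by (auto simp: m_def N_def)
  define NK where "NK = M_log M K"
  obtain c1 n0 where c1: "0 < c1" and sel: "\<forall>n t R. n0 \<le> n \<longrightarrow> 2 ^ n \<le> t \<longrightarrow> t < 2 ^ Suc n \<longrightarrow> R = weight NK (c1 * 2 ^ Suc n) \<longrightarrow>
      1 < R \<and> 1 \<le> R / (4 * real N) \<and> 1 \<le> R * M R / 4 \<and> A \<le> 2 * M R * (R / (4 * real N)) \<and> 2 * real m \<le> t \<and>
      weight NK (c1 * t) \<le> R \<and>
      (\<forall>l\<in>{1..m}. (R / (4 * real N)) ^ Suc m * (4 * K R * ((R * M R / 4) * exp (- t / (real l * (2 * M R))) + exp (- cosh (R * M R / 4) / 2)))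
        \<le> (8 / c1\<^sup>2) / t\<^sup>2)"
    using scale_selection(1)[OF M K KM dexp mN, of A] unfolding NK_def by blast
  obtain G where G: "0 \<le> G" "\<forall>f g h Ch. loc_int f \<longrightarrow> loc_int g \<longrightarrow> weak_deriv m f g \<longrightarrow>
      (\<forall>T. integrable lborel (\<lambda>v. indicator {0..T} v * h v)) \<longrightarrow>
      (AE v in lborel. 0 \<le> v \<longrightarrow> norm (g v) \<le> h v) \<longrightarrow> 0 \<le> Ch \<longrightarrow>
      (\<forall>t\<ge>0. (\<integral>v. indicator {0..t} v * h v \<partial>lborel) \<le> Ch * (1 + t)) \<longrightarrow>
      (\<integral>s. norm (indicator {1..2} s *\<^sub>R f s) \<partial>lborel) \<le> Ch \<longrightarrow>
      (\<exists>cs. length cs = m \<and> (AE t in lborel. t > 0 \<longrightarrow> f t = iter_primitive cs g t) \<and>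
        (\<forall>t\<ge>0. norm (iter_primitive cs g t) \<le> G * Ch * (1 + t) ^ m))"
    using scalar_growth[of k] unfolding m_def by blast
  define T0 where "T0 = (2::real) ^ n0"
  define \<kappa> where "\<kappa> t = dyadic_scale (weight NK) c1 N t" for t
  define C' where "C' = (4 * real N) ^ m * C * (1 + 8 / c1\<^sup>2 + G)"
  have block: "n0 \<le> nat \<lfloor>log 2 t\<rfloor>" "2 ^ nat \<lfloor>log 2 t\<rfloor> \<le> t" "t < 2 ^ Suc (nat \<lfloor>log 2 t\<rfloor>)" if "T0 \<le> t" for t
  proof -
    have "(1::real) \<le> 2 ^ n0" by (rule one_le_power) simp
    then have t1: "1 \<le> t" using that unfolding T0_def by linarith
    show b: "2 ^ nat \<lfloor>log 2 t\<rfloor> \<le> t" "t < 2 ^ Suc (nat \<lfloor>log 2 t\<rfloor>)" using dyadic_block[OF t1] by auto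
    have "(2::real) ^ n0 < 2 ^ Suc (nat \<lfloor>log 2 t\<rfloor>)" using b(2) that by (simp add: T0_def)
    then have "n0 < Suc (nat \<lfloor>log 2 t\<rfloor>)" by (rule power_less_imp_less_exp[rotated]) simp
    then show "n0 \<le> nat \<lfloor>log 2 t\<rfloor>" by simp
  qed
  have \<kappa>R: "\<kappa> t = weight NK (c1 * 2 ^ Suc (nat \<lfloor>log 2 t\<rfloor>)) / (4 * real N)" for t
    by (simp add: \<kappa>_def dyadic_scale_def)
  have est: "AE t in lborel. T0 \<le> t \<longrightarrow> weight NK (c1 * t) ^ m * norm (f t)
        \<le> C' * (\<kappa> t * (\<integral>v. h v / (1 + \<kappa> t / real m * \<bar>t - v\<bar>)\<^sup>2 \<partial>lborel) + (1 + Ch) / t\<^sup>2)"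
    if a: "loc_int f" "loc_int g" "weak_deriv m f g" and h0: "\<forall>v. 0 \<le> h v" and hi: "\<forall>T. integrable lborel (\<lambda>v. indicator {0..T} v * h v)"
      and gh: "AE v in lborel. 0 \<le> v \<longrightarrow> norm (g v) \<le> h v" and Ch: "0 \<le> Ch"
      "\<forall>t\<ge>0. (\<integral>v. indicator {0..t} v * h v \<partial>lborel) \<le> Ch * (1 + t)" "(\<integral>s. norm (indicator {1..2} s *\<^sub>R f s) \<partial>lborel) \<le> Ch"
      and hJ: "\<forall>\<kappa>>0. \<forall>t. integrable lborel (\<lambda>v. h v / (1 + \<kappa> * \<bar>t - v\<bar>)\<^sup>2)"
      and F: "F holomorphic_on {z. - 1 / M \<bar>Im z\<bar> < Re z}" "\<forall>z\<in>Omega M. norm (F z) \<le> K \<bar>Im z\<bar>"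
        "\<forall>z. 0 < Re z \<longrightarrow> F z = (\<integral>r. indicator {0..} r *\<^sub>R (exp (- z * complex_of_real r) * f r) \<partial>lborel)"
    for f g :: "real \<Rightarrow> complex" and h Ch and F :: "complex \<Rightarrow> complex"
  proof -
    obtain cs where cs: "length cs = m" "AE t in lborel. t > 0 \<longrightarrow> f t = iter_primitive cs g t"
      "\<forall>t\<ge>0. norm (iter_primitive cs g t) \<le> G * Ch * (1 + t) ^ m"
      using G(2)[rule_format, OF a hi[rule_format] gh Ch(1) Ch(2)[rule_format] Ch(3)] by blast
    \<comment> \<open>The version of \<open>f\<close> that is an iterated primitive everywhere on the half line and 0 to its left satisfies its bounds pointwise.\<close>
    define f' where "f' r = (if r < 0 then 0 else iter_primitive cs g r)" for r
    have ipm[measurable]: "iter_primitive cs g \<in> borel_measurable borel"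
      using loc_int_iter_primitive[OF a(2)] by (simp add: loc_int_def)
    have f'm[measurable]: "f' \<in> borel_measurable borel" unfolding f'_def[abs_def] by measurable
    have [measurable]: "f \<in> borel_measurable borel" using a(1) by (simp add: loc_int_def)
    have f'0: "f' r = 0" if "r < 0" for r using that by (simp add: f'_def)
    have f'b: "norm (f' r) \<le> G * Ch * (1 + r) ^ m" if "0 \<le> r" for r using cs(3) that by (simp add: f'_def)
    have ff': "AE r in lborel. r \<noteq> 0 \<longrightarrow> indicator {0..} r *\<^sub>R f r = f' r"
      using cs(2) by eventually_elim (auto simp: f'_def indicator_def)
    have GCh: "0 \<le> G * Ch" using G(1) Ch(1) by simp
    have lap: "F z = (\<integral>r. exp (- z * complex_of_real r) * f' r \<partial>lborel)" if "0 < Re z" for z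
    proof -
      have "AE r in lborel. r \<noteq> (0::real)" by (rule AE_lborel_singleton)
      with ff' have "AE r in lborel. indicator {0..} r *\<^sub>R (exp (- z * complex_of_real r) * f r) = exp (- z * complex_of_real r) * f' r"
        by eventually_elim (metis mult_scaleR_right)
      then have "(\<integral>r. indicator {0..} r *\<^sub>R (exp (- z * complex_of_real r) * f r) \<partial>lborel) = (\<integral>r. exp (- z * complex_of_real r) * f' r \<partial>lborel)"
        by (intro integral_cong_AE) measurable
      then show ?thesis using F(3) that by simp
    qed
    have main: "weight NK (c1 * t) ^ m * norm (f' t)
        \<le> C' * (\<kappa> t * (\<integral>v. h v / (1 + \<kappa> t / real m * \<bar>t - v\<bar>)\<^sup>2 \<partial>lborel) + (1 + Ch) / t\<^sup>2)" if t: "T0 \<le> t" for t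
    proof -
      define R where "R = weight NK (c1 * 2 ^ Suc (nat \<lfloor>log 2 t\<rfloor>))"
      note sel' = sel[rule_format, OF block[OF t] R_def]
      define \<mu> where "\<mu> = R / (4 * real N)"
      have \<mu>: "\<mu> = \<kappa> t" by (simp add: \<mu>_def \<kappa>R R_def)
      have s: "1 < R" "1 \<le> \<mu>" "1 \<le> R * M R / 4" "A \<le> 2 * M R * \<mu>" "2 * real m \<le> t" "weight NK (c1 * t) \<le> R"
        using sel' by (auto simp: \<mu>_def)
      have MR: "2 \<le> M R" "2 \<le> K R" using M(3) K(3) s(1) by auto
      define J where "J = (\<integral>v. h v / (1 + \<mu> / real m * \<bar>t - v\<bar>)\<^sup>2 \<partial>lborel)"
      have hJ': "integrable lborel (\<lambda>v. h v / (1 + \<mu> / real m * \<bar>t - v\<bar>)\<^sup>2)"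
      proof -
        have "0 < \<mu> / real m" using s(2) mN by simp
        then show ?thesis using hJ by blast
      qed
      have J0: "0 \<le> J" unfolding J_def using h0 by (intro Bochner_Integration.integral_nonneg) simp
      define Y where "Y = (8 / c1\<^sup>2) / t\<^sup>2"
      \<comment> \<open>\<open>B\<close> is normalised so that \<open>\<mu> ^ Suc m * B\<close> is the error term of order \<open>1 / t\<^sup>2\<close>.\<close>
      define B where "B = Y / \<mu> ^ Suc m"
      have nab: "norm (nabla m s f' t) \<le> \<bar>s\<bar> ^ k * ((1 + \<mu> * \<bar>s\<bar>)\<^sup>2 * J)" if st: "real m * \<bar>s\<bar> \<le> t / 2" for s
      proof -
        obtain b where b: "\<And>s G t. nabla m s G t = (\<Sum>l\<le>m. b l *\<^sub>R G (t - real l * s))"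
          using nabla_sum[of m] by blast
        have "f' (t - real l * s) = iter_primitive cs g (t - real l * s)" if "l \<le> m" for l
        proof -
          have "\<bar>real l * s\<bar> \<le> real m * \<bar>s\<bar>" using that by (simp add: abs_mult mult_right_mono)
          then have "0 \<le> t - real l * s" using st s(5) by linarith
          then show ?thesis by (simp add: f'_def)
        qed
        then have "nabla m s f' t = nabla m s (iter_primitive cs g) t" unfolding b by (intro sum.cong) auto
        also have "norm \<dots> \<le> \<bar>s\<bar> ^ k * (\<integral>v. indicator {t - real m * \<bar>s\<bar>..t + real m * \<bar>s\<bar>} v * h v \<partial>lborel)"
          unfolding m_def
          by (rule nabla_iter_primitive_bound[OF a(2) hi[rule_format] h0[rule_format] gh])
            (use cs(1) st s(5) in \<open>auto simp: m_def\<close>)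
        also have "(\<integral>v. indicator {t - real m * \<bar>s\<bar>..t + real m * \<bar>s\<bar>} v * h v \<partial>lborel)
            \<le> (\<integral>v. (1 + \<mu> * \<bar>s\<bar>)\<^sup>2 * (h v / (1 + \<mu> / real m * \<bar>t - v\<bar>)\<^sup>2) \<partial>lborel)"
        proof (rule integral_mono')
          show "integrable lborel (\<lambda>v. (1 + \<mu> * \<bar>s\<bar>)\<^sup>2 * (h v / (1 + \<mu> / real m * \<bar>t - v\<bar>)\<^sup>2))"
            by (rule integrable_mult_right[OF hJ'])
          show "0 \<le> (1 + \<mu> * \<bar>s\<bar>)\<^sup>2 * (h v / (1 + \<mu> / real m * \<bar>t - v\<bar>)\<^sup>2)" for v using h0 by simp
          show "indicator {t - real m * \<bar>s\<bar>..t + real m * \<bar>s\<bar>} v * h v \<le> (1 + \<mu> * \<bar>s\<bar>)\<^sup>2 * (h v / (1 + \<mu> / real m * \<bar>t - v\<bar>)\<^sup>2)" for v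
          proof (cases "v \<in> {t - real m * \<bar>s\<bar>..t + real m * \<bar>s\<bar>}")
            case True
            then have "\<bar>t - v\<bar> \<le> real m * \<bar>s\<bar>" by auto
            then have "\<mu> / real m * \<bar>t - v\<bar> \<le> \<mu> / real m * (real m * \<bar>s\<bar>)" using s(2) by (intro mult_left_mono) auto
            then have "1 + \<mu> / real m * \<bar>t - v\<bar> \<le> 1 + \<mu> * \<bar>s\<bar>" using mN by simp
            moreover have "0 \<le> \<mu> / real m * \<bar>t - v\<bar>" using s(2) by simp
            ultimately have q: "(1 + \<mu> / real m * \<bar>t - v\<bar>)\<^sup>2 \<le> (1 + \<mu> * \<bar>s\<bar>)\<^sup>2" "0 < (1 + \<mu> / real m * \<bar>t - v\<bar>)\<^sup>2"
              by (auto intro!: power_mono)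
            have "h v * (1 + \<mu> / real m * \<bar>t - v\<bar>)\<^sup>2 \<le> h v * (1 + \<mu> * \<bar>s\<bar>)\<^sup>2" using q h0 by (intro mult_left_mono) auto
            then show ?thesis using True q(2) by (simp add: pos_le_divide_eq mult.commute)
          qed (use h0 in simp)
        qed
        also have "\<dots> = (1 + \<mu> * \<bar>s\<bar>)\<^sup>2 * J" unfolding J_def by (rule integral_mult_right_zero)
        finally show ?thesis by (simp add: mult_left_mono)
      qed
      have low: "norm (\<integral>r. f' r * (complex_of_real (sinc (\<mu> / real l * (t - r))) ^ N * bessel_kernel (R * M R / 4) (real l * (2 * M R)) (t - r)) \<partial>lborel) \<le> B"
        if l: "l \<in> {1..m}" for l
      proof -
        have l1: "1 \<le> real l" using l by simp
        have t0: "0 \<le> t" using s(5) by linarith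
        have "norm (\<integral>r. f' r * (complex_of_real (sinc (\<mu> / real l * (t - r))) ^ N * bessel_kernel (R * M R / 4) (real l * (2 * M R)) (t - r)) \<partial>lborel)
            \<le> 4 * K R * ((R * M R / 4) * exp (- t / (real l * (2 * M R))) + exp (- cosh (R * M R / 4) / 2))"
        proof (rule low_frequency_bound[where d="1 / M R" and R=R])
          show "integrable lborel (\<lambda>r. exp (- \<sigma> * r) *\<^sub>R f' r)" if "0 < \<sigma>" for \<sigma>
            by (rule growth_integrable(1)[OF f'm f'0 f'b that])
          show "integrable lborel (\<lambda>r. f' r * complex_of_real (sinc (\<mu> / real l * (t - r))) ^ N)"
            by (rule growth_integrable(2)[OF f'm f'0 f'b _ t0]) (use s(2) l1 in \<open>auto simp: N_def m_def\<close>)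
          have sub: "- 1 / M \<bar>Im z\<bar> < Re z" if "- (1 / M R) < Re z" "\<bar>Im z\<bar> < R" for z
          proof -
            have "M \<bar>Im z\<bar> \<le> M R" using that s(1) by (intro mono_onD[OF M(2)]) auto
            moreover have "2 \<le> M \<bar>Im z\<bar>" using M(3) by simp
            ultimately have "1 / M R \<le> 1 / M \<bar>Im z\<bar>" by (intro divide_left_mono) auto
            then show ?thesis using that by simp
          qed
          show "F holomorphic_on {z. - (1 / M R) < Re z \<and> \<bar>Im z\<bar> < R}"
            by (rule holomorphic_on_subset[OF F(1)]) (use sub in auto)
          show "norm (F z) \<le> K R" if "- (1 / M R) < Re z" "Re z < 0" "\<bar>Im z\<bar> < R" for z
          proof -
            have "z \<in> Omega M" using sub[of z] that by (simp add: Omega_def)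
            then have "norm (F z) \<le> K \<bar>Im z\<bar>" using F(2) by blast
            also have "\<dots> \<le> K R" using that s(1) by (intro mono_onD[OF K(2)]) auto
            finally show ?thesis .
          qed
          show "1 / (real l * (2 * M R)) < 1 / M R"
            using l1 MR mult_right_mono[of 1 "real l" "2 * M R"] by (intro divide_strict_left_mono) auto
          show "real N * (\<mu> / real l) + R * M R / 4 / (real l * (2 * M R)) < R"
          proof -
            have "real N * (\<mu> / real l) = (R / 4) / real l" using mN by (simp add: \<mu>_def)
            also have "\<dots> \<le> (R / 4) / 1" using l1 s(1) by (intro divide_left_mono) auto
            finally have 1: "real N * (\<mu> / real l) \<le> R / 4" by simp
            have "R * M R / 4 / (real l * (2 * M R)) = (R / 8) / real l" using MR by simp
            also have "\<dots> \<le> (R / 8) / 1" using l1 s(1) by (intro divide_left_mono) auto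
            finally show ?thesis using 1 s(1) by linarith
          qed
        qed (use f'm f'0 lap MR l1 s t0 in auto)
        also have "\<dots> \<le> B"
        proof -
          have "\<mu> ^ Suc m * (4 * K R * ((R * M R / 4) * exp (- t / (real l * (2 * M R))) + exp (- cosh (R * M R / 4) / 2))) \<le> Y"
            using sel' l unfolding \<mu>_def Y_def by blast
          then show ?thesis using s(2) unfolding B_def by (subst pos_le_divide_eq) (auto simp: mult.commute simp del: power_Suc)
        qed
        finally show ?thesis .
      qed
      have "\<mu> ^ m * norm (f' t) \<le> C * (\<mu> * J + \<mu> ^ Suc m * B + (G * Ch) / t\<^sup>2)"
        by (rule point[rule_format, where U="R * M R / 4" and \<alpha>="2 * M R"])
          (use f'm f'0 f'b GCh s MR J0 nab low in auto)
      also have "\<mu> ^ Suc m * B = Y" using s(2) by (simp add: B_def)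
      finally have e: "\<mu> ^ m * norm (f' t) \<le> C * (\<mu> * J + Y + (G * Ch) / t\<^sup>2)" .
      have "weight NK (c1 * t) ^ m * norm (f' t) \<le> (4 * real N * \<mu>) ^ m * norm (f' t)"
      proof (intro mult_right_mono power_mono)
        show "weight NK (c1 * t) \<le> 4 * real N * \<mu>" using s(6) mN by (simp add: \<mu>_def)
        show "0 \<le> weight NK (c1 * t)"
          using weight_ge_1[OF scale_selection(2-4)[OF M K KM dexp mN], of "c1 * t"] by (simp add: NK_def)
      qed simp
      also have "\<dots> = (4 * real N) ^ m * (\<mu> ^ m * norm (f' t))" by (simp add: power_mult_distrib)
      also have "\<dots> \<le> (4 * real N) ^ m * (C * (\<mu> * J + Y + (G * Ch) / t\<^sup>2))" by (intro mult_left_mono e) simp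
      also have "\<dots> \<le> (4 * real N) ^ m * (C * ((1 + 8 / c1\<^sup>2 + G) * (\<mu> * J + (1 + Ch) / t\<^sup>2)))"
      proof (intro mult_left_mono C)
        define x y where "x = 8 / c1\<^sup>2" and "y = 1 / t\<^sup>2"
        have xy: "0 \<le> x" "0 \<le> y" "0 \<le> \<mu> * J" using s(2) J0 by (auto simp: x_def y_def)
        have "\<mu> * J + x * y + G * Ch * y \<le> (1 + x + G) * (\<mu> * J + (1 + Ch) * y)"
        proof -
          have "0 \<le> x * (\<mu> * J)" "0 \<le> G * (\<mu> * J)" "0 \<le> Ch * y" "0 \<le> x * Ch * y" "0 \<le> G * y" "0 \<le> y"
            using xy G(1) Ch(1) by simp_all
          then show ?thesis by (simp add: algebra_simps)
        qed
        then show "\<mu> * J + Y + G * Ch / t\<^sup>2 \<le> (1 + 8 / c1\<^sup>2 + G) * (\<mu> * J + (1 + Ch) / t\<^sup>2)"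
          by (simp add: x_def y_def Y_def)
      qed simp
      also have "\<dots> = C' * (\<mu> * J + (1 + Ch) / t\<^sup>2)" by (simp add: C'_def mult.assoc)
      finally show ?thesis unfolding J_def \<mu> .
    qed
    show ?thesis using cs(2)
    proof eventually_elim
      case (elim t)
      show ?case
      proof
        assume t: "T0 \<le> t"
        have "(1::real) \<le> 2 ^ n0" by (rule one_le_power) simp
        then have "0 < t" using t unfolding T0_def by linarith
        then have "f t = f' t" using elim by (simp add: f'_def)
        then show "weight NK (c1 * t) ^ m * norm (f t)
          \<le> C' * (\<kappa> t * (\<integral>v. h v / (1 + \<kappa> t / real m * \<bar>t - v\<bar>)\<^sup>2 \<partial>lborel) + (1 + Ch) / t\<^sup>2)" using main[OF t] by simp
      qed
    qed
  qed
  have "1 \<le> \<kappa> t" if "T0 \<le> t" for t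
    unfolding \<kappa>R using sel[rule_format, OF block[OF that] refl] by blast
  moreover have "0 \<le> C'" using C G(1) by (simp add: C'_def)
  moreover have "1 \<le> T0" unfolding T0_def by (rule one_le_power) simp
  ultimately show ?thesis
    using c1 est unfolding \<kappa>_def NK_def by (intro exI[of _ c1] exI[of _ T0] exI[of _ C']) blast
qed

section \<open>Averages at a dyadic scale\<close>

lemma shifted_kernel_integral:
  fixes \<kappa> a t :: real
  assumes "0 < \<kappa>" "0 < a"
  shows "integrable lborel (\<lambda>v. \<kappa> / (1 + \<kappa> / a * \<bar>t - v\<bar>)\<^sup>2)" "(\<integral>v. \<kappa> / (1 + \<kappa> / a * \<bar>t - v\<bar>)\<^sup>2 \<partial>lborel) = 2 * a"
proof -
  have ka: "0 < \<kappa> / a" using assms by simp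
  have "integrable lborel (\<lambda>v. \<kappa> * (1 / (1 + \<kappa> / a * \<bar>t + (-1) * v\<bar>)\<^sup>2))"
    by (intro integrable_mult_right lborel_integrable_real_affine[OF integral_inverse_square(1)[OF ka]]) simp
  then show "integrable lborel (\<lambda>v. \<kappa> / (1 + \<kappa> / a * \<bar>t - v\<bar>)\<^sup>2)" by simp
  have "2 / (\<kappa> / a) = \<bar>-1\<bar> *\<^sub>R (\<integral>v. 1 / (1 + \<kappa> / a * \<bar>t + (-1) * v\<bar>)\<^sup>2 \<partial>lborel)"
    unfolding integral_inverse_square(2)[OF ka, symmetric] by (rule lborel_integral_real_affine) simp
  then have "(\<integral>v. 1 / (1 + \<kappa> / a * \<bar>t - v\<bar>)\<^sup>2 \<partial>lborel) = 2 * a / \<kappa>" by simp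
  moreover have "(\<integral>v. \<kappa> * (1 / (1 + \<kappa> / a * \<bar>t - v\<bar>)\<^sup>2) \<partial>lborel) = \<kappa> * (\<integral>v. 1 / (1 + \<kappa> / a * \<bar>t - v\<bar>)\<^sup>2 \<partial>lborel)"
    by (rule integral_mult_right_zero)
  ultimately show "(\<integral>v. \<kappa> / (1 + \<kappa> / a * \<bar>t - v\<bar>)\<^sup>2 \<partial>lborel) = 2 * a" using assms by simp
qed

text \<open>
  A substitute for Hoelder's inequality: integrating \<open>h \<le> x + x powr (1 - p) h powr p\<close> against \<open>k\<close>
  and choosing \<open>x powr p\<close> to be the integral
  of \<open>h powr p * k\<close> costs only the constant \<open>(b + 1) powr p\<close>.
\<close>

lemma powr_average_le:
  fixes h k :: "real \<Rightarrow> real" and p b :: real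
  assumes p: "1 \<le> p" and h: "\<And>v. 0 \<le> h v" and k: "\<And>v. 0 \<le> k v" "integrable lborel k" "(\<integral>v. k v \<partial>lborel) = b"
    and hk: "integrable lborel (\<lambda>v. h v * k v)" "integrable lborel (\<lambda>v. h v powr p * k v)"
  shows "(\<integral>v. h v * k v \<partial>lborel) powr p \<le> (b + 1) powr p * (\<integral>v. h v powr p * k v \<partial>lborel)"
proof -
  define J Q where "J = (\<integral>v. h v * k v \<partial>lborel)" and "Q = (\<integral>v. h v powr p * k v \<partial>lborel)"
  have J0: "0 \<le> J" and Q0: "0 \<le> Q" and b0: "0 \<le> b"
    unfolding J_def Q_def k(3)[symmetric] using h k(1) by (auto intro!: Bochner_Integration.integral_nonneg)
  have key: "J \<le> x * b + x powr (1 - p) * Q" if x: "0 < x" for x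
  proof -
    have "J \<le> (\<integral>v. x * k v + x powr (1 - p) * (h v powr p * k v) \<partial>lborel)"
      unfolding J_def
    proof (rule integral_mono[OF hk(1)])
      show "integrable lborel (\<lambda>v. x * k v + x powr (1 - p) * (h v powr p * k v))"
        by (intro Bochner_Integration.integrable_add integrable_mult_right k hk)
      fix v
      have "h v \<le> x + x powr (1 - p) * h v powr p"
      proof (cases "h v \<le> x")
        case False
        then have "h v powr (1 - p) \<le> x powr (1 - p)" using x p by (intro powr_mono2') auto
        then have "h v powr p * h v powr (1 - p) \<le> h v powr p * x powr (1 - p)" by (intro mult_left_mono) auto
        also have "h v powr p * h v powr (1 - p) = h v" using False x by (simp add: powr_add[symmetric])
        finally show ?thesis using x by (simp add: mult.commute)
      qed (simp add: add_increasing2)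
      then show "h v * k v \<le> x * k v + x powr (1 - p) * (h v powr p * k v)"
        using mult_right_mono[OF _ k(1)[of v], of "h v" "x + x powr (1 - p) * h v powr p"] by (simp add: algebra_simps)
    qed
    also have "\<dots> = x * b + x powr (1 - p) * Q"
      unfolding Q_def k(3)[symmetric] using k(2) hk(2)
      by (subst Bochner_Integration.integral_add) (auto intro!: integrable_mult_right)
    finally show ?thesis .
  qed
  show ?thesis
  proof (cases "Q = 0")
    case True
    have "J \<le> 0"
    proof (rule field_le_epsilon)
      fix e :: real assume e: "0 < e"
      have "J \<le> (e / (b + 1)) * b" using key[of "e / (b + 1)"] True e b0 by simp
      also have "\<dots> \<le> e" using e b0 by (simp add: field_simps)
      finally show "J \<le> 0 + e" by simp
    qed
    then show ?thesis using J0 True unfolding J_def Q_def by simp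
  next
    case False
    then have Qp: "0 < Q" using Q0 by simp
    define x where "x = Q powr (1 / p)"
    have x: "0 < x" using Qp by (simp add: x_def)
    have "x powr (1 - p) * Q = x powr (1 - p) * x powr p" using p Qp by (simp add: x_def powr_powr)
    also have "\<dots> = x" using x by (simp add: powr_add[symmetric])
    finally have "J \<le> (b + 1) * x" using key[OF x] by (simp add: algebra_simps)
    then have "J powr p \<le> ((b + 1) * x) powr p" using J0 p by (intro powr_mono2) auto
    also have "\<dots> = (b + 1) powr p * Q" using b0 x p Qp by (simp add: powr_mult x_def powr_powr)
    finally show ?thesis unfolding J_def Q_def .
  qed
qed

lemma dyadic_index_near:
  fixes t v :: real
  assumes "1 \<le> t" "t / 2 < v" "v < 2 * t"
  defines "n \<equiv> \<lambda>t. nat \<lfloor>log 2 t\<rfloor>"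
  shows "n t \<in> {n v - 1, n v, Suc (n v)}"
proof -
  have v0: "0 < v" using assms by linarith
  have "log 2 (t / 2) < log 2 v" "log 2 v < log 2 (2 * t)" using assms v0 by auto
  then have "log 2 t - 1 < log 2 v" "log 2 v < 1 + log 2 t"
    using assms(1) by (auto simp: log_divide log_mult)
  then have "\<lfloor>log 2 t\<rfloor> - 1 \<le> \<lfloor>log 2 v\<rfloor>" "\<lfloor>log 2 v\<rfloor> \<le> \<lfloor>log 2 t\<rfloor> + 1" by linarith+
  moreover have "0 \<le> \<lfloor>log 2 t\<rfloor>" using assms(1) by simp
  ultimately show ?thesis unfolding n_def by auto
qed

text \<open>
  Schur's test in the variable \<open>t\<close>, where the scale varies. If \<open>\<bar>t - v\<bar> < t / 2\<close>, then \<open>t\<close> lies in one of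
  three dyadic blocks determined by \<open>v\<close>, on each of which the kernel has a fixed scale and mass
  \<open>2 a\<close>. Otherwise the kernel is at most \<open>4 a\<^sup>2 / t\<^sup>2\<close>, because the scale is at least 1.
\<close>

lemma dyadic_kernel_mass:
  fixes W :: "real \<Rightarrow> real" and a c T0 :: real
  assumes W: "\<And>x. 1 \<le> W x" and N: "1 \<le> N" and a: "0 < a" and T0: "1 \<le> T0"
    and one: "\<And>t. T0 \<le> t \<Longrightarrow> 1 \<le> dyadic_scale W c N t"
  shows "(\<integral>\<^sup>+t. ennreal (indicator {T0..} t * (dyadic_scale W c N t / (1 + dyadic_scale W c N t / a * \<bar>t - v\<bar>)\<^sup>2)) \<partial>lborel)
    \<le> ennreal (128 * a\<^sup>2 + 6 * a)"
proof -
  define \<kappa> where "\<kappa> t = dyadic_scale W c N t" for t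
  define n where "n t = nat \<lfloor>log 2 t\<rfloor>" for t :: real
  define \<mu> where "\<mu> j = W (c * 2 ^ Suc j) / (4 * real N)" for j
  have \<mu>0: "0 < \<mu> j" for j using W[of "c * 2 ^ Suc j"] N by (simp add: \<mu>_def)
  have \<kappa>\<mu>: "\<kappa> t = \<mu> (n t)" for t by (simp add: \<kappa>_def \<mu>_def n_def dyadic_scale_def)
  define e where "e j t = \<mu> j / (1 + \<mu> j / a * \<bar>t - v\<bar>)\<^sup>2" for j t
  have e0: "0 \<le> e j t" for j t using \<mu>0[of j] by (simp add: e_def)
  have e: "integrable lborel (e j)" "(\<integral>t. e j t \<partial>lborel) = 2 * a" for j
    using shifted_kernel_integral[OF \<mu>0[of j] a, of v] by (simp_all add: e_def[abs_def] abs_minus_commute)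
  define d where "d t = 64 * a\<^sup>2 * (1 / (1 + 1 * \<bar>t\<bar>)\<^sup>2)" for t :: real
  have d: "integrable lborel d" "(\<integral>t. d t \<partial>lborel) = 128 * a\<^sup>2"
  proof -
    show "integrable lborel d"
      unfolding d_def[abs_def] by (intro integrable_mult_right integral_inverse_square) simp
    have "(\<integral>t. d t \<partial>lborel) = 64 * a\<^sup>2 * (\<integral>t. 1 / (1 + 1 * \<bar>t\<bar>)\<^sup>2 \<partial>(lborel :: real measure))"
      unfolding d_def by (rule integral_mult_right_zero)
    also have "\<dots> = 64 * a\<^sup>2 * 2" by (subst integral_inverse_square(2)) auto
    finally show "(\<integral>t. d t \<partial>lborel) = 128 * a\<^sup>2" by simp
  qed
  define E where "E t = d t + (e (n v - 1) t + e (n v) t + e (Suc (n v)) t)" for t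
  have EI: "has_bochner_integral lborel E (128 * a\<^sup>2 + (2 * a + 2 * a + 2 * a))"
    unfolding E_def using d e by (intro has_bochner_integral_add) (auto simp: has_bochner_integral_iff)
  have d0: "0 \<le> d t" for t by (simp add: d_def)
  have bound: "indicator {T0..} t * (\<kappa> t / (1 + \<kappa> t / a * \<bar>t - v\<bar>)\<^sup>2) \<le> E t" for t
  proof (cases "T0 \<le> t")
    case True
    have t1: "1 \<le> t" using True T0 by simp
    have k1: "1 \<le> \<kappa> t" using one[OF True] by (simp add: \<kappa>_def)
    show ?thesis
    proof (cases "\<bar>t - v\<bar> < t / 2")
      case near: True
      then have "t / 2 < v" "v < 2 * t" using t1 by linarith+
      then have "n t \<in> {n v - 1, n v, Suc (n v)}" unfolding n_def by (rule dyadic_index_near[OF t1])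
      then have "e (n t) t \<le> e (n v - 1) t + e (n v) t + e (Suc (n v)) t"
        using e0[of "n v - 1" t] e0[of "n v" t] e0[of "Suc (n v)" t] by auto
      then show ?thesis using True d0[of t] by (simp add: E_def e_def \<kappa>\<mu>)
    next
      case far: False
      have "\<kappa> t / a * (t / 2) \<le> 1 + \<kappa> t / a * \<bar>t - v\<bar>"
        using far k1 a by (intro add_increasing mult_left_mono) auto
      then have "(\<kappa> t / a * (t / 2))\<^sup>2 \<le> (1 + \<kappa> t / a * \<bar>t - v\<bar>)\<^sup>2" using k1 a t1 by (intro power_mono) auto
      then have "\<kappa> t / (1 + \<kappa> t / a * \<bar>t - v\<bar>)\<^sup>2 \<le> \<kappa> t / (\<kappa> t / a * (t / 2))\<^sup>2"
        using k1 a t1 by (intro divide_left_mono mult_pos_pos zero_less_power) (auto intro: add_pos_nonneg)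
      also have "\<dots> = (4 * a\<^sup>2 / t\<^sup>2) * (1 / \<kappa> t)" using k1 a t1 by (simp add: power2_eq_square field_simps)
      also have "\<dots> \<le> (4 * a\<^sup>2 / t\<^sup>2) * 1" using k1 by (intro mult_left_mono) auto
      also have "\<dots> \<le> d t"
      proof -
        have "(1 + t)\<^sup>2 \<le> (4 * t)\<^sup>2" using t1 by (intro power_mono) auto
        then have "1 / (4 * t)\<^sup>2 \<le> 1 / (1 + t)\<^sup>2" using t1 by (intro divide_left_mono) auto
        then have "64 * a\<^sup>2 * (1 / (4 * t)\<^sup>2) \<le> 64 * a\<^sup>2 * (1 / (1 + t)\<^sup>2)" by (rule mult_left_mono) simp
        then show ?thesis using t1 by (simp add: d_def power_mult_distrib)
      qed
      finally show ?thesis using True e0[of "n v - 1" t] e0[of "n v" t] e0[of "Suc (n v)" t] by (simp add: E_def)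
    qed
  next
    case False
    then show ?thesis using d0[of t] e0[of "n v - 1" t] e0[of "n v" t] e0[of "Suc (n v)" t] by (simp add: E_def)
  qed
  have "(\<integral>\<^sup>+t. ennreal (indicator {T0..} t * (\<kappa> t / (1 + \<kappa> t / a * \<bar>t - v\<bar>)\<^sup>2)) \<partial>lborel) \<le> (\<integral>\<^sup>+t. ennreal (E t) \<partial>lborel)"
    by (intro nn_integral_mono ennreal_leI bound)
  also have "\<dots> = ennreal (\<integral>t. E t \<partial>lborel)"
  proof (rule nn_integral_eq_integral)
    show "integrable lborel E" using EI by (simp add: has_bochner_integral_iff)
    show "AE t in lborel. 0 \<le> E t" unfolding E_def using d0 e0 by (intro AE_I2 add_nonneg_nonneg)
  qed
  also have "(\<integral>t. E t \<partial>lborel) = 128 * a\<^sup>2 + 6 * a" using EI by (simp add: has_bochner_integral_iff)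
  finally show ?thesis by (simp add: \<kappa>_def)
qed

lemma dyadic_scale_measurable:
  assumes "mono W"
  shows "dyadic_scale W c N \<in> borel_measurable borel"
proof -
  have [measurable]: "W \<in> borel_measurable borel" using assms by (rule borel_measurable_mono)
  show ?thesis unfolding dyadic_scale_def[abs_def] by measurable
qed

lemma Lp_kernel_integrable:
  fixes h :: "real \<Rightarrow> real" and p \<kappa> a t :: real
  assumes p: "1 \<le> p" and hm: "h \<in> borel_measurable borel" and h: "\<And>v. 0 \<le> h v"
    and hp: "(\<integral>\<^sup>+v. ennreal (h v powr p) \<partial>lborel) < \<infinity>" and k: "0 < \<kappa>" "0 < a"
  shows "integrable lborel (\<lambda>v. h v powr p * (\<kappa> / (1 + \<kappa> / a * \<bar>t - v\<bar>)\<^sup>2))"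
    and "integrable lborel (\<lambda>v. h v * (\<kappa> / (1 + \<kappa> / a * \<bar>t - v\<bar>)\<^sup>2))"
proof -
  note [measurable] = hm
  define w where "w v = \<kappa> / (1 + \<kappa> / a * \<bar>t - v\<bar>)\<^sup>2" for v
  have [measurable]: "w \<in> borel_measurable borel" unfolding w_def[abs_def] by measurable
  have w: "0 \<le> w v" "w v \<le> \<kappa>" for v
  proof -
    have D: "1 \<le> (1 + \<kappa> / a * \<bar>t - v\<bar>)\<^sup>2" using k by (intro one_le_power) auto
    then have "0 < (1 + \<kappa> / a * \<bar>t - v\<bar>)\<^sup>2 * 1" by linarith
    with D have "\<kappa> / (1 + \<kappa> / a * \<bar>t - v\<bar>)\<^sup>2 \<le> \<kappa> / 1" using k by (intro divide_left_mono) auto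
    then show "0 \<le> w v" "w v \<le> \<kappa>" using k by (auto simp: w_def)
  qed
  have wi: "integrable lborel w" unfolding w_def[abs_def] by (rule shifted_kernel_integral(1)[OF k])
  have hpi: "integrable lborel (\<lambda>v. h v powr p)"
    by (rule integrableI_bounded) (use hp in auto)
  have i1: "integrable lborel (\<lambda>v. h v powr p * w v)"
  proof (rule Bochner_Integration.integrable_bound)
    show "integrable lborel (\<lambda>v. \<kappa> * h v powr p)" by (rule integrable_mult_right[OF hpi])
    have "norm (h v powr p * w v) \<le> norm (\<kappa> * h v powr p)" for v
      using mult_left_mono[OF w(2)[of v], of "h v powr p"] w(1)[of v] k by (simp add: abs_mult mult.commute)
    then show "AE v in lborel. norm (h v powr p * w v) \<le> norm (\<kappa> * h v powr p)" by simp
  qed measurable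
  have i2: "integrable lborel (\<lambda>v. h v * w v)"
  proof (rule Bochner_Integration.integrable_bound)
    show "integrable lborel (\<lambda>v. w v + h v powr p * w v)" by (intro Bochner_Integration.integrable_add wi i1)
    have "norm (h v * w v) \<le> norm (w v + h v powr p * w v)" for v
    proof -
      have "h v \<le> 1 + h v powr p"
      proof (cases "h v \<le> 1")
        case False
        then have "h v powr 1 \<le> h v powr p" using p by (intro powr_mono) auto
        then show ?thesis using False by simp
      qed (simp add: add_increasing2)
      then have "h v * w v \<le> (1 + h v powr p) * w v" using w by (intro mult_right_mono)
      then show ?thesis using h[of v] w(1)[of v] by (simp add: algebra_simps)
    qed
    then show "AE v in lborel. norm (h v * w v) \<le> norm (w v + h v powr p * w v)" by simp
  qed measurable
  show "integrable lborel (\<lambda>v. h v powr p * (\<kappa> / (1 + \<kappa> / a * \<bar>t - v\<bar>)\<^sup>2))"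
    and "integrable lborel (\<lambda>v. h v * (\<kappa> / (1 + \<kappa> / a * \<bar>t - v\<bar>)\<^sup>2))" using i1 i2 by (simp_all add: w_def[abs_def])
qed

text \<open>
  Averaging in \<open>v\<close> costs a constant by \<open>powr_average_le\<close>, and integrating in \<open>t\<close> costs another one by
  \<open>dyadic_kernel_mass\<close>. 
\<close>

lemma dyadic_convolution_Lp:
  fixes W h :: "real \<Rightarrow> real" and a c T0 p :: real
  assumes W: "\<And>x. 1 \<le> W x" "mono W" and N: "1 \<le> N" and a: "0 < a" and T0: "1 \<le> T0"
    and one: "\<And>t. T0 \<le> t \<Longrightarrow> 1 \<le> dyadic_scale W c N t"
    and p: "1 \<le> p" and hm: "h \<in> borel_measurable borel" and h: "\<And>v. 0 \<le> h v"
    and hp: "(\<integral>\<^sup>+v. ennreal (h v powr p) \<partial>lborel) < \<infinity>"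
  shows "(\<integral>\<^sup>+t. ennreal (indicator {T0..} t * (dyadic_scale W c N t * (\<integral>v. h v / (1 + dyadic_scale W c N t / a * \<bar>t - v\<bar>)\<^sup>2 \<partial>lborel)) powr p) \<partial>lborel) < \<infinity>"
proof -
  note [measurable] = hm
  define \<kappa> where "\<kappa> t = dyadic_scale W c N t" for t
  have [measurable]: "\<kappa> \<in> borel_measurable borel" unfolding \<kappa>_def[abs_def] by (rule dyadic_scale_measurable[OF W(2)])
  define w where "w t v = \<kappa> t / (1 + \<kappa> t / a * \<bar>t - v\<bar>)\<^sup>2" for t v
  have [measurable]: "(\<lambda>(t, v). w t v) \<in> borel_measurable (borel \<Otimes>\<^sub>M borel)"
    unfolding w_def case_prod_beta' by measurable
  define J where "J t = \<kappa> t * (\<integral>v. h v / (1 + \<kappa> t / a * \<bar>t - v\<bar>)\<^sup>2 \<partial>lborel)" for t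
  have Jw: "J t = (\<integral>v. h v * w t v \<partial>lborel)" for t
  proof -
    have "(\<integral>v. \<kappa> t * (h v / (1 + \<kappa> t / a * \<bar>t - v\<bar>)\<^sup>2) \<partial>lborel) = J t"
      unfolding J_def by (rule integral_mult_right_zero)
    then show ?thesis by (simp add: w_def mult.commute)
  qed
  have pt: "ennreal (indicator {T0..} t * J t powr p)
      \<le> ennreal ((2 * a + 1) powr p) * (\<integral>\<^sup>+v. ennreal (h v powr p) * ennreal (indicator {T0..} t * w t v) \<partial>lborel)" for t
  proof (cases "T0 \<le> t")
    case True
    have k: "0 < \<kappa> t" using one[OF True] by (simp add: \<kappa>_def)
    have w0: "0 \<le> w t v" for v using k by (simp add: w_def)
    have i: "integrable lborel (\<lambda>v. h v powr p * w t v)" "integrable lborel (\<lambda>v. h v * w t v)"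
      unfolding w_def using Lp_kernel_integrable[OF p hm h hp k a] by auto
    have "J t powr p \<le> (2 * a + 1) powr p * (\<integral>v. h v powr p * w t v \<partial>lborel)"
      unfolding Jw using shifted_kernel_integral[OF k a, of t] i
      by (intro powr_average_le[OF p h w0]) (simp_all add: w_def[abs_def])
    then have "ennreal (J t powr p) \<le> ennreal ((2 * a + 1) powr p) * ennreal (\<integral>v. h v powr p * w t v \<partial>lborel)"
      by (simp add: ennreal_mult'[symmetric] ennreal_leI)
    also have "ennreal (\<integral>v. h v powr p * w t v \<partial>lborel) = (\<integral>\<^sup>+v. ennreal (h v powr p * w t v) \<partial>lborel)"
      by (rule nn_integral_eq_integral[OF i(1), symmetric]) (use w0 in simp)
    finally show ?thesis using True w0 by (simp add: ennreal_mult)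
  qed simp
  have "(\<integral>\<^sup>+t. ennreal (indicator {T0..} t * J t powr p) \<partial>lborel)
      \<le> (\<integral>\<^sup>+t. ennreal ((2 * a + 1) powr p) * (\<integral>\<^sup>+v. ennreal (h v powr p) * ennreal (indicator {T0..} t * w t v) \<partial>lborel) \<partial>lborel)"
    by (intro nn_integral_mono pt)
  also have "\<dots> = ennreal ((2 * a + 1) powr p) * (\<integral>\<^sup>+t. (\<integral>\<^sup>+v. ennreal (h v powr p) * ennreal (indicator {T0..} t * w t v) \<partial>lborel) \<partial>lborel)"
    by (rule nn_integral_cmult) measurable
  also have "(\<integral>\<^sup>+t. (\<integral>\<^sup>+v. ennreal (h v powr p) * ennreal (indicator {T0..} t * w t v) \<partial>lborel) \<partial>lborel)
      = (\<integral>\<^sup>+v. (\<integral>\<^sup>+t. ennreal (h v powr p) * ennreal (indicator {T0..} t * w t v) \<partial>lborel) \<partial>lborel)"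
    by (rule lborel_pair.Fubini') measurable
  also have "\<dots> = (\<integral>\<^sup>+v. ennreal (h v powr p) * (\<integral>\<^sup>+t. ennreal (indicator {T0..} t * w t v) \<partial>lborel) \<partial>lborel)"
    by (intro nn_integral_cong nn_integral_cmult) measurable
  also have "\<dots> \<le> (\<integral>\<^sup>+v. ennreal (h v powr p) * ennreal (128 * a\<^sup>2 + 6 * a) \<partial>lborel)"
    unfolding w_def \<kappa>_def by (intro nn_integral_mono mult_left_mono dyadic_kernel_mass[OF W(1) N a T0 one]) auto
  also have "\<dots> = (\<integral>\<^sup>+v. ennreal (h v powr p) \<partial>lborel) * ennreal (128 * a\<^sup>2 + 6 * a)"
    by (rule nn_integral_multc) measurable
  also have "ennreal ((2 * a + 1) powr p) * \<dots> < \<infinity>" using hp by (simp add: ennreal_mult_less_top)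
  finally show ?thesis unfolding J_def \<kappa>_def by (simp add: mult_left_mono)
qed

section \<open>From vectors to scalars\<close>

lemma strongly_measurable_lebesgue_on_iff:
  fixes f :: "real \<Rightarrow> 'b::real_normed_vector"
  assumes S: "S \<in> sets lebesgue"
  shows "strongly_measurable (lebesgue_on S) f \<longleftrightarrow> strongly_measurable lebesgue (\<lambda>t. indicator S t *\<^sub>R f t)"
proof -
  have S': "S \<inter> space lebesgue \<in> sets lebesgue" using S by simp
  show ?thesis
  proof
    assume "strongly_measurable (lebesgue_on S) f"
    then obtain s where s: "\<And>i::nat. simple_function (lebesgue_on S) (s i)" "AE t in lebesgue_on S. (\<lambda>i. s i t) \<longlonglongrightarrow> f t"
      by (auto simp: strongly_measurable_def)
    have "AE t in lebesgue. t \<in> S \<longrightarrow> (\<lambda>i. s i t) \<longlonglongrightarrow> f t" using s(2) unfolding AE_restrict_space_iff[OF S'] .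
    then have "AE t in lebesgue. (\<lambda>i. indicator S t *\<^sub>R s i t) \<longlonglongrightarrow> indicator S t *\<^sub>R f t"
      by eventually_elim (auto simp: indicator_def)
    moreover have "simple_function lebesgue (\<lambda>t. indicator S t *\<^sub>R s i t)" for i
      using s(1)[of i] unfolding simple_function_restrict_space[OF S'] .
    ultimately show "strongly_measurable lebesgue (\<lambda>t. indicator S t *\<^sub>R f t)"
      unfolding strongly_measurable_def by (intro exI[of _ "\<lambda>i t. indicator S t *\<^sub>R s i t"] conjI allI)
  next
    assume "strongly_measurable lebesgue (\<lambda>t. indicator S t *\<^sub>R f t)"
    then obtain s where s: "\<And>i::nat. simple_function lebesgue (s i)" "AE t in lebesgue. (\<lambda>i. s i t) \<longlonglongrightarrow> indicator S t *\<^sub>R f t"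
      by (auto simp: strongly_measurable_def)
    have "AE t in lebesgue. t \<in> S \<longrightarrow> (\<lambda>i. s i t) \<longlonglongrightarrow> f t" using s(2) by eventually_elim auto
    then have "AE t in lebesgue_on S. (\<lambda>i. s i t) \<longlonglongrightarrow> f t" unfolding AE_restrict_space_iff[OF S'] .
    moreover have "simple_function (lebesgue_on S) (s i)" for i
      unfolding simple_function_restrict_space[OF S']
      by (rule simple_function_compose2[where h="(*\<^sub>R)", OF simple_function_indicator[OF S] s(1)])
    ultimately show "strongly_measurable (lebesgue_on S) f" unfolding strongly_measurable_def by blast
  qed
qed

text \<open>
  The approximations on the unit blocks \<open>{n..<n + 1}\<close> are glued, the \<open>i\<close>-th simple function using the
  first \<open>i\<close> blocks.
\<close>

lemma strongly_measurable_half_line: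
  fixes f :: "real \<Rightarrow> 'b::real_normed_vector"
  assumes f: "\<And>T. strongly_measurable (lebesgue_on {0..T}) f"
  shows "strongly_measurable (lebesgue_on {0..}) f"
proof -
  have "\<exists>s. (\<forall>i::nat. simple_function lebesgue (s i)) \<and> (AE t in lebesgue. (\<lambda>i. s i t) \<longlonglongrightarrow> indicator {0..real (Suc n)} t *\<^sub>R f t)" for n
    using f[of "real (Suc n)"] by (subst (asm) strongly_measurable_lebesgue_on_iff) (auto simp: strongly_measurable_def)
  then obtain s where s: "\<And>n i. simple_function lebesgue (s n i)"
    "\<And>n. AE t in lebesgue. (\<lambda>i. s n i t) \<longlonglongrightarrow> indicator {0..real (Suc n)} t *\<^sub>R f t" by metis
  define u where "u i t = (\<Sum>n<i. indicator {real n..<real (Suc n)} t *\<^sub>R s n i t)" for i :: nat and t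
  have us: "simple_function lebesgue (u i)" for i
  proof -
    have "simple_function lebesgue (\<lambda>t. \<Sum>n<j. indicator {real n..<real (Suc n)} t *\<^sub>R s n i t)" for j
    proof (induction j)
      case (Suc j)
      have "simple_function lebesgue (\<lambda>t. indicator {real j..<real (Suc j)} t *\<^sub>R s j i t)"
        by (rule simple_function_compose2[where h="(*\<^sub>R)", OF simple_function_indicator s(1)]) simp
      from simple_function_compose2[where h="(+)", OF Suc this] show ?case by simp
    qed simp
    then show ?thesis unfolding u_def[abs_def] .
  qed
  have "AE t in lebesgue. \<forall>n. (\<lambda>i. s n i t) \<longlonglongrightarrow> indicator {0..real (Suc n)} t *\<^sub>R f t"
    using s(2) by (simp add: AE_all_countable)
  then have "AE t in lebesgue. (\<lambda>i. u i t) \<longlonglongrightarrow> indicator {0..} t *\<^sub>R f t"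
  proof eventually_elim
    case (elim t)
    show ?case
    proof (cases "0 \<le> t")
      case False
      then have "u i t = 0" for i unfolding u_def by (intro sum.neutral) (auto simp: indicator_def)
      then show ?thesis using False by simp
    next
      case True
      define j where "j = nat \<lfloor>t\<rfloor>"
      have j: "real j \<le> t" "t < real (Suc j)" using True unfolding j_def by linarith+
      have "u i t = s j i t" if "j < i" for i
      proof -
        have z: "indicator {real n..<real (Suc n)} t *\<^sub>R s n i t = (if n = j then s j i t else 0)" for n
        proof (cases "n = j")
          case False
          then have "n < j \<or> j < n" by auto
          then have "t \<notin> {real n..<real (Suc n)}"
          proof
            assume "n < j"
            then have "real (Suc n) \<le> real j" by simp
            then show ?thesis using j by auto
          next
            assume "j < n"
            then have "real (Suc j) \<le> real n" by simp
            then show ?thesis using j by auto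
          qed
          then show ?thesis using False by simp
        qed (use j in auto)
        show ?thesis unfolding u_def z using that by simp
      qed
      then have "\<forall>\<^sub>F i in sequentially. s j i t = u i t"
        by (intro eventually_sequentiallyI[of "Suc j"]) auto
      moreover have "(\<lambda>i. s j i t) \<longlonglongrightarrow> indicator {0..real (Suc j)} t *\<^sub>R f t" using elim by blast
      ultimately have "(\<lambda>i. u i t) \<longlonglongrightarrow> indicator {0..real (Suc j)} t *\<^sub>R f t" by (rule Lim_transform_eventually[rotated])
      then show ?thesis using True j by simp
    qed
  qed
  then have "strongly_measurable lebesgue (\<lambda>t. indicator {0..} t *\<^sub>R f t)"
    using us unfolding strongly_measurable_def by blast
  then show ?thesis by (subst strongly_measurable_lebesgue_on_iff) auto
qed

text \<open>
  Functionals that norm the countably many values of the approximating simple functions also norm the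
  limits. A countable family allows almost-everywhere bounds of the scalar images to be combined
  into an almost-everywhere bound of the norm.
\<close>

lemma countable_norming_family:
  fixes v :: "'b \<Rightarrow> 'a::complex_banach"
  assumes "strongly_measurable M v"
  obtains \<Phi> where "countable \<Phi>" "\<Phi> \<subseteq> dual_ball"
    "AE t in M. \<forall>B. (\<forall>\<phi>\<in>\<Phi>. norm (\<phi> (v t)) \<le> B) \<longrightarrow> norm (v t) \<le> B"
proof -
  obtain s where s: "\<And>i::nat. simple_function M (s i)" "AE t in M. (\<lambda>i. s i t) \<longlonglongrightarrow> v t"
    using assms by (auto simp: strongly_measurable_def)
  have "\<exists>\<phi>. \<phi> \<in> dual_ball \<and> \<phi> x = complex_of_real (norm x)" for x :: 'a
    using norming_functional[of x] by metis
  then obtain \<nu> where \<nu>: "\<And>x::'a. \<nu> x \<in> dual_ball" "\<And>x. \<nu> x x = complex_of_real (norm x)" by metis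
  \<comment> \<open>Simple functions have finite range, so the union is countable.\<close>
  define \<Phi> where "\<Phi> = (\<Union>i. \<nu> ` (s i ` space M))"
  show ?thesis
  proof (rule that[of \<Phi>])
    have "countable (s i ` space M)" for i by (rule countable_finite[OF simple_functionD(1)[OF s(1)]])
    then show "countable \<Phi>" unfolding \<Phi>_def by auto
    show "\<Phi> \<subseteq> dual_ball" using \<nu>(1) by (auto simp: \<Phi>_def)
    show "AE t in M. \<forall>B. (\<forall>\<phi>\<in>\<Phi>. norm (\<phi> (v t)) \<le> B) \<longrightarrow> norm (v t) \<le> B"
      using s(2) AE_space
    proof eventually_elim
      case (elim t)
      show ?case
      proof (intro allI impI)
        fix B assume B: "\<forall>\<phi>\<in>\<Phi>. norm (\<phi> (v t)) \<le> B"
        have le: "norm (s i t) \<le> B + norm (s i t - v t)" for i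
        proof -
          define \<phi> where "\<phi> = \<nu> (s i t)"
          have \<phi>: "\<phi> \<in> \<Phi>" "\<phi> \<in> dual_ball" using \<nu>(1) elim(2) by (auto simp: \<phi>_def \<Phi>_def)
          have "norm (s i t) = norm (\<phi> (s i t))" using \<nu>(2)[of "s i t"] by (simp add: \<phi>_def)
          also have "\<phi> (s i t) = \<phi> (v t) + \<phi> (s i t - v t)" using dual_ballD(1)[OF \<phi>(2), of "v t" "s i t - v t"] by simp
          also have "norm \<dots> \<le> norm (\<phi> (v t)) + norm (\<phi> (s i t - v t))" by (rule norm_triangle_ineq)
          also have "\<dots> \<le> B + norm (s i t - v t)" using B \<phi> dual_ballD(3)[OF \<phi>(2)] by (intro add_mono) auto
          finally show ?thesis .
        qed
        have "(\<lambda>i. norm (s i t)) \<longlonglongrightarrow> norm (v t)" by (intro tendsto_norm elim(1))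
        moreover have "(\<lambda>i. B + norm (s i t - v t)) \<longlonglongrightarrow> B + norm (v t - v t)" by (intro tendsto_intros elim(1))
        ultimately show "norm (v t) \<le> B" using LIMSEQ_le[OF _ _ , of "\<lambda>i. norm (s i t)" "norm (v t)" "\<lambda>i. B + norm (s i t - v t)"] le by simp
      qed
    qed
  qed
qed

lemma bounded_bilinear_scaleC: "bounded_bilinear (scaleC :: complex \<Rightarrow> 'a::complex_banach \<Rightarrow> 'a)"
proof
  fix a b :: complex and x y :: 'a and r :: real
  show "(a + b) *\<^sub>C x = a *\<^sub>C x + b *\<^sub>C x" by (rule scaleC_add_left)
  show "a *\<^sub>C (x + y) = a *\<^sub>C x + a *\<^sub>C y" by (rule scaleC_add_right)
  show "(r *\<^sub>R a) *\<^sub>C x = r *\<^sub>R (a *\<^sub>C x)"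
    by (simp add: scaleR_conv_of_real scaleC_scaleC[symmetric] scaleC_of_real)
  show "a *\<^sub>C (r *\<^sub>R x) = r *\<^sub>R (a *\<^sub>C x)"
    by (simp add: scaleC_of_real[symmetric] scaleC_scaleC mult.commute)
  show "\<exists>K. \<forall>a (x::'a). norm (a *\<^sub>C x) \<le> norm a * norm x * K"
    by (intro exI[of _ 1]) (simp add: norm_scaleC)
qed

lemma borel_version_complex:
  fixes u :: "real \<Rightarrow> complex"
  assumes "u \<in> borel_measurable lebesgue"
  obtains u' where "u' \<in> borel_measurable borel" "AE t in lborel. u t = u' t"
proof -
  have "(\<lambda>t. Re (u t)) \<in> borel_measurable lebesgue" "(\<lambda>t. Im (u t)) \<in> borel_measurable lebesgue"
    using assms by measurable
  from this[THEN completion_ex_borel_measurable_real]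
  obtain a b where ab: "a \<in> borel_measurable lborel" "AE t in lborel. Re (u t) = a t"
      "b \<in> borel_measurable lborel" "AE t in lborel. Im (u t) = b t" by blast
  note [measurable] = ab(1,3)
  show ?thesis
  proof (rule that[of "\<lambda>t. complex_of_real (a t) + \<i> * complex_of_real (b t)"])
    show "(\<lambda>t. complex_of_real (a t) + \<i> * complex_of_real (b t)) \<in> borel_measurable borel"
      using ab(1,3) by simp measurable
    show "AE t in lborel. u t = complex_of_real (a t) + \<i> * complex_of_real (b t)"
      using ab(2,4) by eventually_elim (auto simp: complex_eq_iff)
  qed
qed

text \<open>
  Integrability of the products of \<open>f\<close> with test functions, which is needed before a functional can be
  moved inside the integrals of the weak derivative.
\<close>

lemma vector_integrable_compact_weight:
  fixes f :: "real \<Rightarrow> 'a::complex_banach"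
  assumes f: "strongly_measurable (lebesgue_on {0..}) f"
    and fin: "\<And>T. (\<integral>\<^sup>+t. ennreal (indicator {0..T} t * norm (f t)) \<partial>lebesgue) < \<infinity>"
    and u: "continuous_on UNIV u" "\<And>t. t \<notin> {a..b} \<Longrightarrow> u t = 0" and a: "0 < a"
  shows "vector_bochner_integrable (lebesgue_on {0<..}) (\<lambda>t. u t *\<^sub>R f t)"
proof -
  have S: "{0::real<..} \<in> sets lebesgue" "{0::real<..} \<inter> space lebesgue \<in> sets lebesgue" by auto
  have "strongly_measurable lebesgue (\<lambda>t. indicator {0..} t *\<^sub>R f t)"
    using f by (subst (asm) strongly_measurable_lebesgue_on_iff) auto
  moreover have "(\<lambda>t. indicator {0<..} t * u t) \<in> borel_measurable lebesgue"
  proof (rule measurable_completion)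
    have [measurable]: "u \<in> borel_measurable borel" using u(1) by (rule borel_measurable_continuous_onI)
    show "(\<lambda>t. indicator {0<..} t * u t) \<in> borel_measurable lborel" by measurable
  qed
  ultimately have "strongly_measurable lebesgue (\<lambda>t. (indicator {0<..} t * u t) *\<^sub>R (indicator {0..} t *\<^sub>R f t))"
    using strongly_measurable_compose2[where h="(*\<^sub>R)", OF borel_measurable_imp_strongly_measurable _ tendsto_scaleR] by blast
  moreover have "(indicator {0<..} t * u t) *\<^sub>R (indicator {0..} t *\<^sub>R f t) = indicator {0<..} t *\<^sub>R (u t *\<^sub>R f t)" for t
    by (auto simp: indicator_def)
  ultimately have "strongly_measurable lebesgue (\<lambda>t. indicator {0<..} t *\<^sub>R (u t *\<^sub>R f t))"
    by (simp only:)
  then have sm: "strongly_measurable (lebesgue_on {0<..}) (\<lambda>t. u t *\<^sub>R f t)"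
    unfolding strongly_measurable_lebesgue_on_iff[OF S(1)] .
  have "bounded (u ` {a..b})"
    by (intro compact_imp_bounded compact_continuous_image continuous_on_subset[OF u(1)]) auto
  then obtain B where "\<forall>x\<in>u ` {a..b}. norm x \<le> B" unfolding bounded_iff by blast
  then have B: "\<bar>u t\<bar> \<le> B" if "t \<in> {a..b}" for t using that by force
  have nf: "(\<lambda>t. indicator {0..b} t * norm (f t)) \<in> borel_measurable lebesgue"
  proof -
    have "(\<lambda>t. norm (indicator {0..} t *\<^sub>R f t)) \<in> borel_measurable lebesgue"
      by (rule strongly_measurable_imp_borel_measurable[OF _ \<open>strongly_measurable lebesgue (\<lambda>t. indicator {0..} t *\<^sub>R f t)\<close>])
        (auto intro!: continuous_intros completion.complete_measure_axioms)
    then have "(\<lambda>t. indicator {0..b} t * norm (indicator {0..} t *\<^sub>R f t)) \<in> borel_measurable lebesgue"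
      by (intro borel_measurable_times borel_measurable_indicator) auto
    moreover have "(\<lambda>t. indicator {0..b} t * norm (indicator {0..} t *\<^sub>R f t)) = (\<lambda>t. indicator {0..b} t * norm (f t))"
      by (auto simp: indicator_def fun_eq_iff)
    ultimately show ?thesis by simp
  qed
  have "(\<integral>\<^sup>+t. ennreal (norm (u t *\<^sub>R f t)) \<partial>lebesgue_on {0<..}) = (\<integral>\<^sup>+t. ennreal (norm (u t *\<^sub>R f t)) * indicator {0<..} t \<partial>lebesgue)"
    by (rule nn_integral_restrict_space[OF S(2)])
  also have "\<dots> \<le> (\<integral>\<^sup>+t. ennreal \<bar>B\<bar> * ennreal (indicator {0..b} t * norm (f t)) \<partial>lebesgue)"
  proof (rule nn_integral_mono)
    fix t
    show "ennreal (norm (u t *\<^sub>R f t)) * indicator {0<..} t \<le> ennreal \<bar>B\<bar> * ennreal (indicator {0..b} t * norm (f t))"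
    proof (cases "t \<in> {a..b}")
      case True
      then have "norm (u t *\<^sub>R f t) \<le> \<bar>B\<bar> * norm (f t)" using B[OF True] by (auto intro!: mult_right_mono)
      then show ?thesis using True a by (simp add: ennreal_mult'[symmetric] ennreal_leI)
    qed (simp add: u(2))
  qed
  also have "\<dots> = ennreal \<bar>B\<bar> * (\<integral>\<^sup>+t. ennreal (indicator {0..b} t * norm (f t)) \<partial>lebesgue)"
    by (rule nn_integral_cmult[OF measurable_compose[OF nf measurable_ennreal]])
  also have "\<dots> < \<infinity>" using fin[of b] by (simp add: ennreal_mult_less_top)
  finally show ?thesis by (intro vector_bochner_integrableI complete_measure_lebesgue_on sm S)
qed

lemma lebesgue_on_integral_version:
  fixes u u' :: "real \<Rightarrow> complex"
  assumes S: "S \<in> sets borel" and u: "u \<in> borel_measurable (lebesgue_on S)" and u': "u' \<in> borel_measurable borel"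
    and ae: "AE t in lborel. t \<in> S \<longrightarrow> u t = u' t"
  shows "(\<integral>t. u t \<partial>lebesgue_on S) = (\<integral>t. indicator S t *\<^sub>R u' t \<partial>lborel)"
    and "integrable (lebesgue_on S) u \<longleftrightarrow> integrable lborel (\<lambda>t. indicator S t *\<^sub>R u' t)"
proof -
  have S': "S \<inter> space lebesgue \<in> sets lebesgue" using S by auto
  have [measurable]: "u' \<in> borel_measurable borel" "S \<in> sets borel" by fact+
  have m1: "(\<lambda>t. indicator S t *\<^sub>R u t) \<in> borel_measurable lebesgue"
    using u unfolding borel_measurable_restrict_space_iff[OF S'] by simp
  have m2: "(\<lambda>t. indicator S t *\<^sub>R u' t) \<in> borel_measurable lborel" by measurable
  have m3: "(\<lambda>t. indicator S t *\<^sub>R u' t) \<in> borel_measurable lebesgue" using m2 by (rule measurable_completion)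
  have e: "AE t in lebesgue. indicator S t *\<^sub>R u t = indicator S t *\<^sub>R u' t"
    using ae unfolding AE_completion_iff by eventually_elim (auto simp: indicator_def)
  have "(\<integral>t. u t \<partial>lebesgue_on S) = (\<integral>t. indicator S t *\<^sub>R u t \<partial>lebesgue)" by (rule integral_restrict_space[OF S'])
  also have "\<dots> = (\<integral>t. indicator S t *\<^sub>R u' t \<partial>lebesgue)" by (rule integral_cong_AE[OF m1 m3 e])
  also have "\<dots> = (\<integral>t. indicator S t *\<^sub>R u' t \<partial>lborel)" by (rule integral_completion[OF m2])
  finally show "(\<integral>t. u t \<partial>lebesgue_on S) = (\<integral>t. indicator S t *\<^sub>R u' t \<partial>lborel)" .
  have "integrable (lebesgue_on S) u \<longleftrightarrow> integrable lebesgue (\<lambda>t. indicator S t *\<^sub>R u t)" by (rule integrable_restrict_space[OF S'])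
  also have "\<dots> \<longleftrightarrow> integrable lebesgue (\<lambda>t. indicator S t *\<^sub>R u' t)" by (rule integrable_cong_AE[OF m1 m3 e])
  also have "\<dots> \<longleftrightarrow> integrable lborel (\<lambda>t. indicator S t *\<^sub>R u' t)" by (rule integrable_completion[OF m2])
  finally show "integrable (lebesgue_on S) u \<longleftrightarrow> integrable lborel (\<lambda>t. indicator S t *\<^sub>R u' t)" .
qed

text \<open>
  The norm of \<open>g\<close> is only Lebesgue measurable; a Borel majorant dominates all scalar images
  of \<open>g\<close> simultaneously.
\<close>

lemma Lp_majorant:
  fixes g :: "real \<Rightarrow> 'a::complex_banach" and p :: ennreal
  assumes g: "in_Lp_on p {0..} g"
  obtains h where "h \<in> borel_measurable borel" "\<And>v. 0 \<le> h v" "AE v in lborel. 0 \<le> v \<longrightarrow> norm (g v) \<le> h v"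
    "if p = \<infinity> then \<exists>H. \<forall>v. h v \<le> H else (\<integral>\<^sup>+v. ennreal (h v powr enn2real p) \<partial>lborel) < \<infinity>"
proof (cases "p = \<infinity>")
  case True
  then obtain C where "AE v in lebesgue_on {0..}. norm (g v) \<le> C" using g by (auto simp: in_Lp_on_def)
  then have "AE v in lebesgue. v \<in> {0..} \<longrightarrow> norm (g v) \<le> C" by (subst (asm) AE_restrict_space_iff) auto
  then have "AE v in lborel. v \<in> {0..} \<longrightarrow> norm (g v) \<le> C" unfolding AE_completion_iff .
  then have "AE v in lborel. 0 \<le> v \<longrightarrow> norm (g v) \<le> \<bar>C\<bar>" by eventually_elim auto
  then show ?thesis using True by (intro that[of "\<lambda>_. \<bar>C\<bar>"]) auto
next
  case False
  define q where "q = enn2real p"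
  have sm: "strongly_measurable lebesgue (\<lambda>t. indicator {0..} t *\<^sub>R g t)"
    using g by (subst strongly_measurable_lebesgue_on_iff[symmetric]) (auto simp: in_Lp_on_def)
  have "(\<lambda>t. norm (indicator {0..} t *\<^sub>R g t)) \<in> borel_measurable lebesgue"
    by (rule strongly_measurable_imp_borel_measurable[OF completion.complete_measure_axioms sm]) (intro continuous_intros)
  from completion_ex_borel_measurable_real[OF this]
  obtain b where b: "b \<in> borel_measurable lborel" "AE t in lborel. norm (indicator {0..} t *\<^sub>R g t) = b t" by blast
  note [measurable] = b(1)
  have "(\<integral>\<^sup>+v. ennreal (\<bar>b v\<bar> powr q) \<partial>lborel) = (\<integral>\<^sup>+v. ennreal (\<bar>b v\<bar> powr q) \<partial>lebesgue)"
    by (rule nn_integral_completion[symmetric])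
  also have "\<dots> = (\<integral>\<^sup>+v. ennreal (norm (g v) powr q) * indicator {0..} v \<partial>lebesgue)"
  proof (rule nn_integral_cong_AE)
    show "AE v in lebesgue. ennreal (\<bar>b v\<bar> powr q) = ennreal (norm (g v) powr q) * indicator {0..} v"
      using b(2) unfolding AE_completion_iff
    proof eventually_elim
      case (elim v)
      have e: "\<bar>b v\<bar> = norm (indicator {0..} v *\<^sub>R g v)" unfolding elim[symmetric] by (rule abs_norm_cancel)
      show ?case unfolding e by (simp add: indicator_def)
    qed
  qed
  also have "\<dots> = (\<integral>\<^sup>+v. ennreal (norm (g v) powr q) \<partial>lebesgue_on {0..})"
    by (rule nn_integral_restrict_space[symmetric]) auto
  also have "\<dots> < \<infinity>" using g False by (auto simp: in_Lp_on_def q_def)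
  finally have fin: "(\<integral>\<^sup>+v. ennreal (\<bar>b v\<bar> powr q) \<partial>lborel) < \<infinity>" .
  show ?thesis
  proof (rule that[of "\<lambda>v. \<bar>b v\<bar>"])
    show "(\<lambda>v. \<bar>b v\<bar>) \<in> borel_measurable borel" using b(1) by simp
    show "AE v in lborel. 0 \<le> v \<longrightarrow> norm (g v) \<le> \<bar>b v\<bar>"
      using b(2) by eventually_elim (auto simp: indicator_def)
  qed (use fin False in \<open>auto simp: q_def\<close>)
qed

text \<open>
  All three facts follow from a splitting \<open>h \<le> H + G\<close> into a bounded and an integrable part, where
  for finite \<open>p\<close> one may take \<open>H = 1\<close> and \<open>G = h powr p\<close>.
\<close>

lemma Lp_majorant_facts:
  fixes h :: "real \<Rightarrow> real" and p :: ennreal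
  assumes p: "1 < p" and hm: "h \<in> borel_measurable borel" and h: "\<And>v. 0 \<le> h v"
    and hp: "if p = \<infinity> then \<exists>H. \<forall>v. h v \<le> H else (\<integral>\<^sup>+v. ennreal (h v powr enn2real p) \<partial>lborel) < \<infinity>"
  shows "\<And>T. integrable lborel (\<lambda>v. indicator {0..T} v * h v)"
    and "\<exists>Ch\<ge>0. \<forall>t\<ge>0. (\<integral>v. indicator {0..t} v * h v \<partial>lborel) \<le> Ch * (1 + t)"
    and "\<And>\<kappa> t. 0 < \<kappa> \<Longrightarrow> integrable lborel (\<lambda>v. h v / (1 + \<kappa> * \<bar>t - v\<bar>)\<^sup>2)"
proof -
  note [measurable] = hm
  obtain H G where HG: "0 \<le> H" "integrable lborel G" "\<And>v. 0 \<le> G v" "\<And>v. h v \<le> H + G v"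
  proof (cases "p = \<infinity>")
    case True
    then obtain H where "\<forall>v. h v \<le> H" using hp by auto
    then show ?thesis using h[of 0] order_trans by (intro that[of H "\<lambda>_. 0"]) (auto intro: order_trans[OF h[of 0]])
  next
    case False
    define q where "q = enn2real p"
    have q: "1 \<le> q"
    proof -
      have "p < \<infinity>" using False by (simp add: less_top)
      then have "enn2real 1 \<le> enn2real p" using p by (intro enn2real_mono) auto
      then show ?thesis by (simp add: q_def)
    qed
    have "integrable lborel (\<lambda>v. h v powr q)" by (rule integrableI_bounded) (use hp False in \<open>auto simp: q_def\<close>)
    moreover have "h v \<le> 1 + h v powr q" for v
    proof (cases "h v \<le> 1")
      case False
      then have "h v powr 1 \<le> h v powr q" using q by (intro powr_mono) auto
      then show ?thesis using False by simp
    qed (simp add: add_increasing2)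
    ultimately show ?thesis by (intro that[of 1 "\<lambda>v. h v powr q"]) auto
  qed
  have cI: "integrable lborel (\<lambda>v. indicator {0..T} v *\<^sub>R (H :: real))" for T :: real
    by (rule borel_integrable_compact) auto
  show i: "integrable lborel (\<lambda>v. indicator {0..T} v * h v)" for T
  proof (rule Bochner_Integration.integrable_bound)
    show "integrable lborel (\<lambda>v. indicator {0..T} v *\<^sub>R H + G v)" by (intro Bochner_Integration.integrable_add cI HG)
    show "AE v in lborel. norm (indicator {0..T} v * h v) \<le> norm (indicator {0..T} v *\<^sub>R H + G v)"
      using HG h by (auto simp: indicator_def intro!: AE_I2 order_trans[OF _ abs_ge_self])
  qed measurable
  show "\<exists>Ch\<ge>0. \<forall>t\<ge>0. (\<integral>v. indicator {0..t} v * h v \<partial>lborel) \<le> Ch * (1 + t)"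
  proof (intro exI[of _ "H + (\<integral>v. G v \<partial>lborel)"] conjI allI impI)
    have G0: "0 \<le> (\<integral>v. G v \<partial>lborel)" using HG by (intro Bochner_Integration.integral_nonneg)
    then show "0 \<le> H + (\<integral>v. G v \<partial>lborel)" using HG by simp
    fix t :: real assume t: "0 \<le> t"
    have "(\<integral>v. indicator {0..t} v * h v \<partial>lborel) \<le> (\<integral>v. indicator {0..t} v *\<^sub>R H + G v \<partial>lborel)"
      using HG h by (intro integral_mono i Bochner_Integration.integrable_add cI) (auto simp: indicator_def)
    also have "\<dots> = t * H + (\<integral>v. G v \<partial>lborel)" using t by (subst Bochner_Integration.integral_add[OF cI HG(2)]) simp
    also have "\<dots> \<le> (H + (\<integral>v. G v \<partial>lborel)) * (1 + t)"
      using t HG(1) G0 mult_nonneg_nonneg[OF t G0] by (simp add: algebra_simps)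
    finally show "(\<integral>v. indicator {0..t} v * h v \<partial>lborel) \<le> (H + (\<integral>v. G v \<partial>lborel)) * (1 + t)" .
  qed
  show "integrable lborel (\<lambda>v. h v / (1 + \<kappa> * \<bar>t - v\<bar>)\<^sup>2)" if \<kappa>: "0 < \<kappa>" for \<kappa> t
  proof (rule Bochner_Integration.integrable_bound)
    have "integrable lborel (\<lambda>v. (H / \<kappa>) * (\<kappa> / (1 + \<kappa> / 1 * \<bar>t - v\<bar>)\<^sup>2) + G v)"
      using \<kappa> by (intro Bochner_Integration.integrable_add integrable_mult_right shifted_kernel_integral(1) HG) auto
    then show "integrable lborel (\<lambda>v. H / (1 + \<kappa> * \<bar>t - v\<bar>)\<^sup>2 + G v)" using \<kappa> by simp
    have "norm (h v / (1 + \<kappa> * \<bar>t - v\<bar>)\<^sup>2) \<le> norm (H / (1 + \<kappa> * \<bar>t - v\<bar>)\<^sup>2 + G v)" for v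
    proof -
      have 1: "1 \<le> (1 + \<kappa> * \<bar>t - v\<bar>)\<^sup>2" using \<kappa> by (intro one_le_power) auto
      then have D: "0 < (1 + \<kappa> * \<bar>t - v\<bar>)\<^sup>2" by linarith
      have "h v / (1 + \<kappa> * \<bar>t - v\<bar>)\<^sup>2 \<le> (H + G v) / (1 + \<kappa> * \<bar>t - v\<bar>)\<^sup>2"
        using HG(4)[of v] D by (intro divide_right_mono) auto
      also have "\<dots> = H / (1 + \<kappa> * \<bar>t - v\<bar>)\<^sup>2 + G v / (1 + \<kappa> * \<bar>t - v\<bar>)\<^sup>2" by (rule add_divide_distrib)
      also have "G v / (1 + \<kappa> * \<bar>t - v\<bar>)\<^sup>2 \<le> G v / 1"
        using HG(3)[of v] 1 D by (intro divide_left_mono) auto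
      finally show ?thesis using h[of v] D by (auto intro: order_trans[OF _ abs_ge_self])
    qed
    then show "AE v in lborel. norm (h v / (1 + \<kappa> * \<bar>t - v\<bar>)\<^sup>2) \<le> norm (H / (1 + \<kappa> * \<bar>t - v\<bar>)\<^sup>2 + G v)" by simp
  qed measurable
qed

lemma dual_ball_scaleR: "\<phi> \<in> dual_ball \<Longrightarrow> \<phi> (r *\<^sub>R x) = r *\<^sub>R \<phi> x"
  using dual_ballD(2)[of \<phi> "complex_of_real r" x] by (simp add: scaleC_of_real scaleR_conv_of_real)

lemma dual_ball_continuous: "\<phi> \<in> dual_ball \<Longrightarrow> continuous_on UNIV \<phi>"
  using dual_ballD(4) by (intro linear_continuous_on)

text \<open>
  A functional of norm at most 1 carries the vector-valued data to scalar data with the same bounds. All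
  bounds on the right are independent of \<open>\<phi>\<close>.
\<close>

lemma scalarisation:
  fixes f g :: "real \<Rightarrow> 'a::complex_banach"
  assumes w: "weak_derivative_on {0<..} m f g"
    and f: "strongly_measurable (lebesgue_on {0..}) f" "\<And>T. (\<integral>\<^sup>+t. ennreal (indicator {0..T} t * norm (f t)) \<partial>lebesgue) < \<infinity>"
    and g: "strongly_measurable (lebesgue_on {0..}) g"
    and h: "\<And>T. integrable lborel (\<lambda>v. indicator {0..T} v * h v)" "\<And>v. 0 \<le> h v" "AE v in lborel. 0 \<le> v \<longrightarrow> norm (g v) \<le> h v"
    and \<phi>: "\<phi> \<in> dual_ball"
  obtains f0 g0 where "loc_int f0" "loc_int g0" "AE t in lborel. 0 \<le> t \<longrightarrow> \<phi> (f t) = f0 t"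
    "AE v in lborel. 0 \<le> v \<longrightarrow> norm (g0 v) \<le> h v" "weak_deriv m f0 g0"
    "(\<integral>s. norm (indicator {1..2} s *\<^sub>R f0 s) \<partial>lborel) \<le> enn2real (\<integral>\<^sup>+t. ennreal (indicator {0..2} t * norm (f t)) \<partial>lebesgue)"
proof -
  have version: "\<exists>u. u \<in> borel_measurable borel \<and> (AE t in lborel. \<phi> (indicator {0..} t *\<^sub>R v t) = u t)"
    if v: "strongly_measurable (lebesgue_on {0..}) v" for v :: "real \<Rightarrow> 'a"
  proof -
    have "strongly_measurable lebesgue (\<lambda>t. indicator {0..} t *\<^sub>R v t)"
      using v by (subst strongly_measurable_lebesgue_on_iff[symmetric]) auto
    from strongly_measurable_imp_borel_measurable[OF completion.complete_measure_axioms this dual_ball_continuous[OF \<phi>]]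
    show ?thesis using borel_version_complex by metis
  qed
  obtain f0 where f0[measurable]: "f0 \<in> borel_measurable borel" and ff0: "AE t in lborel. \<phi> (indicator {0..} t *\<^sub>R f t) = f0 t"
    using version[OF f(1)] by blast
  obtain g0 where g0[measurable]: "g0 \<in> borel_measurable borel" and gg0: "AE t in lborel. \<phi> (indicator {0..} t *\<^sub>R g t) = g0 t"
    using version[OF g] by blast
  have eqf: "AE t in lborel. 0 \<le> t \<longrightarrow> \<phi> (f t) = f0 t" using ff0 by eventually_elim auto
  have eqg: "AE t in lborel. 0 \<le> t \<longrightarrow> \<phi> (g t) = g0 t" using gg0 by eventually_elim auto
  have lef: "AE t in lborel. 0 \<le> t \<longrightarrow> norm (f0 t) \<le> norm (f t)"
    using eqf by eventually_elim (metis dual_ballD(3)[OF \<phi>])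
  have nf: "(\<integral>\<^sup>+t. ennreal (norm (indicator {a..b} t *\<^sub>R f0 t)) \<partial>lborel) \<le> (\<integral>\<^sup>+t. ennreal (indicator {0..b} t * norm (f t)) \<partial>lebesgue)"
    if "0 \<le> a" for a b
  proof -
    have "(\<integral>\<^sup>+t. ennreal (norm (indicator {a..b} t *\<^sub>R f0 t)) \<partial>lborel) = (\<integral>\<^sup>+t. ennreal (norm (indicator {a..b} t *\<^sub>R f0 t)) \<partial>lebesgue)"
      by (rule nn_integral_completion[symmetric])
    also have "\<dots> \<le> (\<integral>\<^sup>+t. ennreal (indicator {0..b} t * norm (f t)) \<partial>lebesgue)"
    proof (rule nn_integral_mono_AE)
      show "AE t in lebesgue. ennreal (norm (indicator {a..b} t *\<^sub>R f0 t)) \<le> ennreal (indicator {0..b} t * norm (f t))"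
        using lef unfolding AE_completion_iff
        by eventually_elim (use that in \<open>auto simp: indicator_def intro!: ennreal_leI\<close>)
    qed
    finally show ?thesis .
  qed
  have lf: "loc_int f0"
    unfolding loc_int_def
  proof (intro conjI allI f0)
    show "integrable lborel (\<lambda>t. indicator {0..T} t *\<^sub>R f0 t)" for T
      by (rule integrableI_bounded) (use order.strict_trans1[OF nf[of 0 T] f(2)[of T]] in auto)
  qed
  have hg: "AE v in lborel. 0 \<le> v \<longrightarrow> norm (g0 v) \<le> h v"
    using eqg h(3)
  proof eventually_elim
    case (elim v)
    show ?case using elim dual_ballD(3)[OF \<phi>, of "g v"] by auto
  qed
  have lg: "loc_int g0"
    unfolding loc_int_def
  proof (intro conjI allI g0)
    show "integrable lborel (\<lambda>t. indicator {0..T} t *\<^sub>R g0 t)" for T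
    proof (rule Bochner_Integration.integrable_bound[OF h(1)[of T]])
      show "AE t in lborel. norm (indicator {0..T} t *\<^sub>R g0 t) \<le> norm (indicator {0..T} t * h t)"
        using hg by eventually_elim (use h(2) in \<open>auto simp: indicator_def\<close>)
    qed measurable
  qed
  have gfin: "(\<integral>\<^sup>+t. ennreal (indicator {0..T} t * norm (g t)) \<partial>lebesgue) < \<infinity>" for T
  proof -
    have "(\<integral>\<^sup>+t. ennreal (indicator {0..T} t * norm (g t)) \<partial>lebesgue) \<le> (\<integral>\<^sup>+t. ennreal (indicator {0..T} t * h t) \<partial>lebesgue)"
    proof (rule nn_integral_mono_AE)
      show "AE t in lebesgue. ennreal (indicator {0..T} t * norm (g t)) \<le> ennreal (indicator {0..T} t * h t)"
        using h(3) unfolding AE_completion_iff by eventually_elim (auto simp: indicator_def intro!: ennreal_leI)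
    qed
    also have "\<dots> = (\<integral>\<^sup>+t. ennreal (indicator {0..T} t * h t) \<partial>lborel)" by (rule nn_integral_completion)
    also have "\<dots> = ennreal (\<integral>t. indicator {0..T} t * h t \<partial>lborel)"
      by (rule nn_integral_eq_integral[OF h(1)]) (use h(2) in simp)
    also have "\<dots> < \<infinity>" by simp
    finally show ?thesis .
  qed
  have pairing: "\<phi> (vector_bochner_integral (lebesgue_on {0<..}) (\<lambda>t. u t *\<^sub>R v t)) = (\<integral>t. u t *\<^sub>R v0 t \<partial>lborel)"
    if u: "continuous_on UNIV u" "\<And>t. t \<notin> {a..b} \<Longrightarrow> u t = 0" "0 < a"
      and v: "strongly_measurable (lebesgue_on {0..}) v" "\<And>T. (\<integral>\<^sup>+t. ennreal (indicator {0..T} t * norm (v t)) \<partial>lebesgue) < \<infinity>"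
      and v0: "v0 \<in> borel_measurable borel" "AE t in lborel. 0 \<le> t \<longrightarrow> \<phi> (v t) = v0 t" for u :: "real \<Rightarrow> real" and v :: "real \<Rightarrow> 'a" and v0 a b
  proof -
    have c: "complete_measure (lebesgue_on {0::real<..})" by (rule complete_measure_lebesgue_on) simp
    have vi: "vector_bochner_integrable (lebesgue_on {0<..}) (\<lambda>t. u t *\<^sub>R v t)"
      by (rule vector_integrable_compact_weight[where a=a and b=b]; (rule v u(1,3) | (rule u(2), assumption)))
    note fi = vector_bochner_integral_functional[OF c vi \<phi>]
    have [measurable]: "u \<in> borel_measurable borel" using u(1) by (rule borel_measurable_continuous_onI)
    have "(\<integral>t. \<phi> (u t *\<^sub>R v t) \<partial>lebesgue_on {0<..}) = (\<integral>t. indicator {0<..} t *\<^sub>R (u t *\<^sub>R v0 t) \<partial>lborel)"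
    proof (rule lebesgue_on_integral_version(1))
      show "(\<lambda>t. \<phi> (u t *\<^sub>R v t)) \<in> borel_measurable (lebesgue_on {0<..})" using fi(1) by auto
      show "(\<lambda>t. u t *\<^sub>R v0 t) \<in> borel_measurable borel" using v0(1) by measurable
      show "AE t in lborel. t \<in> {0<..} \<longrightarrow> \<phi> (u t *\<^sub>R v t) = u t *\<^sub>R v0 t"
        using v0(2) by eventually_elim (auto simp: dual_ball_scaleR[OF \<phi>])
    qed simp
    also have "\<dots> = (\<integral>t. u t *\<^sub>R v0 t \<partial>lborel)"
    proof (rule Bochner_Integration.integral_cong[OF refl])
      show "indicator {0<..} t *\<^sub>R (u t *\<^sub>R v0 t) = u t *\<^sub>R v0 t" for t
        using u(2)[of t] u(3) by (cases "0 < t") auto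
    qed
    finally show ?thesis using fi(2) by simp
  qed
  have "weak_deriv m f0 g0"
    unfolding weak_deriv_def
  proof (intro allI impI)
    fix \<psi> assume \<psi>: "test_function_on {0<..} \<psi>"
    obtain a b where ab: "smooth \<psi>" "0 < a" "a < b" "\<And>k t. t \<notin> {a..b} \<Longrightarrow> (deriv ^^ k) \<psi> t = 0"
      using test_functionE[OF \<psi>] by metis
    have "\<phi> (vector_bochner_integral (lebesgue_on {0<..}) (\<lambda>t. (deriv ^^ m) \<psi> t *\<^sub>R f t)) = (\<integral>t. (deriv ^^ m) \<psi> t *\<^sub>R f0 t \<partial>lborel)"
      by (rule pairing[where a=a and b=b];
        (rule smooth_continuous[OF smooth_funpow_deriv[OF ab(1)]] ab(2) f f0 eqf | (rule ab(4), assumption)))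
    moreover have "\<phi> (vector_bochner_integral (lebesgue_on {0<..}) (\<lambda>t. \<psi> t *\<^sub>R g t)) = (\<integral>t. \<psi> t *\<^sub>R g0 t \<partial>lborel)"
      by (rule pairing[where a=a and b=b];
        (rule smooth_continuous[OF ab(1)] ab(2) g gfin g0 eqg | (rule ab(4)[of _ 0, unfolded funpow_0], assumption)))
    moreover have "vector_bochner_integral (lebesgue_on {0<..}) (\<lambda>t. (deriv ^^ m) \<psi> t *\<^sub>R f t)
        = (- 1) ^ m *\<^sub>R vector_bochner_integral (lebesgue_on {0<..}) (\<lambda>t. \<psi> t *\<^sub>R g t)"
      using w \<psi> unfolding weak_derivative_on_def by blast
    ultimately show "(\<integral>t. (deriv ^^ m) \<psi> t *\<^sub>R f0 t \<partial>lborel) = (- 1) ^ m * (\<integral>t. \<psi> t *\<^sub>R g0 t \<partial>lborel)"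
      by (simp add: dual_ball_scaleR[OF \<phi>] scaleR_conv_of_real)
  qed
  moreover have "(\<integral>s. norm (indicator {1..2} s *\<^sub>R f0 s) \<partial>lborel) \<le> enn2real (\<integral>\<^sup>+t. ennreal (indicator {0..2} t * norm (f t)) \<partial>lebesgue)"
  proof -
    have "(\<integral>s. norm (indicator {1..2} s *\<^sub>R f0 s) \<partial>lborel) = enn2real (\<integral>\<^sup>+s. ennreal (norm (indicator {1..2} s *\<^sub>R f0 s)) \<partial>lborel)"
      by (rule integral_eq_nn_integral) auto
    also have "\<dots> \<le> enn2real (\<integral>\<^sup>+t. ennreal (indicator {0..2} t * norm (f t)) \<partial>lebesgue)"
      using nf[of 1 2] f(2)[of 2] by (intro enn2real_mono) auto
    finally show ?thesis .
  qed
  ultimately show ?thesis using that[OF lf lg eqf hg] by blast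
qed

text \<open>
  The polynomial growth of \<open>f\<close> makes the Laplace integral absolutely convergent, so that \<open>\<phi>\<close> can be
  moved inside.
\<close>

lemma laplace_transform_scalar:
  fixes f :: "real \<Rightarrow> 'a::complex_banach"
  assumes f: "strongly_measurable (lebesgue_on {0..}) f" and growth: "AE t in lborel. 0 < t \<longrightarrow> norm (f t) \<le> G * (1 + t) ^ m"
    and G: "0 \<le> G" and z: "0 < Re z" and \<phi>: "\<phi> \<in> dual_ball" and f0: "f0 \<in> borel_measurable borel" "AE t in lborel. 0 \<le> t \<longrightarrow> \<phi> (f t) = f0 t"
  shows "\<phi> (laplace_transform f z) = (\<integral>r. indicator {0..} r *\<^sub>R (exp (- z * complex_of_real r) * f0 r) \<partial>lborel)"
proof -
  have S: "{0::real..} \<in> sets lebesgue" by simp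
  have c: "complete_measure (lebesgue_on {0::real..})" by (rule complete_measure_lebesgue_on[OF S])
  have em: "(\<lambda>t. exp (- z * complex_of_real t)) \<in> borel_measurable (lebesgue_on {0..})"
  proof -
    have "(\<lambda>t. exp (- z * complex_of_real t)) \<in> borel_measurable lborel" by measurable
    then have "(\<lambda>t. exp (- z * complex_of_real t)) \<in> borel_measurable lebesgue" by (rule measurable_completion)
    then show ?thesis by (rule measurable_restrict_space1)
  qed
  have sm: "strongly_measurable (lebesgue_on {0..}) (\<lambda>t. exp (- z * complex_of_real t) *\<^sub>C f t)"
    by (rule strongly_measurable_compose2[OF borel_measurable_imp_strongly_measurable[OF em] f])
      (rule bounded_bilinear.tendsto[OF bounded_bilinear_scaleC])
  define b where "b r = (if r < 0 then 0 else complex_of_real (G * (1 + r) ^ m))" for r :: real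
  have nb: "norm (b r) = G * (1 + r) ^ m" if "0 \<le> r" for r
  proof -
    have "b r = complex_of_real (G * (1 + r) ^ m)" using that by (simp add: b_def)
    then have "norm (b r) = \<bar>G * (1 + r) ^ m\<bar>" by (simp only: norm_of_real)
    then show ?thesis using that G by simp
  qed
  have bI: "integrable lborel (\<lambda>r. exp (- Re z * r) *\<^sub>R b r)"
  proof (rule growth_integrable(1)[OF _ _ _ z])
    show "b \<in> borel_measurable borel" unfolding b_def[abs_def] by measurable
    show "norm (b r) \<le> G * (1 + r) ^ m" if "0 \<le> r" for r using nb[OF that] by simp
  qed (simp add: b_def)
  have "(\<integral>\<^sup>+t. ennreal (norm (exp (- z * complex_of_real t) *\<^sub>C f t)) \<partial>lebesgue_on {0..})
      = (\<integral>\<^sup>+t. ennreal (norm (exp (- z * complex_of_real t) *\<^sub>C f t)) * indicator {0..} t \<partial>lebesgue)"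
    by (rule nn_integral_restrict_space) simp
  also have "\<dots> \<le> (\<integral>\<^sup>+t. ennreal (norm (exp (- Re z * t) *\<^sub>R b t)) \<partial>lebesgue)"
  proof (rule nn_integral_mono_AE)
    have "AE t in lborel. t \<noteq> (0::real)" by (rule AE_lborel_singleton)
    with growth have "AE t in lborel. ennreal (norm (exp (- z * complex_of_real t) *\<^sub>C f t)) * indicator {0..} t \<le> ennreal (norm (exp (- Re z * t) *\<^sub>R b t))"
    proof eventually_elim
      case (elim t)
      show ?case
      proof (cases "0 < t")
        case True
        have nb': "norm (b t) = G * (1 + t) ^ m" using True nb[of t] by simp
        have "norm (exp (- z * complex_of_real t) *\<^sub>C f t) = exp (- Re z * t) * norm (f t)" by (simp add: norm_scaleC)
        also have "\<dots> \<le> exp (- Re z * t) * (G * (1 + t) ^ m)" using elim True by (intro mult_left_mono) auto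
        finally show ?thesis using True nb' by (simp add: ennreal_leI)
      qed (use elim in auto)
    qed
    then show "AE t in lebesgue. ennreal (norm (exp (- z * complex_of_real t) *\<^sub>C f t)) * indicator {0..} t \<le> ennreal (norm (exp (- Re z * t) *\<^sub>R b t))"
      unfolding AE_completion_iff .
  qed
  also have "\<dots> = (\<integral>\<^sup>+t. ennreal (norm (exp (- Re z * t) *\<^sub>R b t)) \<partial>lborel)" by (rule nn_integral_completion)
  also have "\<dots> < \<infinity>" using bI unfolding integrable_iff_bounded by blast
  finally have vi: "vector_bochner_integrable (lebesgue_on {0..}) (\<lambda>t. exp (- z * complex_of_real t) *\<^sub>C f t)"
    by (intro vector_bochner_integrableI[OF c sm])
  note fi = vector_bochner_integral_functional[OF c vi \<phi>]
  have "(\<integral>t. \<phi> (exp (- z * complex_of_real t) *\<^sub>C f t) \<partial>lebesgue_on {0..})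
      = (\<integral>r. indicator {0..} r *\<^sub>R (exp (- z * complex_of_real r) * f0 r) \<partial>lborel)"
  proof (rule lebesgue_on_integral_version(1))
    show "(\<lambda>t. \<phi> (exp (- z * complex_of_real t) *\<^sub>C f t)) \<in> borel_measurable (lebesgue_on {0..})" using fi(1) by auto
    show "(\<lambda>r. exp (- z * complex_of_real r) * f0 r) \<in> borel_measurable borel" using f0(1) by measurable
    show "AE t in lborel. t \<in> {0..} \<longrightarrow> \<phi> (exp (- z * complex_of_real t) *\<^sub>C f t) = exp (- z * complex_of_real t) * f0 t"
      using f0(2) by eventually_elim (auto simp: dual_ballD(2)[OF \<phi>])
  qed simp
  then show ?thesis unfolding laplace_transform_def fi(2) .
qed

lemma vector_analytic_imp_holomorphic:
  fixes F :: "complex \<Rightarrow> 'a::complex_banach"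
  assumes F: "vector_analytic_on F S" and \<phi>: "\<phi> \<in> dual_ball" and "open S"
  shows "(\<lambda>z. \<phi> (F z)) holomorphic_on S"
  unfolding holomorphic_on_open[OF \<open>open S\<close>]
proof (intro ballI)
  fix z assume "z \<in> S"
  then obtain e where "e > 0" "\<forall>w\<in>ball z e. complex_differentiable_at F w" using F by (auto simp: vector_analytic_on_def)
  then have "complex_differentiable_at F z" by simp
  then obtain D where D: "(F has_derivative (\<lambda>h. h *\<^sub>C D)) (at z)" by (auto simp: complex_differentiable_at_def)
  have "((\<lambda>z. \<phi> (F z)) has_derivative (\<lambda>h. \<phi> (h *\<^sub>C D))) (at z)"
    by (rule bounded_linear.has_derivative[OF dual_ballD(4)[OF \<phi>] D])
  then have "((\<lambda>z. \<phi> (F z)) has_field_derivative \<phi> D) (at z)"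
    unfolding has_field_derivative_def by (simp add: dual_ballD(2)[OF \<phi>] mult_commute_abs)
  then show "\<exists>f'. ((\<lambda>z. \<phi> (F z)) has_field_derivative f') (at z)" by blast
qed

section \<open>Weighted integrability\<close>

text \<open>
  For small \<open>t\<close> the function is bounded. For large \<open>t\<close> it is dominated by an average of \<open>h\<close>, which lies
  in \<open>L\<^sup>p\<close>, plus a multiple of \<open>1 / t\<^sup>2\<close>.
\<close>

lemma in_Lp_from_estimate:
  fixes W h u :: "real \<Rightarrow> real" and a c1 T0 c C D :: real and p :: ennreal
  assumes p: "1 < p" and um: "strongly_measurable (lebesgue_on {0..}) u"
    and W: "\<And>x. 1 \<le> W x" "mono W" and N: "1 \<le> N" and a: "0 < a" and T0: "1 \<le> T0"
    and one: "\<And>t. T0 \<le> t \<Longrightarrow> 1 \<le> dyadic_scale W c1 N t"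
    and hm: "h \<in> borel_measurable borel" and h: "\<And>v. 0 \<le> h v"
    and hp: "if p = \<infinity> then \<exists>H. \<forall>v. h v \<le> H else (\<integral>\<^sup>+v. ennreal (h v powr enn2real p) \<partial>lborel) < \<infinity>"
    and small: "AE t in lborel. 0 < t \<longrightarrow> t < T0 \<longrightarrow> norm (u t) \<le> c"
    and large: "AE t in lborel. T0 \<le> t \<longrightarrow> norm (u t)
      \<le> C * (dyadic_scale W c1 N t * (\<integral>v. h v / (1 + dyadic_scale W c1 N t / a * \<bar>t - v\<bar>)\<^sup>2 \<partial>lborel) + D / t\<^sup>2)"
    and CD: "0 \<le> C" "0 \<le> D"
  shows "in_Lp_on p {0..} u"
proof -
  note [measurable] = hm
  define \<kappa> where "\<kappa> t = dyadic_scale W c1 N t" for t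
  have [measurable]: "\<kappa> \<in> borel_measurable borel" unfolding \<kappa>_def[abs_def] by (rule dyadic_scale_measurable[OF W(2)])
  define x where "x t = \<kappa> t * (\<integral>v. h v / (1 + \<kappa> t / a * \<bar>t - v\<bar>)\<^sup>2 \<partial>lborel)" for t
  have [measurable]: "x \<in> borel_measurable borel" unfolding x_def[abs_def] by measurable
  have x0: "0 \<le> x t" if "T0 \<le> t" for t
    using one[OF that] h unfolding x_def \<kappa>_def by (intro mult_nonneg_nonneg Bochner_Integration.integral_nonneg) auto
  have large': "AE t in lborel. T0 \<le> t \<longrightarrow> norm (u t) \<le> C * (x t + D / t\<^sup>2)"
    using large by (simp add: x_def \<kappa>_def)
  have ne: "AE t in lborel. t \<noteq> (0::real)" by (rule AE_lborel_singleton)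
  have Dt: "D / t\<^sup>2 \<le> D" if "T0 \<le> t" for t
  proof -
    have "1 \<le> t\<^sup>2" using that T0 by (intro one_le_power) auto
    then have "D / t\<^sup>2 \<le> D / 1" using CD by (intro divide_left_mono) auto
    then show ?thesis by simp
  qed
  show ?thesis
  proof (cases "p = \<infinity>")
    case True
    then obtain H where H: "\<And>v. h v \<le> H" using hp by auto
    have xb: "x t \<le> H * (2 * a)" if t: "T0 \<le> t" for t
    proof -
      have k: "0 < \<kappa> t" using one[OF t] by (simp add: \<kappa>_def)
      then have ka: "0 < \<kappa> t / a" using a by simp
      have "x t = (\<integral>v. \<kappa> t * (h v / (1 + \<kappa> t / a * \<bar>t - v\<bar>)\<^sup>2) \<partial>lborel)"
        unfolding x_def by (rule integral_mult_right_zero[symmetric])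
      also have "\<dots> \<le> (\<integral>v. H * (\<kappa> t / (1 + \<kappa> t / a * \<bar>t - v\<bar>)\<^sup>2) \<partial>lborel)"
      proof (rule integral_mono)
        show "integrable lborel (\<lambda>v. \<kappa> t * (h v / (1 + \<kappa> t / a * \<bar>t - v\<bar>)\<^sup>2))"
          by (rule integrable_mult_right[OF Lp_majorant_facts(3)[OF p hm h hp ka]])
        show "integrable lborel (\<lambda>v. H * (\<kappa> t / (1 + \<kappa> t / a * \<bar>t - v\<bar>)\<^sup>2))"
          by (rule integrable_mult_right[OF shifted_kernel_integral(1)[OF k a]])
        show "\<kappa> t * (h v / (1 + \<kappa> t / a * \<bar>t - v\<bar>)\<^sup>2) \<le> H * (\<kappa> t / (1 + \<kappa> t / a * \<bar>t - v\<bar>)\<^sup>2)" for v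
        proof -
          have "h v * (\<kappa> t / (1 + \<kappa> t / a * \<bar>t - v\<bar>)\<^sup>2) \<le> H * (\<kappa> t / (1 + \<kappa> t / a * \<bar>t - v\<bar>)\<^sup>2)"
            using H k by (intro mult_right_mono) auto
          then show ?thesis by (simp add: mult.commute)
        qed
      qed
      also have "\<dots> = H * (\<integral>v. \<kappa> t / (1 + \<kappa> t / a * \<bar>t - v\<bar>)\<^sup>2 \<partial>lborel)" by (rule integral_mult_right_zero)
      also have "\<dots> = H * (2 * a)" by (simp only: shifted_kernel_integral(2)[OF k a])
      finally show ?thesis .
    qed
    have "AE t in lborel. t \<in> {0..} \<longrightarrow> norm (u t) \<le> max c (C * (H * (2 * a) + D))"
      using small large' ne
    proof eventually_elim
      case (elim t)
      show ?case
      proof (intro impI, cases "T0 \<le> t")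
        case True
        have "norm (u t) \<le> C * (x t + D / t\<^sup>2)" using elim True by blast
        also have "\<dots> \<le> C * (H * (2 * a) + D)" using xb[OF True] Dt[OF True] CD by (intro mult_left_mono add_mono)
        finally show "norm (u t) \<le> max c (C * (H * (2 * a) + D))" by simp
      next
        case False
        assume "t \<in> {0..}"
        then have "norm (u t) \<le> c" using elim False by auto
        then show "norm (u t) \<le> max c (C * (H * (2 * a) + D))" by simp
      qed
    qed
    then have "AE t in lebesgue. t \<in> {0..} \<longrightarrow> norm (u t) \<le> max c (C * (H * (2 * a) + D))" unfolding AE_completion_iff .
    then have "AE t in lebesgue_on {0..}. norm (u t) \<le> max c (C * (H * (2 * a) + D))"
      by (subst AE_restrict_space_iff) auto
    then show ?thesis using True um unfolding in_Lp_on_def by auto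
  next
    case False
    define q where "q = enn2real p"
    have q: "1 \<le> q"
    proof -
      have "p < \<infinity>" using False by (simp add: less_top)
      then have "enn2real 1 \<le> enn2real p" using p by (intro enn2real_mono) auto
      then show ?thesis by (simp add: q_def)
    qed
    have hq: "(\<integral>\<^sup>+v. ennreal (h v powr q) \<partial>lborel) < \<infinity>" using hp False by (simp add: q_def)
    have conv: "(\<integral>\<^sup>+t. ennreal (indicator {T0..} t * x t powr q) \<partial>lborel) < \<infinity>"
      unfolding x_def \<kappa>_def by (rule dyadic_convolution_Lp[OF W N a T0 one q hm h hq])
    define e where "e t = 4 * (1 / (1 + 1 * \<bar>t\<bar>)\<^sup>2)" for t :: real
    have [measurable]: "e \<in> borel_measurable borel" unfolding e_def[abs_def] by measurable
    have ei: "integrable lborel e" unfolding e_def[abs_def] by (intro integrable_mult_right integral_inverse_square) simp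
    have e0: "0 \<le> e t" for t by (simp add: e_def)
    define B where "B t = ennreal (\<bar>c\<bar> powr q) * indicator {0..T0} t
      + ennreal ((2 * C) powr q) * (ennreal (indicator {T0..} t * x t powr q) + ennreal (D powr q) * ennreal (e t))" for t
    have "(\<integral>\<^sup>+t. ennreal (norm (u t) powr q) \<partial>lebesgue_on {0..}) = (\<integral>\<^sup>+t. ennreal (norm (u t) powr q) * indicator {0..} t \<partial>lebesgue)"
      by (rule nn_integral_restrict_space) simp
    also have "\<dots> \<le> (\<integral>\<^sup>+t. B t \<partial>lebesgue)"
    proof (rule nn_integral_mono_AE)
      have "AE t in lborel. ennreal (norm (u t) powr q) * indicator {0..} t \<le> B t"
        using small large' ne
      proof eventually_elim
        case (elim t)
        consider "t < 0" | "0 < t" "t < T0" | "T0 \<le> t" using elim by linarith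
        then show ?case
        proof cases
          case 2
          then have "norm (u t) powr q \<le> \<bar>c\<bar> powr q" using elim q by (intro powr_mono2) auto
          then have "ennreal (norm (u t) powr q) * indicator {0..} t \<le> ennreal (\<bar>c\<bar> powr q) * indicator {0..T0} t"
            using 2 by (simp add: ennreal_leI)
          also have "\<dots> \<le> B t" unfolding B_def by simp
          finally show ?thesis .
        next
          case 3
          define y where "y = D / t\<^sup>2"
          have y0: "0 \<le> y" using CD by (simp add: y_def)
          have t1: "1 \<le> t" using 3 T0 by simp
          have "norm (u t) \<le> C * (x t + y)" using elim 3 by (simp add: y_def)
          also have "\<dots> \<le> C * (2 * max (x t) y)" using CD by (intro mult_left_mono) auto
          finally have "norm (u t) \<le> (2 * C) * max (x t) y" by simp
          then have "norm (u t) powr q \<le> ((2 * C) * max (x t) y) powr q" using q by (intro powr_mono2) auto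
          also have "\<dots> = (2 * C) powr q * max (x t) y powr q" using CD y0 by (simp add: powr_mult)
          also have "\<dots> \<le> (2 * C) powr q * (x t powr q + y powr q)"
            by (intro mult_left_mono) (auto simp: max_def)
          also have "\<dots> \<le> (2 * C) powr q * (x t powr q + D powr q * e t)"
          proof (intro mult_left_mono add_left_mono)
            have le: "1 / t\<^sup>2 \<le> e t"
            proof -
              have "(1 + t)\<^sup>2 \<le> (2 * t)\<^sup>2" using t1 by (intro power_mono) auto
              then have "1 / (2 * t)\<^sup>2 \<le> 1 / (1 + t)\<^sup>2" using t1 by (intro divide_left_mono) auto
              then have "4 * (1 / (2 * t)\<^sup>2) \<le> 4 * (1 / (1 + t)\<^sup>2)" by (rule mult_left_mono) simp
              then show ?thesis using t1 by (simp add: e_def power_mult_distrib)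
            qed
            have "1 \<le> t\<^sup>2" using t1 by (intro one_le_power)
            then have "(1 / t\<^sup>2) powr q \<le> (1 / t\<^sup>2) powr 1" using q t1 by (intro powr_mono') auto
            then have "(1 / t\<^sup>2) powr q \<le> e t" using le t1 by simp
            then have "D powr q * (1 / t\<^sup>2) powr q \<le> D powr q * e t" by (intro mult_left_mono) auto
            then show "y powr q \<le> D powr q * e t" using CD by (simp add: y_def powr_mult[symmetric])
          qed simp
          finally have "ennreal (norm (u t) powr q) \<le> ennreal ((2 * C) powr q * (x t powr q + D powr q * e t))" by (rule ennreal_leI)
          also have "\<dots> = ennreal ((2 * C) powr q) * (ennreal (x t powr q) + ennreal (D powr q) * ennreal (e t))"
            using e0[of t] by (simp add: ennreal_mult ennreal_plus)
          also have "\<dots> \<le> B t" unfolding B_def using 3 by simp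
          finally show ?thesis using t1 by simp
        qed simp
      qed
      then show "AE t in lebesgue. ennreal (norm (u t) powr q) * indicator {0..} t \<le> B t" unfolding AE_completion_iff .
    qed
    also have "\<dots> = (\<integral>\<^sup>+t. B t \<partial>lborel)" by (rule nn_integral_completion)
    also have "\<dots> = ennreal (\<bar>c\<bar> powr q) * emeasure lborel {0..T0}
        + ennreal ((2 * C) powr q) * ((\<integral>\<^sup>+t. ennreal (indicator {T0..} t * x t powr q) \<partial>lborel) + ennreal (D powr q) * (\<integral>\<^sup>+t. ennreal (e t) \<partial>lborel))"
      unfolding B_def by (simp add: nn_integral_add nn_integral_cmult nn_integral_cmult_indicator)
    also have "(\<integral>\<^sup>+t. ennreal (e t) \<partial>lborel) = ennreal (\<integral>t. e t \<partial>lborel)"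
      by (rule nn_integral_eq_integral[OF ei]) (use e0 in simp)
    also have "ennreal (\<bar>c\<bar> powr q) * emeasure lborel {0..T0}
        + ennreal ((2 * C) powr q) * ((\<integral>\<^sup>+t. ennreal (indicator {T0..} t * x t powr q) \<partial>lborel) + ennreal (D powr q) * ennreal (\<integral>t. e t \<partial>lborel)) < \<infinity>"
      using conv T0 by (simp add: ennreal_mult_less_top ennreal_add_less_top)
    finally show ?thesis using um False unfolding in_Lp_on_def q_def by simp
  qed
qed

text \<open>
  The scalar estimate holds for all functionals in the dual ball with the same constants, hence, by a
  countable norming family, for \<open>f\<close> itself; the weighted norm of \<open>f\<close> is then dominated by averages
  of an \<open>L\<^sup>p\<close> majorant of \<open>fm\<close>.
\<close>

theorem theorem1p1:
  fixes f fm :: "real \<Rightarrow> 'a::complex_banach"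
    and F :: "complex \<Rightarrow> 'a"
    and M K :: "real \<Rightarrow> real"
    and m :: nat
    and p :: ennreal
  assumes "m \<ge> 1"
    and "1 < p"
    and "locally_integrable_on f {0..}"
    and "weak_derivative_on {0<..} m f fm"
    and "in_Lp_on p {0..} fm"
    and "continuous_on {0..} M" and "mono_on {0..} M" and "\<forall>s\<ge>0. M s \<ge> 2"
    and "continuous_on {0..} K" and "mono_on {0..} K" and "\<forall>s\<ge>0. K s \<ge> 2"
    and "\<forall>s>1. K s \<ge> max s (M s)"
    and "\<exists>\<epsilon>. 0 < \<epsilon> \<and> \<epsilon> < 1 \<and> K \<in> O[at_top](\<lambda>s. exp (exp ((s * M s) powr (1 - \<epsilon>))))"
    and "vector_analytic_on F (Omega M \<union> {z. Re z \<ge> 0})"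
    and "\<forall>z. Re z > 0 \<longrightarrow> F z = laplace_transform f z"
    and "\<forall>z\<in>Omega M. norm (F z) \<le> K \<bar>Im z\<bar>"
  shows "\<exists>c\<^sub>1>0. in_Lp_on p {0..} (\<lambda>t. norm (weight (M_log M K) (c\<^sub>1 * t) ^ m *\<^sub>R f t))"
proof -
  note wd = assms(4) and M = assms(6-8) and K = assms(9-11) and KM = assms(12) and dexp = assms(13)
  obtain k where m: "m = Suc k" using assms(1) by (cases m) auto
  define N :: nat where "N = 2 * Suc k + 4"
  define W where "W = weight (M_log M K)"
  have mN: "1 \<le> m" "1 \<le> N" by (auto simp: m N_def)
  note sel = scale_selection(2-4)[OF M K KM dexp mN]
  have W1: "1 \<le> W t" for t unfolding W_def by (rule weight_ge_1[OF sel])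
  have Wmono: "mono W" unfolding W_def by (intro monoI weight_mono[OF sel])
  have loc: "vector_bochner_integrable (lebesgue_on {0..T}) f" for T
    using assms(3) unfolding locally_integrable_on_def by (auto simp: Icc_subset_Ici_iff)
  have fsm: "strongly_measurable (lebesgue_on {0..}) f"
    by (rule strongly_measurable_half_line, rule vector_bochner_integrable_imp(1)[OF complete_measure_lebesgue_on loc]) simp
  have ffin: "(\<integral>\<^sup>+t. ennreal (indicator {0..T} t * norm (f t)) \<partial>lebesgue) < \<infinity>" for T
  proof -
    have "(\<integral>\<^sup>+t. ennreal (norm (f t)) \<partial>lebesgue_on {0..T}) < \<infinity>"
      by (rule vector_bochner_integrable_imp(2)[OF complete_measure_lebesgue_on loc]) simp
    also have "(\<integral>\<^sup>+t. ennreal (norm (f t)) \<partial>lebesgue_on {0..T}) = (\<integral>\<^sup>+t. ennreal (norm (f t)) * indicator {0..T} t \<partial>lebesgue)"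
      by (rule nn_integral_restrict_space) simp
    also have "\<dots> = (\<integral>\<^sup>+t. ennreal (indicator {0..T} t * norm (f t)) \<partial>lebesgue)"
      by (rule nn_integral_cong) (auto simp: indicator_def)
    finally show ?thesis .
  qed
  have gsm: "strongly_measurable (lebesgue_on {0..}) fm" using assms(5) by (simp add: in_Lp_on_def)
  obtain h where hm: "h \<in> borel_measurable borel" and h0: "\<And>v. 0 \<le> h v"
    and gh: "AE v in lborel. 0 \<le> v \<longrightarrow> norm (fm v) \<le> h v"
    and hp: "if p = \<infinity> then \<exists>H. \<forall>v. h v \<le> H else (\<integral>\<^sup>+v. ennreal (h v powr enn2real p) \<partial>lborel) < \<infinity>"
    by (rule Lp_majorant[OF assms(5)]) (rule that; assumption)
  note hf = Lp_majorant_facts[OF assms(2) hm h0 hp]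
  obtain Ch where Ch: "0 \<le> Ch" "\<forall>t\<ge>0. (\<integral>v. indicator {0..t} v * h v \<partial>lborel) \<le> Ch * (1 + t)" using hf(2) by blast
  have h0': "\<forall>v. 0 \<le> h v" and hf1: "\<forall>T. integrable lborel (\<lambda>v. indicator {0..T} v * h v)"
    and hf3: "\<forall>\<kappa>>0. \<forall>t. integrable lborel (\<lambda>v. h v / (1 + \<kappa> * \<bar>t - v\<bar>)\<^sup>2)"
    using h0 hf(1,3) by blast+
  define A where "A = enn2real (\<integral>\<^sup>+t. ennreal (indicator {0..2} t * norm (f t)) \<partial>lebesgue)"
  define Cs where "Cs = Ch + A"
  have A0: "0 \<le> A" by (simp add: A_def)
  have Cs: "0 \<le> Cs" "A \<le> Cs" using Ch(1) A0 by (auto simp: Cs_def)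
  have Csh: "\<forall>t\<ge>0. (\<integral>v. indicator {0..t} v * h v \<partial>lborel) \<le> Cs * (1 + t)"
  proof (intro allI impI)
    fix t :: real assume t: "0 \<le> t"
    have "Ch * (1 + t) \<le> Cs * (1 + t)" using A0 t by (intro mult_right_mono) (auto simp: Cs_def)
    then show "(\<integral>v. indicator {0..t} v * h v \<partial>lborel) \<le> Cs * (1 + t)" using Ch(2) t by (meson order_trans)
  qed
  \<comment> \<open>Almost-everywhere bounds that are uniform over the dual ball lift to the norm of \<open>f\<close>.\<close>
  have fsm0: "strongly_measurable lebesgue (\<lambda>t. indicator {0..} t *\<^sub>R f t)"
    using fsm by (subst strongly_measurable_lebesgue_on_iff[symmetric]) auto
  obtain \<Phi> where \<Phi>: "countable \<Phi>" "\<Phi> \<subseteq> dual_ball"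
    "AE t in lebesgue. \<forall>B. (\<forall>\<phi>\<in>\<Phi>. norm (\<phi> (indicator {0..} t *\<^sub>R f t)) \<le> B) \<longrightarrow> norm (indicator {0..} t *\<^sub>R f t) \<le> B"
    by (rule countable_norming_family[OF fsm0]) (rule that; assumption)
  have lift: "AE t in lborel. P t \<longrightarrow> norm (f t) \<le> b t"
    if P: "\<And>t. P t \<Longrightarrow> 0 \<le> t" and b: "\<And>\<phi>. \<phi> \<in> dual_ball \<Longrightarrow> AE t in lborel. P t \<longrightarrow> norm (\<phi> (f t)) \<le> b t" for P b
  proof -
    have "AE t in lborel. \<forall>\<phi>\<in>\<Phi>. P t \<longrightarrow> norm (\<phi> (f t)) \<le> b t"
      using b \<Phi>(2) by (subst AE_ball_countable[OF \<Phi>(1)]) auto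
    moreover have "AE t in lborel. \<forall>B. (\<forall>\<phi>\<in>\<Phi>. norm (\<phi> (indicator {0..} t *\<^sub>R f t)) \<le> B) \<longrightarrow> norm (indicator {0..} t *\<^sub>R f t) \<le> B"
      using \<Phi>(3) unfolding AE_completion_iff .
    ultimately show ?thesis
    proof eventually_elim
      case (elim t)
      show ?case
      proof
        assume t: "P t"
        have i: "indicator {0..} t *\<^sub>R f t = f t" using P[OF t] by simp
        show "norm (f t) \<le> b t" using elim t unfolding i by blast
      qed
    qed
  qed
  obtain G where G: "0 \<le> G" and growth: "\<forall>f g h Ch. loc_int f \<longrightarrow> loc_int g \<longrightarrow> weak_deriv m f g \<longrightarrow>
      (\<forall>T. integrable lborel (\<lambda>v. indicator {0..T} v * h v)) \<longrightarrow>
      (AE v in lborel. 0 \<le> v \<longrightarrow> norm (g v) \<le> h v) \<longrightarrow> 0 \<le> Ch \<longrightarrow>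
      (\<forall>t\<ge>0. (\<integral>v. indicator {0..t} v * h v \<partial>lborel) \<le> Ch * (1 + t)) \<longrightarrow>
      (\<integral>s. norm (indicator {1..2} s *\<^sub>R f s) \<partial>lborel) \<le> Ch \<longrightarrow>
      (\<exists>cs. length cs = m \<and> (AE t in lborel. t > 0 \<longrightarrow> f t = iter_primitive cs g t) \<and>
        (\<forall>t\<ge>0. norm (iter_primitive cs g t) \<le> G * Ch * (1 + t) ^ m))"
    using scalar_growth[of k] unfolding m by blast
  have scal: "\<exists>f0 g0. loc_int f0 \<and> loc_int g0 \<and> (AE t in lborel. 0 \<le> t \<longrightarrow> \<phi> (f t) = f0 t) \<and>
    (AE v in lborel. 0 \<le> v \<longrightarrow> norm (g0 v) \<le> h v) \<and> weak_deriv m f0 g0 \<and>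
    (\<integral>s. norm (indicator {1..2} s *\<^sub>R f0 s) \<partial>lborel) \<le> Cs" if \<phi>: "\<phi> \<in> dual_ball" for \<phi>
  proof -
    obtain f0 g0 where f0: "loc_int f0" "loc_int g0" "AE t in lborel. 0 \<le> t \<longrightarrow> \<phi> (f t) = f0 t"
      "AE v in lborel. 0 \<le> v \<longrightarrow> norm (g0 v) \<le> h v" "weak_deriv m f0 g0"
      "(\<integral>s. norm (indicator {1..2} s *\<^sub>R f0 s) \<partial>lborel) \<le> enn2real (\<integral>\<^sup>+t. ennreal (indicator {0..2} t * norm (f t)) \<partial>lebesgue)"
      by (rule scalarisation[OF wd fsm ffin gsm hf(1) h0 gh \<phi>]) (rule that; assumption)
    moreover have "(\<integral>s. norm (indicator {1..2} s *\<^sub>R f0 s) \<partial>lborel) \<le> Cs"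
      using f0(6) Cs(2) unfolding A_def by linarith
    ultimately show ?thesis by blast
  qed
  have fgrow: "AE t in lborel. 0 < t \<longrightarrow> norm (f t) \<le> (G * Cs) * (1 + t) ^ m"
  proof (rule lift)
    fix \<phi> :: "'a \<Rightarrow> complex" assume \<phi>: "\<phi> \<in> dual_ball"
    obtain f0 g0 where s: "loc_int f0" "loc_int g0" "AE t in lborel. 0 \<le> t \<longrightarrow> \<phi> (f t) = f0 t"
      "AE v in lborel. 0 \<le> v \<longrightarrow> norm (g0 v) \<le> h v" "weak_deriv m f0 g0"
      "(\<integral>s. norm (indicator {1..2} s *\<^sub>R f0 s) \<partial>lborel) \<le> Cs" using scal[OF \<phi>] by blast
    obtain cs where cs: "AE t in lborel. t > 0 \<longrightarrow> f0 t = iter_primitive cs g0 t"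
      "\<forall>t\<ge>0. norm (iter_primitive cs g0 t) \<le> G * Cs * (1 + t) ^ m"
      using growth[THEN spec[where x=f0], THEN spec[where x=g0], THEN spec[where x=h], THEN spec[where x=Cs],
          THEN mp, OF s(1), THEN mp, OF s(2), THEN mp, OF s(5), THEN mp, OF hf1, THEN mp, OF s(4),
          THEN mp, OF Cs(1), THEN mp, OF Csh, THEN mp, OF s(6)] by blast
    show "AE t in lborel. 0 < t \<longrightarrow> norm (\<phi> (f t)) \<le> (G * Cs) * (1 + t) ^ m"
      using s(3) cs(1) by eventually_elim (use cs(2) in auto)
  qed simp
  obtain c1 T0 C where c: "0 < c1" "1 \<le> T0" "0 \<le> C" "\<forall>t\<ge>T0. 1 \<le> dyadic_scale W c1 N t"
    and est: "\<forall>f g h Ch F.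
      loc_int f \<longrightarrow> loc_int g \<longrightarrow> weak_deriv m f g \<longrightarrow> (\<forall>v. 0 \<le> h v) \<longrightarrow>
      (\<forall>T. integrable lborel (\<lambda>v. indicator {0..T} v * h v)) \<longrightarrow>
      (AE v in lborel. 0 \<le> v \<longrightarrow> norm (g v) \<le> h v) \<longrightarrow> 0 \<le> Ch \<longrightarrow>
      (\<forall>t\<ge>0. (\<integral>v. indicator {0..t} v * h v \<partial>lborel) \<le> Ch * (1 + t)) \<longrightarrow>
      (\<integral>s. norm (indicator {1..2} s *\<^sub>R f s) \<partial>lborel) \<le> Ch \<longrightarrow>
      (\<forall>\<kappa>>0. \<forall>t. integrable lborel (\<lambda>v. h v / (1 + \<kappa> * \<bar>t - v\<bar>)\<^sup>2)) \<longrightarrow>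
      F holomorphic_on {z. - 1 / M \<bar>Im z\<bar> < Re z} \<longrightarrow> (\<forall>z\<in>Omega M. norm (F z) \<le> K \<bar>Im z\<bar>) \<longrightarrow>
      (\<forall>z. 0 < Re z \<longrightarrow> F z = (\<integral>r. indicator {0..} r *\<^sub>R (exp (- z * complex_of_real r) * f r) \<partial>lborel)) \<longrightarrow>
      (AE t in lborel. T0 \<le> t \<longrightarrow> W (c1 * t) ^ m * norm (f t)
        \<le> C * (dyadic_scale W c1 N t * (\<integral>v. h v / (1 + dyadic_scale W c1 N t / real m * \<bar>t - v\<bar>)\<^sup>2 \<partial>lborel)
            + (1 + Ch) / t\<^sup>2))"
    using scalar_estimate[OF M K KM dexp, of k] unfolding m N_def W_def by blast
  define S where "S = {z. - 1 / M \<bar>Im z\<bar> < Re z}"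
  have S_eq: "S = Omega M \<union> {z. Re z \<ge> 0}"
  proof -
    have "0 < M \<bar>Im z\<bar>" for z using M(3)[rule_format, of "\<bar>Im z\<bar>"] by simp
    then have "- 1 / M \<bar>Im z\<bar> < 0" for z by simp
    then have "- 1 / M \<bar>Im z\<bar> < Re z" if "0 \<le> Re z" for z using that less_le_trans by blast
    then show ?thesis unfolding S_def Omega_def by fastforce
  qed
  have openS: "open S"
    unfolding S_def
  proof (rule open_Collect_less)
    have "continuous_on UNIV (\<lambda>z. M \<bar>Im z\<bar>)"
      by (rule continuous_on_compose2[OF M(1)]) (auto intro!: continuous_intros)
    moreover have "M \<bar>Im z\<bar> \<noteq> 0" for z using M(3)[rule_format, of "\<bar>Im z\<bar>"] by simp
    ultimately show "continuous_on UNIV (\<lambda>z. - 1 / M \<bar>Im z\<bar>)" by (intro continuous_intros) auto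
  qed (intro continuous_intros)
  define rhs where "rhs t = C * (dyadic_scale W c1 N t * (\<integral>v. h v / (1 + dyadic_scale W c1 N t / real m * \<bar>t - v\<bar>)\<^sup>2 \<partial>lborel)
            + (1 + Cs) / t\<^sup>2)" for t
  have Wp: "0 < W x ^ m" for x using W1[of x] by (intro zero_less_power) linarith
  have "AE t in lborel. T0 \<le> t \<longrightarrow> norm (f t) \<le> rhs t / W (c1 * t) ^ m"
  proof (rule lift)
    show "0 \<le> t" if "T0 \<le> t" for t using that c(2) by simp
    fix \<phi> :: "'a \<Rightarrow> complex" assume \<phi>: "\<phi> \<in> dual_ball"
    obtain f0 g0 where s: "loc_int f0" "loc_int g0" "AE t in lborel. 0 \<le> t \<longrightarrow> \<phi> (f t) = f0 t"
      "AE v in lborel. 0 \<le> v \<longrightarrow> norm (g0 v) \<le> h v" "weak_deriv m f0 g0"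
      "(\<integral>s. norm (indicator {1..2} s *\<^sub>R f0 s) \<partial>lborel) \<le> Cs" using scal[OF \<phi>] by blast
    have hol: "(\<lambda>z. \<phi> (F z)) holomorphic_on {z. - 1 / M \<bar>Im z\<bar> < Re z}"
      using vector_analytic_imp_holomorphic[OF _ \<phi> openS, of F] assms(14) unfolding S_eq[symmetric] S_def by blast
    have bd: "\<forall>z\<in>Omega M. norm (\<phi> (F z)) \<le> K \<bar>Im z\<bar>"
      using assms(16) dual_ballD(3)[OF \<phi>] by (meson order_trans)
    have lap: "\<forall>z. 0 < Re z \<longrightarrow> \<phi> (F z) = (\<integral>r. indicator {0..} r *\<^sub>R (exp (- z * complex_of_real r) * f0 r) \<partial>lborel)"
    proof (intro allI impI)
      fix z assume z: "0 < Re z"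
      have "0 \<le> G * Cs" using G Cs by simp
      moreover have "f0 \<in> borel_measurable borel" using s(1) by (simp add: loc_int_def)
      ultimately show "\<phi> (F z) = (\<integral>r. indicator {0..} r *\<^sub>R (exp (- z * complex_of_real r) * f0 r) \<partial>lborel)"
        using laplace_transform_scalar[OF fsm fgrow _ z \<phi> _ s(3)] assms(15) z by simp
    qed
    have "AE t in lborel. T0 \<le> t \<longrightarrow> W (c1 * t) ^ m * norm (f0 t) \<le> rhs t"
      unfolding rhs_def
      using est[THEN spec[where x=f0], THEN spec[where x=g0], THEN spec[where x=h], THEN spec[where x=Cs],
          THEN spec[where x="\<lambda>z. \<phi> (F z)"],
          THEN mp, OF s(1), THEN mp, OF s(2), THEN mp, OF s(5), THEN mp, OF h0', THEN mp, OF hf1, THEN mp, OF s(4),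
          THEN mp, OF Cs(1), THEN mp, OF Csh, THEN mp, OF s(6), THEN mp, OF hf3, THEN mp, OF hol,
          THEN mp, OF bd, THEN mp, OF lap] .
    then show "AE t in lborel. T0 \<le> t \<longrightarrow> norm (\<phi> (f t)) \<le> rhs t / W (c1 * t) ^ m"
      using s(3) by eventually_elim (use c(2) Wp in \<open>auto simp: pos_le_divide_eq mult.commute\<close>)
  qed
  then have large: "AE t in lborel. T0 \<le> t \<longrightarrow> W (c1 * t) ^ m * norm (f t) \<le> rhs t"
    by eventually_elim (use Wp in \<open>auto simp: pos_le_divide_eq mult.commute\<close>)
  define u where "u t = norm (W (c1 * t) ^ m *\<^sub>R f t)" for t
  have nu: "norm (u t) = W (c1 * t) ^ m * norm (f t)" for t using Wp[of "c1 * t"] by (simp add: u_def abs_of_pos)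
  have "in_Lp_on p {0..} u"
  proof (rule in_Lp_from_estimate[OF assms(2) _ W1 Wmono mN(2) _ c(2) _ hm h0 hp, where C=C and D="1 + Cs" and a="real m"
        and c="W (c1 * T0) ^ m * ((G * Cs) * (1 + T0) ^ m)"])
    show "strongly_measurable (lebesgue_on {0..}) u"
    proof (rule borel_measurable_imp_strongly_measurable)
      have n: "(\<lambda>t. norm (f t)) \<in> borel_measurable (lebesgue_on {0..})"
        by (rule strongly_measurable_imp_borel_measurable[OF complete_measure_lebesgue_on fsm]) (auto intro!: continuous_intros)
      have [measurable]: "W \<in> borel_measurable borel" using Wmono by (rule borel_measurable_mono)
      have "(\<lambda>t. W (c1 * t) ^ m) \<in> borel_measurable lborel" by measurable
      then have "(\<lambda>t. W (c1 * t) ^ m) \<in> borel_measurable lebesgue" by (rule measurable_completion)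
      then have "(\<lambda>t. W (c1 * t) ^ m) \<in> borel_measurable (lebesgue_on {0..})" by (rule measurable_restrict_space1)
      from borel_measurable_times[OF this n]
      show "u \<in> borel_measurable (lebesgue_on {0..})" using nu by (simp add: u_def[abs_def] abs_of_pos Wp)
    qed
    show "AE t in lborel. 0 < t \<longrightarrow> t < T0 \<longrightarrow> norm (u t) \<le> W (c1 * T0) ^ m * ((G * Cs) * (1 + T0) ^ m)"
      using fgrow
    proof eventually_elim
      case (elim t)
      show ?case
      proof (intro impI)
        assume t: "0 < t" "t < T0"
        have "W (c1 * t) \<le> W (c1 * T0)" using t c(1) by (intro monoD[OF Wmono]) auto
        then have 1: "W (c1 * t) ^ m \<le> W (c1 * T0) ^ m" using W1[of "c1 * t"] by (intro power_mono) auto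
        have "(G * Cs) * (1 + t) ^ m \<le> (G * Cs) * (1 + T0) ^ m" using t G Cs by (intro mult_left_mono power_mono) auto
        then have 2: "norm (f t) \<le> (G * Cs) * (1 + T0) ^ m" using elim t by auto
        show "norm (u t) \<le> W (c1 * T0) ^ m * ((G * Cs) * (1 + T0) ^ m)"
          unfolding nu using 1 2 Wp[of "c1 * T0"] by (intro mult_mono) auto
      qed
    qed
    show "AE t in lborel. T0 \<le> t \<longrightarrow> norm (u t)
      \<le> C * (dyadic_scale W c1 N t * (\<integral>v. h v / (1 + dyadic_scale W c1 N t / real m * \<bar>t - v\<bar>)\<^sup>2 \<partial>lborel) + (1 + Cs) / t\<^sup>2)"
      using large unfolding nu rhs_def .
  qed (use c Cs mN in auto)
  then show ?thesis using c(1) unfolding u_def W_def by blast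
qed

end
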